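(* Let $q\in[0,1)$, let $\{X_t\}_{t\ge0}$ be the canonical $q$-Brownian motion on the $q$-Fock space, with associated non-commutative probability space $(\mathcal{A},\varphi)$, and let $\mathbb{X}^{2,S}$ be the Stratonovich product Lévy area above $X$. For all $0\le s<t$ and every $\mathbf{U}\in\mathcal{A}_s\hat\otimes\mathcal{A}_s$, $$\mathbb{X}^{2,S}_{st}[\mathbf{U}]=\int_s^t(\mathbf{U}\sharp\delta X_{su})\,\mathrm{d}X_u+\frac12(t-s)\,(\mathrm{Id}\times\Gamma_q)[\mathbf{U}]\qquad\text{in }L^2(\varphi),$$ where $\int_s^t(\mathbf{U}\sharp\delta X_{su})\,\mathrm{d}X_u$ is the product Itô integral on $[s,t]$ of the (Itô integrable) biprocess $u\mapsto(\mathbf{U}\sharp\delta X_{su})\otimes1$ against $X$.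
   Context: Canonical $q$-Brownian motion: on the $q$-Fock space over $L^2(\mathbb{R}_+;\mathbb{C})$ (completion of $\mathbb{C}\Omega\oplus\bigoplus_{n\ge1}H^{\otimes n}$, $H=L^2(\mathbb{R}_+;\mathbb{C})$, for $\langle f_1\otimes\cdots\otimes f_n,g_1\otimes\cdots\otimes g_m\rangle_q=\mathbf{1}_{n=m}\sum_{\sigma\in S_n}q^{\mathrm{inv}(\sigma)}\prod_i\langle f_i,g_{\sigma(i)}\rangle$, where $\mathrm{inv}(\sigma)$ is the number of inversions), $X_t:=a(\mathbf{1}_{[0,t]})+a^\ast(\mathbf{1}_{[0,t]})$ with $a^\ast(f)$ the left creation operator and $a(f)$ its adjoint; $\mathcal{A}$ is the von Neumann algebra generated by $\{X_t\}_{t\ge0}$ and $\varphi=\langle\Omega,\cdot\,\Omega\rangle_q$ is the (faithful, tracial) vacuum state. $\|\cdot\|$ is the operator norm; $L^2(\varphi)$ is the completion of $\mathcal{A}$ for $\langle U,V\rangle=\varphi(UV^\ast)$. Notation: $\delta g_{st}:=g_t-g_s$. $\mathcal{A}_t$ is the operator-norm closure of the unital algebra generated by $\{X_s\}_{s\le t}$; $\mathcal{B}_t$ is the von Neumann algebra generated by $\{X_s\}_{s\le t}$; $\varphi(U|\mathcal{B}_t)$ is the unique $Z\in\mathcal{B}_t$ with $\varphi(ZW^\ast)=\varphi(UW^\ast)$ for all $W\in\mathcal{B}_t$. $\hat\otimes$ is the projective tensor product (norm $\inf\sum_i\|U_i\|\|V_i\|$), and $\sharp$ is the continuous linear extension of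 $(U_1\otimes U_2)\sharp Y:=U_1YU_2$. Second quantization: $\Gamma_q:\bigcup_{t\ge0}\mathcal{A}_t\to\mathcal{A}$, $\Gamma_q(U):=\varphi\big(\delta X_{s,s+1}\,U\,\delta X_{s,s+1}\,\big|\,\mathcal{B}_s\big)$ for $U\in\mathcal{A}_s$ (this does not depend on the choice of $s$ with $U\in\mathcal{A}_s$). $\mathrm{Id}\times\Gamma_q$ is the continuous extension $\mathcal{A}_s\hat\otimes\mathcal{A}_s\to L^2(\varphi)$ of $(\mathrm{Id}\times\Gamma_q)[U\otimes V]:=U\,\Gamma_q(V)$. Product Itô integral: a biprocess is a map $\mathbf{V}:I\to\mathcal{A}\hat\otimes\mathcal{A}$ on an interval $I$; it is adapted if $\mathbf{V}_u\in\mathcal{A}_u\hat\otimes\mathcal{A}_u$ for all $u\in I$. An adapted biprocess is Itô integrable against $X$ if the Riemann sums $\sum_{t_i\in\Delta}\mathbf{V}_{t_i}\sharp\delta X_{t_it_{i+1}}$ converge in $L^2(\varphi)$ as the mesh $|\Delta|$ of the partition $\Delta$ of $I$ tends to $0$; the limit is the product Itô integral $\int_I\mathbf{V}_u\sharp\mathrm{d}X_u$. Stratonovich product Lévy area: let $X^n$ be the linear interpolation of $X$ along the dyadic points $i/2^n$, $i\ge0$, and $\mathbb{X}^{2,n}_{st}[\mathbf{U}]:=\int_s^t(\mathbf{U}\sharp\delta X^n_{su})\,\mathrm{d}X^n_u$ (classical Lebesgue integral). Then $\mathbb{X}^{2,S}_{st}[\mathbf{U}]:=\lim_{n\to\infty}\mathbb{X}^{2,n}_{st}[\mathbf{U}]$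 for $\mathbf{U}\in\mathcal{A}_s\hat\otimes\mathcal{A}_s$; it is known that the limit exists in operator norm, that for every $T>0$ and $\gamma\in(0,1/2)$ one has $\sup_{0\le s<t\le T}\sup_{\mathbf{U}\neq0}\|\mathbb{X}^{2,n}_{st}[\mathbf{U}]-\mathbb{X}^{2,S}_{st}[\mathbf{U}]\|/(|t-s|^{2\gamma}\|\mathbf{U}\|)\to0$ with $\mathbf{U}$ ranging over $\mathcal{A}_s\hat\otimes\mathcal{A}_s$, and that $\mathbb{X}^{2,S}_{st}[\mathbf{U}]\in\mathcal{A}_t$. *)

theory Defs
  imports "HOL-Analysis.Analysis" "HOL-Combinatorics.Permutations"
begin

section \<open>Complex normed spaces and complex Hilbert spaces\<close>

class complex_normed_vector = real_normed_vector +
  fixes scaleC :: "complex \<Rightarrow> 'a \<Rightarrow> 'a" (infixr "*\<^sub>C" 75)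
  assumes scaleC_add_right: "c *\<^sub>C (x + y) = c *\<^sub>C x + c *\<^sub>C y"
    and scaleC_add_left: "(c + d) *\<^sub>C x = c *\<^sub>C x + d *\<^sub>C x"
    and scaleC_scaleC: "c *\<^sub>C d *\<^sub>C x = (c * d) *\<^sub>C x"
    and scaleC_of_real: "of_real r *\<^sub>C x = r *\<^sub>R x"
    and norm_scaleC: "norm (c *\<^sub>C x) = cmod c * norm x"

text \<open>The inner product is linear in the \<^emph>\<open>second\<close> argument; this is the convention under which
  \<open>T \<mapsto> \<langle>\<Omega>, T \<Omega>\<rangle>\<close> is a linear functional.\<close>

class complex_hilbert = complex_normed_vector + banach +
  fixes cinner :: "'a \<Rightarrow> 'a \<Rightarrow> complex"
  assumes cinner_commute: "cinner x y = cnj (cinner y x)"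
    and cinner_add_right: "cinner x (y + z) = cinner x y + cinner x z"
    and cinner_scaleC_right: "cinner x (c *\<^sub>C y) = c * cinner x y"
    and cinner_self: "cinner x x = of_real ((norm x)\<^sup>2)"

instantiation complex :: complex_hilbert
begin

definition scaleC_complex :: "complex \<Rightarrow> complex \<Rightarrow> complex" where
  "scaleC_complex c x = c * x"

definition cinner_complex :: "complex \<Rightarrow> complex \<Rightarrow> complex" where
  "cinner_complex x y = cnj x * y"

instance
proof
  fix x :: complex
  show "cinner x x = of_real ((norm x)\<^sup>2)"
    by (simp add: cinner_complex_def complex_norm_square[unfolded of_real_power] mult.commute)
qed (simp_all add: scaleC_complex_def cinner_complex_def distrib_left distrib_right norm_mult
    scaleR_conv_of_real)

end

lemma bounded_linear_scaleC_right: "bounded_linear ((*\<^sub>C) c :: 'a::complex_normed_vector \<Rightarrow> 'a)"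
proof (rule bounded_linear_intro[where K = "cmod c"])
  fix x y :: 'a and r :: real
  show "c *\<^sub>C (x + y) = c *\<^sub>C x + c *\<^sub>C y"
    by (rule scaleC_add_right)
  show "c *\<^sub>C r *\<^sub>R x = r *\<^sub>R c *\<^sub>C x"
    by (simp add: scaleC_of_real[symmetric] scaleC_scaleC mult.commute)
  show "norm (c *\<^sub>C x) \<le> norm x * cmod c"
    by (simp add: norm_scaleC)
qed

instantiation blinfun :: (real_normed_vector, complex_normed_vector) complex_normed_vector
begin

definition scaleC_blinfun :: "complex \<Rightarrow> ('a \<Rightarrow>\<^sub>L 'b) \<Rightarrow> ('a \<Rightarrow>\<^sub>L 'b)" where
  "scaleC_blinfun c T = Blinfun (\<lambda>x. c *\<^sub>C blinfun_apply T x)"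

lemma scaleC_blinfun_apply: "blinfun_apply (c *\<^sub>C T) x = c *\<^sub>C blinfun_apply T x"
  unfolding scaleC_blinfun_def
  by (simp add: bounded_linear_Blinfun_apply
      bounded_linear_compose[OF bounded_linear_scaleC_right blinfun.bounded_linear_right])

instance
proof
  fix c d :: complex and r :: real and S T :: "'a \<Rightarrow>\<^sub>L 'b"
  show "c *\<^sub>C (S + T) = c *\<^sub>C S + c *\<^sub>C T"
    by (rule blinfun_eqI) (simp add: scaleC_blinfun_apply blinfun.add_left scaleC_add_right)
  show "(c + d) *\<^sub>C T = c *\<^sub>C T + d *\<^sub>C T"
    by (rule blinfun_eqI) (simp add: scaleC_blinfun_apply blinfun.add_left scaleC_add_left)
  show "c *\<^sub>C d *\<^sub>C T = (c * d) *\<^sub>C T"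
    by (rule blinfun_eqI) (simp add: scaleC_blinfun_apply scaleC_scaleC)
  show "of_real r *\<^sub>C T = r *\<^sub>R T"
    by (rule blinfun_eqI) (simp add: scaleC_blinfun_apply scaleC_of_real blinfun.scaleR_left)
  have le: "norm (a *\<^sub>C R) \<le> cmod a * norm R" for a and R :: "'a \<Rightarrow>\<^sub>L 'b"
  proof (rule norm_blinfun_bound)
    fix x
    have "cmod a * norm (blinfun_apply R x) \<le> cmod a * (norm R * norm x)"
      by (intro mult_left_mono norm_blinfun) simp
    then show "norm (blinfun_apply (a *\<^sub>C R) x) \<le> cmod a * norm R * norm x"
      by (simp add: scaleC_blinfun_apply norm_scaleC mult.assoc)
  qed simp
  have one: "1 *\<^sub>C R = R" for R :: "'a \<Rightarrow>\<^sub>L 'b"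
    using scaleC_of_real[of 1 "blinfun_apply R x" for x]
    by (intro blinfun_eqI) (simp add: scaleC_blinfun_apply)
  show "norm (c *\<^sub>C T) = cmod c * norm T"
  proof (cases "c = 0")
    case True
    then show ?thesis using le[of c T] by simp
  next
    case False
    have "inverse c *\<^sub>C blinfun_apply (c *\<^sub>C T) x = blinfun_apply T x" for x
      using one[of T] by (simp add: scaleC_blinfun_apply scaleC_scaleC False flip: scaleC_blinfun_apply[of 1])
    then have "T = inverse c *\<^sub>C (c *\<^sub>C T)"
      by (intro blinfun_eqI) (simp only: scaleC_blinfun_apply)
    then have "norm T \<le> cmod (inverse c) * norm (c *\<^sub>C T)"
      using le[of "inverse c" "c *\<^sub>C T"] by simp
    then have "cmod c * norm T \<le> norm (c *\<^sub>C T)"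
      using False by (simp only: norm_inverse) (simp add: field_simps)
    then show ?thesis using le[of c T] by simp
  qed
qed

end

definition csubspace :: "'a::complex_normed_vector set \<Rightarrow> bool" where
  "csubspace S \<longleftrightarrow> 0 \<in> S \<and> (\<forall>x\<in>S. \<forall>y\<in>S. x + y \<in> S) \<and> (\<forall>c. \<forall>x\<in>S. c *\<^sub>C x \<in> S)"

text \<open>\<open>J\<close> exhibits the Hilbert space \<open>'h\<close> as the completion, for the semi-inner product determined by
  \<open>form\<close>, of the space of formal linear combinations of elements of \<open>S\<close> (modulo null vectors). Up to a
  unitary intertwining the maps \<open>J\<close> there is exactly one such \<open>'h\<close>. Relations such as linearity of \<open>J\<close>
  (or multilinearity, when \<open>S\<close> consists of elementary tensors) follow from those of \<open>form\<close>.\<close>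

definition hilbert_completion ::
  "'a set \<Rightarrow> ('a \<Rightarrow> 'a \<Rightarrow> complex) \<Rightarrow> ('a \<Rightarrow> 'h::complex_hilbert) \<Rightarrow> bool" where
  "hilbert_completion S form J \<longleftrightarrow>
     (\<forall>x\<in>S. \<forall>y\<in>S. cinner (J x) (J y) = form x y) \<and> closure (csubspace hull (J ` S)) = UNIV"


section \<open>Operators and operator algebras\<close>

text \<open>The type \<open>'h \<Rightarrow>\<^sub>L 'h\<close> consists of the bounded real-linear maps; the operators on the complex
  Hilbert space \<open>'h\<close> are the following ones.\<close>

definition cops :: "('h::complex_hilbert \<Rightarrow>\<^sub>L 'h) set" where
  "cops = {T. \<forall>c x. blinfun_apply T (c *\<^sub>C x) = c *\<^sub>C blinfun_apply T x}"

definition cadjoint :: "('h::complex_hilbert \<Rightarrow>\<^sub>L 'h) \<Rightarrow> 'h \<Rightarrow>\<^sub>L 'h" where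
  "cadjoint T = (THE S. \<forall>x y. cinner (blinfun_apply S x) y = cinner x (blinfun_apply T y))"

definition unital_subalgebra :: "('h::complex_hilbert \<Rightarrow>\<^sub>L 'h) set \<Rightarrow> bool" where
  "unital_subalgebra M \<longleftrightarrow> csubspace M \<and> id_blinfun \<in> M \<and> (\<forall>S\<in>M. \<forall>T\<in>M. S o\<^sub>L T \<in> M)"

definition commutant :: "('h::complex_hilbert \<Rightarrow>\<^sub>L 'h) set \<Rightarrow> ('h \<Rightarrow>\<^sub>L 'h) set" where
  "commutant M = {T \<in> cops. \<forall>S\<in>M. S o\<^sub>L T = T o\<^sub>L S}"

definition von_neumann_algebra :: "('h::complex_hilbert \<Rightarrow>\<^sub>L 'h) set \<Rightarrow> bool" where
  "von_neumann_algebra M \<longleftrightarrow> (\<forall>T\<in>M. cadjoint T \<in> M) \<and> commutant (commutant M) = M"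


section \<open>Projective tensor products\<close>

text \<open>The projective tensor product of a subspace \<open>A\<close> of a normed space with itself is realised
  inside the linear functionals on the bounded bilinear forms on \<open>A\<close>: the elementary tensor
  \<open>U \<otimes> V\<close> is evaluation at \<open>(U, V)\<close>. Since the bounded bilinear forms are the dual of the projective
  tensor product, this is a faithful picture. The elements of the completion are the sums of absolutely
  convergent series of elementary tensors, and the projective norm is the infimum of
  \<open>\<Sum>i. \<parallel>U i\<parallel> \<parallel>V i\<parallel>\<close> over all such representations. The subspace is a parameter because the
  projective norm is not inherited from a larger space.\<close>

type_synonym 'a tensor = "('a \<Rightarrow> 'a \<Rightarrow> complex) \<Rightarrow> complex"

definition bilinear_forms :: "'a::complex_normed_vector set \<Rightarrow> ('a \<Rightarrow> 'a \<Rightarrow> complex) set" where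
  "bilinear_forms A = {b.
     (\<forall>U\<in>A. \<forall>U'\<in>A. \<forall>V\<in>A. b (U + U') V = b U V + b U' V) \<and>
     (\<forall>U\<in>A. \<forall>V\<in>A. \<forall>V'\<in>A. b U (V + V') = b U V + b U V') \<and>
     (\<forall>c. \<forall>U\<in>A. \<forall>V\<in>A. b (c *\<^sub>C U) V = c * b U V \<and> b U (c *\<^sub>C V) = c * b U V) \<and>
     (\<exists>K. \<forall>U\<in>A. \<forall>V\<in>A. cmod (b U V) \<le> K * (norm U * norm V))}"

definition elem_tensor :: "'a::complex_normed_vector set \<Rightarrow> 'a \<Rightarrow> 'a \<Rightarrow> 'a tensor" where
  "elem_tensor A U V = (\<lambda>b. if b \<in> bilinear_forms A then b U V else 0)"

definition tensor_series ::
  "'a::complex_normed_vector set \<Rightarrow> 'a tensor \<Rightarrow> (nat \<Rightarrow> 'a) \<Rightarrow> (nat \<Rightarrow> 'a) \<Rightarrow> bool" where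
  "tensor_series A x U V \<longleftrightarrow>
     range U \<subseteq> A \<and> range V \<subseteq> A \<and> summable (\<lambda>i. norm (U i) * norm (V i)) \<and>
     x = (\<lambda>b. \<Sum>i. elem_tensor A (U i) (V i) b)"

definition proj_tensor :: "'a::complex_normed_vector set \<Rightarrow> 'a tensor set" where
  "proj_tensor A = {x. \<exists>U V. tensor_series A x U V}"

definition proj_norm :: "'a::complex_normed_vector set \<Rightarrow> 'a tensor \<Rightarrow> real" where
  "proj_norm A x = Inf {\<Sum>i. norm (U i) * norm (V i) | U V. tensor_series A x U V}"

definition bounded_linear_on_tensor ::
  "'a::complex_normed_vector set \<Rightarrow> ('a tensor \<Rightarrow> 'b::complex_normed_vector) \<Rightarrow> bool" where
  "bounded_linear_on_tensor A F \<longleftrightarrow>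
     (\<forall>x\<in>proj_tensor A. \<forall>y\<in>proj_tensor A. F (\<lambda>b. x b + y b) = F x + F y) \<and>
     (\<forall>c. \<forall>x\<in>proj_tensor A. F (\<lambda>b. c * x b) = c *\<^sub>C F x) \<and>
     (\<exists>K. \<forall>x\<in>proj_tensor A. norm (F x) \<le> K * proj_norm A x)"

text \<open>Value at \<open>x\<close> of the continuous linear extension of \<open>U \<otimes> V \<mapsto> \<beta> U V\<close>.\<close>

definition tensor_lift ::
  "'a::complex_normed_vector set \<Rightarrow> ('a \<Rightarrow> 'a \<Rightarrow> 'b::complex_normed_vector) \<Rightarrow> 'a tensor \<Rightarrow> 'b" where
  "tensor_lift A \<beta> x = (THE z. \<exists>F. bounded_linear_on_tensor A F \<and>
     (\<forall>U\<in>A. \<forall>V\<in>A. F (elem_tensor A U V) = \<beta> U V) \<and> z = F x)"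

definition sharp ::
  "('h::complex_hilbert \<Rightarrow>\<^sub>L 'h) set \<Rightarrow> ('h \<Rightarrow>\<^sub>L 'h) tensor \<Rightarrow> ('h \<Rightarrow>\<^sub>L 'h) \<Rightarrow> 'h \<Rightarrow>\<^sub>L 'h" where
  "sharp A x Y = tensor_lift A (\<lambda>U V. U o\<^sub>L Y o\<^sub>L V) x"


section \<open>The \<open>q\<close>-Fock space and the \<open>q\<close>-Brownian motion\<close>

text \<open>Representatives of the elements of \<open>L\<^sup>2(\<real>\<^sub>+; \<complex>)\<close>; functions that agree almost everywhere
  become identified in the Fock space, where their difference has norm zero.\<close>

definition L2fun :: "(real \<Rightarrow> complex) set" where
  "L2fun = {f \<in> borel_measurable (lebesgue_on {0..}).
     integrable (lebesgue_on {0..}) (\<lambda>x. (cmod (f x))\<^sup>2)}"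

definition L2inner :: "(real \<Rightarrow> complex) \<Rightarrow> (real \<Rightarrow> complex) \<Rightarrow> complex" where
  "L2inner f g = (LINT x|lebesgue_on {0..}. cnj (f x) * g x)"

definition inversions :: "nat \<Rightarrow> (nat \<Rightarrow> nat) \<Rightarrow> nat" where
  "inversions n \<sigma> = card {(i, j). i < j \<and> j < n \<and> \<sigma> i > \<sigma> j}"

definition q_inner :: "real \<Rightarrow> (real \<Rightarrow> complex) list \<Rightarrow> (real \<Rightarrow> complex) list \<Rightarrow> complex" where
  "q_inner q fs gs = (if length fs = length gs then
     (\<Sum>\<sigma> | \<sigma> permutes {..<length fs}. of_real (q ^ inversions (length fs) \<sigma>) *
        (\<Prod>i<length fs. L2inner (fs ! i) (gs ! \<sigma> i))) else 0)"

text \<open>The list \<open>[f\<^sub>1, \<dots>, f\<^sub>n]\<close> stands for \<open>f\<^sub>1 \<otimes> \<cdots> \<otimes> f\<^sub>n\<close> and the empty list for \<open>\<Omega>\<close>. As the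
  completion depends on the real number \<open>q\<close>, it cannot be a single type; the Fock space is any Hilbert
  space \<open>'h\<close> carrying a map \<open>E\<close> that identifies it with the completion.\<close>

definition q_fock_space :: "real \<Rightarrow> ((real \<Rightarrow> complex) list \<Rightarrow> 'h::complex_hilbert) \<Rightarrow> bool" where
  "q_fock_space q E \<longleftrightarrow> hilbert_completion {fs. set fs \<subseteq> L2fun} (q_inner q) E"

context
  fixes E :: "(real \<Rightarrow> complex) list \<Rightarrow> 'h::complex_hilbert"
begin

definition vacuum :: 'h where
  "vacuum = E []"

definition creation :: "(real \<Rightarrow> complex) \<Rightarrow> 'h \<Rightarrow>\<^sub>L 'h" where
  "creation f = (THE T. T \<in> cops \<and> (\<forall>fs. set fs \<subseteq> L2fun \<longrightarrow> blinfun_apply T (E fs) = E (f # fs)))"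

definition annihilation :: "(real \<Rightarrow> complex) \<Rightarrow> 'h \<Rightarrow>\<^sub>L 'h" where
  "annihilation f = cadjoint (creation f)"

definition qbm :: "real \<Rightarrow> 'h \<Rightarrow>\<^sub>L 'h" where
  "qbm t = annihilation (indicator {0..t}) + creation (indicator {0..t})"

definition vacuum_state :: "('h \<Rightarrow>\<^sub>L 'h) \<Rightarrow> complex" where
  "vacuum_state T = cinner vacuum (blinfun_apply T vacuum)"

definition vn_alg :: "('h \<Rightarrow>\<^sub>L 'h) set" where
  "vn_alg = von_neumann_algebra hull (qbm ` {0..})"

definition norm_alg_upto :: "real \<Rightarrow> ('h \<Rightarrow>\<^sub>L 'h) set" where
  "norm_alg_upto t = closure (unital_subalgebra hull (qbm ` {0..t}))"

definition vn_alg_upto :: "real \<Rightarrow> ('h \<Rightarrow>\<^sub>L 'h) set" where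
  "vn_alg_upto t = von_neumann_algebra hull (qbm ` {0..t})"

definition cond_expectation :: "real \<Rightarrow> ('h \<Rightarrow>\<^sub>L 'h) \<Rightarrow> 'h \<Rightarrow>\<^sub>L 'h" where
  "cond_expectation t U = (THE Z. Z \<in> vn_alg_upto t \<and>
     (\<forall>W\<in>vn_alg_upto t. vacuum_state (Z o\<^sub>L cadjoint W) = vacuum_state (U o\<^sub>L cadjoint W)))"

text \<open>The result is the same for every \<open>s\<close> such that \<open>U\<close> belongs to the algebra up to time \<open>s\<close>.\<close>

definition second_quantization :: "('h \<Rightarrow>\<^sub>L 'h) \<Rightarrow> 'h \<Rightarrow>\<^sub>L 'h" where
  "second_quantization U = (THE Z. \<forall>s\<ge>0. U \<in> norm_alg_upto s \<longrightarrow>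
     Z = cond_expectation s ((qbm (s + 1) - qbm s) o\<^sub>L U o\<^sub>L (qbm (s + 1) - qbm s)))"


subsection \<open>\<open>L\<^sup>2(\<phi>)\<close> and the product Ito integral\<close>

text \<open>The inner product \<open>\<langle>U, V\<rangle> = \<phi>(U V\<^sup>*)\<close> of \<open>L\<^sup>2(\<phi>)\<close> is linear in its first argument, whence the
  exchange of \<open>U\<close> and \<open>V\<close>. The map \<open>J\<close> is the inclusion of the von Neumann algebra into \<open>L\<^sup>2(\<phi>)\<close>.\<close>

definition L2_vacuum :: "(('h \<Rightarrow>\<^sub>L 'h) \<Rightarrow> 'l::complex_hilbert) \<Rightarrow> bool" where
  "L2_vacuum J \<longleftrightarrow> hilbert_completion vn_alg (\<lambda>V U. vacuum_state (U o\<^sub>L cadjoint V)) J"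

definition id_times_second_quantization ::
  "(('h \<Rightarrow>\<^sub>L 'h) \<Rightarrow> 'l::complex_hilbert) \<Rightarrow> real \<Rightarrow> ('h \<Rightarrow>\<^sub>L 'h) tensor \<Rightarrow> 'l" where
  "id_times_second_quantization J s =
     tensor_lift (norm_alg_upto s) (\<lambda>U V. J (U o\<^sub>L second_quantization V))"

definition adapted_biprocess :: "real set \<Rightarrow> (real \<Rightarrow> ('h \<Rightarrow>\<^sub>L 'h) tensor) \<Rightarrow> bool" where
  "adapted_biprocess I V \<longleftrightarrow> (\<forall>u\<in>I. V u \<in> proj_tensor (norm_alg_upto u))"

text \<open>Partitions \<open>s = p 0 < p 1 < \<dots> < p N = t\<close>, with the biprocess evaluated at left end points.\<close>

definition has_ito_integral ::
  "(('h \<Rightarrow>\<^sub>L 'h) \<Rightarrow> 'l::complex_hilbert) \<Rightarrow> (real \<Rightarrow> ('h \<Rightarrow>\<^sub>L 'h) tensor) \<Rightarrow> 'l \<Rightarrow> real \<Rightarrow> real \<Rightarrow> bool"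
  where
  "has_ito_integral J V Z s t \<longleftrightarrow> adapted_biprocess {s..t} V \<and>
     (\<forall>\<epsilon>>0. \<exists>\<delta>>0. \<forall>N (p :: nat \<Rightarrow> real).
        p 0 = s \<and> p N = t \<and> (\<forall>i<N. p i < p (Suc i) \<and> p (Suc i) - p i < \<delta>) \<longrightarrow>
        dist (J (\<Sum>i<N. sharp (norm_alg_upto (p i)) (V (p i)) (qbm (p (Suc i)) - qbm (p i)))) Z < \<epsilon>)"

definition ito_integrable ::
  "(('h \<Rightarrow>\<^sub>L 'h) \<Rightarrow> 'l::complex_hilbert) \<Rightarrow> (real \<Rightarrow> ('h \<Rightarrow>\<^sub>L 'h) tensor) \<Rightarrow> real \<Rightarrow> real \<Rightarrow> bool" where
  "ito_integrable J V s t \<longleftrightarrow> (\<exists>Z. has_ito_integral J V Z s t)"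

definition ito_integral ::
  "(('h \<Rightarrow>\<^sub>L 'h) \<Rightarrow> 'l::complex_hilbert) \<Rightarrow> (real \<Rightarrow> ('h \<Rightarrow>\<^sub>L 'h) tensor) \<Rightarrow> real \<Rightarrow> real \<Rightarrow> 'l" where
  "ito_integral J V s t = (THE Z. has_ito_integral J V Z s t)"

text \<open>The biprocess \<open>u \<mapsto> (U \<sharp> \<delta>X\<^sub>s\<^sub>u) \<otimes> 1\<close>.\<close>

definition levy_biprocess :: "real \<Rightarrow> ('h \<Rightarrow>\<^sub>L 'h) tensor \<Rightarrow> real \<Rightarrow> ('h \<Rightarrow>\<^sub>L 'h) tensor" where
  "levy_biprocess s U u =
     elem_tensor (norm_alg_upto u) (sharp (norm_alg_upto s) U (qbm u - qbm s)) id_blinfun"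


subsection \<open>The Stratonovich product Levy area\<close>

definition dyadic_qbm :: "nat \<Rightarrow> real \<Rightarrow> 'h \<Rightarrow>\<^sub>L 'h" where
  "dyadic_qbm n u = (let i = real_of_int \<lfloor>2 ^ n * u\<rfloor> in
     qbm (i / 2 ^ n) + (2 ^ n * u - i) *\<^sub>R (qbm ((i + 1) / 2 ^ n) - qbm (i / 2 ^ n)))"

text \<open>The integrand is piecewise continuous, so the Henstock-Kurzweil integral agrees with the
  Lebesgue integral; the derivative is taken to be arbitrary at the finitely many dyadic points.\<close>

definition levy_area_approx ::
  "nat \<Rightarrow> real \<Rightarrow> real \<Rightarrow> ('h \<Rightarrow>\<^sub>L 'h) tensor \<Rightarrow> 'h \<Rightarrow>\<^sub>L 'h" where
  "levy_area_approx n s t U = integral {s..t} (\<lambda>u.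
     sharp (norm_alg_upto s) U (dyadic_qbm n u - dyadic_qbm n s) o\<^sub>L
     vector_derivative (dyadic_qbm n) (at u))"

definition stratonovich_levy_area ::
  "real \<Rightarrow> real \<Rightarrow> ('h \<Rightarrow>\<^sub>L 'h) tensor \<Rightarrow> 'h \<Rightarrow>\<^sub>L 'h" where
  "stratonovich_levy_area s t U = lim (\<lambda>n. levy_area_approx n s t U)"

end

end

theory Submission
  imports Defs
begin

text \<open>Write \<open>X\<^sub>s\<^sub>u\<close> for the increments. Along the dyadic grid the area of the interpolated path is, up to
  boundary terms that vanish in norm, the trapezoidal sum
  \<open>\<Sum>i. (U \<sharp> \<delta>X\<^sub>s\<^sub>i + 1/2 U \<sharp> \<delta>X\<^sub>i\<^sub>,\<^sub>i\<^sub>+\<^sub>1) \<delta>X\<^sub>i\<^sub>,\<^sub>i\<^sub>+\<^sub>1\<close>, that is, an Ito sum plus half of a quadratic sum.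
  Refining the grid changes the trapezoidal sum only by products of increments over disjoint intervals
  around elements of the past, and such a sum is small in operator norm: field operators split into
  creation and annihilation, orthogonal families of these are bounded as rows and columns with a constant
  depending only on \<open>q\<close>, and the one dangerous term, annihilation times past times creation, is controlled
  by a Haagerup-type inequality for Wick products. Hence the trapezoidal sums converge in norm.

  In \<open>L\<^sup>2\<close> everything is tested on the vacuum after taking adjoints. An adjoint Ito sum applied to the
  vacuum is a sum of creation operators over disjoint intervals applied to vectors of the past, so two of
  them are compared on a common refinement. In the quadratic sum only annihilation times \<open>V\<close> times
  creation survives, and on vectors of the past it acts as the length of the interval times the second
  quantization of \<open>V\<close>, which multiplies Wick products of \<open>n\<close> letters by \<open>q\<^sup>n\<close>.\<close>

text \<open>The obstacle is the product of annihilation, past element and creation. Row and column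
  estimates bound it by the total length with no power of the mesh, so refining gains nothing. For
  disjoint intervals the scalar in the commutation relation vanishes and annihilation times creation
  becomes q times creation times annihilation, where both sides are annihilation columns and gain
  the mesh. Commuting the outer pair into a Wick product of n letters costs q^n, which damps the n +
  1 components of that product; the sum of (n + 1) q^n converges because q < 1. The condition 0
  \<le> q makes all weights nonnegative, so weighted sums over splittings are controlled by
  q-binomial coefficients. A tensor is handled through one absolutely convergent series of
  elementary tensors. The left factors can be pulled out of every sum, so an estimate that is
  uniform in an operator of the past passes to the tensor. Many objects are definite descriptions
  (adjoint, creation operator, conditional expectation, lift to the tensor product), hence each must
  first be shown to exist and be unique.\<close>

notation blinfun_apply (infixr "\<cdot>" 85)

section \<open>Complex Hilbert spaces and adjoints\<close>

lemma scaleC_zero_right [simp]: "c *\<^sub>C (0::'a::complex_normed_vector) = 0"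
  using bounded_linear_scaleC_right[of c, THEN bounded_linear.linear] by (rule linear_0)

lemma scaleC_one [simp]: "1 *\<^sub>C (x::'a::complex_normed_vector) = x"
  using scaleC_of_real[of 1 x] by simp

lemma scaleC_zero_left [simp]: "0 *\<^sub>C (x::'a::complex_normed_vector) = 0"
  using scaleC_of_real[of 0 x] by simp

lemma scaleC_minus_one: "(- 1) *\<^sub>C (x::'a::complex_normed_vector) = - x"
  using scaleC_of_real[of "-1" x] by simp

lemma scaleC_diff_right: "c *\<^sub>C (x - y :: 'a::complex_normed_vector) = c *\<^sub>C x - c *\<^sub>C y"
  using bounded_linear_scaleC_right[of c, THEN bounded_linear.linear] by (rule linear_diff)

lemma scaleC_sum_right: "c *\<^sub>C (\<Sum>i\<in>I. f i :: 'a::complex_normed_vector) = (\<Sum>i\<in>I. c *\<^sub>C f i)"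
  using bounded_linear_scaleC_right[of c, THEN bounded_linear.linear] by (rule linear_sum)

lemma scaleC_sum_left: "(\<Sum>i\<in>I. f i) *\<^sub>C (x :: 'a::complex_normed_vector) = (\<Sum>i\<in>I. f i *\<^sub>C x)"
  by (induction I rule: infinite_finite_induct) (simp_all add: scaleC_add_left)

lemma scaleC_scaleR: "c *\<^sub>C r *\<^sub>R (x :: 'a::complex_normed_vector) = r *\<^sub>R c *\<^sub>C x"
  using bounded_linear_scaleC_right[of c, THEN bounded_linear.linear] by (rule linear_scale)

lemma scaleC_commute: "c *\<^sub>C d *\<^sub>C (x :: 'a::complex_normed_vector) = d *\<^sub>C c *\<^sub>C x"
  by (simp add: scaleC_scaleC mult.commute)

lemma csubspace_0: "csubspace S \<Longrightarrow> 0 \<in> S"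
  and csubspace_add: "csubspace S \<Longrightarrow> x \<in> S \<Longrightarrow> y \<in> S \<Longrightarrow> x + y \<in> S"
  and csubspace_scale: "csubspace S \<Longrightarrow> x \<in> S \<Longrightarrow> c *\<^sub>C x \<in> S"
  by (auto simp: csubspace_def)

lemma csubspace_scaleR: "csubspace S \<Longrightarrow> x \<in> S \<Longrightarrow> r *\<^sub>R x \<in> S"
  using csubspace_scale[of S x "of_real r"] by (simp add: scaleC_of_real)

lemma csubspace_minus: "csubspace S \<Longrightarrow> x \<in> S \<Longrightarrow> - x \<in> S"
  using csubspace_scale[of S x "-1"] by (simp add: scaleC_minus_one)

lemma csubspace_diff: "csubspace S \<Longrightarrow> x \<in> S \<Longrightarrow> y \<in> S \<Longrightarrow> x - y \<in> S"
  using csubspace_add[of S x "-y"] csubspace_minus[of S y] by simp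

lemma csubspace_sum: "csubspace S \<Longrightarrow> (\<And>i. i \<in> I \<Longrightarrow> f i \<in> S) \<Longrightarrow> (\<Sum>i\<in>I. f i) \<in> S"
  by (induction I rule: infinite_finite_induct) (auto intro: csubspace_0 csubspace_add)

lemma csubspace_hull: "csubspace (csubspace hull S)"
  by (rule hull_in) (auto simp: csubspace_def)

lemma csubspace_hull_induct [consumes 1, case_names base zero add scale]:
  assumes "x \<in> csubspace hull S" "\<And>x. x \<in> S \<Longrightarrow> P x" "P 0"
    and "\<And>x y. P x \<Longrightarrow> P y \<Longrightarrow> P (x + y)" "\<And>c x. P x \<Longrightarrow> P (c *\<^sub>C x)"
  shows "P x"
  using assms(1)
  by (rule hull_induct) (use assms in \<open>auto simp: csubspace_def\<close>)

lemma csubspace_hull_image_sum: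
  assumes "x \<in> csubspace hull (j ` S)"
  obtains F c where "finite F" "F \<subseteq> S" "x = (\<Sum>i\<in>F. c i *\<^sub>C j i)"
proof -
  have "\<exists>F c. finite F \<and> F \<subseteq> S \<and> x = (\<Sum>i\<in>F. c i *\<^sub>C j i)"
    using assms
  proof (induction rule: csubspace_hull_induct)
    case (base x)
    then obtain i where "i \<in> S" "x = j i" by auto
    then show ?case by (intro exI[of _ "{i}"] exI[of _ "\<lambda>_. 1"]) auto
  next
    case zero
    then show ?case by (intro exI[of _ "{}"]) auto
  next
    case (add x y)
    then obtain F c G d where *: "finite F" "F \<subseteq> S" "x = (\<Sum>i\<in>F. c i *\<^sub>C j i)"
      "finite G" "G \<subseteq> S" "y = (\<Sum>i\<in>G. d i *\<^sub>C j i)" by metis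
    define c' where "c' i = (if i \<in> F then c i else 0)" for i
    define d' where "d' i = (if i \<in> G then d i else 0)" for i
    have "x = (\<Sum>i\<in>F \<union> G. c' i *\<^sub>C j i)" "y = (\<Sum>i\<in>F \<union> G. d' i *\<^sub>C j i)"
      unfolding *(3,6) by (intro sum.mono_neutral_cong_left; use * in \<open>auto simp: c'_def d'_def\<close>)+
    then have "x + y = (\<Sum>i\<in>F \<union> G. (c' i + d' i) *\<^sub>C j i)"
      by (simp add: scaleC_add_left sum.distrib)
    then show ?case using * by (intro exI[of _ "F \<union> G"] exI[of _ "\<lambda>i. c' i + d' i"]) auto
  next
    case (scale c x)
    then obtain F d where *: "finite F" "F \<subseteq> S" "x = (\<Sum>i\<in>F. d i *\<^sub>C j i)" by metis
    then show ?case
      by (intro exI[of _ F] exI[of _ "\<lambda>i. c * d i"]) (auto simp: scaleC_sum_right scaleC_scaleC)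
  qed
  then show thesis using that by blast
qed

lemma csubspace_closure:
  fixes S :: "'a::complex_normed_vector set"
  assumes "csubspace S" shows "csubspace (closure S)"
  unfolding csubspace_def
proof (intro conjI ballI allI)
  show "0 \<in> closure S" using assms closure_subset by (auto simp: csubspace_def)
next
  fix x y assume "x \<in> closure S" "y \<in> closure S"
  then obtain f g where f: "\<forall>n::nat. f n \<in> S" "f \<longlonglongrightarrow> x" "\<forall>n. g n \<in> S" "g \<longlonglongrightarrow> y"
    unfolding closure_sequential by blast
  then have "(\<lambda>n. f n + g n) \<longlonglongrightarrow> x + y" by (intro tendsto_add)
  then show "x + y \<in> closure S" unfolding closure_sequential
    by (intro exI[of _ "\<lambda>n. f n + g n"]) (use f assms in \<open>auto intro: csubspace_add\<close>)
next
  fix x c assume "x \<in> closure S"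
  then obtain f where f: "\<forall>n::nat. f n \<in> S" "f \<longlonglongrightarrow> x"
    unfolding closure_sequential by blast
  then have "(\<lambda>n. c *\<^sub>C f n) \<longlonglongrightarrow> c *\<^sub>C x"
    by (intro bounded_linear.tendsto[OF bounded_linear_scaleC_right])
  then show "c *\<^sub>C x \<in> closure S" unfolding closure_sequential
    by (intro exI[of _ "\<lambda>n. c *\<^sub>C f n"]) (use f assms in \<open>auto intro: csubspace_scale\<close>)
qed

section \<open>Inner products, orthogonal projection and Riesz representation\<close>

lemma cinner_add_left: "cinner (x + y) z = cinner x z + cinner y z"
  by (subst (1 2 3) cinner_commute) (simp add: cinner_add_right)

lemma cinner_scaleC_left: "cinner (c *\<^sub>C x) z = cnj c * cinner x z"
  by (subst (1 2) cinner_commute) (simp add: cinner_scaleC_right)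

lemma cinner_scaleR_right: "cinner x (r *\<^sub>R y) = of_real r * cinner x y"
  by (simp add: scaleC_of_real[symmetric] cinner_scaleC_right)

lemma cinner_scaleR_left: "cinner (r *\<^sub>R x) y = of_real r * cinner x y"
  by (simp add: scaleC_of_real[symmetric] cinner_scaleC_left)

lemma cinner_zero_right [simp]: "cinner x 0 = 0"
  using cinner_scaleC_right[of x 0 x] by simp

lemma cinner_zero_left [simp]: "cinner 0 x = 0"
  by (subst cinner_commute) simp

lemma cinner_minus_right: "cinner x (- y) = - cinner x y"
  using cinner_scaleC_right[of x "-1" y] by (simp add: scaleC_minus_one)

lemma cinner_minus_left: "cinner (- x) y = - cinner x y"
  by (subst (1 2) cinner_commute) (simp add: cinner_minus_right)

lemma cinner_diff_right: "cinner x (y - z) = cinner x y - cinner x z"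
  using cinner_add_right[of x y "-z"] by (simp add: cinner_minus_right)

lemma cinner_diff_left: "cinner (x - y) z = cinner x z - cinner y z"
  using cinner_add_left[of x "-y" z] by (simp add: cinner_minus_left)

lemma cinner_sum_right: "cinner x (\<Sum>i\<in>I. f i) = (\<Sum>i\<in>I. cinner x (f i))"
  by (induction I rule: infinite_finite_induct) (simp_all add: cinner_add_right)

lemma cinner_sum_left: "cinner (\<Sum>i\<in>I. f i) x = (\<Sum>i\<in>I. cinner (f i) x)"
  by (induction I rule: infinite_finite_induct) (simp_all add: cinner_add_left)

lemma Re_cinner_self: "Re (cinner x x) = (norm x)\<^sup>2"
  by (simp add: cinner_self)

lemma cmod_cinner_self: "cmod (cinner x x) = (norm x)\<^sup>2"
  unfolding cinner_self by (simp del: of_real_power)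

lemma norm_add_square: "(norm (x + y))\<^sup>2 = (norm x)\<^sup>2 + (norm y)\<^sup>2 + 2 * Re (cinner x y)"
  using cinner_commute[of y x]
  by (simp add: Re_cinner_self[symmetric] cinner_add_left cinner_add_right)

lemma norm_diff_square: "(norm (x - y))\<^sup>2 = (norm x)\<^sup>2 + (norm y)\<^sup>2 - 2 * Re (cinner x y)"
  using norm_add_square[of x "-y"] by (simp add: cinner_minus_right)

text \<open>Cauchy-Schwarz: subtracting from \<open>x\<close> its component along \<open>y\<close>
  leaves an orthogonal remainder, and Pythagoras bounds the component by \<open>x\<close>.\<close>

lemma cmod_cinner_le: "cmod (cinner x y) \<le> norm x * norm y"
proof (cases "y = 0")
  case False
  define c where "c = cinner y x / of_real ((norm y)\<^sup>2)"
  have "cinner y (x - c *\<^sub>C y) = 0"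
    using False by (simp add: c_def cinner_diff_right cinner_scaleC_right cinner_self)
  then have orth: "cinner (c *\<^sub>C y) (x - c *\<^sub>C y) = 0"
    by (simp add: cinner_scaleC_left)
  have "(norm x)\<^sup>2 = (norm (c *\<^sub>C y + (x - c *\<^sub>C y)))\<^sup>2" by simp
  also have "\<dots> = (norm (c *\<^sub>C y))\<^sup>2 + (norm (x - c *\<^sub>C y))\<^sup>2"
    unfolding norm_add_square orth by simp
  finally have "(norm (c *\<^sub>C y))\<^sup>2 \<le> (norm x)\<^sup>2" by simp
  then have "cmod c * norm y \<le> norm x"
    by (simp add: norm_scaleC power2_le_iff_abs_le)
  then have "cmod (cinner y x) \<le> norm x * norm y"
    using False by (simp add: c_def norm_divide norm_mult power2_eq_square field_simps)
  then show ?thesis by (subst cinner_commute) simp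
qed simp

lemma bounded_bilinear_cinner: "bounded_bilinear (cinner :: 'a::complex_hilbert \<Rightarrow> _)"
proof
  show "\<exists>K. \<forall>a b :: 'a. norm (cinner a b) \<le> norm a * norm b * K"
    using cmod_cinner_le by (intro exI[of _ 1]) auto
qed (auto simp: cinner_add_left cinner_add_right cinner_scaleR_left cinner_scaleR_right scaleR_conv_of_real)

lemma cinner_eqI:
  assumes "\<And>y. cinner y x = cinner y x'"
  shows "x = x'"
proof -
  have "cinner (x - x') (x - x') = 0" using assms by (simp add: cinner_diff_right)
  then show ?thesis unfolding cinner_self by simp
qed

lemma norm_le_of_cinner:
  assumes "\<And>y. cmod (cinner y x) \<le> K * norm y" "K \<ge> 0"
  shows "norm x \<le> K"
proof (cases "x = 0")
  case False
  then show ?thesis using assms(1)[of x] by (simp add: cmod_cinner_self power2_eq_square)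
qed (use assms in simp)

lemma parallelogram: "(norm (x + y :: 'a::complex_hilbert))\<^sup>2 + (norm (x - y))\<^sup>2 = 2 * (norm x)\<^sup>2 + 2 * (norm y)\<^sup>2"
  by (simp add: norm_add_square norm_diff_square)

text \<open>A minimising sequence for the distance is Cauchy: midpoints stay in \<open>M\<close>, so
  the parallelogram law turns near-minimality of two points into closeness. Orthogonality is the
  first-order condition at the minimum.\<close>

lemma orthogonal_projection_exists:
  fixes M :: "'a::complex_hilbert set"
  assumes M: "csubspace M" "closed M"
  obtains m where "m \<in> M" "\<And>z. z \<in> M \<Longrightarrow> cinner z (x - m) = 0"
proof -
  define d where "d = (INF z\<in>M. (norm (x - z))\<^sup>2)"
  have bdd: "bdd_below ((\<lambda>z. (norm (x - z))\<^sup>2) ` M)" by (intro bdd_belowI[of _ 0]) auto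
  have ne: "M \<noteq> {}" using M csubspace_0 by blast
  have d_le: "d \<le> (norm (x - z))\<^sup>2" if "z \<in> M" for z
    unfolding d_def using bdd that by (intro cINF_lower)
  have "\<exists>z\<in>M. (norm (x - z))\<^sup>2 < d + 1 / real (Suc n)" for n
    using cINF_less_iff[OF ne bdd, of "d + 1 / real (Suc n)"] unfolding d_def by simp
  then obtain f where f: "\<And>n. f n \<in> M" "\<And>n. (norm (x - f n))\<^sup>2 < d + 1 / real (Suc n)" by metis
  have est: "(norm (f m - f n))\<^sup>2 \<le> 2 / real (Suc m) + 2 / real (Suc n)" for m n
  proof -
    have mid: "(1/2) *\<^sub>R (f m + f n) \<in> M" by (intro csubspace_scaleR csubspace_add M f)
    have "(x - f m) + (x - f n) = 2 *\<^sub>R (x - (1/2) *\<^sub>R (f m + f n))"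
      by (simp add: scaleR_2 algebra_simps)
    then have "(norm ((x - f m) + (x - f n)))\<^sup>2 = 4 * (norm (x - (1/2) *\<^sub>R (f m + f n)))\<^sup>2"
      by (simp only: norm_scaleR) (simp add: power_mult_distrib)
    moreover have "(x - f m) - (x - f n) = f n - f m" by simp
    ultimately show ?thesis
      using parallelogram[of "x - f m" "x - f n"] d_le[OF mid] f(2)[of m] f(2)[of n]
      by (simp add: norm_minus_commute)
  qed
  have "Cauchy f"
  proof (rule metric_CauchyI)
    fix e :: real assume "e > 0"
    then obtain N where N: "4 / e\<^sup>2 < real N" using reals_Archimedean2 by blast
    have N0: "real N > 0" using N \<open>e > 0\<close> by (meson divide_pos_pos le_less_trans less_eq_real_def less_trans zero_less_numeral zero_less_power)
    show "\<exists>M. \<forall>m\<ge>M. \<forall>n\<ge>M. dist (f m) (f n) < e"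
    proof (intro exI[of _ N] allI impI)
      fix m n assume "m \<ge> N" "n \<ge> N"
      then have "2 / real (Suc m) \<le> 2 / real N" "2 / real (Suc n) \<le> 2 / real N"
        using N0 by (auto intro!: divide_left_mono)
      then have "(norm (f m - f n))\<^sup>2 \<le> 4 / real N" using est[of m n] by simp
      also have "\<dots> < e\<^sup>2" using N N0 \<open>e > 0\<close> by (simp add: field_simps)
      finally show "dist (f m) (f n) < e" using \<open>e > 0\<close>
        by (simp add: dist_norm power_less_imp_less_base)
    qed
  qed
  then obtain m where lim: "f \<longlonglongrightarrow> m" using Cauchy_convergent_iff convergent_def by blast
  have mM: "m \<in> M" using closed_sequentially[OF M(2)] f lim by blast
  have "(\<lambda>n. (norm (x - f n))\<^sup>2) \<longlonglongrightarrow> (norm (x - m))\<^sup>2" by (intro tendsto_intros lim)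
  moreover have "(\<lambda>n. d + 1 / real (Suc n)) \<longlonglongrightarrow> d + 0"
    by (intro tendsto_intros LIMSEQ_Suc[OF lim_1_over_n])
  ultimately have dm: "(norm (x - m))\<^sup>2 \<le> d"
    using f(2) by (intro LIMSEQ_le[of _ _ "\<lambda>n. d + 1 / real (Suc n)" d]) (auto intro: less_imp_le)
  have "cinner z (x - m) = 0" if z: "z \<in> M" for z
  proof (cases "z = 0")
    case False
    \<comment> \<open>Moving from \<open>m\<close> by \<open>c *\<^sub>C z\<close> would lower the
      squared distance by the squared norm of \<open>c *\<^sub>C z\<close>, so minimality forces
      \<open>c = 0\<close>.\<close>
    define c where "c = cinner z (x - m) / of_real ((norm z)\<^sup>2)"
    have "m + c *\<^sub>C z \<in> M" by (intro csubspace_add csubspace_scale M mM z)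
    then have "(norm (x - m))\<^sup>2 \<le> (norm ((x - m) - c *\<^sub>C z))\<^sup>2"
      using d_le dm by (smt (verit) diff_diff_add)
    then have "2 * Re (cinner (x - m) (c *\<^sub>C z)) \<le> (norm (c *\<^sub>C z))\<^sup>2"
      by (simp add: norm_diff_square)
    moreover have "cinner (x - m) (c *\<^sub>C z) = c * cnj c * of_real ((norm z)\<^sup>2)"
      using False by (subst cinner_scaleC_right, subst cinner_commute)
        (simp add: c_def field_simps power2_eq_square)
    ultimately have "(cmod c)\<^sup>2 * (norm z)\<^sup>2 \<le> 0"
      by (simp add: norm_scaleC power_mult_distrib complex_norm_square[symmetric] mult.commute del: of_real_power)
    then have "c = 0" using False
      by (metis mult_le_0_iff norm_eq_zero not_less power_eq_0_iff zero_le_power2 order_antisym)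
    then show ?thesis using False by (simp add: c_def)
  qed simp
  then show thesis using that mM by blast
qed

text \<open>A vector \<open>w\<close> orthogonal to the kernel carries all of \<open>f\<close>,
  because \<open>x - (f x / f w) *\<^sub>C w\<close> lies in the kernel. The conjugate in the choice
  of \<open>y\<close> compensates the conjugate-linearity of \<open>cinner\<close> in its first
  argument.\<close>

lemma riesz_representation:
  fixes f :: "'a::complex_hilbert \<Rightarrow> complex"
  assumes "bounded_linear f" and f_scale: "\<And>c x. f (c *\<^sub>C x) = c * f x"
  obtains y where "\<And>x. f x = cinner y x"
proof (cases "\<forall>x. f x = 0")
  case True
  then show thesis using that[of 0] by simp
next
  case False
  then obtain u where u: "f u \<noteq> 0" by blast
  interpret f: bounded_linear f by fact
  have "csubspace {x. f x = 0}" by (auto simp: csubspace_def f.add f_scale f.zero)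
  moreover have "closed {x. f x = 0}"
    by (intro closed_Collect_eq continuous_intros f.continuous_on)
  ultimately obtain m where m: "f m = 0" "\<And>z. f z = 0 \<Longrightarrow> cinner z (u - m) = 0"
    using orthogonal_projection_exists[of "{x. f x = 0}" u] by auto
  define w where "w = u - m"
  have fw: "f w = f u" using m by (simp add: w_def f.diff)
  have w0: "w \<noteq> 0" using fw u f.zero by auto
  define y where "y = (cnj (f w) / of_real ((norm w)\<^sup>2)) *\<^sub>C w"
  have "f x = cinner y x" for x
  proof -
    have "f (x - (f x / f w) *\<^sub>C w) = 0" using fw u by (simp add: f.diff f_scale)
    then have "cinner (x - (f x / f w) *\<^sub>C w) w = 0" using m by (simp add: w_def)
    then have "cinner w (x - (f x / f w) *\<^sub>C w) = 0" by (subst cinner_commute) simp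
    then have "cinner w x = (f x / f w) * of_real ((norm w)\<^sup>2)"
      by (simp add: cinner_diff_right cinner_scaleC_right cinner_self)
    then show ?thesis using w0 fw u by (simp add: y_def cinner_scaleC_left)
  qed
  then show thesis using that by blast
qed

section \<open>Complex-linear operators and their adjoints\<close>

lemma copsD: "T \<in> cops \<Longrightarrow> T \<cdot> (c *\<^sub>C x) = c *\<^sub>C T \<cdot> x"
  by (simp add: cops_def)

lemma copsI: "(\<And>c x. T \<cdot> (c *\<^sub>C x) = c *\<^sub>C T \<cdot> x) \<Longrightarrow> T \<in> cops"
  by (simp add: cops_def)

lemma cops_add: "S \<in> cops \<Longrightarrow> T \<in> cops \<Longrightarrow> S + T \<in> cops"
  by (rule copsI) (simp add: blinfun.add_left scaleC_add_right copsD)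

lemma cops_diff: "S \<in> cops \<Longrightarrow> T \<in> cops \<Longrightarrow> S - T \<in> cops"
  by (rule copsI) (simp add: blinfun.diff_left scaleC_diff_right copsD)

lemma cops_zero [simp]: "0 \<in> cops"
  by (rule copsI) simp

lemma cops_id [simp]: "id_blinfun \<in> cops"
  by (rule copsI) simp

lemma cops_compose: "S \<in> cops \<Longrightarrow> T \<in> cops \<Longrightarrow> S o\<^sub>L T \<in> cops"
  by (rule copsI) (simp add: copsD)

lemma cops_scaleC: "S \<in> cops \<Longrightarrow> c *\<^sub>C S \<in> cops"
  by (rule copsI) (simp add: scaleC_blinfun_apply copsD scaleC_scaleC mult.commute)

lemma cops_scaleR: "S \<in> cops \<Longrightarrow> r *\<^sub>R S \<in> cops"
  using cops_scaleC[of S "of_real r"] by (simp add: scaleC_of_real)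

lemma cops_sum: "(\<And>i. i \<in> I \<Longrightarrow> T i \<in> cops) \<Longrightarrow> (\<Sum>i\<in>I. T i) \<in> cops"
  by (induction I rule: infinite_finite_induct) (auto intro: cops_add)

lemma csubspace_cops: "csubspace cops"
  by (auto simp: csubspace_def intro: cops_add cops_scaleC)

lemma closed_cops: "closed (cops :: ('h::complex_hilbert \<Rightarrow>\<^sub>L 'h) set)"
proof -
  have "cops = (\<Inter>c. \<Inter>x. {T :: 'h \<Rightarrow>\<^sub>L 'h. T \<cdot> (c *\<^sub>C x) = c *\<^sub>C T \<cdot> x})"
    by (auto simp: cops_def)
  moreover have "closed {T :: 'h \<Rightarrow>\<^sub>L 'h. T \<cdot> (c *\<^sub>C x) = c *\<^sub>C T \<cdot> x}" for c x
    by (intro closed_Collect_eq continuous_intros bounded_linear.continuous_on[OF bounded_linear_scaleC_right])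
  ultimately show ?thesis by (metis (no_types, lifting) closed_INT)
qed

text \<open>\<open>cadjoint\<close> is a definite description, so nothing can be said about it
  before this. Existence is Riesz representation for y -> <x, T y>, whose complex linearity comes
  from \<open>T \<in> cops\<close>.\<close>

lemma cadjoint_exists:
  fixes T :: "'h::complex_hilbert \<Rightarrow>\<^sub>L 'h"
  assumes T: "T \<in> cops"
  shows "\<exists>!S. \<forall>x y. cinner (S \<cdot> x) y = cinner x (T \<cdot> y)"
proof -
  have "\<exists>z. \<forall>y. cinner x (T \<cdot> y) = cinner z y" for x
  proof -
    have "bounded_linear (\<lambda>y. cinner x (T \<cdot> y))"
      by (intro bounded_linear_compose[OF bounded_bilinear.bounded_linear_right[OF bounded_bilinear_cinner]]
          blinfun.bounded_linear_right)
    moreover have "cinner x (T \<cdot> (c *\<^sub>C y)) = c * cinner x (T \<cdot> y)" for c y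
      using T by (simp add: copsD cinner_scaleC_right)
    ultimately show ?thesis by (rule riesz_representation) blast
  qed
  then obtain g where g: "\<And>x y. cinner x (T \<cdot> y) = cinner (g x) y" by metis
  have eq: "a = b" if "\<And>y. cinner a y = cinner b y" for a b :: 'h
    by (rule cinner_eqI, subst (1 2) cinner_commute) (simp add: that)
  have "bounded_linear g"
  proof (rule bounded_linear_intro[of _ "norm T"])
    fix x y :: 'h and r :: real
    show "g (x + y) = g x + g y" by (rule eq) (simp add: cinner_add_left g[symmetric])
    show "g (r *\<^sub>R x) = r *\<^sub>R g x" by (rule eq) (simp add: cinner_scaleR_left g[symmetric])
    show "norm (g x) \<le> norm x * norm T"
    proof (rule norm_le_of_cinner)
      fix y
      have "cmod (cinner y (g x)) = cmod (cinner x (T \<cdot> y))"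
        by (subst g, subst cinner_commute) simp
      also have "\<dots> \<le> norm x * (norm T * norm y)"
        by (intro order_trans[OF cmod_cinner_le] mult_left_mono norm_blinfun) auto
      finally show "cmod (cinner y (g x)) \<le> norm x * norm T * norm y" by simp
    qed simp
  qed
  then have S: "\<forall>x y. cinner (Blinfun g \<cdot> x) y = cinner x (T \<cdot> y)"
    by (simp add: bounded_linear_Blinfun_apply g)
  show ?thesis
  proof (rule ex1I)
    show "\<forall>x y. cinner (Blinfun g \<cdot> x) y = cinner x (T \<cdot> y)" by (fact S)
  next
    fix S' assume "\<forall>x y. cinner (S' \<cdot> x) y = cinner x (T \<cdot> y)"
    with S show "S' = Blinfun g" by (intro blinfun_eqI, intro eq) simp
  qed
qed

lemma cinner_cadjoint_left:
  "T \<in> cops \<Longrightarrow> cinner (cadjoint T \<cdot> x) y = cinner x (T \<cdot> y)"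
  using theI'[OF cadjoint_exists] unfolding cadjoint_def by blast

lemma cinner_cadjoint_right:
  "T \<in> cops \<Longrightarrow> cinner x (cadjoint T \<cdot> y) = cinner (T \<cdot> x) y"
  by (subst (1 2) cinner_commute) (simp add: cinner_cadjoint_left)

lemma cadjoint_eqI:
  assumes "\<And>x y. cinner (S \<cdot> x) y = cinner x (T \<cdot> y)" "T \<in> cops"
  shows "cadjoint T = S"
  using cadjoint_exists[OF assms(2)] assms(1) cinner_cadjoint_left[OF assms(2)] by blast

lemma cadjoint_cops: "T \<in> cops \<Longrightarrow> cadjoint T \<in> cops"
  by (rule copsI, rule cinner_eqI) (simp add: cinner_cadjoint_right copsD cinner_scaleC_right)

lemma cadjoint_cadjoint [simp]: "T \<in> cops \<Longrightarrow> cadjoint (cadjoint T) = T"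
  by (intro cadjoint_eqI cadjoint_cops) (simp_all add: cinner_cadjoint_right)

lemma cadjoint_add: "S \<in> cops \<Longrightarrow> T \<in> cops \<Longrightarrow> cadjoint (S + T) = cadjoint S + cadjoint T"
  by (intro cadjoint_eqI cops_add) (simp_all add: blinfun.add_left cinner_add_left cinner_add_right cinner_cadjoint_left)

lemma cadjoint_diff: "S \<in> cops \<Longrightarrow> T \<in> cops \<Longrightarrow> cadjoint (S - T) = cadjoint S - cadjoint T"
  by (intro cadjoint_eqI cops_diff) (simp_all add: blinfun.diff_left cinner_diff_left cinner_diff_right cinner_cadjoint_left)

lemma cadjoint_scaleC: "T \<in> cops \<Longrightarrow> cadjoint (c *\<^sub>C T) = cnj c *\<^sub>C cadjoint T"
  by (intro cadjoint_eqI cops_scaleC) (simp_all add: scaleC_blinfun_apply cinner_scaleC_left cinner_scaleC_right cinner_cadjoint_left)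

lemma cadjoint_scaleR: "T \<in> cops \<Longrightarrow> cadjoint (r *\<^sub>R T) = r *\<^sub>R cadjoint T"
  using cadjoint_scaleC[of T "of_real r"] by (simp add: scaleC_of_real)

lemma cadjoint_compose: "S \<in> cops \<Longrightarrow> T \<in> cops \<Longrightarrow> cadjoint (S o\<^sub>L T) = cadjoint T o\<^sub>L cadjoint S"
  by (intro cadjoint_eqI cops_compose) (simp_all add: cinner_cadjoint_left)

lemma cadjoint_id [simp]: "cadjoint id_blinfun = id_blinfun"
  by (intro cadjoint_eqI) simp_all

lemma cadjoint_zero [simp]: "cadjoint 0 = 0"
  by (intro cadjoint_eqI) simp_all

lemma cadjoint_sum: "(\<And>i. i \<in> I \<Longrightarrow> T i \<in> cops) \<Longrightarrow> cadjoint (\<Sum>i\<in>I. T i) = (\<Sum>i\<in>I. cadjoint (T i))"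
  by (induction I rule: infinite_finite_induct) (simp_all add: cadjoint_add cops_sum)

lemma norm_blinfun_le_of_cinner:
  fixes T :: "'h::complex_hilbert \<Rightarrow>\<^sub>L 'h"
  assumes "\<And>x y. cmod (cinner x (T \<cdot> y)) \<le> K * (norm x * norm y)" "K \<ge> 0"
  shows "norm T \<le> K"
proof (rule norm_blinfun_bound)
  fix y show "norm (T \<cdot> y) \<le> K * norm y"
    by (rule norm_le_of_cinner) (use assms in \<open>simp_all add: ac_simps\<close>)
qed fact

lemma cmod_cinner_blinfun_le: "cmod (cinner x (T \<cdot> y)) \<le> norm T * (norm x * norm y)"
proof -
  have "norm x * norm (T \<cdot> y) \<le> norm x * (norm T * norm y)"
    by (intro mult_left_mono norm_blinfun) auto
  then show ?thesis using cmod_cinner_le[of x "T \<cdot> y"] by (simp add: ac_simps)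
qed

lemma norm_cadjoint: 
  assumes "T \<in> cops" shows "norm (cadjoint T) = norm T"
proof -
  have "norm (cadjoint R) \<le> norm R" if "R \<in> cops" for R :: "'a \<Rightarrow>\<^sub>L 'a"
  proof (rule norm_blinfun_le_of_cinner)
    fix x y show "cmod (cinner x (cadjoint R \<cdot> y)) \<le> norm R * (norm x * norm y)"
    proof -
      have "cinner x (cadjoint R \<cdot> y) = cnj (cinner y (R \<cdot> x))"
        by (subst cinner_commute) (simp only: cinner_cadjoint_left[OF that])
      then show ?thesis using cmod_cinner_blinfun_le[of y R x] by (simp add: mult.commute)
    qed
  qed simp
  from this[OF assms] this[OF cadjoint_cops[OF assms]] show ?thesis using assms by simp
qed

section \<open>Closures of linear relations\<close>

text \<open>A relation rather than a map, because different formal combinations may give the same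
  vector: that a vanishing combination of the \<open>j i\<close> forces the same combination of the
  \<open>k i\<close> to vanish is a consequence of a norm bound, available only later.\<close>

definition lin_graph :: "'i set \<Rightarrow> ('i \<Rightarrow> 'a::complex_normed_vector) \<Rightarrow> ('i \<Rightarrow> 'b::complex_normed_vector) \<Rightarrow> ('a \<times> 'b) set" where
  "lin_graph S j k = {(\<Sum>i\<in>F. c i *\<^sub>C j i, \<Sum>i\<in>F. c i *\<^sub>C k i) |F c. finite F \<and> F \<subseteq> S}"

lemma lin_graphI: "finite F \<Longrightarrow> F \<subseteq> S \<Longrightarrow> (\<Sum>i\<in>F. c i *\<^sub>C j i, \<Sum>i\<in>F. c i *\<^sub>C k i) \<in> lin_graph S j k"
  unfolding lin_graph_def by blast

lemma lin_graphE:
  assumes "(x, y) \<in> lin_graph S j k"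
  obtains F c where "finite F" "F \<subseteq> S" "x = (\<Sum>i\<in>F. c i *\<^sub>C j i)" "y = (\<Sum>i\<in>F. c i *\<^sub>C k i)"
  using assms unfolding lin_graph_def by blast

lemma lin_graph_add:
  fixes j :: "'i \<Rightarrow> 'a::complex_normed_vector" and k :: "'i \<Rightarrow> 'b::complex_normed_vector"
  assumes xy: "(x, y) \<in> lin_graph S j k" "(x', y') \<in> lin_graph S j k"
  shows "(x + x', y + y') \<in> lin_graph S j k"
proof -
  obtain F c where 1: "finite F" "F \<subseteq> S" "x = (\<Sum>i\<in>F. c i *\<^sub>C j i)" "y = (\<Sum>i\<in>F. c i *\<^sub>C k i)"
    by (rule lin_graphE[OF xy(1)])
  obtain F' c' where 2: "finite F'" "F' \<subseteq> S" "x' = (\<Sum>i\<in>F'. c' i *\<^sub>C j i)" "y' = (\<Sum>i\<in>F'. c' i *\<^sub>C k i)"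
    by (rule lin_graphE[OF xy(2)])
  define d where "d i = (if i \<in> F then c i else 0) + (if i \<in> F' then c' i else 0)" for i
  have ext: "(\<Sum>i\<in>G. b i *\<^sub>C l i) = (\<Sum>i\<in>F \<union> F'. (if i \<in> G then b i else 0) *\<^sub>C l i)"
    if "G \<subseteq> F \<union> F'" for G b and l :: "'i \<Rightarrow> 'z::complex_normed_vector"
    using that 1 2 by (intro sum.mono_neutral_cong_left) auto
  have sum_eq: "(\<Sum>i\<in>F. c i *\<^sub>C l i) + (\<Sum>i\<in>F'. c' i *\<^sub>C l i) = (\<Sum>i\<in>F \<union> F'. d i *\<^sub>C l i)"
    for l :: "'i \<Rightarrow> 'z::complex_normed_vector"
    unfolding ext[OF Un_upper1] ext[OF Un_upper2] by (simp add: d_def scaleC_add_left sum.distrib)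
  show ?thesis using lin_graphI[of "F \<union> F'" S d j k] 1 2 by (simp add: sum_eq)
qed

lemma lin_graph_scale:
  assumes "(x, y) \<in> lin_graph S j k"
  shows "(c *\<^sub>C x, c *\<^sub>C y) \<in> lin_graph S j k"
proof -
  obtain F d where 1: "finite F" "F \<subseteq> S" "x = (\<Sum>i\<in>F. d i *\<^sub>C j i)" "y = (\<Sum>i\<in>F. d i *\<^sub>C k i)"
    by (rule lin_graphE[OF assms])
  then show ?thesis using lin_graphI[of F S "\<lambda>i. c * d i" j k] by (simp add: scaleC_sum_right scaleC_scaleC)
qed

lemma lin_graph_diff:
  assumes "(x, y) \<in> lin_graph S j k" "(x', y') \<in> lin_graph S j k"
  shows "(x - x', y - y') \<in> lin_graph S j k"
  using lin_graph_add[OF assms(1) lin_graph_scale[OF assms(2), of "-1"]] by (simp add: scaleC_minus_one)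

lemma lin_graph_mono: "S \<subseteq> S' \<Longrightarrow> lin_graph S j k \<subseteq> lin_graph S' j k"
  unfolding lin_graph_def by blast

lemma lin_graph_domain:
  assumes "x \<in> csubspace hull (j ` S)"
  obtains y where "(x, y) \<in> lin_graph S j k"
proof -
  obtain F c where "finite F" "F \<subseteq> S" "x = (\<Sum>i\<in>F. c i *\<^sub>C j i)"
    by (rule csubspace_hull_image_sum[OF assms])
  then show thesis using lin_graphI[of F S c j k] that by simp
qed

lemma lin_graph_range:
  assumes "(x, y) \<in> lin_graph S j k"
  shows "x \<in> csubspace hull (j ` S)" "y \<in> csubspace hull (k ` S)"
proof -
  obtain F c where 1: "finite F" "F \<subseteq> S" "x = (\<Sum>i\<in>F. c i *\<^sub>C j i)" "y = (\<Sum>i\<in>F. c i *\<^sub>C k i)"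
    by (rule lin_graphE[OF assms])
  show "x \<in> csubspace hull (j ` S)" "y \<in> csubspace hull (k ` S)"
    unfolding 1(3,4) by (intro csubspace_sum csubspace_scale csubspace_hull hull_inc; use 1(2) in blast)+
qed

lemma closure_pairs_sequential:
  fixes x :: "'a::real_normed_vector" and y :: "'b::real_normed_vector"
  shows "(x, y) \<in> closure G \<longleftrightarrow> (\<exists>f g. (\<forall>n::nat. (f n, g n) \<in> G) \<and> f \<longlonglongrightarrow> x \<and> g \<longlonglongrightarrow> y)"
proof
  assume "(x, y) \<in> closure G"
  then obtain p where p: "\<forall>n::nat. p n \<in> G" "p \<longlonglongrightarrow> (x, y)" unfolding closure_sequential by blast
  then show "\<exists>f g. (\<forall>n::nat. (f n, g n) \<in> G) \<and> f \<longlonglongrightarrow> x \<and> g \<longlonglongrightarrow> y"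
    using tendsto_fst[OF p(2)] tendsto_snd[OF p(2)]
    by (intro exI[of _ "\<lambda>n. fst (p n)"] exI[of _ "\<lambda>n. snd (p n)"]) auto
next
  assume "\<exists>f g. (\<forall>n::nat. (f n, g n) \<in> G) \<and> f \<longlonglongrightarrow> x \<and> g \<longlonglongrightarrow> y"
  then obtain f g where "\<forall>n::nat. (f n, g n) \<in> G" "f \<longlonglongrightarrow> x" "g \<longlonglongrightarrow> y" by blast
  then show "(x, y) \<in> closure G" unfolding closure_sequential
    by (intro exI[of _ "\<lambda>n. (f n, g n)"]) (auto intro: tendsto_Pair)
qed

lemma closure_lin_graph_seq:
  assumes "(x, y) \<in> closure (lin_graph S j k)"
  obtains f g where "\<And>n::nat. (f n, g n) \<in> lin_graph S j k" "f \<longlonglongrightarrow> x" "g \<longlonglongrightarrow> y"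
  using assms unfolding closure_pairs_sequential by blast

lemma closure_lin_graph_add:
  assumes "(x, y) \<in> closure (lin_graph S j k)" "(x', y') \<in> closure (lin_graph S j k)"
  shows "(x + x', y + y') \<in> closure (lin_graph S j k)"
proof -
  obtain f g where f: "\<And>n::nat. (f n, g n) \<in> lin_graph S j k" "f \<longlonglongrightarrow> x" "g \<longlonglongrightarrow> y"
    using closure_lin_graph_seq[OF assms(1)] by blast
  obtain f' g' where f': "\<And>n::nat. (f' n, g' n) \<in> lin_graph S j k" "f' \<longlonglongrightarrow> x'" "g' \<longlonglongrightarrow> y'"
    using closure_lin_graph_seq[OF assms(2)] by blast
  show ?thesis
    unfolding closure_pairs_sequential
    by (intro exI[of _ "\<lambda>n. f n + f' n"] exI[of _ "\<lambda>n. g n + g' n"]) (simp add: f f' tendsto_add lin_graph_add)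
qed

lemma closure_lin_graph_scale:
  assumes "(x, y) \<in> closure (lin_graph S j k)"
  shows "(c *\<^sub>C x, c *\<^sub>C y) \<in> closure (lin_graph S j k)"
proof -
  obtain f g where f: "\<And>n::nat. (f n, g n) \<in> lin_graph S j k" "f \<longlonglongrightarrow> x" "g \<longlonglongrightarrow> y"
    using closure_lin_graph_seq[OF assms] by blast
  show ?thesis
    unfolding closure_pairs_sequential
    by (intro exI[of _ "\<lambda>n. c *\<^sub>C f n"] exI[of _ "\<lambda>n. c *\<^sub>C g n"])
      (simp add: f lin_graph_scale bounded_linear.tendsto[OF bounded_linear_scaleC_right])
qed

context
  fixes S and j :: "'i \<Rightarrow> 'a::complex_normed_vector" and k :: "'i \<Rightarrow> 'b::{complex_normed_vector, banach}" and K
  assumes bound: "\<And>x y. (x, y) \<in> lin_graph S j k \<Longrightarrow> norm y \<le> K * norm x"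
begin

text \<open>The bound carries Cauchy sequences from the first coordinate to the second, where
  completeness supplies the limit.\<close>

lemma closure_lin_graph_total:
  assumes "x \<in> closure (csubspace hull (j ` S))"
  obtains y where "(x, y) \<in> closure (lin_graph S j k)"
proof -
  obtain f where f: "\<forall>n::nat. f n \<in> csubspace hull (j ` S)" "f \<longlonglongrightarrow> x"
    using assms unfolding closure_sequential by blast
  have "\<exists>y. (f n, y) \<in> lin_graph S j k" for n
    using f(1) by (blast elim: lin_graph_domain)
  then have "\<exists>g. \<forall>n. (f n, g n) \<in> lin_graph S j k" by (intro choice allI)
  then obtain g where g: "\<And>n. (f n, g n) \<in> lin_graph S j k" by blast
  have g_le: "dist (g m) (g n) \<le> (\<bar>K\<bar> + 1) * dist (f m) (f n)" for m n
  proof -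
    have "dist (g m) (g n) \<le> K * dist (f m) (f n)"
      using bound[OF lin_graph_diff[OF g g]] by (simp add: dist_norm)
    \<comment> \<open>The sign of \<open>K\<close> is unknown and the Cauchy argument divides by the
      constant.\<close>
    also have "\<dots> \<le> (\<bar>K\<bar> + 1) * dist (f m) (f n)" by (intro mult_right_mono) auto
    finally show ?thesis .
  qed
  have "Cauchy g"
  proof (rule metric_CauchyI)
    fix e :: real assume "e > 0"
    then obtain N where N: "\<And>m n. m \<ge> N \<Longrightarrow> n \<ge> N \<Longrightarrow> dist (f m) (f n) < e / (\<bar>K\<bar> + 1)"
      using metric_CauchyD[OF LIMSEQ_imp_Cauchy[OF f(2)], of "e / (\<bar>K\<bar> + 1)"] by force
    have "dist (g m) (g n) < e" if "m \<ge> N" "n \<ge> N" for m n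
      using g_le[of m n] N[OF that] by (simp add: pos_less_divide_eq mult.commute)
    then show "\<exists>N. \<forall>m\<ge>N. \<forall>n\<ge>N. dist (g m) (g n) < e" by blast
  qed
  then obtain y where "g \<longlonglongrightarrow> y" unfolding Cauchy_convergent_iff convergent_def by (rule exE)
  then have "(x, y) \<in> closure (lin_graph S j k)"
    unfolding closure_pairs_sequential using f(2) g by blast
  then show thesis by (rule that)
qed

lemma closure_lin_graph_bound:
  assumes "(x, y) \<in> closure (lin_graph S j k)"
  shows "norm y \<le> K * norm x"
proof -
  obtain f g where f: "\<And>n::nat. (f n, g n) \<in> lin_graph S j k" "f \<longlonglongrightarrow> x" "g \<longlonglongrightarrow> y"
    using closure_lin_graph_seq[OF assms] by blast
  show ?thesis
    by (rule LIMSEQ_le[OF tendsto_norm[OF f(3)] tendsto_mult[OF tendsto_const tendsto_norm[OF f(2)]]])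
      (intro exI[of _ 0] allI impI bound f(1))
qed

text \<open>Two values at the same point differ by the second coordinate of a pair whose first
  coordinate is 0, and the bound kills it.\<close>

lemma closure_lin_graph_functional:
  assumes "(x, y) \<in> closure (lin_graph S j k)" "(x, y') \<in> closure (lin_graph S j k)"
  shows "y = y'"
  using closure_lin_graph_bound[OF closure_lin_graph_add[OF assms(1) closure_lin_graph_scale[OF assms(2), of "-1"]]]
  by (simp add: scaleC_minus_one)

end

text \<open>Asking for the bound on all finite combinations also settles well-definedness, so the
  spanning family may be linearly dependent, as words are.\<close>

lemma dense_extension:
  fixes j k :: "'i \<Rightarrow> 'h::complex_hilbert"
  assumes dense: "closure (csubspace hull (j ` S)) = UNIV"
    and bound: "\<And>F c. finite F \<Longrightarrow> F \<subseteq> S \<Longrightarrow>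
      norm (\<Sum>i\<in>F. c i *\<^sub>C k i) \<le> K * norm (\<Sum>i\<in>F. c i *\<^sub>C j i)"
  obtains T where "T \<in> cops" "\<And>i. i \<in> S \<Longrightarrow> T \<cdot> j i = k i"
proof -
  let ?G = "closure (lin_graph S j k)"
  have G_bound: "norm y \<le> K * norm x" if "(x, y) \<in> lin_graph S j k" for x y
    by (rule lin_graphE[OF that]) (simp add: bound)
  have "\<exists>y. (x, y) \<in> ?G" for x
    by (rule closure_lin_graph_total[OF G_bound, where x = x]) (auto simp: dense)
  then have "\<exists>h. \<forall>x. (x, h x) \<in> ?G" by (intro choice allI)
  then obtain h where h: "\<And>x. (x, h x) \<in> ?G" by blast
  have h_eq: "h x = y" if "(x, y) \<in> ?G" for x y
    by (rule closure_lin_graph_functional[OF G_bound h that])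
  have h_scale: "h (c *\<^sub>C x) = c *\<^sub>C h x" for c x
    by (rule h_eq[OF closure_lin_graph_scale[OF h]])
  have bl: "bounded_linear h"
  proof (rule bounded_linear_intro[of _ K])
    show "h (x + y) = h x + h y" for x y by (rule h_eq[OF closure_lin_graph_add[OF h h]])
    show "h (r *\<^sub>R x) = r *\<^sub>R h x" for r x using h_scale[of "of_real r" x] by (simp add: scaleC_of_real)
    show "norm (h x) \<le> norm x * K" for x
      using closure_lin_graph_bound[OF G_bound h] by (simp add: mult.commute)
  qed
  show thesis
  proof (rule that[of "Blinfun h"])
    show "Blinfun h \<in> cops" by (rule copsI) (simp add: bounded_linear_Blinfun_apply[OF bl] h_scale)
    fix i assume "i \<in> S"
    then have "(j i, k i) \<in> ?G"
      using lin_graphI[of "{i}" S "\<lambda>_. 1" j k] closure_subset by auto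
    then show "Blinfun h \<cdot> j i = k i"
      by (simp add: bounded_linear_Blinfun_apply[OF bl] h_eq)
  qed
qed

section \<open>Splitting words and the \<open>q\<close>-inner product\<close>

text \<open>\<open>rem_sum q xs F\<close> sums \<open>F y r\<close> over the ways to remove a letter \<open>y\<close> from \<open>xs\<close> leaving \<open>r\<close>, with weight \<open>q\<^sup>i\<close> if
  \<open>y\<close> was at position \<open>i\<close>. \<open>split_sum q xs k F\<close> sums \<open>F A R\<close> over the ways to split \<open>xs\<close> into a subword \<open>A\<close> of length
  \<open>k\<close> and the complementary subword \<open>R\<close>, with \<open>q\<close> raised to the number of pairs of a letter of \<open>R\<close> that
  precedes a letter of \<open>A\<close>.\<close>

primrec rem_sum :: "real \<Rightarrow> 'a list \<Rightarrow> ('a \<Rightarrow> 'a list \<Rightarrow> 'b) \<Rightarrow> 'b::real_vector" where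
  "rem_sum q [] F = 0"
| "rem_sum q (x # xs) F = F x xs + q *\<^sub>R rem_sum q xs (\<lambda>y r. F y (x # r))"

primrec split_sum :: "real \<Rightarrow> 'a list \<Rightarrow> nat \<Rightarrow> ('a list \<Rightarrow> 'a list \<Rightarrow> 'b) \<Rightarrow> 'b::real_vector" where
  "split_sum q [] k F = (if k = 0 then F [] [] else 0)"
| "split_sum q (x # xs) k F =
     (if k = 0 then 0 else split_sum q xs (k - 1) (\<lambda>A R. F (x # A) R)) +
     q ^ k *\<^sub>R split_sum q xs k (\<lambda>A R. F A (x # R))"

lemma rem_sum_cong:
  assumes "\<And>y r. mset (y # r) = mset xs \<Longrightarrow> F y r = G y r"
  shows "rem_sum q xs F = rem_sum q xs G"
  using assms
proof (induction xs arbitrary: F G)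
  case (Cons x xs)
  have "rem_sum q xs (\<lambda>y r. F y (x # r)) = rem_sum q xs (\<lambda>y r. G y (x # r))"
    by (intro Cons.IH Cons.prems) auto
  then show ?case using Cons.prems[of x xs] by simp
qed simp

lemma split_sum_cong:
  assumes "\<And>A R. mset (A @ R) = mset xs \<Longrightarrow> length A = k \<Longrightarrow> F A R = G A R"
  shows "split_sum q xs k F = split_sum q xs k G"
  using assms
proof (induction xs arbitrary: k F G)
  case (Cons x xs)
  have "split_sum q xs k (\<lambda>A R. F A (x # R)) = split_sum q xs k (\<lambda>A R. G A (x # R))"
    by (intro Cons.IH Cons.prems) auto
  moreover have "k \<noteq> 0 \<Longrightarrow> split_sum q xs (k - 1) (\<lambda>A R. F (x # A) R) = split_sum q xs (k - 1) (\<lambda>A R. G (x # A) R)"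
    by (intro Cons.IH Cons.prems) auto
  ultimately show ?case by simp
qed simp

lemma rem_sum_linear: "linear h \<Longrightarrow> h (rem_sum q xs F) = rem_sum q xs (\<lambda>y r. h (F y r))"
  by (induction xs arbitrary: F) (simp_all add: linear_0 linear_add linear_scale)

lemma split_sum_linear: "linear h \<Longrightarrow> h (split_sum q xs k F) = split_sum q xs k (\<lambda>A R. h (F A R))"
  by (induction xs arbitrary: k F) (simp_all add: linear_0 linear_add linear_scale)

lemma rem_sum_in:
  assumes "csubspace S" "\<And>y r. mset (y # r) = mset w \<Longrightarrow> F y r \<in> S"
  shows "rem_sum q w F \<in> S"
  using assms(2)
proof (induction w arbitrary: F)
  case (Cons x w)
  have "rem_sum q w (\<lambda>y r. F y (x # r)) \<in> S"
    by (intro Cons.IH Cons.prems) auto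
  then show ?case using Cons.prems by (auto intro!: csubspace_add[OF assms(1)] csubspace_scaleR[OF assms(1)])
qed (use csubspace_0[OF assms(1)] in simp)

lemma rem_sum_add: "rem_sum q xs (\<lambda>y r. F y r + G y r) = rem_sum q xs F + rem_sum q xs G"
  by (induction xs arbitrary: F G) (simp_all add: algebra_simps)

lemma split_sum_add: "split_sum q xs k (\<lambda>A R. F A R + G A R) = split_sum q xs k F + split_sum q xs k G"
  by (induction xs arbitrary: k F G) (simp_all add: algebra_simps)

lemma rem_sum_zero [simp]: "rem_sum q xs (\<lambda>y r. 0) = 0"
  by (induction xs) simp_all

lemma split_sum_zero [simp]: "split_sum q xs k (\<lambda>A R. 0) = 0"
  by (induction xs arbitrary: k) simp_all

lemma rem_sum_sum: "rem_sum q xs (\<lambda>y r. \<Sum>i\<in>I. F i y r) = (\<Sum>i\<in>I. rem_sum q xs (F i))"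
  by (induction I rule: infinite_finite_induct) (simp_all add: rem_sum_add)

lemma split_sum_sum: "split_sum q xs k (\<lambda>A R. \<Sum>i\<in>I. F i A R) = (\<Sum>i\<in>I. split_sum q xs k (F i))"
  by (induction I rule: infinite_finite_induct) (simp_all add: split_sum_add)

lemma rem_sum_append:
  "rem_sum q (xs @ ys) F = rem_sum q xs (\<lambda>y r. F y (r @ ys)) + q ^ length xs *\<^sub>R rem_sum q ys (\<lambda>y r. F y (xs @ r))"
  by (induction xs arbitrary: F) (simp_all add: algebra_simps)

lemma split_sum_0 [simp]: "split_sum q xs 0 F = F [] xs"
  by (induction xs arbitrary: F) simp_all

lemma split_sum_too_large: "length xs < k \<Longrightarrow> split_sum q xs k F = 0"
  by (induction xs arbitrary: k F) simp_all

lemma split_sum_length [simp]: "split_sum q xs (length xs) F = F xs []"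
  by (induction xs arbitrary: F) (simp_all add: split_sum_too_large)

text \<open>Choosing a subword and then singling out one of its letters is the same as singling out
  the letter first. The weights agree: the position of the letter in \<open>xs\<close> is its
  position in \<open>A\<close> plus the number of letters of \<open>R\<close> before it.\<close>

lemma split_sum_Suc:
  "split_sum q xs (Suc k) (\<lambda>A R. rem_sum q A (\<lambda>x A'. F x A' R)) =
   rem_sum q xs (\<lambda>x r. split_sum q r k (\<lambda>A R. F x A R))"
proof (induction xs arbitrary: k F)
  case (Cons x xs)
  have "split_sum q (x # xs) (Suc k) (\<lambda>A R. rem_sum q A (\<lambda>x A'. F x A' R)) =
     split_sum q xs k (\<lambda>A R. F x A R) + q *\<^sub>R split_sum q xs k (\<lambda>A R. rem_sum q A (\<lambda>y r. F y (x # r) R)) +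
     q ^ Suc k *\<^sub>R split_sum q xs (Suc k) (\<lambda>A R. rem_sum q A (\<lambda>y A'. F y A' (x # R)))"
    using split_sum_linear[of "\<lambda>v. q *\<^sub>R v" q xs k "\<lambda>A R. rem_sum q A (\<lambda>y r. F y (x # r) R)"]
    by (simp add: split_sum_add linear_iff scaleR_add_right)
  also have "q *\<^sub>R split_sum q xs k (\<lambda>A R. rem_sum q A (\<lambda>y r. F y (x # r) R)) =
     q *\<^sub>R (if k = 0 then 0 else rem_sum q xs (\<lambda>y r. split_sum q r (k - 1) (\<lambda>A R. F y (x # A) R)))"
  proof (cases k)
    case (Suc k')
    then show ?thesis using Cons.IH[of k' "\<lambda>y A R. F y (x # A) R"] by simp
  qed simp
  also have "split_sum q xs (Suc k) (\<lambda>A R. rem_sum q A (\<lambda>y A'. F y A' (x # R))) =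
     rem_sum q xs (\<lambda>y r. split_sum q r k (\<lambda>A R. F y A (x # R)))"
    by (rule Cons.IH)
  also have "split_sum q xs k (\<lambda>A R. F x A R) +
      q *\<^sub>R (if k = 0 then 0 else rem_sum q xs (\<lambda>y r. split_sum q r (k - 1) (\<lambda>A R. F y (x # A) R))) +
      q ^ Suc k *\<^sub>R rem_sum q xs (\<lambda>y r. split_sum q r k (\<lambda>A R. F y A (x # R))) =
    rem_sum q (x # xs) (\<lambda>y r. split_sum q r k (\<lambda>A R. F y A R))"
    using rem_sum_linear[of "\<lambda>v. q ^ k *\<^sub>R v" q xs "\<lambda>y r. split_sum q r k (\<lambda>A R. F y A (x # R))", symmetric]
    by (cases "k = 0") (simp_all add: rem_sum_add linear_iff scaleR_add_right)
  finally show ?case .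
qed simp

text \<open>With a single letter left out of \<open>A\<close>, the weight counts the letters after
  it, which is its position in the reversed word.\<close>

lemma split_sum_last:
  "length xs = Suc n \<Longrightarrow> split_sum q xs n F = rem_sum q (rev xs) (\<lambda>x r. F (rev r) [x])"
proof (induction xs arbitrary: n F)
  case (Cons x xs)
  then have n: "n = length xs" by simp
  show ?case
  proof (cases n)
    case (Suc m)
    then have "split_sum q xs m (\<lambda>A. F (x # A)) = rem_sum q (rev xs) (\<lambda>y r. F (x # rev r) [y])"
      using n by (intro Cons.IH) simp
    moreover have "split_sum q xs (Suc m) (\<lambda>A R. F A (x # R)) = F xs [x]"
      using split_sum_length[of q xs "\<lambda>A R. F A (x # R)"] Suc n by (simp only:)
    ultimately show ?thesis using Suc n by (simp add: rem_sum_append)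
  qed (use n in simp)
qed simp

lemma norm_split_sum_le:
  fixes F :: "'a list \<Rightarrow> 'a list \<Rightarrow> 'b::real_normed_vector"
  assumes "0 \<le> q" "\<And>A R. mset (A @ R) = mset xs \<Longrightarrow> length A = k \<Longrightarrow> norm (F A R) \<le> G A R"
  shows "norm (split_sum q xs k F) \<le> split_sum q xs k G"
  using assms(2)
proof (induction xs arbitrary: k F G)
  case (Cons x xs)
  have "norm (split_sum q xs k (\<lambda>A R. F A (x # R))) \<le> split_sum q xs k (\<lambda>A R. G A (x # R))"
    by (intro Cons.IH Cons.prems) auto
  then have "norm (q ^ k *\<^sub>R split_sum q xs k (\<lambda>A R. F A (x # R))) \<le> q ^ k * split_sum q xs k (\<lambda>A R. G A (x # R))"
    using assms(1) by (simp add: mult_left_mono)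
  moreover have "k \<noteq> 0 \<Longrightarrow> norm (split_sum q xs (k - 1) (\<lambda>A R. F (x # A) R)) \<le> split_sum q xs (k - 1) (\<lambda>A R. G (x # A) R)"
    by (intro Cons.IH Cons.prems) auto
  ultimately show ?case by (simp add: norm_triangle_le add_mono)
qed simp

text \<open>With \<open>F = 1\<close> the sum is the \<open>q\<close>-binomial coefficient, which is bounded uniformly in both parameters.\<close>

definition binomial_bound :: "real \<Rightarrow> real" where
  "binomial_bound q = exp (1 / (1 - q)\<^sup>2)"

lemma split_sum_1_le:
  assumes "0 \<le> q" "q < 1"
  shows "split_sum q xs k (\<lambda>A R. 1) \<le> binomial_bound q"
proof -
  have q1: "q ^ Suc i < 1" for i
    using assms power_Suc_less_one[of q i] by (cases "q = 0") auto
  \<comment> \<open>The products c_k of the factors 1 / (1 - q^(i+1)) satisfy c_(k-1) + q^k c_k =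
    c_k, which is the recursion of \<open>split_sum\<close> in the first letter.\<close>
  have *: "split_sum q xs k (\<lambda>A R. 1) \<le> (\<Prod>i<k. 1 / (1 - q ^ Suc i))" for xs :: "'a list" and k
  proof (induction xs arbitrary: k)
    case (Cons x xs)
    show ?case
    proof (cases k)
      case (Suc m)
      let ?c = "\<Prod>i<m. 1 / (1 - q ^ Suc i)"
      have "split_sum q (x # xs) k (\<lambda>A R. 1) \<le> ?c + q ^ Suc m * (\<Prod>i<Suc m. 1 / (1 - q ^ Suc i))"
        using Cons.IH[of m] Cons.IH[of "Suc m"] assms Suc
        by (simp add: add_mono mult_left_mono del: prod.lessThan_Suc power_Suc)
      also have "\<dots> = (\<Prod>i<k. 1 / (1 - q ^ Suc i))"
        using q1[of m] Suc by (simp add: field_simps)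
      finally show ?thesis .
    qed (use Cons in simp)
  next
    case Nil
    have "0 \<le> 1 / (1 - q ^ Suc i)" for i using q1[of i] by simp
    then have "0 \<le> (\<Prod>i<k. 1 / (1 - q ^ Suc i))" by (intro prod_nonneg) auto
    then show ?case by (cases k) auto
  qed
  \<comment> \<open>This removes the dependence on k: each factor is 1 + q^(i+1) / (1 - q^(i+1)), at
    most exp (q^i / (1 - q)), and the geometric series in the exponent sums to at most 1 / (1 -
    q)^2.\<close>
  have "(\<Prod>i<k. 1 / (1 - q ^ Suc i)) \<le> (\<Prod>i<k. exp (q ^ i / (1 - q)))"
  proof (intro prod_mono conjI)
    fix i
    show "0 \<le> 1 / (1 - q ^ Suc i)" using q1[of i] by simp
    have "1 / (1 - q ^ Suc i) = 1 + q ^ Suc i / (1 - q ^ Suc i)" using q1[of i] by (simp add: field_simps)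
    also have "\<dots> \<le> 1 + q ^ i / (1 - q)"
    proof -
      have a: "q ^ Suc i \<le> q ^ i" "q ^ Suc i \<le> q"
        using assms by (simp_all add: mult_left_le_one_le power_le_one mult_right_le_one_le)
      then have "q ^ Suc i / (1 - q ^ Suc i) \<le> q ^ i / (1 - q)"
        using assms q1[of i] by (intro frac_le) auto
      then show ?thesis by simp
    qed
    also have "\<dots> \<le> exp (q ^ i / (1 - q))" by (rule exp_ge_add_one_self)
    finally show "1 / (1 - q ^ Suc i) \<le> exp (q ^ i / (1 - q))" .
  qed
  also have "\<dots> = exp (\<Sum>i<k. q ^ i / (1 - q))" by (simp add: exp_sum)
  also have "(\<Sum>i<k. q ^ i / (1 - q)) \<le> 1 / (1 - q)\<^sup>2"
  proof -
    have "(\<Sum>i<k. q ^ i) \<le> (\<Sum>i. q ^ i)"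
      using assms by (intro sum_le_suminf summable_geometric) auto
    also have "\<dots> = 1 / (1 - q)" using assms by (intro suminf_geometric) auto
    finally show ?thesis using assms
      by (simp add: sum_divide_distrib[symmetric] power2_eq_square divide_right_mono flip: divide_divide_eq_left)
  qed
  finally show ?thesis using *[of xs k] by (simp add: binomial_bound_def)
qed

lemma binomial_bound_ge_1: "1 \<le> binomial_bound q"
  by (simp add: binomial_bound_def)

lemma norm_split_sum_bound:
  fixes F :: "'a list \<Rightarrow> 'a list \<Rightarrow> 'b::real_normed_vector"
  assumes q: "0 \<le> q" "q < 1" and M: "0 \<le> M"
    and F: "\<And>A R. mset (A @ R) = mset xs \<Longrightarrow> length A = k \<Longrightarrow> norm (F A R) \<le> M"
  shows "norm (split_sum q xs k F) \<le> binomial_bound q * M"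
proof -
  have "norm (split_sum q xs k F) \<le> split_sum q xs k (\<lambda>A R. M * 1)"
    using F by (intro norm_split_sum_le q) auto
  also have "\<dots> = M * split_sum q xs k (\<lambda>A R. 1)"
    by (intro split_sum_linear[symmetric] bounded_linear.linear[OF bounded_linear_mult_right])
  also have "\<dots> \<le> M * binomial_bound q"
    using M split_sum_1_le[OF q] by (intro mult_left_mono)
  finally show ?thesis by (simp add: mult.commute)
qed

text \<open>A permutation of \<open>Suc n\<close> points is encoded by the image \<open>i\<close> of 0 and a permutation \<open>\<tau>\<close> of \<open>n\<close> points; the
  point 0 then contributes \<open>i\<close> inversions.\<close>

definition shift_at :: "nat \<Rightarrow> nat \<Rightarrow> nat" where
  "shift_at i k = (if k < i then k else Suc k)"

definition unshift_at :: "nat \<Rightarrow> nat \<Rightarrow> nat" where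
  "unshift_at i k = (if k < i then k else k - 1)"

definition perm_cons :: "nat \<Rightarrow> (nat \<Rightarrow> nat) \<Rightarrow> nat \<Rightarrow> nat" where
  "perm_cons i \<tau> k = (case k of 0 \<Rightarrow> i | Suc j \<Rightarrow> shift_at i (\<tau> j))"

lemma shift_at_less_iff: "shift_at i a < shift_at i b \<longleftrightarrow> a < b"
  by (auto simp: shift_at_def)

lemma shift_at_eq_iff: "shift_at i a = shift_at i b \<longleftrightarrow> a = b"
  by (auto simp: shift_at_def)

lemma shift_at_neq: "shift_at i a \<noteq> i"
  by (auto simp: shift_at_def)

lemma unshift_shift_at [simp]: "unshift_at i (shift_at i k) = k"
  by (auto simp: shift_at_def unshift_at_def)

lemma shift_unshift_at: "k \<noteq> i \<Longrightarrow> shift_at i (unshift_at i k) = k"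
  by (auto simp: shift_at_def unshift_at_def)

lemma permutes_perm_cons:
  assumes "\<tau> permutes {..<n}" "i \<le> n"
  shows "perm_cons i \<tau> permutes {..<Suc n}"
proof (rule bij_imp_permutes)
  have inj: "inj \<tau>" using assms permutes_inj by blast
  show "bij_betw (perm_cons i \<tau>) {..<Suc n} {..<Suc n}"
    unfolding bij_betw_def
  proof
    show "inj_on (perm_cons i \<tau>) {..<Suc n}"
    proof (rule inj_onI)
      fix a b assume "perm_cons i \<tau> a = perm_cons i \<tau> b"
      then show "a = b"
        using inj by (auto simp: perm_cons_def shift_at_eq_iff shift_at_neq shift_at_neq[symmetric]
            split: nat.splits dest: injD)
    qed
    then show "perm_cons i \<tau> ` {..<Suc n} = {..<Suc n}"
    proof (intro card_subset_eq)
      show "perm_cons i \<tau> ` {..<Suc n} \<subseteq> {..<Suc n}"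
      proof
        fix y assume "y \<in> perm_cons i \<tau> ` {..<Suc n}"
        then obtain k where k: "k < Suc n" "y = perm_cons i \<tau> k" by auto
        show "y \<in> {..<Suc n}"
        proof (cases k)
          case (Suc j)
          then have "\<tau> j < n" using permutes_in_image[OF assms(1), of j] k by simp
          then show ?thesis using k Suc by (simp add: perm_cons_def shift_at_def)
        qed (use k assms in \<open>simp add: perm_cons_def\<close>)
      qed
    qed (auto simp: card_image)
  qed
  fix x assume "x \<notin> {..<Suc n}"
  then obtain j where j: "x = Suc j" "n \<le> j" by (cases x) auto
  then have "\<tau> j = j" using permutes_not_in[OF assms(1), of j] by simp
  then show "perm_cons i \<tau> x = x"
    using j assms(2) by (simp add: perm_cons_def shift_at_def)
qed

lemma perm_cons_0 [simp]: "perm_cons i \<tau> 0 = i"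
  and perm_cons_Suc [simp]: "perm_cons i \<tau> (Suc j) = shift_at i (\<tau> j)"
  by (simp_all add: perm_cons_def)

lemma perm_cons_decomp:
  assumes "\<sigma> permutes {..<Suc n}"
  defines "\<tau> \<equiv> \<lambda>j. unshift_at (\<sigma> 0) (\<sigma> (Suc j))"
  shows "\<sigma> 0 \<le> n" "perm_cons (\<sigma> 0) \<tau> = \<sigma>" "\<tau> permutes {..<n}"
proof -
  have inj: "inj \<sigma>" using assms permutes_inj by blast
  show le: "\<sigma> 0 \<le> n" using permutes_in_image[OF assms(1), of 0] by simp
  have ne: "\<sigma> (Suc j) \<noteq> \<sigma> 0" for j using inj by (metis injD nat.distinct(1))
  show eq: "perm_cons (\<sigma> 0) \<tau> = \<sigma>"
    by (rule ext) (auto simp: perm_cons_def \<tau>_def shift_unshift_at[OF ne] split: nat.splits)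
  show "\<tau> permutes {..<n}"
  proof (rule bij_imp_permutes)
    have sh: "shift_at (\<sigma> 0) (\<tau> j) = \<sigma> (Suc j)" for j
      by (simp add: \<tau>_def shift_unshift_at[OF ne])
    show "bij_betw \<tau> {..<n} {..<n}"
      unfolding bij_betw_def
    proof
      show "inj_on \<tau> {..<n}"
        by (rule inj_onI) (metis inj injD sh Suc_inject)
      then show "\<tau> ` {..<n} = {..<n}"
      proof (intro card_subset_eq)
        show "\<tau> ` {..<n} \<subseteq> {..<n}"
        proof
          fix y assume "y \<in> \<tau> ` {..<n}"
          then obtain j where j: "j < n" "y = \<tau> j" by auto
          have "\<sigma> (Suc j) \<le> n" using permutes_in_image[OF assms(1), of "Suc j"] j by simp
          then show "y \<in> {..<n}" using sh[of j] ne[of j] le j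
            by (auto simp: shift_at_def split: if_splits)
        qed
      qed (auto simp: card_image)
    qed
    fix x assume "x \<notin> {..<n}"
    then have "\<sigma> (Suc x) = Suc x" using permutes_not_in[OF assms(1)] by simp
    then show "\<tau> x = x" using le \<open>x \<notin> {..<n}\<close> by (simp add: \<tau>_def unshift_at_def)
  qed
qed

lemma inversions_perm_cons:
  assumes "\<tau> permutes {..<n}" "i \<le> n"
  shows "inversions (Suc n) (perm_cons i \<tau>) = i + inversions n \<tau>"
proof -
  define \<sigma> where "\<sigma> = perm_cons i \<tau>"
  have p: "\<sigma> permutes {..<Suc n}" unfolding \<sigma>_def by (rule permutes_perm_cons[OF assms])
  define A where "A = {(a, b). a < b \<and> b < Suc n \<and> \<sigma> a > \<sigma> b \<and> a = 0}"
  define B where "B = {(a, b). a < b \<and> b < Suc n \<and> \<sigma> a > \<sigma> b \<and> a \<noteq> 0}"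
  have fin: "finite A" "finite B"
    by (rule finite_subset[of _ "{..<Suc n} \<times> {..<Suc n}"]; auto simp: A_def B_def)+
  have "{(a, b). a < b \<and> b < Suc n \<and> \<sigma> a > \<sigma> b} = A \<union> B" "A \<inter> B = {}"
    by (auto simp: A_def B_def)
  then have "inversions (Suc n) \<sigma> = card A + card B"
    unfolding inversions_def using fin by (simp add: card_Un_disjoint)
  \<comment> \<open>The inversions (0, b) correspond to the values below \<open>i\<close>: each is
    taken exactly once, and never at 0, where the value is \<open>i\<close>.\<close>
  moreover have "card A = i"
  proof -
    have bij: "bij_betw \<sigma> UNIV UNIV" using p permutes_bij by blast
    have "bij_betw (\<lambda>c. (0, inv \<sigma> c)) {..<i} A"
    proof (rule bij_betw_byWitness[where f' = "\<lambda>(a, b). \<sigma> b"])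
      show "\<forall>a\<in>{..<i}. (case (0::nat, inv \<sigma> a) of (a, b) \<Rightarrow> \<sigma> b) = a"
        using bij by (simp add: bij_is_surj surj_f_inv_f)
      show "\<forall>a'\<in>A. (0, inv \<sigma> (case a' of (a, b) \<Rightarrow> \<sigma> b)) = a'"
        using bij by (auto simp: A_def bij_is_inj inv_f_f)
      show "(\<lambda>c. (0, inv \<sigma> c)) ` {..<i} \<subseteq> A"
      proof
        fix x assume "x \<in> (\<lambda>c. (0::nat, inv \<sigma> c)) ` {..<i}"
        then obtain c where c: "c < i" "x = (0, inv \<sigma> c)" by auto
        have s: "\<sigma> (inv \<sigma> c) = c" using bij by (simp add: bij_is_surj surj_f_inv_f)
        have "inv \<sigma> c < Suc n" using permutes_in_image[OF p, of "inv \<sigma> c"] s c assms by simp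
        moreover have "inv \<sigma> c \<noteq> 0" using s c by (metis \<sigma>_def perm_cons_0 nat_neq_iff)
        ultimately show "x \<in> A" using c s by (auto simp: A_def \<sigma>_def)
      qed
      show "(\<lambda>(a, b). \<sigma> b) ` A \<subseteq> {..<i}" by (auto simp: A_def \<sigma>_def)
    qed
    then show ?thesis using bij_betw_same_card by fastforce
  qed
  moreover have "card B = inversions n \<tau>"
  proof -
    have "B = (\<lambda>(a, b). (Suc a, Suc b)) ` {(a, b). a < b \<and> b < n \<and> \<tau> a > \<tau> b}"
    proof (intro set_eqI iffI)
      fix x assume "x \<in> B"
      then obtain a b where x: "x = (Suc a, Suc b)" "Suc a < Suc b" "Suc b < Suc n" "\<sigma> (Suc a) > \<sigma> (Suc b)"
        unfolding B_def by (cases x, cases "fst x", auto) (metis less_nat_zero_code not0_implies_Suc not_less_eq)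
      then show "x \<in> (\<lambda>(a, b). (Suc a, Suc b)) ` {(a, b). a < b \<and> b < n \<and> \<tau> a > \<tau> b}"
        by (auto simp: \<sigma>_def shift_at_less_iff)
    qed (auto simp: B_def \<sigma>_def shift_at_less_iff)
    moreover have "inj_on (\<lambda>(a, b). (Suc a, Suc b)) X" for X by (auto simp: inj_on_def)
    ultimately show ?thesis unfolding inversions_def by (simp add: card_image)
  qed
  ultimately show ?thesis by (simp add: \<sigma>_def)
qed

section \<open>Recursion, factorisation and reversal of the q-inner product\<close>

lemma rem_sum_eq_sum:
  "rem_sum q xs F = (\<Sum>i<length xs. q ^ i *\<^sub>R F (xs ! i) (take i xs @ drop (Suc i) xs))"
  by (induction xs arbitrary: F)
    (simp_all add: sum.lessThan_Suc_shift scaleR_sum_right del: sum.lessThan_Suc)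

lemma nth_take_drop_Suc:
  assumes "i < length xs" "k < length xs - 1"
  shows "(take i xs @ drop (Suc i) xs) ! k = xs ! shift_at i k"
  using assms by (auto simp: nth_append shift_at_def min_def)

lemma q_inner_Nil [simp]: "q_inner q [] [] = 1"
  by (simp add: q_inner_def inversions_def)

lemma q_inner_length: "length fs \<noteq> length gs \<Longrightarrow> q_inner q fs gs = 0"
  by (simp add: q_inner_def)

text \<open>Grouping the permutations by the image i of 0 expands the inner product along its first
  letter, with weight q^i from the inversions that involve 0. The later arguments work with this
  recursion and not with permutations.\<close>

lemma q_inner_Cons:
  "q_inner q (f # fs) gs = rem_sum q gs (\<lambda>g r. L2inner f g * q_inner q fs r)"
proof (cases "length gs = Suc (length fs)")
  case False
  have "rem_sum q gs (\<lambda>g r. L2inner f g * q_inner q fs r) = rem_sum q gs (\<lambda>g r. 0)"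
  proof (rule rem_sum_cong)
    fix y r assume "mset (y # r) = mset gs"
    then have "length gs = Suc (length r)" by (metis length_Cons mset_eq_length)
    then show "L2inner f y * q_inner q fs r = 0" using False by (simp add: q_inner_length)
  qed
  then show ?thesis using False by (simp add: q_inner_length)
next
  case True
  define n where "n = length fs"
  have len: "length gs = Suc n" using True by (simp add: n_def)
  define w where "w m \<tau> xs ys = complex_of_real (q ^ inversions m \<tau>) * (\<Prod>i<m. L2inner (xs ! i) (ys ! \<tau> i))"
    for m \<tau> and xs ys :: "(real \<Rightarrow> complex) list"
  have "q_inner q (f # fs) gs = (\<Sum>\<sigma> | \<sigma> permutes {..<Suc n}. w (Suc n) \<sigma> (f # fs) gs)"
    using True by (simp add: q_inner_def n_def w_def)
  also have "\<dots> = (\<Sum>(i, \<tau>) \<in> {..n} \<times> {\<tau>. \<tau> permutes {..<n}}.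
      of_real (q ^ i) * L2inner f (gs ! i) * w n \<tau> fs (take i gs @ drop (Suc i) gs))"
  proof (rule sum.reindex_bij_witness[where
        i = "\<lambda>(i, \<tau>). perm_cons i \<tau>" and j = "\<lambda>\<sigma>. (\<sigma> 0, \<lambda>j. unshift_at (\<sigma> 0) (\<sigma> (Suc j)))"])
    fix \<sigma> assume "\<sigma> \<in> {\<sigma>. \<sigma> permutes {..<Suc n}}"
    then have \<sigma>: "\<sigma> permutes {..<Suc n}" by simp
    note d = perm_cons_decomp[OF \<sigma>]
    define \<tau> where "\<tau> = (\<lambda>j. unshift_at (\<sigma> 0) (\<sigma> (Suc j)))"
    show "(case (\<sigma> 0, \<lambda>j. unshift_at (\<sigma> 0) (\<sigma> (Suc j))) of (i, \<tau>) \<Rightarrow> perm_cons i \<tau>) = \<sigma>" using d by simp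
    show "(\<sigma> 0, \<lambda>j. unshift_at (\<sigma> 0) (\<sigma> (Suc j))) \<in> {..n} \<times> {\<tau>. \<tau> permutes {..<n}}" using d by simp
    have \<tau>: "\<tau> permutes {..<n}" "perm_cons (\<sigma> 0) \<tau> = \<sigma>" "\<sigma> 0 \<le> n" using d by (simp_all add: \<tau>_def)
    have sh: "\<sigma> (Suc j) = shift_at (\<sigma> 0) (\<tau> j)" for j by (metis \<tau>(2) perm_cons_Suc)
    have "w (Suc n) \<sigma> (f # fs) gs = of_real (q ^ (\<sigma> 0 + inversions n \<tau>)) *
        (L2inner f (gs ! \<sigma> 0) * (\<Prod>i<n. L2inner (fs ! i) (gs ! \<sigma> (Suc i))))"
      using inversions_perm_cons[OF \<tau>(1,3)] \<tau>(2)
      by (simp add: w_def prod.lessThan_Suc_shift del: prod.lessThan_Suc)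
    also have "(\<Prod>i<n. L2inner (fs ! i) (gs ! \<sigma> (Suc i))) =
        (\<Prod>i<n. L2inner (fs ! i) ((take (\<sigma> 0) gs @ drop (Suc (\<sigma> 0)) gs) ! \<tau> i))"
    proof (intro prod.cong refl)
      fix i assume "i \<in> {..<n}"
      then have "\<tau> i < n" using permutes_in_image[OF \<tau>(1), of i] by simp
      then show "L2inner (fs ! i) (gs ! \<sigma> (Suc i)) =
          L2inner (fs ! i) ((take (\<sigma> 0) gs @ drop (Suc (\<sigma> 0)) gs) ! \<tau> i)"
        using len \<tau>(3) by (subst nth_take_drop_Suc) (simp_all add: sh)
    qed
    finally show "(case (\<sigma> 0, \<lambda>j. unshift_at (\<sigma> 0) (\<sigma> (Suc j))) of
        (i, \<tau>) \<Rightarrow> of_real (q ^ i) * L2inner f (gs ! i) * w n \<tau> fs (take i gs @ drop (Suc i) gs)) =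
        w (Suc n) \<sigma> (f # fs) gs"
      by (simp add: w_def power_add \<tau>_def[symmetric])
  next
    fix p assume "p \<in> {..n} \<times> {\<tau>. \<tau> permutes {..<n}}"
    then obtain i \<tau> where p: "p = (i, \<tau>)" "i \<le> n" "\<tau> permutes {..<n}" by auto
    show "(case p of (i, \<tau>) \<Rightarrow> perm_cons i \<tau>) \<in> {\<sigma>. \<sigma> permutes {..<Suc n}}"
      using permutes_perm_cons[OF p(3,2)] p by simp
    show "((case p of (i, \<tau>) \<Rightarrow> perm_cons i \<tau>) 0,
        \<lambda>j. unshift_at ((case p of (i, \<tau>) \<Rightarrow> perm_cons i \<tau>) 0) ((case p of (i, \<tau>) \<Rightarrow> perm_cons i \<tau>) (Suc j))) = p"
      using p by simp
  qed
  also have "\<dots> = (\<Sum>i\<le>n. of_real (q ^ i) * L2inner f (gs ! i) *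
      (\<Sum>\<tau> | \<tau> permutes {..<n}. w n \<tau> fs (take i gs @ drop (Suc i) gs)))"
    by (simp add: sum.cartesian_product[symmetric] sum_distrib_left)
  also have "\<dots> = (\<Sum>i<length gs. q ^ i *\<^sub>R (L2inner f (gs ! i) * q_inner q fs (take i gs @ drop (Suc i) gs)))"
  proof (rule sum.cong)
    show "{..n} = {..<length gs}" using len by auto
    fix i assume "i \<in> {..<length gs}"
    then have "length (take i gs @ drop (Suc i) gs) = n" using len by auto
    then show "of_real (q ^ i) * L2inner f (gs ! i) *
       (\<Sum>\<tau> | \<tau> permutes {..<n}. w n \<tau> fs (take i gs @ drop (Suc i) gs)) =
      q ^ i *\<^sub>R (L2inner f (gs ! i) * q_inner q fs (take i gs @ drop (Suc i) gs))"
      by (simp add: q_inner_def w_def n_def scaleR_conv_of_real mult.assoc)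
  qed
  finally show ?thesis by (simp add: rem_sum_eq_sum)
qed

text \<open>Removing letters one at a time amounts to choosing the subword that they form. This
  makes the adjoint of a product of creation operators computable on words.\<close>

lemma q_inner_append:
  "q_inner q (us @ vs) gs = split_sum q gs (length us) (\<lambda>A R. q_inner q us A * q_inner q vs R)"
proof (induction us arbitrary: gs)
  case (Cons f us)
  have "q_inner q ((f # us) @ vs) gs =
      rem_sum q gs (\<lambda>g r. split_sum q r (length us) (\<lambda>A R. L2inner f g * q_inner q us A * q_inner q vs R))"
  proof -
    have "q_inner q ((f # us) @ vs) gs = rem_sum q gs (\<lambda>g r. L2inner f g * q_inner q (us @ vs) r)"
      by (simp add: q_inner_Cons)
    also have "\<dots> = rem_sum q gs (\<lambda>g r. split_sum q r (length us) (\<lambda>A R. L2inner f g * q_inner q us A * q_inner q vs R))"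
    proof (rule rem_sum_cong)
      fix g r
      show "L2inner f g * q_inner q (us @ vs) r =
        split_sum q r (length us) (\<lambda>A R. L2inner f g * q_inner q us A * q_inner q vs R)"
        using split_sum_linear[OF bounded_linear.linear[OF bounded_linear_mult_right], where k = "length us"]
        by (simp add: Cons.IH mult.assoc)
    qed
    finally show ?thesis .
  qed
  also have "\<dots> = split_sum q gs (Suc (length us))
      (\<lambda>A R. rem_sum q A (\<lambda>g A'. L2inner f g * q_inner q us A' * q_inner q vs R))"
    by (rule split_sum_Suc[symmetric])
  also have "\<dots> = split_sum q gs (Suc (length us)) (\<lambda>A R. q_inner q (f # us) A * q_inner q vs R)"
    using rem_sum_linear[OF bounded_linear.linear[OF bounded_linear_mult_left], where F = "\<lambda>g A'. L2inner f g * q_inner q us A'"]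
    by (intro split_sum_cong) (simp add: q_inner_Cons)
  finally show ?case by simp
qed simp

text \<open>The recursion sees only the first letter, so the last letter is split off as a subword
  of length one; \<open>split_sum_last\<close> then gives the same weights read from the other
  end.\<close>

lemma q_inner_rev: "q_inner q (rev fs) (rev gs) = q_inner q fs gs"
proof (induction fs arbitrary: gs)
  case Nil
  then show ?case by (cases "gs = []") (simp_all add: q_inner_length)
next
  case (Cons f fs)
  show ?case
  proof (cases "length gs = Suc (length fs)")
    case True
    have "q_inner q (rev (f # fs)) (rev gs) =
        split_sum q (rev gs) (length fs) (\<lambda>A R. q_inner q (rev fs) A * q_inner q [f] R)"
      by (simp add: q_inner_append)
    also have "\<dots> = rem_sum q gs (\<lambda>x r. q_inner q (rev fs) (rev r) * q_inner q [f] [x])"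
      using True by (subst split_sum_last) simp_all
    also have "\<dots> = q_inner q (f # fs) gs"
      by (simp add: Cons.IH q_inner_Cons mult.commute)
    finally show ?thesis .
  qed (simp add: q_inner_length)
qed

section \<open>Creation and annihilation operators\<close>

lemma bounded_linear_cinner_right: "bounded_linear (cinner (x :: 'a::complex_hilbert))"
  by (rule bounded_bilinear.bounded_linear_right[OF bounded_bilinear_cinner])

section \<open>Square-integrable letters and words\<close>

lemma L2fun_integrable_product:
  assumes "f \<in> L2fun" "g \<in> L2fun"
  shows "integrable (lebesgue_on {0..}) (\<lambda>x. cnj (f x) * g x)"
proof (rule Bochner_Integration.integrable_bound)
  show "integrable (lebesgue_on {0..}) (\<lambda>x. (cmod (f x))\<^sup>2 + (cmod (g x))\<^sup>2)"
    using assms by (auto simp: L2fun_def)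
  have "(\<lambda>x. cnj (f x)) \<in> borel_measurable (lebesgue_on {0..})"
    using assms by (intro borel_measurable_continuous_on[of cnj]) (auto simp: L2fun_def intro: continuous_intros)
  then show "(\<lambda>x. cnj (f x) * g x) \<in> borel_measurable (lebesgue_on {0..})"
    using assms by (intro borel_measurable_times) (auto simp: L2fun_def)
  have "norm (cnj (f x) * g x) \<le> norm ((cmod (f x))\<^sup>2 + (cmod (g x))\<^sup>2)" for x
  proof -
    have "2 * (cmod (f x) * cmod (g x)) \<le> (cmod (f x))\<^sup>2 + (cmod (g x))\<^sup>2" "0 \<le> cmod (f x) * cmod (g x)"
      using sum_squares_bound[of "cmod (f x)" "cmod (g x)"] by simp_all
    then show ?thesis by (simp only: norm_mult complex_mod_cnj real_norm_def)
  qed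
  then show "AE x in lebesgue_on {0..}. norm (cnj (f x) * g x) \<le> norm ((cmod (f x))\<^sup>2 + (cmod (g x))\<^sup>2)"
    by simp
qed

lemma L2fun_add:
  assumes "f \<in> L2fun" "g \<in> L2fun"
  shows "(\<lambda>x. f x + g x) \<in> L2fun"
proof -
  have "integrable (lebesgue_on {0..}) (\<lambda>x. (cmod (f x + g x))\<^sup>2)"
  proof (rule Bochner_Integration.integrable_bound)
    show "integrable (lebesgue_on {0..}) (\<lambda>x. 2 * (cmod (f x))\<^sup>2 + 2 * (cmod (g x))\<^sup>2)"
      using assms by (auto simp: L2fun_def)
    show "(\<lambda>x. (cmod (f x + g x))\<^sup>2) \<in> borel_measurable (lebesgue_on {0..})"
      using assms by (auto simp: L2fun_def)
    have "norm ((cmod (f x + g x))\<^sup>2) \<le> norm (2 * (cmod (f x))\<^sup>2 + 2 * (cmod (g x))\<^sup>2)" for x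
    proof -
      have "(cmod (f x + g x))\<^sup>2 \<le> (cmod (f x) + cmod (g x))\<^sup>2"
        by (intro power_mono norm_triangle_ineq) auto
      also have "\<dots> \<le> 2 * (cmod (f x))\<^sup>2 + 2 * (cmod (g x))\<^sup>2"
        using sum_squares_bound[of "cmod (f x)" "cmod (g x)"] by (simp add: power2_sum)
      finally show ?thesis by simp
    qed
    then show "AE x in lebesgue_on {0..}. norm ((cmod (f x + g x))\<^sup>2) \<le> norm (2 * (cmod (f x))\<^sup>2 + 2 * (cmod (g x))\<^sup>2)"
      by simp
  qed
  then show ?thesis using assms by (auto simp: L2fun_def)
qed

lemma L2fun_scale: "f \<in> L2fun \<Longrightarrow> (\<lambda>x. c * f x) \<in> L2fun"
  by (auto simp: L2fun_def norm_mult power_mult_distrib)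

lemma L2fun_Re: "f \<in> L2fun \<Longrightarrow> (\<lambda>x. of_real (Re (f x))) \<in> L2fun"
  and L2fun_Im: "f \<in> L2fun \<Longrightarrow> (\<lambda>x. of_real (Im (f x))) \<in> L2fun"
proof -
  assume f: "f \<in> L2fun"
  then have i: "integrable (lebesgue_on {0..}) (\<lambda>x. (cmod (f x))\<^sup>2)" and [measurable]: "f \<in> borel_measurable (lebesgue_on {0..})"
    by (auto simp: L2fun_def)
  have "integrable (lebesgue_on {0..}) (\<lambda>x. (cmod (of_real (Re (f x))))\<^sup>2)"
    by (rule Bochner_Integration.integrable_bound[OF i])
      (auto simp: cmod_power2 simp del: of_real_power)
  then show "(\<lambda>x. of_real (Re (f x))) \<in> L2fun" by (auto simp: L2fun_def)
  have "integrable (lebesgue_on {0..}) (\<lambda>x. (cmod (of_real (Im (f x))))\<^sup>2)"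
    by (rule Bochner_Integration.integrable_bound[OF i])
      (auto simp: cmod_power2 simp del: of_real_power)
  then show "(\<lambda>x. of_real (Im (f x))) \<in> L2fun" by (auto simp: L2fun_def)
qed

lemma L2inner_add_left:
  assumes "f \<in> L2fun" "f' \<in> L2fun" "g \<in> L2fun"
  shows "L2inner (\<lambda>x. f x + f' x) g = L2inner f g + L2inner f' g"
  unfolding L2inner_def using L2fun_integrable_product assms by (simp add: distrib_right)

lemma L2inner_scale_left: "L2inner (\<lambda>x. c * f x) g = cnj c * L2inner f g"
  unfolding L2inner_def by (simp add: mult.assoc)

lemma L2inner_self: "L2inner f f = of_real (Re (L2inner f f))" "Re (L2inner f f) \<ge> 0"
proof -
  have "L2inner f f = of_real (LINT x|lebesgue_on {0..}. (cmod (f x))\<^sup>2)"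
    unfolding L2inner_def integral_complex_of_real[symmetric]
    by (simp add: mult.commute complex_norm_square[symmetric] del: of_real_power)
  then show "L2inner f f = of_real (Re (L2inner f f))" "Re (L2inner f f) \<ge> 0"
    by (auto intro!: integral_nonneg_AE)
qed

definition words :: "(real \<Rightarrow> complex) list set" where
  "words = {w. set w \<subseteq> L2fun}"

lemma words_Cons [simp]: "f # w \<in> words \<longleftrightarrow> f \<in> L2fun \<and> w \<in> words"
  and words_Nil [simp]: "[] \<in> words"
  and words_append [simp]: "v @ w \<in> words \<longleftrightarrow> v \<in> words \<and> w \<in> words"
  and words_rev [simp]: "rev w \<in> words \<longleftrightarrow> w \<in> words"
  by (auto simp: words_def)

lemma words_mset: "mset v = mset w \<Longrightarrow> v \<in> words \<longleftrightarrow> w \<in> words"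
  using mset_eq_setD[of v w] by (simp add: words_def)

lemma words_rem: "w \<in> words \<Longrightarrow> mset (y # r) = mset w \<Longrightarrow> y \<in> L2fun \<and> r \<in> words"
  using words_mset[of "y # r" w] by simp

lemma words_split: "w \<in> words \<Longrightarrow> mset (A @ R) = mset w \<Longrightarrow> A \<in> words \<and> R \<in> words"
  using words_mset[of "A @ R" w] by simp

section \<open>Existence of the creation operators and the q-commutation relation\<close>

locale q_fock =
  fixes q :: real and E :: "(real \<Rightarrow> complex) list \<Rightarrow> 'h::complex_hilbert"
  assumes q_nonneg: "0 \<le> q" and q_less_1: "q < 1" and fock: "q_fock_space q E"
begin

lemma cinner_E: "x \<in> words \<Longrightarrow> y \<in> words \<Longrightarrow> cinner (E x) (E y) = q_inner q x y"
  using fock by (auto simp: q_fock_space_def hilbert_completion_def words_def)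

lemma E_dense: "closure (csubspace hull (E ` words)) = UNIV"
  using fock by (auto simp: q_fock_space_def hilbert_completion_def words_def)

lemma words_dense_induct:
  assumes "csubspace M" "closed M" "\<And>w. w \<in> words \<Longrightarrow> E w \<in> M"
  shows "x \<in> M"
proof -
  have "csubspace hull (E ` words) \<subseteq> M"
    by (rule hull_minimal) (use assms in auto)
  then have "closure (csubspace hull (E ` words)) \<subseteq> M" using assms(2) by (rule closure_minimal)
  then show ?thesis using E_dense by auto
qed

lemma E_total:
  assumes "\<And>w. w \<in> words \<Longrightarrow> cinner x (E w) = 0"
  shows "x = 0"
proof -
  have "x \<in> {y. cinner x y = 0}"
  proof (rule words_dense_induct)
    show "csubspace {y. cinner x y = 0}"
      by (auto simp: csubspace_def cinner_add_right cinner_scaleC_right)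
    show "closed {y. cinner x y = 0}"
      by (rule closed_Collect_eq[OF linear_continuous_on[OF bounded_linear_cinner_right] continuous_on_const])
  qed (use assms in auto)
  then show ?thesis by (simp add: cinner_self)
qed

lemma op_eqI:
  assumes "S \<in> cops" "T \<in> cops" "\<And>w. w \<in> words \<Longrightarrow> S \<cdot> E w = T \<cdot> E w"
  shows "S = T"
proof (rule blinfun_eqI)
  fix x
  have "x \<in> {y. S \<cdot> y = T \<cdot> y}"
  proof (rule words_dense_induct)
    show "csubspace {y. S \<cdot> y = T \<cdot> y}"
      using assms by (auto simp: csubspace_def blinfun.add_right copsD)
    show "closed {y. S \<cdot> y = T \<cdot> y}"
      by (rule closed_Collect_eq[OF linear_continuous_on linear_continuous_on]) (rule blinfun.bounded_linear_right)+
  qed (use assms in auto)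
  then show "S \<cdot> x = T \<cdot> x" by simp
qed

lemma norm_vacuum: "norm (E []) = 1"
proof -
  have "complex_of_real ((norm (E []))\<^sup>2) = 1"
    using cinner_self[of "E []"] cinner_E[of "[]" "[]"] by simp
  then have "(norm (E []))\<^sup>2 = 1\<^sup>2" unfolding of_real_eq_1_iff by simp
  then show ?thesis by (rule power2_eq_imp_eq) auto
qed

lemma cinner_E_Cons:
  assumes "f \<in> L2fun" "w \<in> words" "v \<in> words"
  shows "cinner (E (f # w)) (E v) = rem_sum q v (\<lambda>g r. L2inner f g * cinner (E w) (E r))"
  using assms words_rem[OF assms(3)]
  by (subst cinner_E) (auto simp: q_inner_Cons cinner_E intro!: rem_sum_cong)

lemma cinner_E_Cons_right:
  assumes "f \<in> L2fun" "w \<in> words" "v \<in> words"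
  shows "cinner (E (f # w)) (E v) = cinner (E w) (rem_sum q v (\<lambda>g r. L2inner f g *\<^sub>C E r))"
proof -
  have "linear (\<lambda>y. cinner (E w) y)"
    using bounded_linear.linear[OF bounded_bilinear.bounded_linear_right[OF bounded_bilinear_cinner]] .
  then show ?thesis by (simp add: cinner_E_Cons assms cinner_scaleC_right rem_sum_linear)
qed

text \<open>Formal linear combinations of words are kept as lists, because \<open>contract\<close> (the prospective annihilation
  operator) has to be iterated before it is known to respect null vectors.\<close>

primrec contractions :: "(real \<Rightarrow> complex) \<Rightarrow> (real \<Rightarrow> complex) list \<Rightarrow> (complex \<times> (real \<Rightarrow> complex) list) list" where
  "contractions f [] = []"
| "contractions f (v # w) = (L2inner f v, w) # map (\<lambda>(c, r). (of_real q * c, v # r)) (contractions f w)"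

definition eval :: "((real \<Rightarrow> complex) list \<Rightarrow> 'h) \<Rightarrow> (complex \<times> (real \<Rightarrow> complex) list) list \<Rightarrow> 'h" where
  "eval j x = (\<Sum>(c, w)\<leftarrow>x. c *\<^sub>C j w)"

lemma eval_simps [simp]: "eval j [] = 0" "eval j ((c, w) # x) = c *\<^sub>C j w + eval j x"
  "eval j (x @ y) = eval j x + eval j y"
  by (simp_all add: eval_def)

lemma eval_scale: "eval j (map (\<lambda>(c, w). (d * c, w)) x) = d *\<^sub>C eval j x"
  by (induction x) (auto simp: scaleC_add_right scaleC_scaleC)

lemma eval_map: "eval j (map (\<lambda>(c, r). (d * c, g r)) x) = d *\<^sub>C eval (\<lambda>r. j (g r)) x"
  by (induction x) (auto simp: scaleC_add_right scaleC_scaleC)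

lemma eval_contractions: "eval j (contractions f w) = rem_sum q w (\<lambda>g r. L2inner f g *\<^sub>C j r)"
proof (induction w arbitrary: j)
  case (Cons v w)
  show ?case by (simp add: eval_map Cons.IH scaleC_of_real)
qed simp

definition contract :: "(real \<Rightarrow> complex) \<Rightarrow> (complex \<times> (real \<Rightarrow> complex) list) list \<Rightarrow> (complex \<times> (real \<Rightarrow> complex) list) list" where
  "contract f x = concat (map (\<lambda>(c, w). map (\<lambda>(d, r). (c * d, r)) (contractions f w)) x)"

lemma contract_simps [simp]: "contract f [] = []"
  "contract f ((c, w) # x) = map (\<lambda>(d, r). (c * d, r)) (contractions f w) @ contract f x"
  by (simp_all add: contract_def)

lemma set_contractions: "(c, r) \<in> set (contractions f w) \<Longrightarrow> set r \<subseteq> set w \<and> length w = Suc (length r)"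
proof (induction w arbitrary: c r)
  case (Cons v w)
  from Cons.prems consider "r = w" | c' r' where "(c', r') \<in> set (contractions f w)" "r = v # r'" by auto
  then show ?case using Cons.IH by cases auto
qed simp

lemma set_contract:
  assumes "(c, r) \<in> set (contract f x)"
  obtains d w where "(d, w) \<in> set x" "set r \<subseteq> set w" "length w = Suc (length r)"
  using assms set_contractions unfolding contract_def by fastforce

lemma eval_cinner_Cons:
  assumes f: "f \<in> L2fun" and x: "snd ` set x \<subseteq> words" and y: "snd ` set y \<subseteq> words"
  shows "cinner (eval (\<lambda>w. E (f # w)) x) (eval E y) = cinner (eval E x) (eval E (contract f y))"
proof -
  have 1: "cinner (eval (\<lambda>w. E (f # w)) x) (E v) = cinner (eval E x) (eval E (contractions f v))"
    if "v \<in> words" for v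
    using x by (induction x)
      (auto simp: cinner_add_left cinner_scaleC_left eval_contractions cinner_E_Cons_right f that)
  show ?thesis using y
    by (induction y) (auto simp: cinner_add_right cinner_scaleC_right eval_scale 1)
qed

text \<open>The commutation relation a(f) a*(f) = |f|^2 + q a*(f) a(f) as a quadratic form. It is
  stated for formal combinations since neither operator is available yet.\<close>

lemma eval_Cons_Cons:
  assumes f: "f \<in> L2fun" and x: "snd ` set x \<subseteq> words"
  shows "(norm (eval (\<lambda>w. E (f # w)) x))\<^sup>2 =
    Re (L2inner f f) * (norm (eval E x))\<^sup>2 + q * (norm (eval E (contract f x)))\<^sup>2"
proof -
  have 1: "cinner (eval (\<lambda>w. E (f # w)) x) (E (f # v)) =
      L2inner f f * cinner (eval E x) (E v) + of_real q * cinner (eval E x) (eval (\<lambda>w. E (f # w)) (contractions f v))"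
    if "v \<in> words" for v
    using eval_cinner_Cons[OF f x, of "[(1, f # v)]"] that f
    by (simp add: eval_map cinner_add_right cinner_scaleC_right)
  have 2: "cinner (eval (\<lambda>w. E (f # w)) x) (eval (\<lambda>w. E (f # w)) y) = L2inner f f * cinner (eval E x) (eval E y) +
      of_real q * cinner (eval E x) (eval (\<lambda>w. E (f # w)) (contract f y))" if "snd ` set y \<subseteq> words" for y
    using that by (induction y) (auto simp: cinner_add_right cinner_scaleC_right 1 eval_scale algebra_simps)
  have w: "snd ` set (contract f x) \<subseteq> words"
    using x by (fastforce simp: words_def elim!: set_contract)
  have "cinner (eval E x) (eval (\<lambda>w. E (f # w)) (contract f x)) = of_real ((norm (eval E (contract f x)))\<^sup>2)"
    by (subst cinner_commute) (simp add: eval_cinner_Cons[OF f w x] cinner_self)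
  then have "of_real ((norm (eval (\<lambda>w. E (f # w)) x))\<^sup>2) = of_real (Re (L2inner f f)) * complex_of_real ((norm (eval E x))\<^sup>2) +
      of_real q * of_real ((norm (eval E (contract f x)))\<^sup>2)"
    using 2[OF x] L2inner_self(1)[of f] by (simp only: cinner_self)
  then show ?thesis unfolding of_real_mult[symmetric] of_real_add[symmetric] of_real_eq_iff .
qed

text \<open>By duality the contraction of \<open>x\<close> is bounded through the creation operator on its own, shorter words;
  iterating produces a geometric series in \<open>q\<close>.\<close>

lemma eval_Cons_bound:
  assumes f: "f \<in> L2fun" and x: "snd ` set x \<subseteq> words"
  shows "(norm (eval (\<lambda>w. E (f # w)) x))\<^sup>2 \<le> Re (L2inner f f) / (1 - q) * (norm (eval E x))\<^sup>2"
proof -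
  define N where "N = Re (L2inner f f)"
  have N: "N \<ge> 0" unfolding N_def by (rule L2inner_self)
  \<comment> \<open>Contraction shortens words, so the induction runs on a strict bound for their
    length. The constant is the solution of K = N + q K.\<close>
  have "(norm (eval (\<lambda>w. E (f # w)) x))\<^sup>2 \<le> N / (1 - q) * (norm (eval E x))\<^sup>2"
    if "\<forall>w\<in>snd ` set x. length w < n" for n
    using x that
  proof (induction n arbitrary: x)
    case 0
    then show ?case by simp
  next
    case (Suc n)
    define y where "y = contract f x"
    have y: "snd ` set y \<subseteq> words" "\<forall>w\<in>snd ` set y. length w < n"
      using Suc.prems unfolding y_def words_def by (fastforce elim!: set_contract)+
    \<comment> \<open>Duality gives |y|^2 \<le> |f # y| |x|. After squaring, the induction
      hypothesis for \<open>y\<close> provides a factor |y|^2 that cancels.\<close>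
    have "(norm (eval E y))\<^sup>2 = cmod (cinner (eval (\<lambda>w. E (f # w)) y) (eval E x))"
      using eval_cinner_Cons[OF f y(1) Suc.prems(1)] by (simp add: y_def[symmetric] cmod_cinner_self)
    also have "\<dots> \<le> norm (eval (\<lambda>w. E (f # w)) y) * norm (eval E x)" by (rule cmod_cinner_le)
    finally have "((norm (eval E y))\<^sup>2)\<^sup>2 \<le> (norm (eval (\<lambda>w. E (f # w)) y) * norm (eval E x))\<^sup>2"
      by (intro power_mono) auto
    also have "\<dots> \<le> N / (1 - q) * (norm (eval E y))\<^sup>2 * (norm (eval E x))\<^sup>2"
      unfolding power_mult_distrib by (intro mult_right_mono Suc.IH y) auto
    finally have "(norm (eval E y))\<^sup>2 * (norm (eval E y))\<^sup>2 \<le> (N / (1 - q) * (norm (eval E x))\<^sup>2) * (norm (eval E y))\<^sup>2"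
      by (simp only: power2_eq_square mult_ac)
    moreover have "0 \<le> N / (1 - q) * (norm (eval E x))\<^sup>2" using N q_less_1 by simp
    ultimately have "(norm (eval E y))\<^sup>2 \<le> N / (1 - q) * (norm (eval E x))\<^sup>2"
      by (cases "norm (eval E y) = 0")
        (simp, metis mult_right_le_imp_le zero_less_power2)
    then have "(norm (eval (\<lambda>w. E (f # w)) x))\<^sup>2 \<le> N * (norm (eval E x))\<^sup>2 + q * (N / (1 - q) * (norm (eval E x))\<^sup>2)"
      unfolding eval_Cons_Cons[OF f Suc.prems(1)] y_def N_def
      by (intro add_left_mono mult_left_mono q_nonneg)
    also have "\<dots> = N / (1 - q) * (norm (eval E x))\<^sup>2"
      using q_less_1 by (simp add: field_simps)
    finally show ?case .
  qed
  from this[of "Suc (Max (length ` snd ` set x))"] show ?thesis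
    unfolding N_def by (simp add: less_Suc_eq_le)
qed

lemma creation_exists:
  assumes f: "f \<in> L2fun"
  shows "\<exists>!T. T \<in> cops \<and> (\<forall>fs. set fs \<subseteq> L2fun \<longrightarrow> T \<cdot> E fs = E (f # fs))"
proof -
  define K where "K = sqrt (Re (L2inner f f) / (1 - q))"
  have bound: "norm (\<Sum>w\<in>F. c w *\<^sub>C E (f # w)) \<le> K * norm (\<Sum>w\<in>F. c w *\<^sub>C E w)"
    if F: "finite F" "F \<subseteq> words" for F c
  proof -
    obtain ws where ws: "set ws = F" "distinct ws" using finite_distinct_list[OF F(1)] by blast
    define x where "x = map (\<lambda>w. (c w, w)) ws"
    have ev: "(\<Sum>w\<in>F. c w *\<^sub>C j w) = eval j x" for j
      using ws by (simp add: eval_def x_def sum.distinct_set_conv_list[symmetric] comp_def)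
    have "(norm (eval (\<lambda>w. E (f # w)) x))\<^sup>2 \<le> Re (L2inner f f) / (1 - q) * (norm (eval E x))\<^sup>2"
      using F ws by (intro eval_Cons_bound f) (auto simp: x_def)
    then have "norm (eval (\<lambda>w. E (f # w)) x) \<le> sqrt (Re (L2inner f f) / (1 - q) * (norm (eval E x))\<^sup>2)"
      by (rule real_le_rsqrt)
    then show ?thesis unfolding ev by (simp add: K_def real_sqrt_mult real_sqrt_divide)
  qed
  obtain T where "T \<in> cops" "\<And>w. w \<in> words \<Longrightarrow> T \<cdot> E w = E (f # w)"
    using dense_extension[OF E_dense bound] by blast
  then show ?thesis by (intro ex1I[of _ T]) (auto intro!: op_eqI simp: words_def)
qed

lemma creation_cops [simp]: "f \<in> L2fun \<Longrightarrow> creation E f \<in> cops"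
  and creation_E [simp]: "f \<in> L2fun \<Longrightarrow> w \<in> words \<Longrightarrow> creation E f \<cdot> E w = E (f # w)"
  using theI'[OF creation_exists] unfolding creation_def by (auto simp: words_def)

lemma annihilation_cops [simp]: "f \<in> L2fun \<Longrightarrow> annihilation E f \<in> cops"
  by (simp add: annihilation_def cadjoint_cops)

lemma cadjoint_creation: "cadjoint (creation E f) = annihilation E f"
  by (simp add: annihilation_def)

lemma cadjoint_annihilation: "f \<in> L2fun \<Longrightarrow> cadjoint (annihilation E f) = creation E f"
  by (simp add: annihilation_def)

lemma annihilation_E:
  assumes "f \<in> L2fun" "w \<in> words"
  shows "annihilation E f \<cdot> E w = rem_sum q w (\<lambda>g r. L2inner f g *\<^sub>C E r)"
proof -
  have "annihilation E f \<cdot> E w - rem_sum q w (\<lambda>g r. L2inner f g *\<^sub>C E r) = 0"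
  proof (rule E_total)
    fix v assume v: "v \<in> words"
    have "cinner (E v) (annihilation E f \<cdot> E w - rem_sum q w (\<lambda>g r. L2inner f g *\<^sub>C E r)) = 0"
      using assms v by (simp add: annihilation_def cinner_diff_right cinner_cadjoint_right cinner_E_Cons_right[symmetric])
    then show "cinner (annihilation E f \<cdot> E w - rem_sum q w (\<lambda>g r. L2inner f g *\<^sub>C E r)) (E v) = 0"
      by (subst cinner_commute) simp
  qed
  then show ?thesis by simp
qed

lemma annihilation_vacuum [simp]: "f \<in> L2fun \<Longrightarrow> annihilation E f \<cdot> E [] = 0"
  by (simp add: annihilation_E)

lemma annihilation_E_Cons:
  assumes "f \<in> L2fun" "g \<in> L2fun" "w \<in> words"
  shows "annihilation E f \<cdot> E (g # w) =
    L2inner f g *\<^sub>C E w + q *\<^sub>R creation E g \<cdot> annihilation E f \<cdot> E w"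
proof -
  have "rem_sum q w (\<lambda>h r. L2inner f h *\<^sub>C E (g # r)) = 
      rem_sum q w (\<lambda>h r. creation E g \<cdot> (L2inner f h *\<^sub>C E r))"
    using assms words_rem[OF assms(3)] by (intro rem_sum_cong) (simp add: copsD)
  also have "\<dots> = creation E g \<cdot> rem_sum q w (\<lambda>h r. L2inner f h *\<^sub>C E r)"
    by (intro rem_sum_linear[symmetric] bounded_linear.linear[OF blinfun.bounded_linear_right])
  finally show ?thesis using assms by (simp add: annihilation_E)
qed

lemma annihilation_creation:
  assumes "f \<in> L2fun" "g \<in> L2fun"
  shows "annihilation E f o\<^sub>L creation E g = L2inner f g *\<^sub>C id_blinfun + q *\<^sub>R (creation E g o\<^sub>L annihilation E f)"
  using assms
  by (intro op_eqI cops_add cops_scaleR cops_scaleC cops_compose)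
    (simp_all add: annihilation_E_Cons blinfun.add_left scaleC_blinfun_apply blinfun.scaleR_left)

lemma annihilation_creation_apply:
  assumes "f \<in> L2fun" "g \<in> L2fun"
  shows "annihilation E f \<cdot> creation E g \<cdot> x =
    L2inner f g *\<^sub>C x + q *\<^sub>R creation E g \<cdot> annihilation E f \<cdot> x"
  using arg_cong[OF annihilation_creation[OF assms], of "\<lambda>T. T \<cdot> x"]
  by (simp add: blinfun.add_left scaleC_blinfun_apply blinfun.scaleR_left)

text \<open>\<open>E\<close> is not postulated to be multilinear. Linearity in a letter holds
  because a vector is determined by its inner products with words.\<close>

lemma creation_add:
  assumes "f \<in> L2fun" "g \<in> L2fun"
  shows "creation E (\<lambda>x. f x + g x) = creation E f + creation E g"
proof (rule op_eqI)
  fix w assume w: "w \<in> words"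
  have "E ((\<lambda>x. f x + g x) # w) - (E (f # w) + E (g # w)) = 0"
  proof (rule E_total)
    fix v assume v: "v \<in> words"
    have "rem_sum q v (\<lambda>h r. L2inner (\<lambda>x. f x + g x) h * cinner (E w) (E r)) =
      rem_sum q v (\<lambda>h r. L2inner f h * cinner (E w) (E r) + L2inner g h * cinner (E w) (E r))"
      using assms words_rem[OF v] by (intro rem_sum_cong) (simp add: L2inner_add_left distrib_right)
    then show "cinner (E ((\<lambda>x. f x + g x) # w) - (E (f # w) + E (g # w))) (E v) = 0"
      using assms v w by (simp add: cinner_diff_left cinner_add_left cinner_E_Cons L2fun_add rem_sum_add)
  qed
  then show "creation E (\<lambda>x. f x + g x) \<cdot> E w = (creation E f + creation E g) \<cdot> E w"
    using assms w by (simp add: L2fun_add blinfun.add_left)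
qed (use assms in \<open>auto intro: cops_add L2fun_add creation_cops\<close>)

lemma creation_scale:
  assumes "f \<in> L2fun"
  shows "creation E (\<lambda>x. c * f x) = c *\<^sub>C creation E f"
proof (rule op_eqI)
  fix w assume w: "w \<in> words"
  have "E ((\<lambda>x. c * f x) # w) - c *\<^sub>C E (f # w) = 0"
  proof (rule E_total)
    fix v assume v: "v \<in> words"
    have "rem_sum q v (\<lambda>h r. L2inner (\<lambda>x. c * f x) h * cinner (E w) (E r)) =
      cnj c * rem_sum q v (\<lambda>h r. L2inner f h * cinner (E w) (E r))"
      using rem_sum_linear[OF bounded_linear.linear[OF bounded_linear_mult_right], of "cnj c" q v]
      by (simp add: L2inner_scale_left mult.assoc)
    then show "cinner (E ((\<lambda>x. c * f x) # w) - c *\<^sub>C E (f # w)) (E v) = 0"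
      using assms v w by (simp add: cinner_diff_left cinner_scaleC_left cinner_E_Cons L2fun_scale)
  qed
  then show "creation E (\<lambda>x. c * f x) \<cdot> E w = (c *\<^sub>C creation E f) \<cdot> E w"
    using assms w by (simp add: L2fun_scale scaleC_blinfun_apply)
qed (use assms in \<open>auto intro: cops_scaleC L2fun_scale creation_cops\<close>)

lemma cinner_E_append:
  assumes "u \<in> words" "v \<in> words" "w \<in> words"
  shows "cinner (E (u @ v)) (E w) = split_sum q w (length u) (\<lambda>A R. cinner (E u) (E A) * cinner (E v) (E R))"
proof -
  have "split_sum q w (length u) (\<lambda>A R. q_inner q u A * q_inner q v R) =
      split_sum q w (length u) (\<lambda>A R. cinner (E u) (E A) * cinner (E v) (E R))"
    using assms words_split[OF assms(3)] by (intro split_sum_cong) (simp add: cinner_E)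
  then show ?thesis using assms by (simp add: cinner_E q_inner_append)
qed

lemma cinner_E_length: "u \<in> words \<Longrightarrow> v \<in> words \<Longrightarrow> length u \<noteq> length v \<Longrightarrow> cinner (E u) (E v) = 0"
  by (simp add: cinner_E q_inner_length)

end

text \<open>Reversal preserves the inner product, so right creation operators are left creation
  operators of another Fock space structure and need no theory of their own.\<close>

lemma q_fock_rev:
  assumes "q_fock q E"
  shows "q_fock q (\<lambda>w. E (rev w))"
proof -
  interpret q_fock q E by fact
  have "(\<lambda>w. E (rev w)) ` words = E ` words"
    by (auto simp: image_iff) (metis rev_rev_ident words_rev)+
  then show ?thesis
    using E_dense cinner_E q_inner_rev q_nonneg q_less_1
    by (unfold_locales) (simp_all add: q_fock_space_def hilbert_completion_def words_def[symmetric])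
qed

section \<open>Row bounds for creation operators\<close>

definition orthonormal :: "'a::complex_hilbert set \<Rightarrow> bool" where
  "orthonormal B \<longleftrightarrow> (\<forall>b\<in>B. \<forall>c\<in>B. cinner b c = (if b = c then 1 else 0))"

lemma orthonormal_coefficient:
  assumes "finite B" "orthonormal B" "b \<in> B"
  shows "cinner b (\<Sum>c\<in>B. f c *\<^sub>C c) = f b"
proof -
  have "cinner b (\<Sum>c\<in>B. f c *\<^sub>C c) = (\<Sum>c\<in>B. if b = c then f c else 0)"
    unfolding cinner_sum_right
    by (intro sum.cong refl) (use assms in \<open>auto simp: cinner_scaleC_right orthonormal_def\<close>)
  also have "\<dots> = f b" using assms by simp
  finally show ?thesis .
qed

lemma orthonormal_residual:
  assumes "finite B" "orthonormal B" "b \<in> B"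
  shows "cinner b (x - (\<Sum>c\<in>B. cinner c x *\<^sub>C c)) = 0"
  by (simp add: cinner_diff_right orthonormal_coefficient[OF assms])

lemma bessel_inequality:
  assumes "finite B" "orthonormal B"
  shows "(\<Sum>b\<in>B. (cmod (cinner b x))\<^sup>2) \<le> (norm x)\<^sup>2"
proof -
  define p where "p = (\<Sum>b\<in>B. cinner b x *\<^sub>C b)"
  have "cinner p (x - p) = 0"
    unfolding p_def cinner_sum_left
    by (intro sum.neutral ballI) (simp add: cinner_scaleC_left orthonormal_residual[OF assms])
  then have "(norm (p + (x - p)))\<^sup>2 = (norm p)\<^sup>2 + (norm (x - p))\<^sup>2" unfolding norm_add_square by simp
  then have le: "(norm p)\<^sup>2 \<le> (norm x)\<^sup>2" by simp
  have "cinner p p = (\<Sum>b\<in>B. cnj (cinner b x) * cinner b p)"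
    by (subst p_def) (simp add: cinner_sum_left cinner_scaleC_left)
  also have "\<dots> = (\<Sum>b\<in>B. of_real ((cmod (cinner b x))\<^sup>2))"
    by (intro sum.cong refl) (simp only: p_def orthonormal_coefficient[OF assms] complex_norm_square mult.commute)
  finally have "of_real ((norm p)\<^sup>2) = complex_of_real (\<Sum>b\<in>B. (cmod (cinner b x))\<^sup>2)"
    unfolding cinner_self by simp
  then show ?thesis using le unfolding of_real_eq_iff by simp
qed

lemma orthonormal_expansion:
  assumes "finite B" "orthonormal B" "x \<in> csubspace hull B"
  shows "x = (\<Sum>b\<in>B. cinner b x *\<^sub>C b)"
  using assms(3)
proof (induction rule: csubspace_hull_induct)
  case (base x)
  have "(\<Sum>b\<in>B. cinner b x *\<^sub>C b) = (\<Sum>b\<in>B. if b = x then x else 0)"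
    by (intro sum.cong refl) (use assms base in \<open>auto simp: orthonormal_def\<close>)
  then show ?case using assms base by simp
next
  case (scale c x)
  then show ?case by (metis (no_types, lifting) cinner_scaleC_right scaleC_scaleC scaleC_sum_right sum.cong)
next
  case (add x y)
  have "(\<Sum>b\<in>B. cinner b (x + y) *\<^sub>C b) = (\<Sum>b\<in>B. cinner b x *\<^sub>C b) + (\<Sum>b\<in>B. cinner b y *\<^sub>C b)"
    by (simp add: cinner_add_right scaleC_add_left sum.distrib)
  then show ?case using add by simp
qed simp

text \<open>The process starts from a given orthonormal family because the row bound must keep that
  family while enlarging its span to contain further words.\<close>

lemma gram_schmidt:
  assumes "finite X" "finite B" "orthonormal B"
  shows "\<exists>B'. finite B' \<and> B \<subseteq> B' \<and> orthonormal B' \<and> X \<subseteq> csubspace hull B' \<and> B' \<subseteq> csubspace hull (B \<union> X)"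
  using assms(1)
proof (induction X)
  case empty
  show ?case using assms by (intro exI[of _ B]) (auto intro: hull_inc)
next
  case (insert x X)
  then obtain B' where B': "finite B'" "B \<subseteq> B'" "orthonormal B'" "X \<subseteq> csubspace hull B'"
    "B' \<subseteq> csubspace hull (B \<union> X)" by blast
  define y where "y = x - (\<Sum>b\<in>B'. cinner b x *\<^sub>C b)"
  have p: "(\<Sum>b\<in>B'. cinner b x *\<^sub>C b) \<in> csubspace hull B'"
    by (intro csubspace_sum csubspace_scale csubspace_hull hull_inc)
  have sub: "csubspace hull (B \<union> X) \<subseteq> csubspace hull (B \<union> insert x X)" by (intro hull_mono) auto
  show ?case
  proof (cases "y = 0")
    case True
    then have "x \<in> csubspace hull B'" using p by (simp add: y_def)
    then show ?thesis using B' sub by (intro exI[of _ B']) auto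
  next
    case False
    define e where "e = inverse (norm y) *\<^sub>R y"
    have e1: "cinner e e = 1" using False by (simp add: e_def cinner_self)
    have e0: "cinner b e = 0" if "b \<in> B'" for b
      unfolding e_def cinner_scaleR_right y_def orthonormal_residual[OF B'(1,3) that] by simp
    have e0': "cinner e b = 0" if "b \<in> B'" for b
      using e0[OF that] by (subst cinner_commute) simp
    have y_in: "y \<in> csubspace hull (B \<union> insert x X)"
      unfolding y_def
    proof (rule csubspace_diff[OF csubspace_hull])
      show "x \<in> csubspace hull (B \<union> insert x X)" by (rule hull_inc) simp
      show "(\<Sum>b\<in>B'. cinner b x *\<^sub>C b) \<in> csubspace hull (B \<union> insert x X)"
        using B'(5) sub by (intro csubspace_sum csubspace_scale csubspace_hull) auto
    qed
    have mono: "csubspace hull B' \<subseteq> csubspace hull (insert e B')" by (intro hull_mono) auto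
    have "y = norm y *\<^sub>R e" using False by (simp add: e_def)
    then have "y \<in> csubspace hull (insert e B')"
      by (metis csubspace_hull csubspace_scaleR hull_inc insertI1)
    then have "y + (\<Sum>b\<in>B'. cinner b x *\<^sub>C b) \<in> csubspace hull (insert e B')"
      using p mono by (intro csubspace_add csubspace_hull) auto
    then have "x \<in> csubspace hull (insert e B')" by (simp add: y_def)
    moreover have "orthonormal (insert e B')"
      using B'(3) e1 e0 e0' by (auto simp: orthonormal_def)
    moreover have "e \<in> csubspace hull (B \<union> insert x X)"
      unfolding e_def using y_in by (intro csubspace_scaleR csubspace_hull)
    ultimately show ?thesis using B' sub mono by (intro exI[of _ "insert e B'"]) auto
  qed
qed

text \<open>Log-convexity makes the ratios \<open>a (Suc r) / a r\<close> increase, so the first one cannot exceed the growth rate.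
  For powers of a selfadjoint operator this replaces the spectral radius formula.\<close>

lemma geometric_growth_bound:
  fixes a :: "nat \<Rightarrow> real"
  assumes nonneg: "\<And>r. 0 \<le> a r" and convex: "\<And>r. (a (Suc r))\<^sup>2 \<le> a r * a (Suc (Suc r))"
    and growth: "\<And>r. a r \<le> K * C ^ r" and C: "0 < C"
  shows "a 1 \<le> C * a 0"
proof (rule ccontr)
  assume "\<not> a 1 \<le> C * a 0"
  then have gt: "C * a 0 < a 1" by simp
  have a0: "a 0 > 0"
  proof (rule ccontr)
    assume "\<not> a 0 > 0"
    then have "a 0 = 0" using nonneg[of 0] by simp
    then have "(a 1)\<^sup>2 \<le> 0" using convex[of 0] by simp
    then show False using gt \<open>a 0 = 0\<close> by simp
  qed
  define \<rho> where "\<rho> = a 1 / a 0"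
  have \<rho>: "\<rho> > C" using gt a0 by (simp add: \<rho>_def field_simps)
  have "a r > 0 \<and> a (Suc r) \<ge> \<rho> * a r" for r
  proof (induction r)
    case 0
    then show ?case using a0 by (simp add: \<rho>_def)
  next
    case (Suc r)
    then have pos: "a (Suc r) > 0" using \<rho> C by (smt (verit) mult_pos_pos)
    have "\<rho> * a r * a (Suc r) \<le> a (Suc r) * a (Suc r)" using Suc pos by (intro mult_right_mono) auto
    also have "\<dots> \<le> a r * a (Suc (Suc r))" using convex[of r] by (simp add: power2_eq_square)
    finally have "a r * (\<rho> * a (Suc r)) \<le> a r * a (Suc (Suc r))" by (simp add: mult_ac)
    then show ?case using Suc pos by simp
  qed
  note step = this
  have "a r \<ge> \<rho> ^ r * a 0" for r
  proof (induction r)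
    case (Suc r)
    have "\<rho> ^ Suc r * a 0 \<le> \<rho> * a r" using Suc \<rho> C by (simp add: mult.assoc)
    then show ?case using step[of r] by simp
  qed simp
  then have "\<rho> ^ r * a 0 \<le> K * C ^ r" for r using growth order_trans by blast
  then have "(\<rho> / C) ^ r \<le> K / a 0" for r
    using a0 C by (simp add: power_divide field_simps)
  moreover have "\<exists>r. K / a 0 < (\<rho> / C) ^ r" using \<rho> C by (intro real_arch_pow) simp
  ultimately show False using not_less by blast
qed

text \<open>The norms of the iterates are log-convex because <T y, T y> = <y, T T y>. The factor
  \<open>K\<close> may depend on \<open>x\<close>; only the rate survives.\<close>

lemma selfadjoint_norm_le_of_growth:
  assumes T: "T \<in> cops" "cadjoint T = T" and C: "0 < C"
    and growth: "\<And>r. norm ((blinfun_apply T ^^ r) x) \<le> K * C ^ r"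
  shows "norm (T \<cdot> x) \<le> C * norm x"
proof -
  define a where "a r = norm ((blinfun_apply T ^^ r) x)" for r
  have "a 1 \<le> C * a 0"
  proof (rule geometric_growth_bound)
    fix r
    let ?y = "(blinfun_apply T ^^ r) x"
    have "(a (Suc r))\<^sup>2 = cmod (cinner (T \<cdot> ?y) (T \<cdot> ?y))"
      by (simp add: a_def cmod_cinner_self)
    also have "cinner (T \<cdot> ?y) (T \<cdot> ?y) = cinner ?y (T \<cdot> T \<cdot> ?y)"
      using cinner_cadjoint_left[OF T(1)] T(2) by simp
    also have "cmod \<dots> \<le> a r * a (Suc (Suc r))" using cmod_cinner_le by (auto simp: a_def)
    finally show "(a (Suc r))\<^sup>2 \<le> a r * a (Suc (Suc r))" .
  qed (use growth C in \<open>auto simp: a_def\<close>)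
  then show ?thesis by (simp add: a_def)
qed

section \<open>Multiplication by vectors of degree k, and its row bound\<close>

context q_fock begin

primrec create_word :: "(real \<Rightarrow> complex) list \<Rightarrow> 'h \<Rightarrow>\<^sub>L 'h" where
  "create_word [] = id_blinfun"
| "create_word (f # w) = creation E f o\<^sub>L create_word w"

lemma create_word_cops: "w \<in> words \<Longrightarrow> create_word w \<in> cops"
  by (induction w) (auto intro: cops_compose)

lemma create_word_E: "w \<in> words \<Longrightarrow> v \<in> words \<Longrightarrow> create_word w \<cdot> E v = E (w @ v)"
  by (induction w) auto

lemma create_word_append: "create_word (v @ w) = create_word v o\<^sub>L create_word w"
  by (induction v) (auto intro: blinfun_eqI)

definition word_span :: "nat \<Rightarrow> 'h set" where
  "word_span k = csubspace hull (E ` {w \<in> words. length w = k})"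

text \<open>\<open>T\<close> is left multiplication by the vector \<open>b\<close> of degree \<open>k\<close>; it is determined by its adjoint on words.\<close>

definition creates :: "nat \<Rightarrow> 'h \<Rightarrow> ('h \<Rightarrow>\<^sub>L 'h) \<Rightarrow> bool" where
  "creates k b T \<longleftrightarrow> T \<in> cops \<and>
    (\<forall>v\<in>words. cadjoint T \<cdot> E v = split_sum q v k (\<lambda>A R. cinner b (E A) *\<^sub>C E R))"

lemma creates_unique:
  assumes "creates k b S" "creates k b T"
  shows "S = T"
proof -
  have c: "S \<in> cops" "T \<in> cops" using assms by (simp_all add: creates_def)
  have "cadjoint S = cadjoint T"
    using assms by (intro op_eqI cadjoint_cops c) (simp add: creates_def)
  then show ?thesis by (metis c cadjoint_cadjoint)
qed

text \<open>Tested against words, the factorisation of the inner product along an initial segment is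
  exactly the formula for the adjoint.\<close>

lemma creates_word:
  assumes "w \<in> words"
  shows "creates (length w) (E w) (create_word w)"
  unfolding creates_def
proof (intro conjI ballI)
  fix v assume v: "v \<in> words"
  have "cadjoint (create_word w) \<cdot> E v - split_sum q v (length w) (\<lambda>A R. cinner (E w) (E A) *\<^sub>C E R) = 0"
  proof (rule E_total)
    fix u assume u: "u \<in> words"
    have "cinner (E u) (cadjoint (create_word w) \<cdot> E v) = cinner (E (w @ u)) (E v)"
      using assms u by (simp add: cinner_cadjoint_right create_word_cops create_word_E)
    also have "\<dots> = split_sum q v (length w) (\<lambda>A R. cinner (E u) (cinner (E w) (E A) *\<^sub>C E R))"
      using assms u v by (simp add: cinner_E_append cinner_scaleC_right)
    also have "\<dots> = cinner (E u) (split_sum q v (length w) (\<lambda>A R. cinner (E w) (E A) *\<^sub>C E R))"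
      by (intro split_sum_linear[symmetric] bounded_linear.linear bounded_linear_cinner_right)
    finally have "cinner (E u) (cadjoint (create_word w) \<cdot> E v -
        split_sum q v (length w) (\<lambda>A R. cinner (E w) (E A) *\<^sub>C E R)) = 0"
      by (simp add: cinner_diff_right)
    then show "cinner (cadjoint (create_word w) \<cdot> E v -
        split_sum q v (length w) (\<lambda>A R. cinner (E w) (E A) *\<^sub>C E R)) (E u) = 0"
      by (subst cinner_commute) simp
  qed
  then show "cadjoint (create_word w) \<cdot> E v =
      split_sum q v (length w) (\<lambda>A R. cinner (E w) (E A) *\<^sub>C E R)" by simp
qed (use assms create_word_cops in auto)

lemma creates_zero: "creates k 0 0"
  by (simp add: creates_def)

lemma creates_add: "creates k b S \<Longrightarrow> creates k c T \<Longrightarrow> creates k (b + c) (S + T)"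
  by (simp add: creates_def cops_add cadjoint_add blinfun.add_left cinner_add_left scaleC_add_left split_sum_add)

lemma creates_scale: "creates k b T \<Longrightarrow> creates k (a *\<^sub>C b) (a *\<^sub>C T)"
  by (simp add: creates_def cops_scaleC cadjoint_scaleC scaleC_blinfun_apply cinner_scaleC_left scaleC_scaleC
      split_sum_linear[OF bounded_linear.linear[OF bounded_linear_scaleC_right]])

lemma creates_sum: "(\<And>i. i \<in> I \<Longrightarrow> creates k (b i) (T i)) \<Longrightarrow> creates k (\<Sum>i\<in>I. b i) (\<Sum>i\<in>I. T i)"
  by (induction I rule: infinite_finite_induct) (auto intro: creates_add creates_zero)

text \<open>A vector has many expansions in words, so an operator is chosen by its defining
  property; consistency then comes from \<open>creates_unique\<close> instead of from comparing
  expansions.\<close>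

definition create :: "nat \<Rightarrow> 'h \<Rightarrow> 'h \<Rightarrow>\<^sub>L 'h" where
  "create k b = (SOME T. creates k b T)"

lemma create_creates:
  assumes "b \<in> word_span k"
  shows "creates k b (create k b)"
proof -
  have "\<exists>T. creates k b T"
    using assms unfolding word_span_def
  proof (induction rule: csubspace_hull_induct)
    case (base b)
    then show ?case using creates_word by blast
  qed (use creates_zero creates_add creates_scale in blast)+
  then show ?thesis unfolding create_def by (rule someI_ex)
qed

lemma create_cops: "b \<in> word_span k \<Longrightarrow> create k b \<in> cops"
  using create_creates by (auto simp: creates_def)

lemma create_adjoint_E:
  "b \<in> word_span k \<Longrightarrow> v \<in> words \<Longrightarrow>
    cadjoint (create k b) \<cdot> E v = split_sum q v k (\<lambda>A R. cinner b (E A) *\<^sub>C E R)"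
  using create_creates by (auto simp: creates_def)

lemma create_word_expansion:
  assumes "finite B" "orthonormal B" "B \<subseteq> word_span k" "A \<in> words" "length A = k" "E A \<in> csubspace hull B"
  shows "create_word A = (\<Sum>b\<in>B. cinner b (E A) *\<^sub>C create k b)"
proof (rule creates_unique)
  show "creates k (E A) (create_word A)" using creates_word assms by blast
  have "creates k (\<Sum>b\<in>B. cinner b (E A) *\<^sub>C b) (\<Sum>b\<in>B. cinner b (E A) *\<^sub>C create k b)"
    using assms by (intro creates_sum creates_scale create_creates) auto
  then show "creates k (E A) (\<Sum>b\<in>B. cinner b (E A) *\<^sub>C create k b)"
    using orthonormal_expansion[OF assms(1,2,6)] by simp
qed

text \<open>The row with entries \<open>create k b\<close> composed with its adjoint, so that a
  bound for this operator is a bound for the square of the row.\<close>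

definition gram_op :: "nat \<Rightarrow> 'h set \<Rightarrow> 'h \<Rightarrow>\<^sub>L 'h" where
  "gram_op k B = (\<Sum>b\<in>B. create k b o\<^sub>L cadjoint (create k b))"

lemma gram_op_cops: "B \<subseteq> word_span k \<Longrightarrow> gram_op k B \<in> cops"
  unfolding gram_op_def by (intro cops_sum cops_compose cadjoint_cops create_cops) auto

lemma gram_op_selfadjoint:
  assumes "B \<subseteq> word_span k"
  shows "cadjoint (gram_op k B) = gram_op k B"
proof -
  have c: "create k b \<in> cops" if "b \<in> B" for b using assms that create_cops by auto
  show ?thesis unfolding gram_op_def
    by (subst cadjoint_sum) (auto intro!: sum.cong simp: c cadjoint_compose cadjoint_cops cops_compose)
qed

lemma cinner_gram_op:
  assumes "B \<subseteq> word_span k"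
  shows "cinner x (gram_op k B \<cdot> x) = of_real (\<Sum>b\<in>B. (norm (cadjoint (create k b) \<cdot> x))\<^sup>2)"
proof -
  have c: "create k b \<in> cops" if "b \<in> B" for b using assms that create_cops by auto
  have "cinner x (gram_op k B \<cdot> x) =
      (\<Sum>b\<in>B. cinner x (create k b \<cdot> cadjoint (create k b) \<cdot> x))"
    unfolding gram_op_def by (simp add: blinfun.sum_left cinner_sum_right)
  also have "\<dots> = (\<Sum>b\<in>B. of_real ((norm (cadjoint (create k b) \<cdot> x))\<^sup>2))"
  proof (intro sum.cong refl)
    fix b assume "b \<in> B"
    then show "cinner x (create k b \<cdot> cadjoint (create k b) \<cdot> x) =
       of_real ((norm (cadjoint (create k b) \<cdot> x))\<^sup>2)"
      using cinner_cadjoint_left[OF c] cinner_self by metis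
  qed
  finally show ?thesis by simp
qed

text \<open>Summing over the basis reassembles each \<open>E A\<close>, and the basis disappears:
  what remains only rearranges letters, with weights that add up to a q-binomial
  coefficient.\<close>

lemma gram_op_E:
  assumes B: "finite B" "orthonormal B" "B \<subseteq> word_span k" and v: "v \<in> words"
    and span: "\<And>A R. mset (A @ R) = mset v \<Longrightarrow> length A = k \<Longrightarrow> E A \<in> csubspace hull B"
  shows "gram_op k B \<cdot> E v = split_sum q v k (\<lambda>A R. E (A @ R))"
proof -
  have "gram_op k B \<cdot> E v =
      (\<Sum>b\<in>B. create k b \<cdot> split_sum q v k (\<lambda>A R. cinner b (E A) *\<^sub>C E R))"
    unfolding gram_op_def using B v
    by (auto simp: blinfun.sum_left create_adjoint_E intro!: sum.cong)
  also have "\<dots> = (\<Sum>b\<in>B. split_sum q v k (\<lambda>A R. create k b \<cdot> (cinner b (E A) *\<^sub>C E R)))"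
    by (intro sum.cong refl split_sum_linear bounded_linear.linear[OF blinfun.bounded_linear_right])
  also have "\<dots> = split_sum q v k (\<lambda>A R. \<Sum>b\<in>B. create k b \<cdot> (cinner b (E A) *\<^sub>C E R))"
    by (rule split_sum_sum[symmetric])
  also have "\<dots> = split_sum q v k (\<lambda>A R. E (A @ R))"
  proof (rule split_sum_cong)
    fix A R assume AR: "mset (A @ R) = mset v" "length A = k"
    have w: "A \<in> words" "R \<in> words" using words_split[OF v AR(1)] by auto
    have "(\<Sum>b\<in>B. create k b \<cdot> (cinner b (E A) *\<^sub>C E R)) =
        (\<Sum>b\<in>B. cinner b (E A) *\<^sub>C create k b) \<cdot> E R"
      using B by (auto simp: blinfun.sum_left scaleC_blinfun_apply copsD create_cops intro!: sum.cong)
    also have "\<dots> = E (A @ R)"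
      using create_word_expansion[OF B w(1) AR(2) span[OF AR]] w by (simp add: create_word_E[symmetric])
    finally show "(\<Sum>b\<in>B. create k b \<cdot> (cinner b (E A) *\<^sub>C E R)) = E (A @ R)" .
  qed
  finally show ?thesis .
qed

lemma linear_funpow_blinfun: "linear (blinfun_apply (T :: 'h \<Rightarrow>\<^sub>L 'h) ^^ r)"
  by (induction r) (auto simp: linear_id[unfolded id_def] linear_compose[unfolded comp_def] comp_def
      bounded_linear.linear[OF blinfun.bounded_linear_right] intro: linear_compose[unfolded comp_def])

abbreviation Cq :: real where "Cq \<equiv> binomial_bound q"

lemma Cq_pos: "0 < Cq" using binomial_bound_ge_1[of q] by linarith

text \<open>Each application of the operator multiplies norms of words by at most the \<open>q\<close>-binomial bound, so its
  iterates on a fixed vector grow at most geometrically.\<close>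

lemma norm_gram_op_le:
  assumes B: "finite B" "orthonormal B" "B \<subseteq> word_span k"
    and x: "x = (\<Sum>v\<in>F. c v *\<^sub>C E v)" "F \<subseteq> words" "finite F"
    and span: "\<And>v A R. v \<in> F \<Longrightarrow> mset (A @ R) = mset v \<Longrightarrow> length A = k \<Longrightarrow> E A \<in> csubspace hull B"
  shows "norm (gram_op k B \<cdot> x) \<le> Cq * norm x"
proof -
  define G where "G = gram_op k B"
  \<comment> \<open>The operator only permutes letters, so the maximum over the finitely many
    rearrangements of \<open>v\<close> serves at every iteration.\<close>
  define M where "M v = Max ((\<lambda>w. norm (E w)) ` {w. mset w = mset v})" for v
  have M: "norm (E w) \<le> M v" if "mset w = mset v" for v w
    unfolding M_def using that mset_eq_finite[of v] by (intro Max_ge) auto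
  have M0: "0 \<le> M v" for v using M[of v v] norm_ge_zero order_trans by blast
  have it: "norm ((blinfun_apply G ^^ r) (E w)) \<le> M v * Cq ^ r" if "v \<in> F" "mset w = mset v" for v w r
    using that(2)
  proof (induction r arbitrary: w)
    case 0
    then show ?case using M by simp
  next
    case (Suc r)
    have w: "w \<in> words" using words_mset[OF Suc.prems] that x by auto
    have "(blinfun_apply G ^^ Suc r) (E w) = (blinfun_apply G ^^ r) (split_sum q w k (\<lambda>A R. E (A @ R)))"
      unfolding G_def funpow_Suc_right comp_def
      using span[OF that(1)] Suc.prems by (subst gram_op_E[OF B w]) auto
    also have "\<dots> = split_sum q w k (\<lambda>A R. (blinfun_apply G ^^ r) (E (A @ R)))"
      by (rule split_sum_linear[OF linear_funpow_blinfun])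
    also have "norm \<dots> \<le> Cq * (M v * Cq ^ r)"
      using Suc M0 Cq_pos q_nonneg q_less_1 by (intro norm_split_sum_bound) auto
    finally show ?case by (simp add: mult_ac)
  qed
  show ?thesis unfolding G_def[symmetric]
  proof (rule selfadjoint_norm_le_of_growth)
    fix r
    have "(blinfun_apply G ^^ r) x = (\<Sum>v\<in>F. c v *\<^sub>C (blinfun_apply G ^^ r) (E v))"
    proof -
      have "(blinfun_apply G ^^ r) (a *\<^sub>C y) = a *\<^sub>C (blinfun_apply G ^^ r) y" for a y
        using gram_op_cops[OF B(3)] by (induction r) (auto simp: copsD G_def)
      then show ?thesis unfolding x(1) by (simp add: linear_sum[OF linear_funpow_blinfun])
    qed
    also have "norm \<dots> \<le> (\<Sum>v\<in>F. cmod (c v) * (M v * Cq ^ r))"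
      by (intro sum_norm_le) (auto simp: norm_scaleC intro!: mult_left_mono it)
    finally show "norm ((blinfun_apply G ^^ r) x) \<le> (\<Sum>v\<in>F. cmod (c v) * M v) * Cq ^ r"
      by (simp add: sum_distrib_right mult.assoc)
  qed (use gram_op_cops[OF B(3)] gram_op_selfadjoint[OF B(3)] Cq_pos in \<open>auto simp: G_def\<close>)
qed

text \<open>For a combination of words, \<open>B\<close> is enlarged until its span contains every
  word of length \<open>k\<close> in the letters that occur, where \<open>gram_op\<close> is
  explicit. The additional terms only increase the sum; density and continuity do the rest.\<close>

lemma sum_norm_create_adjoint_le:
  assumes B: "finite B" "orthonormal B" "B \<subseteq> word_span k"
  shows "(\<Sum>b\<in>B. (norm (cadjoint (create k b) \<cdot> x))\<^sup>2) \<le> Cq * (norm x)\<^sup>2"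
proof -
  define M where "M = {x. (\<Sum>b\<in>B. (norm (cadjoint (create k b) \<cdot> x))\<^sup>2) \<le> Cq * (norm x)\<^sup>2}"
  have "csubspace hull (E ` words) \<subseteq> M"
  proof
    fix x assume "x \<in> csubspace hull (E ` words)"
    then obtain F c where F: "finite F" "F \<subseteq> words" "x = (\<Sum>v\<in>F. c v *\<^sub>C E v)"
      by (rule csubspace_hull_image_sum)
    define L where "L = (\<Union>v\<in>F. set v)"
    define W where "W = {A. set A \<subseteq> L \<and> length A = k}"
    have "finite L" using F by (auto simp: L_def)
    then have "finite W" unfolding W_def by (rule finite_lists_length_eq)
    have W: "E ` W \<subseteq> word_span k"
    proof
      fix y assume "y \<in> E ` W"
      then obtain A where A: "A \<in> W" "y = E A" by blast
      have "L \<subseteq> L2fun" using F by (auto simp: L_def words_def)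
      then have "A \<in> {w \<in> words. length w = k}" using A by (auto simp: W_def words_def)
      then show "y \<in> word_span k" unfolding word_span_def A(2) by (intro hull_inc imageI)
    qed
    obtain B' where B': "finite B'" "B \<subseteq> B'" "orthonormal B'" "E ` W \<subseteq> csubspace hull B'"
      "B' \<subseteq> csubspace hull (B \<union> E ` W)"
      using gram_schmidt[of "E ` W" B] \<open>finite W\<close> B by blast
    have "csubspace hull (B \<union> E ` W) \<subseteq> word_span k"
      by (rule hull_minimal) (use B W in \<open>auto simp: word_span_def csubspace_hull\<close>)
    then have B'k: "B' \<subseteq> word_span k" using B' by auto
    have span: "E A \<in> csubspace hull B'" if "v \<in> F" "mset (A @ R) = mset v" "length A = k" for v A R
    proof -
      have "set A \<subseteq> set v" using mset_eq_setD[OF that(2)] by auto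
      then have "A \<in> W" using that by (auto simp: W_def L_def)
      then show ?thesis using B' by auto
    qed
    have "(\<Sum>b\<in>B. (norm (cadjoint (create k b) \<cdot> x))\<^sup>2) \<le>
        (\<Sum>b\<in>B'. (norm (cadjoint (create k b) \<cdot> x))\<^sup>2)"
      using B' by (intro sum_mono2) auto
    also have "\<dots> = cmod (cinner x (gram_op k B' \<cdot> x))"
      unfolding cinner_gram_op[OF B'k] by (simp only: norm_of_real abs_of_nonneg[OF sum_nonneg[OF zero_le_power2]])
    also have "\<dots> \<le> norm x * (Cq * norm x)"
      using norm_gram_op_le[OF B'(1,3) B'k F(3,2,1) span]
      by (intro order_trans[OF cmod_cinner_le] mult_left_mono) auto
    finally show "x \<in> M" by (simp add: M_def power2_eq_square mult_ac)
  qed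
  moreover have "closed M"
    unfolding M_def by (intro closed_Collect_le continuous_intros)
  ultimately have "closure (csubspace hull (E ` words)) \<subseteq> M" by (rule closure_minimal)
  then show ?thesis using E_dense by (auto simp: M_def)
qed

text \<open>The row has the same norm as the column of the adjoints; here this is Cauchy-Schwarz
  after pairing the sum with itself.\<close>

lemma norm_sum_create_le:
  assumes B: "finite B" "orthonormal B" "B \<subseteq> word_span k"
  shows "(norm (\<Sum>b\<in>B. create k b \<cdot> x b))\<^sup>2 \<le> Cq * (\<Sum>b\<in>B. (norm (x b))\<^sup>2)"
proof -
  define y where "y = (\<Sum>b\<in>B. create k b \<cdot> x b)"
  have "(norm y)\<^sup>2 = cmod (cinner y (\<Sum>b\<in>B. create k b \<cdot> x b))"
    using cmod_cinner_self[of y] by (simp add: y_def)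
  also have "cinner y (\<Sum>b\<in>B. create k b \<cdot> x b) =
      (\<Sum>b\<in>B. cinner (cadjoint (create k b) \<cdot> y) (x b))"
    unfolding cinner_sum_right using B by (intro sum.cong refl cinner_cadjoint_left[symmetric] create_cops) auto
  also have "cmod (\<Sum>b\<in>B. cinner (cadjoint (create k b) \<cdot> y) (x b))
    \<le> (\<Sum>b\<in>B. norm (cadjoint (create k b) \<cdot> y) * norm (x b))"
    by (intro sum_norm_le cmod_cinner_le)
  also have "\<dots> \<le> sqrt ((\<Sum>b\<in>B. (norm (cadjoint (create k b) \<cdot> y))\<^sup>2) * (\<Sum>b\<in>B. (norm (x b))\<^sup>2))"
    by (intro real_le_rsqrt Cauchy_Schwarz_ineq_sum)
  also have "\<dots> \<le> sqrt (Cq * (norm y)\<^sup>2 * (\<Sum>b\<in>B. (norm (x b))\<^sup>2))"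
    by (intro real_sqrt_le_mono mult_right_mono sum_norm_create_adjoint_le B sum_nonneg) auto
  also have "\<dots> = norm y * sqrt (Cq * (\<Sum>b\<in>B. (norm (x b))\<^sup>2))"
    by (simp add: real_sqrt_mult)
  finally have "norm y * norm y \<le> norm y * sqrt (Cq * (\<Sum>b\<in>B. (norm (x b))\<^sup>2))"
    by (simp add: power2_eq_square)
  then have "norm y \<le> sqrt (Cq * (\<Sum>b\<in>B. (norm (x b))\<^sup>2))"
    using Cq_pos by (cases "norm y = 0") (auto simp: sum_nonneg mult_le_cancel_left)
  then have "(norm y)\<^sup>2 \<le> (sqrt (Cq * (\<Sum>b\<in>B. (norm (x b))\<^sup>2)))\<^sup>2" by (intro power_mono) auto
  also have "\<dots> = Cq * (\<Sum>b\<in>B. (norm (x b))\<^sup>2)"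
    using Cq_pos by (simp add: sum_nonneg)
  finally show ?thesis unfolding y_def .
qed

section \<open>Rows and columns of one-letter operators\<close>

lemma norm_E_single: "g \<in> L2fun \<Longrightarrow> (norm (E [g]))\<^sup>2 = Re (L2inner g g)"
  using Re_cinner_self[of "E [g]"] cinner_E[of "[g]" "[g]"] by (simp add: q_inner_Cons)

lemma creates_creation: "g \<in> L2fun \<Longrightarrow> creates 1 (E [g]) (creation E g)"
proof -
  assume "g \<in> L2fun"
  moreover have "creation E g o\<^sub>L id_blinfun = creation E g" by (rule blinfun_eqI) simp
  ultimately show ?thesis using creates_word[of "[g]"] by simp
qed

lemma creation_normalized:
  assumes "g \<in> L2fun" 
  shows "creation E g = norm (E [g]) *\<^sub>R create 1 (inverse (norm (E [g])) *\<^sub>R E [g])"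
proof (rule creates_unique[OF creates_creation[OF assms]])
  have "E [g] \<in> word_span 1" using assms by (auto simp: word_span_def intro!: hull_inc)
  then have "inverse (norm (E [g])) *\<^sub>R E [g] \<in> word_span 1"
    unfolding word_span_def by (intro csubspace_scaleR csubspace_hull)
  then have "creates 1 (of_real (norm (E [g])) *\<^sub>C (inverse (norm (E [g])) *\<^sub>R E [g]))
      (of_real (norm (E [g])) *\<^sub>C create 1 (inverse (norm (E [g])) *\<^sub>R E [g]))"
    by (intro creates_scale create_creates)
  then show "creates 1 (E [g]) (norm (E [g]) *\<^sub>R create 1 (inverse (norm (E [g])) *\<^sub>R E [g]))"
    by (cases "E [g] = 0") (simp_all add: scaleC_of_real)
qed

lemma orthogonal_normalized:
  assumes g: "\<And>i. i \<in> I \<Longrightarrow> g i \<in> L2fun"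
    and orth: "\<And>i j. i \<in> I \<Longrightarrow> j \<in> I \<Longrightarrow> i \<noteq> j \<Longrightarrow> L2inner (g i) (g j) = 0"
    and nz: "\<And>i. i \<in> I \<Longrightarrow> E [g i] \<noteq> 0"
  defines "b \<equiv> \<lambda>i. inverse (norm (E [g i])) *\<^sub>R E [g i]"
  shows "orthonormal (b ` I)" "inj_on b I" "b ` I \<subseteq> word_span 1"
proof -
  have bb: "cinner (b i) (b j) = (if i = j then 1 else 0)" if "i \<in> I" "j \<in> I" for i j
  proof (cases "i = j")
    case True
    then show ?thesis using nz[of j] that by (simp add: b_def cinner_self)
  next
    case False
    then have "cinner (E [g i]) (E [g j]) = 0"
      using orth[of i j] g that by (simp add: cinner_E q_inner_Cons)
    then show ?thesis using False by (simp add: b_def cinner_scaleR_left cinner_scaleR_right)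
  qed
  show inj: "inj_on b I"
  proof (rule inj_onI)
    fix i j assume "i \<in> I" "j \<in> I" "b i = b j"
    then show "i = j" using bb[of i j] bb[of i i] by (auto split: if_splits)
  qed
  show "orthonormal (b ` I)"
    unfolding orthonormal_def using bb inj by (auto simp: inj_on_eq_iff)
  have "E [g i] \<in> word_span 1" if "i \<in> I" for i
    using g[OF that] by (auto simp: word_span_def intro!: hull_inc)
  then show "b ` I \<subseteq> word_span 1"
    unfolding b_def word_span_def by (auto intro!: csubspace_scaleR csubspace_hull)
qed

lemma creation_zero_norm: "g \<in> L2fun \<Longrightarrow> E [g] = 0 \<Longrightarrow> creation E g = 0"
  using creation_normalized[of g] by simp

text \<open>This is the source of smallness: a column of annihilation operators over orthogonal
  functions is controlled by the largest squared norm and not by the sum, as if it were a single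
  operator.\<close>

lemma sum_norm_annihilation_le:
  assumes fin: "finite I" and g: "\<And>i. i \<in> I \<Longrightarrow> g i \<in> L2fun"
    and orth: "\<And>i j. i \<in> I \<Longrightarrow> j \<in> I \<Longrightarrow> i \<noteq> j \<Longrightarrow> L2inner (g i) (g j) = 0"
    and le: "\<And>i. i \<in> I \<Longrightarrow> Re (L2inner (g i) (g i)) \<le> \<epsilon>" and eps: "0 \<le> \<epsilon>"
  shows "(\<Sum>i\<in>I. (norm (annihilation E (g i) \<cdot> x))\<^sup>2) \<le> Cq * \<epsilon> * (norm x)\<^sup>2"
proof -
  define b where "b i = inverse (norm (E [g i])) *\<^sub>R E [g i]" for i
  \<comment> \<open>A function with null vector cannot be normalised, but its operators
    vanish.\<close>
  define I' where "I' = {i \<in> I. E [g i] \<noteq> 0}"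
  have I': "finite I'" "I' \<subseteq> I" using fin by (auto simp: I'_def)
  have on: "orthonormal (b ` I')" "inj_on b I'" "b ` I' \<subseteq> word_span 1"
    unfolding b_def by (rule orthogonal_normalized[of I' g]; use g orth in \<open>simp add: I'_def\<close>)+
  have "(\<Sum>i\<in>I. (norm (annihilation E (g i) \<cdot> x))\<^sup>2) =
      (\<Sum>i\<in>I'. (norm (annihilation E (g i) \<cdot> x))\<^sup>2)"
    using fin I' by (intro sum.mono_neutral_right)
      (auto simp: I'_def annihilation_def creation_zero_norm[OF g])
  also have "\<dots> \<le> (\<Sum>i\<in>I'. \<epsilon> * (norm (cadjoint (create 1 (b i)) \<cdot> x))\<^sup>2)"
  proof (rule sum_mono)
    fix i assume i: "i \<in> I'"
    have c: "create 1 (b i) \<in> cops" using on i by (intro create_cops) auto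
    have "g i \<in> L2fun" using g i I' by auto
    then have "annihilation E (g i) = norm (E [g i]) *\<^sub>R cadjoint (create 1 (b i))"
      unfolding annihilation_def
      by (subst creation_normalized) (simp_all only: b_def[symmetric] cadjoint_scaleR[OF c])
    then show "(norm (annihilation E (g i) \<cdot> x))\<^sup>2 \<le> \<epsilon> * (norm (cadjoint (create 1 (b i)) \<cdot> x))\<^sup>2"
      using le[of i] norm_E_single[of "g i"] g i I'
      by (auto simp: blinfun.scaleR_left power_mult_distrib intro!: mult_right_mono)
  qed
  also have "\<dots> = \<epsilon> * (\<Sum>c\<in>b ` I'. (norm (cadjoint (create 1 c) \<cdot> x))\<^sup>2)"
    using on by (simp add: sum.reindex sum_distrib_left)
  also have "\<dots> \<le> \<epsilon> * (Cq * (norm x)\<^sup>2)"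
    using eps on I' by (intro mult_left_mono sum_norm_create_adjoint_le) auto
  finally show ?thesis by (simp add: mult_ac)
qed

text \<open>The weights stay inside the sum because in the Ito estimates the vectors vary with
  \<open>i\<close> while the squared norms of the functions add up to the length of the
  interval.\<close>

lemma norm_sum_creation_le:
  assumes fin: "finite I" and g: "\<And>i. i \<in> I \<Longrightarrow> g i \<in> L2fun"
    and orth: "\<And>i j. i \<in> I \<Longrightarrow> j \<in> I \<Longrightarrow> i \<noteq> j \<Longrightarrow> L2inner (g i) (g j) = 0"
  shows "(norm (\<Sum>i\<in>I. creation E (g i) \<cdot> x i))\<^sup>2 \<le>
    Cq * (\<Sum>i\<in>I. Re (L2inner (g i) (g i)) * (norm (x i))\<^sup>2)"
proof -
  define b where "b i = inverse (norm (E [g i])) *\<^sub>R E [g i]" for i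
  define I' where "I' = {i \<in> I. E [g i] \<noteq> 0}"
  have I': "finite I'" "I' \<subseteq> I" using fin by (auto simp: I'_def)
  have on: "orthonormal (b ` I')" "inj_on b I'" "b ` I' \<subseteq> word_span 1"
    unfolding b_def by (rule orthogonal_normalized[of I' g]; use g orth in \<open>simp add: I'_def\<close>)+
  define y where "y c = norm (E [g (inv_into I' b c)]) *\<^sub>R x (inv_into I' b c)" for c
  have "(\<Sum>i\<in>I. creation E (g i) \<cdot> x i) = (\<Sum>i\<in>I'. creation E (g i) \<cdot> x i)"
    using fin I' by (intro sum.mono_neutral_right) (auto simp: I'_def creation_zero_norm[OF g])
  also have "\<dots> = (\<Sum>i\<in>I'. create 1 (b i) \<cdot> y (b i))"
  proof (rule sum.cong[OF refl])
    fix i assume i: "i \<in> I'"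
    have "creation E (g i) = norm (E [g i]) *\<^sub>R create 1 (b i)"
      using creation_normalized[of "g i"] g i I' by (auto simp: b_def)
    then show "creation E (g i) \<cdot> x i = create 1 (b i) \<cdot> y (b i)"
      using i on by (simp add: y_def blinfun.scaleR_left blinfun.scaleR_right)
  qed
  also have "\<dots> = (\<Sum>c\<in>b ` I'. create 1 c \<cdot> y c)"
    using on by (simp add: sum.reindex)
  finally have "(norm (\<Sum>i\<in>I. creation E (g i) \<cdot> x i))\<^sup>2 \<le> Cq * (\<Sum>c\<in>b ` I'. (norm (y c))\<^sup>2)"
    using norm_sum_create_le[of "b ` I'" 1 y] on I' by simp
  also have "(\<Sum>c\<in>b ` I'. (norm (y c))\<^sup>2) = (\<Sum>i\<in>I'. Re (L2inner (g i) (g i)) * (norm (x i))\<^sup>2)"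
    using on I' g by (auto simp: sum.reindex y_def power_mult_distrib norm_E_single intro!: sum.cong)
  also have "Cq * \<dots> \<le> Cq * (\<Sum>i\<in>I. Re (L2inner (g i) (g i)) * (norm (x i))\<^sup>2)"
    using Cq_pos I' fin L2inner_self(2) by (intro mult_left_mono sum_mono2) auto
  finally show ?thesis .
qed

lemma norm_creation_le:
  assumes "g \<in> L2fun"
  shows "norm (creation E g) \<le> sqrt (Cq * Re (L2inner g g))"
proof (rule norm_blinfun_bound)
  fix x
  have "(norm (creation E g \<cdot> x))\<^sup>2 \<le> Cq * Re (L2inner g g) * (norm x)\<^sup>2"
    using norm_sum_creation_le[of "{()}" "\<lambda>_. g" "\<lambda>_. x"] assms by simp
  then have "norm (creation E g \<cdot> x) \<le> sqrt (Cq * Re (L2inner g g) * (norm x)\<^sup>2)"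
    by (rule real_le_rsqrt)
  then show "norm (creation E g \<cdot> x) \<le> sqrt (Cq * Re (L2inner g g)) * norm x"
    by (simp add: real_sqrt_mult)
qed (use Cq_pos L2inner_self(2) in auto)

lemma norm_annihilation: "g \<in> L2fun \<Longrightarrow> norm (annihilation E g) = norm (creation E g)"
  by (simp add: annihilation_def norm_cadjoint)

section \<open>Wick products\<close>

primrec annihilate_word :: "(real \<Rightarrow> complex) list \<Rightarrow> 'h \<Rightarrow>\<^sub>L 'h" where
  "annihilate_word [] = id_blinfun"
| "annihilate_word (f # w) = annihilation E f o\<^sub>L annihilate_word w"

lemma annihilate_word_eq: "w \<in> words \<Longrightarrow> annihilate_word w = cadjoint (create_word (rev w))"
proof (induction w)
  case (Cons f w)
  have "creation E f o\<^sub>L id_blinfun = creation E f" by (rule blinfun_eqI) simp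
  then show ?case using Cons
    by (simp add: create_word_append cadjoint_compose create_word_cops annihilation_def)
qed simp

lemma annihilate_word_vacuum: "w \<in> words \<Longrightarrow> w \<noteq> [] \<Longrightarrow> annihilate_word w \<cdot> E [] = 0"
proof (induction w)
  case (Cons f w)
  then show ?case by (cases "w = []") auto
qed simp

text \<open>The insertion \<open>Q\<close> sits between creators and annihilators, where outer
  operators meet once they have been commuted inwards from both ends.\<close>

definition wick_with :: "('h \<Rightarrow>\<^sub>L 'h) \<Rightarrow> (real \<Rightarrow> complex) list \<Rightarrow> 'h \<Rightarrow>\<^sub>L 'h" where
  "wick_with Q w = (\<Sum>k\<le>length w. split_sum q w k (\<lambda>A R. create_word A o\<^sub>L Q o\<^sub>L annihilate_word R))"

definition wick :: "(real \<Rightarrow> complex) list \<Rightarrow> 'h \<Rightarrow>\<^sub>L 'h" where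
  "wick w = (\<Sum>k\<le>length w. split_sum q w k (\<lambda>A R. create_word A o\<^sub>L annihilate_word R))"

lemma id_blinfun_compose [simp]: "id_blinfun o\<^sub>L T = T" "T o\<^sub>L id_blinfun = T"
  by (auto intro: blinfun_eqI)

lemma wick_with_id: "wick_with id_blinfun w = wick w"
  by (simp add: wick_with_def wick_def)

text \<open>A nonempty block of annihilators kills the vacuum, so only the purely creating summand
  survives. Thus the norm of a combination of words is an L2 norm of the corresponding
  operators.\<close>

lemma wick_vacuum:
  assumes w: "w \<in> words"
  shows "wick w \<cdot> E [] = E w"
proof -
  have l: "linear (\<lambda>T. T \<cdot> E [])"
    by (rule bounded_linear.linear[OF blinfun.bounded_linear_left])
  have "split_sum q w k (\<lambda>A R. (create_word A o\<^sub>L annihilate_word R) \<cdot> E []) =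
      (if k = length w then E w else 0)" if "k \<le> length w" for k
  proof (cases "k = length w")
    case True
    then show ?thesis using w create_word_E[of w "[]"] by simp
  next
    case False
    have "split_sum q w k (\<lambda>A R. (create_word A o\<^sub>L annihilate_word R) \<cdot> E []) = split_sum q w k (\<lambda>A R. 0)"
    proof (rule split_sum_cong)
      fix A R assume AR: "mset (A @ R) = mset w" "length A = k"
      then have "length A + length R = length w" by (metis length_append mset_eq_length)
      then have "R \<noteq> []" using AR False that by auto
      then show "(create_word A o\<^sub>L annihilate_word R) \<cdot> E [] = 0"
        using words_split[OF w AR(1)] by (simp add: annihilate_word_vacuum)
    qed
    then show ?thesis using False by simp
  qed
  then show ?thesis
    unfolding wick_def blinfun.sum_left by (simp add: split_sum_linear[OF l])
qed

lemma annihilation_create_word: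
  assumes "f \<in> L2fun" "A \<in> words"
  shows "annihilation E f o\<^sub>L create_word A =
    q ^ length A *\<^sub>R (create_word A o\<^sub>L annihilation E f) + rem_sum q A (\<lambda>g A'. L2inner f g *\<^sub>C create_word A')"
  using assms(2)
proof (induction A)
  case (Cons g A)
  then have g: "g \<in> L2fun" "A \<in> words" by auto
  have l: "linear (\<lambda>T. creation E g o\<^sub>L T)"
    by (rule bounded_linear.linear[OF bounded_bilinear.bounded_linear_right[OF bounded_bilinear_blinfun_compose]])
  have "annihilation E f o\<^sub>L create_word (g # A) = (annihilation E f o\<^sub>L creation E g) o\<^sub>L create_word A"
    by (rule blinfun_eqI) simp
  also have "\<dots> = L2inner f g *\<^sub>C create_word A + q *\<^sub>R (creation E g o\<^sub>L (annihilation E f o\<^sub>L create_word A))"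
    unfolding annihilation_creation[OF assms(1) g(1)]
    by (rule blinfun_eqI) (simp add: blinfun.add_left scaleC_blinfun_apply blinfun.scaleR_left)
  also have "creation E g o\<^sub>L (annihilation E f o\<^sub>L create_word A) =
      q ^ length A *\<^sub>R (create_word (g # A) o\<^sub>L annihilation E f) +
      rem_sum q A (\<lambda>h A'. L2inner f h *\<^sub>C create_word (g # A'))"
  proof -
    have "creation E g o\<^sub>L rem_sum q A (\<lambda>h A'. L2inner f h *\<^sub>C create_word A') =
        rem_sum q A (\<lambda>h A'. creation E g o\<^sub>L (L2inner f h *\<^sub>C create_word A'))"
      by (rule rem_sum_linear[OF l])
    moreover have "creation E g o\<^sub>L (c *\<^sub>C T) = c *\<^sub>C (creation E g o\<^sub>L T)" for c and T :: "'h \<Rightarrow>\<^sub>L 'h"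
      using g(1) by (intro blinfun_eqI) (simp add: scaleC_blinfun_apply copsD)
    moreover have "creation E g o\<^sub>L (r *\<^sub>R (create_word A o\<^sub>L annihilation E f)) =
        r *\<^sub>R (create_word (g # A) o\<^sub>L annihilation E f)" for r
      by (rule blinfun_eqI) (simp add: blinfun.scaleR_left blinfun.scaleR_right)
    ultimately show ?thesis
      unfolding Cons.IH[OF g(2)] by (simp add: linear_add[OF l])
  qed
  finally show ?case by (simp add: scaleR_add_right)
qed simp

lemma annihilation_create_word_orthogonal:
  assumes "f \<in> L2fun" "A \<in> words" "\<And>g. g \<in> set A \<Longrightarrow> L2inner f g = 0"
  shows "annihilation E f o\<^sub>L create_word A = q ^ length A *\<^sub>R (create_word A o\<^sub>L annihilation E f)"
proof -
  have "rem_sum q A (\<lambda>g A'. L2inner f g *\<^sub>C create_word A') = rem_sum q A (\<lambda>g A'. 0)"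
  proof (rule rem_sum_cong)
    fix g A' assume "mset (g # A') = mset A"
    then have "g \<in> set A" by (metis list.set_intros(1) mset_eq_setD)
    then show "L2inner f g *\<^sub>C create_word A' = 0" using assms by simp
  qed
  then show ?thesis using annihilation_create_word[OF assms(1,2)] by simp
qed

lemma annihilate_word_creation_orthogonal:
  assumes h: "h \<in> L2fun" "R \<in> words" "\<And>g. g \<in> set R \<Longrightarrow> L2inner h g = 0"
  shows "annihilate_word R o\<^sub>L creation E h = q ^ length R *\<^sub>R (creation E h o\<^sub>L annihilate_word R)"
proof -
  have "annihilation E h o\<^sub>L create_word (rev R) = q ^ length R *\<^sub>R (create_word (rev R) o\<^sub>L annihilation E h)"
    using annihilation_create_word_orthogonal[of h "rev R"] h by simp
  then have "cadjoint (annihilation E h o\<^sub>L create_word (rev R)) =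
      cadjoint (q ^ length R *\<^sub>R (create_word (rev R) o\<^sub>L annihilation E h))" by simp
  then show ?thesis
    using h by (simp add: cadjoint_compose cadjoint_scaleR create_word_cops cops_compose annihilate_word_eq
        cadjoint_annihilation)
qed

text \<open>Creation puts \<open>f\<close> in front of \<open>A\<close>. Annihilation either passes
  through \<open>A\<close>, gaining q^|A|, and joins the annihilators, or is contracted with a
  letter of \<open>A\<close>. The first two cases make up \<open>wick (f # w)\<close>.\<close>

lemma wick_Cons:
  assumes f: "f \<in> L2fun" and w: "w \<in> words"
  shows "(annihilation E f + creation E f) o\<^sub>L wick w =
    wick (f # w) + rem_sum q w (\<lambda>g r. L2inner f g *\<^sub>C wick r)"
proof -
  have lc: "linear (\<lambda>T. creation E f o\<^sub>L T)" and la: "linear (\<lambda>T. annihilation E f o\<^sub>L T)"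
    by (rule bounded_linear.linear[OF bounded_bilinear.bounded_linear_right[OF bounded_bilinear_blinfun_compose]])+
  have lr: "linear (\<lambda>T. T o\<^sub>L S)" for S :: "'h \<Rightarrow>\<^sub>L 'h"
    by (rule bounded_linear.linear[OF bounded_bilinear.bounded_linear_left[OF bounded_bilinear_blinfun_compose]])
  define C where "C = (\<Sum>k\<le>length w. split_sum q w k (\<lambda>A R. create_word (f # A) o\<^sub>L annihilate_word R))"
  define D where "D = (\<Sum>k\<le>length w. q ^ k *\<^sub>R split_sum q w k (\<lambda>A R. create_word A o\<^sub>L annihilate_word (f # R)))"
  define G where "G = (\<Sum>k\<le>length w. split_sum q w k (\<lambda>A R. rem_sum q A (\<lambda>g A'. L2inner f g *\<^sub>C (create_word A' o\<^sub>L annihilate_word R))))"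
  have 1: "wick (f # w) = C + D"
  proof -
    have "wick (f # w) = (\<Sum>k\<le>Suc (length w). if k = 0 then 0 else split_sum q w (k - 1) (\<lambda>A R. create_word (f # A) o\<^sub>L annihilate_word R))
       + (\<Sum>k\<le>Suc (length w). q ^ k *\<^sub>R split_sum q w k (\<lambda>A R. create_word A o\<^sub>L annihilate_word (f # R)))"
      by (simp add: wick_def sum.distrib del: sum.atMost_Suc create_word.simps annihilate_word.simps)
    also have "(\<Sum>k\<le>Suc (length w). if k = 0 then 0 else split_sum q w (k - 1) (\<lambda>A R. create_word (f # A) o\<^sub>L annihilate_word R)) = C"
      unfolding C_def sum.atMost_Suc_shift by simp
    also have "(\<Sum>k\<le>Suc (length w). q ^ k *\<^sub>R split_sum q w k (\<lambda>A R. create_word A o\<^sub>L annihilate_word (f # R))) = D"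
      unfolding D_def by (simp add: split_sum_too_large del: create_word.simps annihilate_word.simps)
    finally show ?thesis .
  qed
  have 2: "creation E f o\<^sub>L wick w = C"
  proof -
    have "creation E f o\<^sub>L (create_word A o\<^sub>L annihilate_word R) = create_word (f # A) o\<^sub>L annihilate_word R" for A R
      by (rule blinfun_eqI) simp
    then show ?thesis
      unfolding wick_def C_def linear_sum[OF lc] split_sum_linear[OF lc] by simp
  qed
  have 3: "annihilation E f o\<^sub>L wick w = D + G"
  proof -
    have "split_sum q w k (\<lambda>A R. annihilation E f o\<^sub>L (create_word A o\<^sub>L annihilate_word R)) =
      split_sum q w k (\<lambda>A R. q ^ k *\<^sub>R (create_word A o\<^sub>L annihilate_word (f # R)) +
         rem_sum q A (\<lambda>g A'. L2inner f g *\<^sub>C (create_word A' o\<^sub>L annihilate_word R)))" for k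
    proof (rule split_sum_cong)
      fix A R assume AR: "mset (A @ R) = mset w" "length A = k"
      have A: "A \<in> words" using words_split[OF w AR(1)] by simp
      have "annihilation E f o\<^sub>L (create_word A o\<^sub>L annihilate_word R) = (annihilation E f o\<^sub>L create_word A) o\<^sub>L annihilate_word R"
        by (rule blinfun_eqI) simp
      also have "\<dots> = q ^ k *\<^sub>R (create_word A o\<^sub>L annihilate_word (f # R)) +
          (rem_sum q A (\<lambda>g A'. L2inner f g *\<^sub>C create_word A') o\<^sub>L annihilate_word R)"
        unfolding annihilation_create_word[OF f A] AR(2)
        by (rule blinfun_eqI) (simp add: blinfun.add_left blinfun.scaleR_left)
      also have "rem_sum q A (\<lambda>g A'. L2inner f g *\<^sub>C create_word A') o\<^sub>L annihilate_word R =
          rem_sum q A (\<lambda>g A'. (L2inner f g *\<^sub>C create_word A') o\<^sub>L annihilate_word R)"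
        by (rule rem_sum_linear[OF lr])
      also have "(\<lambda>g A'. (L2inner f g *\<^sub>C create_word A') o\<^sub>L annihilate_word R) =
          (\<lambda>g A'. L2inner f g *\<^sub>C (create_word A' o\<^sub>L annihilate_word R))"
        by (intro ext blinfun_eqI) (simp add: scaleC_blinfun_apply)
      finally show "annihilation E f o\<^sub>L (create_word A o\<^sub>L annihilate_word R) = q ^ k *\<^sub>R (create_word A o\<^sub>L annihilate_word (f # R)) +
         rem_sum q A (\<lambda>g A'. L2inner f g *\<^sub>C (create_word A' o\<^sub>L annihilate_word R))" .
    qed
    then show ?thesis
      unfolding wick_def D_def G_def linear_sum[OF la] split_sum_linear[OF la]
      by (simp add: split_sum_add sum.distrib split_sum_linear[OF bounded_linear.linear[OF bounded_linear_scaleR_right]]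
          del: annihilate_word.simps)
  qed
  have 4: "G = rem_sum q w (\<lambda>g r. L2inner f g *\<^sub>C wick r)"
  proof (cases "w = []")
    case True
    then show ?thesis by (simp add: G_def)
  next
    case False
    then obtain n where n: "length w = Suc n" by (cases w) auto
    \<comment> \<open>For k = 0 there is no letter to contract, so the sum starts at 1 and is
      shifted; then contraction and choice of the subword change places.\<close>
    have "G = (\<Sum>k\<le>n. split_sum q w (Suc k) (\<lambda>A R. rem_sum q A (\<lambda>g A'. L2inner f g *\<^sub>C (create_word A' o\<^sub>L annihilate_word R))))"
      unfolding G_def n sum.atMost_Suc_shift by simp
    also have "\<dots> = (\<Sum>k\<le>n. rem_sum q w (\<lambda>g r. split_sum q r k (\<lambda>A R. L2inner f g *\<^sub>C (create_word A o\<^sub>L annihilate_word R))))"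
      by (simp add: split_sum_Suc)
    also have "\<dots> = rem_sum q w (\<lambda>g r. \<Sum>k\<le>n. split_sum q r k (\<lambda>A R. L2inner f g *\<^sub>C (create_word A o\<^sub>L annihilate_word R)))"
      by (rule rem_sum_sum[symmetric])
    also have "\<dots> = rem_sum q w (\<lambda>g r. L2inner f g *\<^sub>C wick r)"
    proof (rule rem_sum_cong)
      fix g r assume "mset (g # r) = mset w"
      then have "length r = n" using n by (metis length_Cons mset_eq_length nat.inject)
      then show "(\<Sum>k\<le>n. split_sum q r k (\<lambda>A R. L2inner f g *\<^sub>C (create_word A o\<^sub>L annihilate_word R))) = L2inner f g *\<^sub>C wick r"
        by (simp add: wick_def scaleC_sum_right split_sum_linear[OF bounded_linear.linear[OF bounded_linear_scaleC_right]])
    qed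
    finally show ?thesis .
  qed
  show ?thesis
    using 1 2 3 4 by (simp add: bounded_bilinear.add_left[OF bounded_bilinear_blinfun_compose])
qed

text \<open>Passing the creators \<open>A\<close> costs q^|A| and passing the annihilators
  \<open>R\<close> costs q^|R|, so the total factor does not depend on the splitting and comes out
  of the sum.\<close>

lemma annihilation_wick_creation:
  assumes g: "g \<in> L2fun" and h: "h \<in> L2fun" and w: "w \<in> words"
    and orth: "\<And>f. f \<in> set w \<Longrightarrow> L2inner g f = 0" "\<And>f. f \<in> set w \<Longrightarrow> L2inner h f = 0"
  shows "annihilation E g o\<^sub>L wick w o\<^sub>L creation E h = q ^ length w *\<^sub>R wick_with (annihilation E g o\<^sub>L creation E h) w"
proof -
  have l: "linear (\<lambda>T. annihilation E g o\<^sub>L T o\<^sub>L creation E h)"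
    by (intro linearI) (auto intro!: blinfun_eqI simp: blinfun.add_left blinfun.add_right blinfun.scaleR_left blinfun.scaleR_right)
  have "split_sum q w k (\<lambda>A R. annihilation E g o\<^sub>L (create_word A o\<^sub>L annihilate_word R) o\<^sub>L creation E h) =
    split_sum q w k (\<lambda>A R. q ^ length w *\<^sub>R (create_word A o\<^sub>L (annihilation E g o\<^sub>L creation E h) o\<^sub>L annihilate_word R))" for k
  proof (rule split_sum_cong)
    fix A R assume AR: "mset (A @ R) = mset w" "length A = k"
    have wd: "A \<in> words" "R \<in> words" using words_split[OF w AR(1)] by auto
    have len: "length w = length A + length R" using AR by (metis length_append mset_eq_length)
    have sub: "set A \<subseteq> set w" "set R \<subseteq> set w" using mset_eq_setD[OF AR(1)] by auto
    have "annihilation E g o\<^sub>L (create_word A o\<^sub>L annihilate_word R) o\<^sub>L creation E h =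
        (annihilation E g o\<^sub>L create_word A) o\<^sub>L (annihilate_word R o\<^sub>L creation E h)"
      by (rule blinfun_eqI) simp
    also have "\<dots> = q ^ length w *\<^sub>R (create_word A o\<^sub>L (annihilation E g o\<^sub>L creation E h) o\<^sub>L annihilate_word R)"
      using sub orth
      by (subst annihilation_create_word_orthogonal[OF g wd(1)], blast,
          subst annihilate_word_creation_orthogonal[OF h wd(2)], blast)
        (rule blinfun_eqI, simp add: blinfun.scaleR_left blinfun.scaleR_right len power_add)
    finally show "annihilation E g o\<^sub>L (create_word A o\<^sub>L annihilate_word R) o\<^sub>L creation E h =
        q ^ length w *\<^sub>R (create_word A o\<^sub>L (annihilation E g o\<^sub>L creation E h) o\<^sub>L annihilate_word R)" .
  qed
  then show ?thesis
    unfolding wick_def wick_with_def linear_sum[OF l] split_sum_linear[OF l]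
    by (simp add: scaleR_sum_right split_sum_linear[OF bounded_linear.linear[OF bounded_linear_scaleR_right]])
qed

lemma wick_with_add: "w \<in> words \<Longrightarrow> wick_with (Q + Q') w = wick_with Q w + wick_with Q' w"
  by (simp add: wick_with_def bounded_bilinear.add_left[OF bounded_bilinear_blinfun_compose]
      bounded_bilinear.add_right[OF bounded_bilinear_blinfun_compose] split_sum_add sum.distrib)

lemma wick_with_zero [simp]: "wick_with 0 w = 0"
  by (simp add: wick_with_def bounded_bilinear.zero_left[OF bounded_bilinear_blinfun_compose]
      bounded_bilinear.zero_right[OF bounded_bilinear_blinfun_compose])

lemma wick_with_sum: "w \<in> words \<Longrightarrow> wick_with (\<Sum>i\<in>I. Q i) w = (\<Sum>i\<in>I. wick_with (Q i) w)"
  by (induction I rule: infinite_finite_induct) (auto simp: wick_with_add)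

end

section \<open>A Haagerup inequality\<close>

lemma cinner_split_sum:
  fixes F :: "'a list \<Rightarrow> 'a list \<Rightarrow> 'h::complex_hilbert" and G :: "'b list \<Rightarrow> 'b list \<Rightarrow> 'h"
  shows "cinner (split_sum q w k F) (split_sum p v l G) =
    split_sum q w k (\<lambda>A R. split_sum p v l (\<lambda>A' R'. cinner (F A R) (G A' R')))"
proof -
  have l: "linear (\<lambda>x. cinner x y)" for y :: 'h
    by (rule bounded_linear.linear[OF bounded_bilinear.bounded_linear_left[OF bounded_bilinear_cinner]])
  have r: "linear (cinner x)" for x :: 'h
    by (rule bounded_linear.linear[OF bounded_linear_cinner_right])
  show ?thesis by (subst split_sum_linear[OF l]) (simp only: split_sum_linear[OF r])
qed

lemma cnj_split_sum: "cnj (split_sum q w k F) = split_sum q w k (\<lambda>A R. cnj (F A R))"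
  by (rule split_sum_linear[OF bounded_linear.linear[OF bounded_linear_cnj]])

lemma cnj_q_inner:
  assumes "\<And>f g. f \<in> set u \<Longrightarrow> g \<in> set v \<Longrightarrow> cnj (L2inner f g) = L2inner f g"
  shows "cnj (q_inner q u v) = q_inner q u v"
  using assms
proof (induction u arbitrary: v)
  case Nil
  then show ?case by (cases v) (simp_all add: q_inner_length)
next
  case (Cons f u)
  have "cnj (q_inner q (f # u) v) = rem_sum q v (\<lambda>g r. cnj (L2inner f g * q_inner q u r))"
    unfolding q_inner_Cons by (rule rem_sum_linear[OF bounded_linear.linear[OF bounded_linear_cnj]])
  also have "\<dots> = rem_sum q v (\<lambda>g r. L2inner f g * q_inner q u r)"
  proof (rule rem_sum_cong)
    fix g r assume "mset (g # r) = mset v"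
    then have "set (g # r) = set v" by (rule mset_eq_setD)
    then have sub: "g \<in> set v" "set r \<subseteq> set v" by auto
    then have "cnj (q_inner q u r) = q_inner q u r" by (intro Cons.IH Cons.prems) auto
    then show "cnj (L2inner f g * q_inner q u r) = L2inner f g * q_inner q u r"
      using Cons.prems[of f g] sub by simp
  qed
  finally show ?case by (simp add: q_inner_Cons)
qed

lemma L2_set_product_bound:
  fixes f :: "'a \<Rightarrow> real"
  assumes "(\<Sum>i\<in>I. (f i)\<^sup>2) \<le> F" "(\<Sum>i\<in>I. (g i)\<^sup>2) \<le> G"
  shows "(\<Sum>i\<in>I. f i * g i) \<le> sqrt F * sqrt G"
proof -
  have "(\<Sum>i\<in>I. f i * g i) \<le> sqrt ((\<Sum>i\<in>I. (f i)\<^sup>2) * (\<Sum>i\<in>I. (g i)\<^sup>2))"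
    by (intro real_le_rsqrt Cauchy_Schwarz_ineq_sum)
  also have "\<dots> \<le> sqrt (F * G)"
  proof (intro real_sqrt_le_mono mult_mono assms)
    have "0 \<le> (\<Sum>i\<in>I. (f i)\<^sup>2)" by (intro sum_nonneg) simp
    then show "0 \<le> F" using assms(1) by linarith
    show "0 \<le> (\<Sum>i\<in>I. (g i)\<^sup>2)" by (intro sum_nonneg) simp
  qed
  finally show ?thesis by (simp add: real_sqrt_mult)
qed

context q_fock begin

definition real_words :: "(real \<Rightarrow> complex) list set \<Rightarrow> bool" where
  "real_words F \<longleftrightarrow> (\<forall>v\<in>F. \<forall>w\<in>F. \<forall>f\<in>set v. \<forall>g\<in>set w. cnj (L2inner f g) = L2inner f g)"

text \<open>Reversing words is only an antiunitary symmetry of the part spanned by words with real inner products,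
  hence the restriction to such families.\<close>

lemma norm_mirror:
  assumes F: "F \<subseteq> words" "real_words F"
  shows "norm (\<Sum>w\<in>F. cnj (c w) *\<^sub>C split_sum q w k (\<lambda>A R. cnj (d A) *\<^sub>C E (rev R))) =
    norm (\<Sum>w\<in>F. c w *\<^sub>C split_sum q w k (\<lambda>A R. d A *\<^sub>C E R))" (is "norm ?x = norm ?y")
proof -
  have "cinner ?x ?x = (\<Sum>w\<in>F. \<Sum>w'\<in>F. c w * cnj (c w') *
      split_sum q w k (\<lambda>A R. split_sum q w' k (\<lambda>A' R'. d A * cnj (d A') * cinner (E (rev R)) (E (rev R')))))"
    unfolding cinner_sum_left unfolding cinner_sum_right
    by (simp add: cinner_scaleC_left cinner_scaleC_right cinner_split_sum mult_ac)
  also have "\<dots> = (\<Sum>w\<in>F. \<Sum>w'\<in>F. c w * cnj (c w') *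
      split_sum q w k (\<lambda>A R. split_sum q w' k (\<lambda>A' R'. d A * cnj (d A') * cnj (cinner (E R) (E R')))))"
  proof (intro sum.cong refl arg_cong2[where f = "(*)"] split_sum_cong)
    fix w w' A R A' R' assume *: "w \<in> F" "w' \<in> F" "mset (A @ R) = mset w" "mset (A' @ R') = mset w'"
    have wd: "R \<in> words" "R' \<in> words" using words_split * F by blast+
    have sub: "set R \<subseteq> set w" "set R' \<subseteq> set w'" using mset_eq_setD[OF *(3)] mset_eq_setD[OF *(4)] by auto
    have "cnj (q_inner q R R') = q_inner q R R'"
    proof (rule cnj_q_inner)
      fix f g assume "f \<in> set R" "g \<in> set R'"
      then have "f \<in> set w" "g \<in> set w'" using sub by auto
      then show "cnj (L2inner f g) = L2inner f g" using F(2) *(1,2) unfolding real_words_def by blast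
    qed
    then show "cinner (E (rev R)) (E (rev R')) = cnj (cinner (E R) (E R'))"
      using wd by (simp add: cinner_E q_inner_rev)
  qed
  also have "\<dots> = cnj (cinner ?y ?y)"
    unfolding cinner_sum_left unfolding cinner_sum_right
    by (simp add: cinner_scaleC_left cinner_scaleC_right cinner_split_sum mult_ac cnj_split_sum)
  finally have "complex_of_real ((norm ?x)\<^sup>2) = of_real ((norm ?y)\<^sup>2)"
    unfolding cinner_self by simp
  then have "(norm ?x)\<^sup>2 = (norm ?y)\<^sup>2" by (simp only: of_real_eq_iff)
  then show ?thesis by simp
qed

text \<open>In orthonormal bases of degrees \<open>k\<close> and \<open>n - k\<close> the component
  is a coefficient matrix between a row of creators and a column of annihilators. Each of these
  costs \<open>sqrt Cq\<close>, and so does comparing the Hilbert-Schmidt norm of the matrix with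
  the norm of the vector.\<close>

lemma norm_split_component_le:
  assumes F: "finite F" "F \<subseteq> words" "real_words F" "\<And>w. w \<in> F \<Longrightarrow> length w = n" and k: "k \<le> n"
    and Q: "Q \<in> cops"
  shows "norm (\<Sum>w\<in>F. c w *\<^sub>C split_sum q w k (\<lambda>A R. create_word A o\<^sub>L Q o\<^sub>L annihilate_word R))
    \<le> Cq * sqrt Cq * norm Q * norm (\<Sum>w\<in>F. c w *\<^sub>C E w)" (is "norm ?Z \<le> _")
proof -
  define \<xi> where "\<xi> = (\<Sum>w\<in>F. c w *\<^sub>C E w)"
  define L where "L = (\<Union>w\<in>F. set w)"
  define W where "W m = {A. set A \<subseteq> L \<and> length A = m}" for m
  have L: "finite L" "L \<subseteq> L2fun" using F by (auto simp: L_def words_def)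
  have W: "finite (W m)" "W m \<subseteq> {w \<in> words. length w = m}" for m
    using finite_lists_length_eq[OF L(1)] L(2) by (auto simp: W_def words_def)
  have "\<exists>B. finite B \<and> orthonormal B \<and> E ` W m \<subseteq> csubspace hull B \<and> B \<subseteq> word_span m" for m
  proof -
    obtain B where B: "finite B" "orthonormal B" "E ` W m \<subseteq> csubspace hull B" "B \<subseteq> csubspace hull ({} \<union> E ` W m)"
      using gram_schmidt[of "E ` W m" "{}"] W(1) by (auto simp: orthonormal_def)
    have "csubspace hull ({} \<union> E ` W m) \<subseteq> word_span m"
      unfolding word_span_def using W(2) by (intro hull_mono) auto
    then show ?thesis using B by blast
  qed
  then obtain B where B: "\<And>m. finite (B m)" "\<And>m. orthonormal (B m)"
    "\<And>m A. A \<in> W m \<Longrightarrow> E A \<in> csubspace hull B m" "\<And>m. B m \<subseteq> word_span m"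
    by (metis image_subset_iff)
  define T where "T b = create k b" for b
  define T' where "T' b = create (n - k) b" for b
  have Tc: "b \<in> B k \<Longrightarrow> T b \<in> cops" "b \<in> B (n - k) \<Longrightarrow> T' b \<in> cops" for b
    using B(4) by (auto simp: T_def T'_def intro: create_cops)
  \<comment> \<open>The second slot carries \<open>rev R\<close> because
    \<open>annihilate_word R\<close> is the adjoint of \<open>create_word (rev R)\<close>.\<close>
  define \<eta> where "\<eta> b b' = (\<Sum>w\<in>F. c w * split_sum q w k (\<lambda>A R. cinner b (E A) * cinner (E (rev R)) b'))" for b b'
  have split: "A \<in> W k" "R \<in> W (n - k)" "rev R \<in> W (n - k)" "A \<in> words" "R \<in> words"
    if "w \<in> F" "mset (A @ R) = mset w" "length A = k" for w A R
  proof -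
    have "length A + length R = n" using that F(4) by (metis length_append mset_eq_length)
    moreover have "set A \<union> set R = set w" using mset_eq_setD[OF that(2)] by simp
    ultimately show "A \<in> W k" "R \<in> W (n - k)" "rev R \<in> W (n - k)"
      using that unfolding W_def L_def by auto
    show "A \<in> words" "R \<in> words" using words_split that F(2) by blast+
  qed
  have elem: "cinner x ((create_word A o\<^sub>L Q o\<^sub>L annihilate_word R) \<cdot> y) =
      (\<Sum>b\<in>B k. \<Sum>b'\<in>B (n - k). (cinner b (E A) * cinner (E (rev R)) b') *
        cinner (cadjoint (T b) \<cdot> x) (Q \<cdot> cadjoint (T' b') \<cdot> y))"
    if AR: "A \<in> W k" "rev R \<in> W (n - k)" "R \<in> words" for A R x y
  proof -
    have wA: "A \<in> words" "length A = k" and wR: "rev R \<in> words" "length (rev R) = n - k"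
      using W(2)[of k] W(2)[of "n - k"] AR(1,2) by blast+
    have A: "create_word A = (\<Sum>b\<in>B k. cinner b (E A) *\<^sub>C T b)"
      unfolding T_def by (intro create_word_expansion B AR wA)
    have "create_word (rev R) = (\<Sum>b\<in>B (n - k). cinner b (E (rev R)) *\<^sub>C T' b)"
      unfolding T'_def by (intro create_word_expansion B AR wR)
    then have R: "annihilate_word R = (\<Sum>b\<in>B (n - k). cinner (E (rev R)) b *\<^sub>C cadjoint (T' b))"
      using AR(3) Tc cinner_commute[of "E (rev R)"]
      by (simp add: annihilate_word_eq cadjoint_sum cops_scaleC cadjoint_scaleC)
    have "cinner x ((create_word A o\<^sub>L Q o\<^sub>L annihilate_word R) \<cdot> y) =
       (\<Sum>b\<in>B k. cinner b (E A) * cinner x (T b \<cdot> Q \<cdot> annihilate_word R \<cdot> y))"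
      unfolding A by (simp add: blinfun.sum_left cinner_sum_right scaleC_blinfun_apply cinner_scaleC_right)
    also have "\<dots> = (\<Sum>b\<in>B k. cinner b (E A) * cinner (cadjoint (T b) \<cdot> x) (Q \<cdot> annihilate_word R \<cdot> y))"
      by (intro sum.cong refl) (simp add: cinner_cadjoint_left Tc)
    also have "\<dots> = (\<Sum>b\<in>B k. \<Sum>b'\<in>B (n - k). (cinner b (E A) * cinner (E (rev R)) b') *
        cinner (cadjoint (T b) \<cdot> x) (Q \<cdot> cadjoint (T' b') \<cdot> y))"
      unfolding R using Q
      by (simp add: blinfun.sum_left blinfun.sum_right cinner_sum_right scaleC_blinfun_apply copsD cinner_scaleC_right
          sum_distrib_left mult.assoc)
    finally show ?thesis .
  qed
  have inner: "cinner x (?Z \<cdot> y) =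
      (\<Sum>b\<in>B k. \<Sum>b'\<in>B (n - k). \<eta> b b' *
        cinner (cadjoint (T b) \<cdot> x) (Q \<cdot> cadjoint (T' b') \<cdot> y))" for x y
  proof -
    define S where "S b b' = cinner (cadjoint (T b) \<cdot> x) (Q \<cdot> cadjoint (T' b') \<cdot> y)" for b b'
    have l: "linear (\<lambda>T. cinner x (T \<cdot> y))"
      by (intro bounded_linear.linear bounded_linear_compose[OF bounded_linear_cinner_right blinfun.bounded_linear_left])
    have "cinner x (?Z \<cdot> y) = (\<Sum>w\<in>F. c w * split_sum q w k
        (\<lambda>A R. cinner x ((create_word A o\<^sub>L Q o\<^sub>L annihilate_word R) \<cdot> y)))"
      by (simp add: blinfun.sum_left cinner_sum_right scaleC_blinfun_apply cinner_scaleC_right split_sum_linear[OF l]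
          del: blinfun_apply_blinfun_compose)
    also have "\<dots> = (\<Sum>w\<in>F. c w * split_sum q w k
        (\<lambda>A R. \<Sum>b\<in>B k. \<Sum>b'\<in>B (n - k). (cinner b (E A) * cinner (E (rev R)) b') * S b b'))"
      unfolding S_def
      by (intro sum.cong refl arg_cong2[where f = "(*)"] split_sum_cong elem) (use split in auto)
    also have "\<dots> = (\<Sum>w\<in>F. c w * (\<Sum>b\<in>B k. \<Sum>b'\<in>B (n - k). split_sum q w k
        (\<lambda>A R. cinner b (E A) * cinner (E (rev R)) b') * S b b'))"
      by (simp add: split_sum_sum split_sum_linear[OF bounded_linear.linear[OF bounded_linear_mult_left]])
    also have "\<dots> = (\<Sum>b\<in>B k. \<Sum>b'\<in>B (n - k). \<eta> b b' * S b b')"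
      unfolding \<eta>_def sum_distrib_left sum_distrib_right
      by (subst sum.swap, intro sum.cong refl, subst sum.swap) (simp add: mult.assoc)
    finally show ?thesis by (simp add: S_def)
  qed
  have \<eta>_le: "(\<Sum>(b, b')\<in>B k \<times> B (n - k). (cmod (\<eta> b b'))\<^sup>2) \<le> Cq * (norm \<xi>)\<^sup>2"
  proof -
    \<comment> \<open>For fixed \<open>b\<close> the entries are coefficients of one vector, to
      which Bessel applies; that vector is the mirror image of the adjoint of \<open>T b\<close>
      applied to \<open>\<xi>\<close>.\<close>
    have "(\<Sum>b'\<in>B (n - k). (cmod (\<eta> b b'))\<^sup>2) \<le> (norm (cadjoint (T b) \<cdot> \<xi>))\<^sup>2" if b: "b \<in> B k" for b
    proof -
      define \<phi> where "\<phi> = (\<Sum>w\<in>F. cnj (c w) *\<^sub>C split_sum q w k (\<lambda>A R. cnj (cinner b (E A)) *\<^sub>C E (rev R)))"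
      have l: "linear (\<lambda>x. cinner x y)" for y :: 'h
        by (rule bounded_linear.linear[OF bounded_bilinear.bounded_linear_left[OF bounded_bilinear_cinner]])
      have "cinner \<phi> b' = \<eta> b b'" for b'
        unfolding \<phi>_def \<eta>_def
        by (simp add: cinner_sum_left cinner_scaleC_left split_sum_linear[OF l])
      then have "cmod (\<eta> b b') = cmod (cinner b' \<phi>)" for b'
        using cinner_commute[of b' \<phi>] by simp
      then have "(\<Sum>b'\<in>B (n - k). (cmod (\<eta> b b'))\<^sup>2) \<le> (norm \<phi>)\<^sup>2"
        using bessel_inequality[OF B(1,2)] by simp
      also have "norm \<phi> = norm (\<Sum>w\<in>F. c w *\<^sub>C split_sum q w k (\<lambda>A R. cinner b (E A) *\<^sub>C E R))"
        unfolding \<phi>_def by (rule norm_mirror[OF F(2,3)])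
      also have "(\<Sum>w\<in>F. c w *\<^sub>C split_sum q w k (\<lambda>A R. cinner b (E A) *\<^sub>C E R)) = cadjoint (T b) \<cdot> \<xi>"
        using b B(4) F(2) cadjoint_cops[OF Tc(1)[OF b]]
        by (auto simp: \<xi>_def T_def blinfun.sum_right copsD create_adjoint_E subset_iff intro!: sum.cong)
      finally show ?thesis .
    qed
    then have "(\<Sum>(b, b')\<in>B k \<times> B (n - k). (cmod (\<eta> b b'))\<^sup>2) \<le> (\<Sum>b\<in>B k. (norm (cadjoint (T b) \<cdot> \<xi>))\<^sup>2)"
      by (simp add: sum.cartesian_product[symmetric] sum_mono)
    also have "\<dots> \<le> Cq * (norm \<xi>)\<^sup>2"
      unfolding T_def by (intro sum_norm_create_adjoint_le B)
    finally show ?thesis .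
  qed
  show ?thesis
    unfolding \<xi>_def[symmetric]
  proof (rule norm_blinfun_le_of_cinner)
    fix x y
    define X where "X b = norm (cadjoint (T b) \<cdot> x)" for b
    define Y where "Y b = norm (cadjoint (T' b) \<cdot> y)" for b
    have "cmod (cinner x (?Z \<cdot> y)) \<le> (\<Sum>b\<in>B k. \<Sum>b'\<in>B (n - k). cmod (\<eta> b b') * (norm Q * (X b * Y b')))"
      unfolding inner X_def Y_def
      by (intro sum_norm_le) (auto simp: norm_mult intro!: mult_left_mono cmod_cinner_blinfun_le)
    also have "\<dots> = norm Q * (\<Sum>(b, b')\<in>B k \<times> B (n - k). cmod (\<eta> b b') * (X b * Y b'))"
      by (simp add: sum.cartesian_product[symmetric] sum_distrib_left mult_ac)
    also have "(\<Sum>(b, b')\<in>B k \<times> B (n - k). cmod (\<eta> b b') * (X b * Y b')) \<le>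
        sqrt (Cq * (norm \<xi>)\<^sup>2) * sqrt ((Cq * (norm x)\<^sup>2) * (Cq * (norm y)\<^sup>2))"
    proof -
      have "(\<Sum>(b, b')\<in>B k \<times> B (n - k). (X b * Y b')\<^sup>2) = (\<Sum>b\<in>B k. (X b)\<^sup>2) * (\<Sum>b'\<in>B (n - k). (Y b')\<^sup>2)"
        by (simp add: sum.cartesian_product[symmetric] sum_product power_mult_distrib)
      also have "\<dots> \<le> (Cq * (norm x)\<^sup>2) * (Cq * (norm y)\<^sup>2)"
        unfolding X_def Y_def T_def T'_def using Cq_pos
        by (intro mult_mono sum_norm_create_adjoint_le B sum_nonneg) auto
      finally show ?thesis
        using L2_set_product_bound[of "\<lambda>(b, b'). cmod (\<eta> b b')" "B k \<times> B (n - k)" _ "\<lambda>(b, b'). X b * Y b'"] \<eta>_le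
        by (simp add: case_prod_beta)
    qed
    also have "norm Q * (sqrt (Cq * (norm \<xi>)\<^sup>2) * sqrt ((Cq * (norm x)\<^sup>2) * (Cq * (norm y)\<^sup>2))) =
        Cq * sqrt Cq * norm Q * norm \<xi> * (norm x * norm y)"
      using Cq_pos by (simp add: real_sqrt_mult)
    finally show "cmod (cinner x (?Z \<cdot> y)) \<le> Cq * sqrt Cq * norm Q * norm \<xi> * (norm x * norm y)"
      by (simp add: mult_left_mono)
  qed (use Cq_pos in simp)
qed

text \<open>\<open>Cq * sqrt Cq\<close> is the cost of one component, and 1 / (1 - q)^2 is the sum
  of (n + 1) q^n, for the n + 1 components in degree n.\<close>

definition haagerup_const :: real where
  "haagerup_const = Cq * sqrt Cq / (1 - q)\<^sup>2"

lemma haagerup_const_nonneg: "0 \<le> haagerup_const"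
  using Cq_pos by (simp add: haagerup_const_def)

text \<open>Words of different lengths are orthogonal, so passing to one degree is a
  contraction.\<close>

lemma norm_homogeneous_component_le:
  assumes "finite F" "F \<subseteq> words"
  shows "norm (\<Sum>w\<in>{w \<in> F. length w = n}. c w *\<^sub>C E w) \<le> norm (\<Sum>w\<in>F. c w *\<^sub>C E w)" (is "norm ?x \<le> norm ?y")
proof -
  have "cinner ?x (\<Sum>w\<in>{w \<in> F. length w \<noteq> n}. c w *\<^sub>C E w) = 0"
    unfolding cinner_sum_left cinner_sum_right
    using assms by (intro sum.neutral ballI) (auto simp: cinner_scaleC_left cinner_scaleC_right cinner_E_length subset_iff)
  moreover have "?y = ?x + (\<Sum>w\<in>{w \<in> F. length w \<noteq> n}. c w *\<^sub>C E w)"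
    by (subst sum.union_disjoint[symmetric]) (use assms in \<open>auto intro!: sum.cong\<close>)
  ultimately have "(norm ?y)\<^sup>2 = (norm ?x)\<^sup>2 + (norm (\<Sum>w\<in>{w \<in> F. length w \<noteq> n}. c w *\<^sub>C E w))\<^sup>2"
    by (simp add: norm_add_square)
  then have "(norm ?x)\<^sup>2 \<le> (norm ?y)\<^sup>2" by simp
  then show ?thesis by (simp add: power2_le_iff_abs_le)
qed

text \<open>Each degree n contributes n + 1 components, all bounded by the same constant; the factor
  q^n makes the sum over degrees converge independently of the longest word.\<close>

theorem haagerup_inequality:
  assumes F: "finite F" "F \<subseteq> words" "real_words F" and Q: "Q \<in> cops"
  shows "norm (\<Sum>w\<in>F. (c w * of_real (q ^ length w)) *\<^sub>C wick_with Q w) \<le>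
    haagerup_const * norm Q * norm (\<Sum>w\<in>F. c w *\<^sub>C E w)"
proof -
  define \<xi> where "\<xi> = (\<Sum>w\<in>F. c w *\<^sub>C E w)"
  define N where "N = Suc (Max (length ` F))"
  have N: "length w < N" if "w \<in> F" for w
    unfolding N_def less_Suc_eq_le using F that by (intro Max_ge) auto
  define Fn where "Fn n = {w \<in> F. length w = n}" for n
  define Z where "Z n k = (\<Sum>w\<in>Fn n. c w *\<^sub>C split_sum q w k (\<lambda>A R. create_word A o\<^sub>L Q o\<^sub>L annihilate_word R))" for n k
  have Z_le: "norm (Z n k) \<le> Cq * sqrt Cq * norm Q * norm \<xi>" if "k \<le> n" for n k
  proof -
    have "norm (Z n k) \<le> Cq * sqrt Cq * norm Q * norm (\<Sum>w\<in>Fn n. c w *\<^sub>C E w)"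
      unfolding Z_def
      by (rule norm_split_component_le[where n = n]) (use F Q that in \<open>auto simp: Fn_def real_words_def\<close>)
    also have "\<dots> \<le> Cq * sqrt Cq * norm Q * norm \<xi>"
      unfolding \<xi>_def Fn_def using Cq_pos F by (intro mult_left_mono norm_homogeneous_component_le) auto
    finally show ?thesis .
  qed
  have "(\<Sum>w\<in>F. (c w * of_real (q ^ length w)) *\<^sub>C wick_with Q w) =
      (\<Sum>n<N. \<Sum>w\<in>Fn n. (c w * of_real (q ^ length w)) *\<^sub>C wick_with Q w)"
    unfolding Fn_def using F N by (intro sum.group[symmetric]) auto
  also have "\<dots> = (\<Sum>n<N. q ^ n *\<^sub>R (\<Sum>k\<le>n. Z n k))"
  proof (intro sum.cong refl)
    fix n
    have "(\<Sum>w\<in>Fn n. (c w * of_real (q ^ length w)) *\<^sub>C wick_with Q w) =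
        (\<Sum>w\<in>Fn n. \<Sum>k\<le>n. q ^ n *\<^sub>R c w *\<^sub>C split_sum q w k (\<lambda>A R. create_word A o\<^sub>L Q o\<^sub>L annihilate_word R))"
    proof (intro sum.cong refl)
      fix w assume "w \<in> Fn n"
      then have n: "length w = n" by (simp add: Fn_def)
      have "(c w * of_real (q ^ length w)) *\<^sub>C X = q ^ n *\<^sub>R c w *\<^sub>C X" for X :: "'h \<Rightarrow>\<^sub>L 'h"
        using n by (simp add: scaleC_of_real[symmetric] scaleC_scaleC mult.commute del: of_real_power)
      then show "(c w * of_real (q ^ length w)) *\<^sub>C wick_with Q w =
        (\<Sum>k\<le>n. q ^ n *\<^sub>R c w *\<^sub>C split_sum q w k (\<lambda>A R. create_word A o\<^sub>L Q o\<^sub>L annihilate_word R))"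
        using n by (simp add: wick_with_def scaleC_sum_right scaleR_sum_right)
    qed
    then show "(\<Sum>w\<in>Fn n. (c w * of_real (q ^ length w)) *\<^sub>C wick_with Q w) = q ^ n *\<^sub>R (\<Sum>k\<le>n. Z n k)"
      unfolding Z_def by (subst (asm) sum.swap) (simp add: scaleR_sum_right)
  qed
  also have "norm \<dots> \<le> (\<Sum>n<N. q ^ n * (real (Suc n) * (Cq * sqrt Cq * norm Q * norm \<xi>)))"
  proof (intro sum_norm_le)
    fix n
    have "norm (\<Sum>k\<le>n. Z n k) \<le> (\<Sum>k\<le>n. Cq * sqrt Cq * norm Q * norm \<xi>)"
      by (intro sum_norm_le Z_le) simp
    then show "norm (q ^ n *\<^sub>R (\<Sum>k\<le>n. Z n k)) \<le> q ^ n * (real (Suc n) * (Cq * sqrt Cq * norm Q * norm \<xi>))"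
      using q_nonneg by (simp add: mult_left_mono)
  qed
  also have "\<dots> = (\<Sum>n<N. real (Suc n) * q ^ n) * (Cq * sqrt Cq * norm Q * norm \<xi>)"
    unfolding sum_distrib_right by (simp only: mult_ac)
  also have "(\<Sum>n<N. real (Suc n) * q ^ n) \<le> 1 / (1 - q)\<^sup>2"
  proof -
    have s: "(\<lambda>n. real (Suc n) * q ^ n) sums (1 / (1 - q)\<^sup>2)"
      using geometric_deriv_sums[of q] q_nonneg q_less_1 by simp
    show ?thesis
      unfolding sums_unique[OF s] using q_nonneg sums_summable[OF s] by (intro sum_le_suminf) auto
  qed
  also have "1 / (1 - q)\<^sup>2 * (Cq * sqrt Cq * norm Q * norm \<xi>) = haagerup_const * norm Q * norm \<xi>"
    by (simp add: haagerup_const_def)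
  finally show ?thesis using Cq_pos by (simp add: \<xi>_def mult_right_mono)
qed

end

section \<open>Algebras generated by the \<open>q\<close>-Brownian motion\<close>

lemma measurable_indicator_L2fun:
  assumes "A \<in> lmeasurable"
  shows "(indicator A :: real \<Rightarrow> complex) \<in> L2fun"
proof -
  have A: "A \<in> sets lebesgue" using assms by (rule fmeasurableD)
  then have m: "A \<inter> {0..} \<in> sets (lebesgue_on {0..})" by (auto simp: sets_restrict_space)
  have "(indicator A :: real \<Rightarrow> complex) \<in> borel_measurable (lebesgue_on {0..})"
    using A by (intro measurable_restrict_space1 borel_measurable_indicator)
  moreover have "integrable (lebesgue_on {0..}) (indicator (A \<inter> {0..}) :: real \<Rightarrow> real)"
  proof (rule integrable_real_indicator[OF m])
    have "emeasure (lebesgue_on {0..}) (A \<inter> {0..}) = emeasure lebesgue (A \<inter> {0..})"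
      by (rule emeasure_restrict_space) auto
    also have "\<dots> \<le> emeasure lebesgue A" by (rule emeasure_mono) (use A in auto)
    also have "\<dots> < \<infinity>" using fmeasurableD2[OF assms] by (simp add: less_top)
    finally show "emeasure (lebesgue_on {0..}) (A \<inter> {0..}) < \<infinity>" .
  qed
  then have "integrable (lebesgue_on {0..}) (\<lambda>x. (cmod (indicator A x))\<^sup>2)"
    by (rule Bochner_Integration.integrable_cong[THEN iffD1, rotated 2])
      (auto simp: indicator_def space_restrict_space)
  ultimately show ?thesis by (simp add: L2fun_def)
qed

lemma L2inner_indicator:
  assumes "A \<in> lmeasurable" "B \<in> lmeasurable" "A \<subseteq> {0..}"
  shows "L2inner (indicator A) (indicator B) = of_real (measure lebesgue (A \<inter> B))"
proof -
  have AB: "A \<inter> B \<in> sets lebesgue" using assms by (auto dest: fmeasurableD)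
  have "L2inner (indicator A) (indicator B) = (LINT x|lebesgue_on {0..}. complex_of_real (indicator (A \<inter> B) x))"
    unfolding L2inner_def by (intro Bochner_Integration.integral_cong) (auto simp: indicator_def)
  also have "\<dots> = of_real (LINT x|lebesgue_on {0..}. indicator (A \<inter> B) x)"
    by (rule integral_complex_of_real)
  also have "(LINT x|lebesgue_on {0..}. indicator (A \<inter> B) x) = measure (lebesgue_on {0..}) (A \<inter> B \<inter> space (lebesgue_on {0..}))"
    by (rule Bochner_Integration.integral_indicator)
  also have "A \<inter> B \<inter> space (lebesgue_on {0..}) = A \<inter> B" using assms(3) by (auto simp: space_restrict_space)
  also have "measure (lebesgue_on {0..}) (A \<inter> B) = measure lebesgue (A \<inter> B)"
    using assms(3) AB by (intro measure_restrict_space) auto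
  finally show ?thesis .
qed

abbreviation ind :: "real set \<Rightarrow> real \<Rightarrow> complex" where "ind \<equiv> indicator"

text \<open>The fields of these functions are the generators \<open>qbm E r\<close> themselves, so
  Wick products of words in such letters lie in the algebra of the past; their inner products are
  real, as the mirror argument requires.\<close>

definition letters :: "real \<Rightarrow> (real \<Rightarrow> complex) set" where
  "letters s = (\<lambda>r. ind {0..r}) ` {0..s}"

definition time_words :: "real \<Rightarrow> (real \<Rightarrow> complex) list set" where
  "time_words s = {w. set w \<subseteq> letters s}"

lemma ind_L2fun [simp]: "ind {a..b} \<in> L2fun" "ind {a<..b} \<in> L2fun"
  by (auto intro!: measurable_indicator_L2fun bounded_set_imp_lmeasurable)

lemma letters_L2fun: "f \<in> letters s \<Longrightarrow> f \<in> L2fun"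
  by (auto simp: letters_def)

lemma time_words_words: "time_words s \<subseteq> words"
  using letters_L2fun by (auto simp: time_words_def words_def)

lemma letters_mono: "s \<le> t \<Longrightarrow> letters s \<subseteq> letters t"
  by (auto simp: letters_def)

lemma time_words_mono: "s \<le> t \<Longrightarrow> time_words s \<subseteq> time_words t"
  using letters_mono by (auto simp: time_words_def)

lemma time_words_simps [simp]: "[] \<in> time_words s" "f # w \<in> time_words s \<longleftrightarrow> f \<in> letters s \<and> w \<in> time_words s"
  by (auto simp: time_words_def)

lemma time_words_mset: "mset v = mset w \<Longrightarrow> v \<in> time_words s \<longleftrightarrow> w \<in> time_words s"
  using mset_eq_setD[of v w] by (simp add: time_words_def)

lemma L2inner_ind:
  "0 \<le> a \<Longrightarrow> L2inner (ind {a<..b}) (ind {c<..d}) = of_real (measure lebesgue ({a<..b} \<inter> {c<..d}))"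
  "0 \<le> a \<Longrightarrow> L2inner (ind {a<..b}) (ind {0..d}) = of_real (measure lebesgue ({a<..b} \<inter> {0..d}))"
  "L2inner (ind {0..b}) (ind {0..d}) = of_real (measure lebesgue ({0..b} \<inter> {0..d}))"
proof -
  have m: "{a..b} \<in> lmeasurable" "{a<..b} \<in> lmeasurable" for a b :: real
    by (auto intro!: bounded_set_imp_lmeasurable)
  show "0 \<le> a \<Longrightarrow> L2inner (ind {a<..b}) (ind {c<..d}) = of_real (measure lebesgue ({a<..b} \<inter> {c<..d}))"
    "0 \<le> a \<Longrightarrow> L2inner (ind {a<..b}) (ind {0..d}) = of_real (measure lebesgue ({a<..b} \<inter> {0..d}))"
    "L2inner (ind {0..b}) (ind {0..d}) = of_real (measure lebesgue ({0..b} \<inter> {0..d}))"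
    by (rule L2inner_indicator[OF m(2) m(2)] L2inner_indicator[OF m(2) m(1)] L2inner_indicator[OF m(1) m(1)]; auto)+
qed

lemma L2inner_ind_self: "0 \<le> a \<Longrightarrow> a \<le> b \<Longrightarrow> L2inner (ind {a<..b}) (ind {a<..b}) = of_real (b - a)"
  by (simp add: L2inner_ind)

lemma L2inner_ind_disjoint: "0 \<le> a \<Longrightarrow> {a<..b} \<inter> {c<..d} = {} \<Longrightarrow> L2inner (ind {a<..b}) (ind {c<..d}) = 0"
  by (simp only: L2inner_ind measure_empty of_real_0)

lemma L2inner_ind_letters: "0 \<le> s \<Longrightarrow> s \<le> a \<Longrightarrow> f \<in> letters s \<Longrightarrow> L2inner (ind {a<..b}) f = 0"
proof -
  assume *: "0 \<le> s" "s \<le> a" "f \<in> letters s"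
  then obtain r where r: "f = ind {0..r}" "r \<le> s" by (auto simp: letters_def)
  then have "{a<..b} \<inter> {0..r} = {}" using * by auto
  then show ?thesis using * r by (simp only: L2inner_ind measure_empty of_real_0)
qed

lemma L2inner_letters_real: "f \<in> letters s \<Longrightarrow> g \<in> letters s \<Longrightarrow> cnj (L2inner f g) = L2inner f g"
  by (auto simp: letters_def L2inner_ind)

section \<open>Commutants and von Neumann algebras\<close>

lemma blinfun_compose_eq_iff: "S o\<^sub>L T = T' o\<^sub>L S' \<longleftrightarrow> (\<forall>x. S \<cdot> T \<cdot> x = T' \<cdot> S' \<cdot> x)"
  by (auto intro: blinfun_eqI dest!: arg_cong[where f = blinfun_apply] simp: fun_eq_iff)

lemma commutant_iff:
  "T \<in> commutant M \<longleftrightarrow> T \<in> cops \<and> (\<forall>S\<in>M. \<forall>x. S \<cdot> T \<cdot> x = T \<cdot> S \<cdot> x)"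
  by (simp add: commutant_def blinfun_compose_eq_iff)

lemma commutant_cops: "commutant M \<subseteq> cops"
  by (auto simp: commutant_def)

lemma commutant_antimono: "M \<subseteq> N \<Longrightarrow> commutant N \<subseteq> commutant M"
  by (auto simp: commutant_def)

lemma subset_bicommutant: "M \<subseteq> cops \<Longrightarrow> M \<subseteq> commutant (commutant M)"
  by (auto simp: commutant_def)

lemma commutant_bicommutant: "M \<subseteq> cops \<Longrightarrow> commutant (commutant (commutant M)) = commutant M"
  using subset_bicommutant[OF commutant_cops, of M] commutant_antimono[OF subset_bicommutant[of M]] by blast

lemma csubspace_commutant:
  assumes "M \<subseteq> cops" shows "csubspace (commutant M)"
  unfolding csubspace_def
proof (intro conjI ballI allI)
  show "0 \<in> commutant M" by (simp add: commutant_iff)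
  show "S + T \<in> commutant M" if "S \<in> commutant M" "T \<in> commutant M" for S T
    using that by (simp add: commutant_iff cops_add blinfun.add_left blinfun.add_right)
  show "c *\<^sub>C T \<in> commutant M" if "T \<in> commutant M" for c T
    using that assms by (auto simp: commutant_iff cops_scaleC scaleC_blinfun_apply copsD subset_iff)
qed

lemma unital_subalgebra_commutant:
  assumes "M \<subseteq> cops" shows "unital_subalgebra (commutant M)"
  unfolding unital_subalgebra_def
  using csubspace_commutant[OF assms] by (auto simp: commutant_iff cops_compose)

lemma closed_commutant: "closed (commutant (M :: ('h::complex_hilbert \<Rightarrow>\<^sub>L 'h) set))"
proof -
  have "commutant M = cops \<inter> (\<Inter>S\<in>M. {T. S o\<^sub>L T = T o\<^sub>L S})" by (auto simp: commutant_def)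
  moreover have "closed {T. S o\<^sub>L T = T o\<^sub>L S}" for S :: "'h \<Rightarrow>\<^sub>L 'h"
    by (intro closed_Collect_eq continuous_intros)
  ultimately show ?thesis using closed_cops by (metis (no_types, lifting) closed_INT closed_Int)
qed

lemma commutant_adjoint:
  assumes M: "M \<subseteq> cops" "\<And>S. S \<in> M \<Longrightarrow> cadjoint S \<in> M" and T: "T \<in> commutant M"
  shows "cadjoint T \<in> commutant M"
proof -
  have Tc: "T \<in> cops" using T by (simp add: commutant_def)
  have "S o\<^sub>L cadjoint T = cadjoint T o\<^sub>L S" if "S \<in> M" for S
  proof -
    have "cadjoint S o\<^sub>L T = T o\<^sub>L cadjoint S" using T M(2)[OF that] by (simp add: commutant_def)
    then have "cadjoint (cadjoint S o\<^sub>L T) = cadjoint (T o\<^sub>L cadjoint S)" by simp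
    then show ?thesis using that M Tc by (simp add: cadjoint_compose cadjoint_cops subset_iff)
  qed
  then show ?thesis using Tc by (simp add: commutant_def cadjoint_cops)
qed

lemma von_neumann_algebra_bicommutant:
  assumes "S \<subseteq> cops" "\<And>T. T \<in> S \<Longrightarrow> cadjoint T \<in> S"
  shows "von_neumann_algebra (commutant (commutant S))"
  unfolding von_neumann_algebra_def
  using commutant_bicommutant[OF commutant_cops, of S]
    commutant_adjoint[OF commutant_cops commutant_adjoint[OF assms], of _]
  by (auto simp: commutant_bicommutant[OF assms(1)])

lemma von_neumann_algebra_cops: "von_neumann_algebra M \<Longrightarrow> M \<subseteq> cops"
  unfolding von_neumann_algebra_def using commutant_cops by blast

lemma von_neumann_algebra_Inter:
  assumes "T \<noteq> {}" "\<And>M. M \<in> T \<Longrightarrow> von_neumann_algebra M"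
  shows "von_neumann_algebra (\<Inter>T)"
proof -
  have sub: "\<Inter>T \<subseteq> cops" using assms von_neumann_algebra_cops by blast
  have "commutant (commutant (\<Inter>T)) \<subseteq> M" if "M \<in> T" for M
  proof -
    have "commutant (commutant (\<Inter>T)) \<subseteq> commutant (commutant M)"
      using that by (intro commutant_antimono) auto
    then show ?thesis using assms(2)[OF that] by (simp add: von_neumann_algebra_def)
  qed
  then have "commutant (commutant (\<Inter>T)) = \<Inter>T" using subset_bicommutant[OF sub] by blast
  moreover have "\<forall>X\<in>\<Inter>T. cadjoint X \<in> \<Inter>T" using assms(2) by (auto simp: von_neumann_algebra_def)
  ultimately show ?thesis by (simp add: von_neumann_algebra_def)
qed

text \<open>The hull is an intersection, and the bicommutant of the selfadjoint generators supplies
  a member, so the intersection is not over the empty family.\<close>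

lemma von_neumann_algebra_hull:
  assumes "S \<subseteq> cops" "\<And>T. T \<in> S \<Longrightarrow> cadjoint T = T"
  shows "von_neumann_algebra (von_neumann_algebra hull S)"
    and "von_neumann_algebra hull S \<subseteq> commutant (commutant S)"
proof -
  have v: "von_neumann_algebra (commutant (commutant S))"
    using assms by (intro von_neumann_algebra_bicommutant) auto
  then show "von_neumann_algebra hull S \<subseteq> commutant (commutant S)"
    using subset_bicommutant[OF assms(1)] by (intro hull_minimal)
  show "von_neumann_algebra (von_neumann_algebra hull S)"
    unfolding hull_def
    by (rule von_neumann_algebra_Inter) (use v subset_bicommutant[OF assms(1)] in auto)
qed

lemma von_neumann_algebra_props:
  assumes "von_neumann_algebra M"
  shows "csubspace M" "unital_subalgebra M" "closed M" "T \<in> M \<Longrightarrow> cadjoint T \<in> M"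
proof -
  have M: "M = commutant (commutant M)" using assms by (simp add: von_neumann_algebra_def)
  show "csubspace M" by (subst M) (rule csubspace_commutant[OF commutant_cops])
  show "unital_subalgebra M" by (subst M) (rule unital_subalgebra_commutant[OF commutant_cops])
  show "closed M" by (subst M) (rule closed_commutant)
  show "T \<in> M \<Longrightarrow> cadjoint T \<in> M" using assms by (simp add: von_neumann_algebra_def)
qed

lemma unital_subalgebra_hull: "unital_subalgebra (unital_subalgebra hull S)"
  by (rule hull_in) (auto simp: unital_subalgebra_def csubspace_def)

lemma unital_subalgebra_closure:
  assumes "unital_subalgebra M" shows "unital_subalgebra (closure M)"
  unfolding unital_subalgebra_def
proof (intro conjI ballI)
  show "csubspace (closure M)" using assms by (intro csubspace_closure) (simp add: unital_subalgebra_def)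
  show "id_blinfun \<in> closure M" using assms closure_subset by (auto simp: unital_subalgebra_def)
  fix S T assume "S \<in> closure M" "T \<in> closure M"
  then obtain f g where f: "\<forall>n::nat. f n \<in> M" "f \<longlonglongrightarrow> S" "\<forall>n. g n \<in> M" "g \<longlonglongrightarrow> T"
    unfolding closure_sequential by blast
  then have "(\<lambda>n. f n o\<^sub>L g n) \<longlonglongrightarrow> (S o\<^sub>L T)"
    by (intro bounded_bilinear.tendsto[OF bounded_bilinear_blinfun_compose])
  moreover have "\<forall>n. f n o\<^sub>L g n \<in> M" using f assms by (auto simp: unital_subalgebra_def)
  ultimately show "S o\<^sub>L T \<in> closure M" unfolding closure_sequential
    by (intro exI[of _ "\<lambda>n. f n o\<^sub>L g n"]) auto
qed

lemma tendsto_cadjoint: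
  assumes "(f \<longlongrightarrow> T) F" "\<And>n. f n \<in> cops" "T \<in> cops"
  shows "((\<lambda>n. cadjoint (f n)) \<longlongrightarrow> cadjoint T) F"
proof (rule metric_tendsto_imp_tendsto[OF assms(1)])
  have "dist (cadjoint (f n)) (cadjoint T) = dist (f n) T" for n
    using assms by (simp add: dist_norm cadjoint_diff[symmetric] norm_cadjoint cops_diff)
  then show "\<forall>\<^sub>F n in F. dist (cadjoint (f n)) (cadjoint T) \<le> dist (f n) T" by simp
qed

text \<open>A selfadjoint operator that preserves \<open>M\<close> also preserves the orthogonal
  complement, hence commutes with the projection. This places the projection in a commutant.\<close>

lemma projection_operator_exists:
  fixes M :: "'h::complex_hilbert set"
  assumes M: "csubspace M" "closed M"
  obtains P where "P \<in> cops" "\<And>x. P \<cdot> x \<in> M" "\<And>x. x \<in> M \<Longrightarrow> P \<cdot> x = x"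
    "\<And>T. T \<in> cops \<Longrightarrow> cadjoint T = T \<Longrightarrow> (\<And>x. x \<in> M \<Longrightarrow> T \<cdot> x \<in> M) \<Longrightarrow> T o\<^sub>L P = P o\<^sub>L T"
proof -
  have "\<exists>m. m \<in> M \<and> (\<forall>z\<in>M. cinner z (x - m) = 0)" for x
  proof -
    obtain m where "m \<in> M" "\<And>z. z \<in> M \<Longrightarrow> cinner z (x - m) = 0"
      by (rule orthogonal_projection_exists[OF M, of x]) blast
    then show ?thesis by blast
  qed
  then have "\<exists>p. \<forall>x. p x \<in> M \<and> (\<forall>z\<in>M. cinner z (x - p x) = 0)" by (intro choice allI)
  then obtain p where p: "\<And>x. p x \<in> M" "\<And>x z. z \<in> M \<Longrightarrow> cinner z (x - p x) = 0" by blast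
  have uniq: "p x = m" if "m \<in> M" "\<And>z. z \<in> M \<Longrightarrow> cinner z (x - m) = 0" for x m
  proof -
    have "cinner (p x - m) ((x - m) - (x - p x)) = 0"
      using that p csubspace_diff[OF M(1) p(1) that(1)] by (subst cinner_diff_right) simp
    then show ?thesis by (simp add: cinner_self)
  qed
  have add: "p (x + y) = p x + p y" for x y
  proof (rule uniq)
    fix z assume "z \<in> M"
    then show "cinner z (x + y - (p x + p y)) = 0"
      using p(2)[of z x] p(2)[of z y] by (simp add: cinner_diff_right cinner_add_right)
  qed (intro csubspace_add M p)
  have scale: "p (c *\<^sub>C x) = c *\<^sub>C p x" for c x
  proof (rule uniq)
    fix z assume "z \<in> M"
    then show "cinner z (c *\<^sub>C x - c *\<^sub>C p x) = 0"
      using p(2)[of z x] by (simp add: cinner_scaleC_right scaleC_diff_right[symmetric])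
  qed (intro csubspace_scale M p)
  have "norm (p x) \<le> norm x" for x
  proof -
    have "(norm (p x + (x - p x)))\<^sup>2 = (norm (p x))\<^sup>2 + (norm (x - p x))\<^sup>2"
      unfolding norm_add_square p(2)[OF p(1)] by simp
    then have "(norm (p x))\<^sup>2 \<le> (norm x)\<^sup>2" by simp
    then show ?thesis by (simp add: power2_le_iff_abs_le)
  qed
  then have bl: "bounded_linear p"
    using scale[of "of_real _"] add by (intro bounded_linear_intro[of _ 1]) (auto simp: scaleC_of_real)
  have P: "Blinfun p \<cdot> x = p x" for x by (simp add: bounded_linear_Blinfun_apply[OF bl])
  show thesis
  proof (rule that[of "Blinfun p"])
    show "Blinfun p \<in> cops" by (rule copsI) (simp add: P scale)
    show "Blinfun p \<cdot> x \<in> M" for x by (simp add: P p)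
    show "Blinfun p \<cdot> x = x" if "x \<in> M" for x unfolding P by (rule uniq) (use that in auto)
    fix T :: "'h \<Rightarrow>\<^sub>L 'h" assume T: "T \<in> cops" "cadjoint T = T" "\<And>x. x \<in> M \<Longrightarrow> T \<cdot> x \<in> M"
    have "p (T \<cdot> x) = T \<cdot> p x" for x
    proof (rule uniq)
      show "T \<cdot> p x \<in> M" by (intro T p)
      fix z assume z: "z \<in> M"
      have "cinner z (T \<cdot> (x - p x)) = cinner (T \<cdot> z) (x - p x)"
        using cinner_cadjoint_left[OF T(1), of z "x - p x"] T(2) by simp
      also have "\<dots> = 0" by (intro p T z)
      finally show "cinner z (T \<cdot> x - T \<cdot> p x) = 0" by (simp add: blinfun.diff_right)
    qed
    then show "T o\<^sub>L Blinfun p = Blinfun p o\<^sub>L T" by (simp add: blinfun_compose_eq_iff P)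
  qed
qed

section \<open>The algebras of the past and the vectors they generate\<close>

context q_fock begin

definition field :: "(real \<Rightarrow> complex) \<Rightarrow> 'h \<Rightarrow>\<^sub>L 'h" where
  "field f = annihilation E f + creation E f"

lemma field_cops [simp]: "f \<in> L2fun \<Longrightarrow> field f \<in> cops"
  by (simp add: field_def cops_add)

lemma cadjoint_field: "f \<in> L2fun \<Longrightarrow> cadjoint (field f) = field f"
  by (simp add: field_def cadjoint_add cadjoint_creation cadjoint_annihilation add.commute)

lemma field_apply: "field f \<cdot> x = annihilation E f \<cdot> x + creation E f \<cdot> x"
  by (simp add: field_def blinfun.add_left)

lemma qbm_field: "qbm E t = field (ind {0..t})"
  by (simp add: qbm_def field_def)

lemma qbm_cops [simp]: "qbm E t \<in> cops"
  by (simp add: qbm_field)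

lemma cadjoint_qbm: "cadjoint (qbm E t) = qbm E t"
  by (simp add: qbm_field cadjoint_field)

lemma creation_ind_diff:
  assumes "0 \<le> a" "a \<le> b"
  shows "creation E (ind {a<..b}) = creation E (ind {0..b}) - creation E (ind {0..a})"
proof -
  have eq: "ind {0..b} = (\<lambda>x. ind {a<..b} x + ind {0..a} x)"
    using assms by (auto simp: fun_eq_iff indicator_def)
  have "creation E (ind {0..b}) = creation E (ind {a<..b}) + creation E (ind {0..a})"
    unfolding eq by (rule creation_add) auto
  then show ?thesis by simp
qed

lemma qbm_increment:
  assumes "0 \<le> a" "a \<le> b"
  shows "qbm E b - qbm E a = field (ind {a<..b})"
  using creation_ind_diff[OF assms]
  by (simp add: qbm_field field_def annihilation_def cadjoint_diff)

abbreviation poly_alg :: "real \<Rightarrow> ('h \<Rightarrow>\<^sub>L 'h) set" where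
  "poly_alg s \<equiv> unital_subalgebra hull (qbm E ` {0..s})"

text \<open>\<open>wick_Cons\<close> is solved for the longest Wick product; the contracted terms
  are shorter by two letters, whence the strong induction.\<close>

lemma poly_alg_wick:
  assumes "w \<in> time_words s"
  shows "wick w \<in> poly_alg s"
  using assms
proof (induction "length w" arbitrary: w rule: less_induct)
  case less
  have sub: "csubspace (poly_alg s)" using unital_subalgebra_hull by (auto simp: unital_subalgebra_def)
  show ?case
  proof (cases w)
    case Nil
    then show ?thesis using unital_subalgebra_hull[of "qbm E ` {0..s}"] by (simp add: wick_def unital_subalgebra_def)
  next
    case (Cons f v)
    then have fv: "f \<in> letters s" "v \<in> time_words s" using less.prems by auto
    then obtain r where r: "f = ind {0..r}" "0 \<le> r" "r \<le> s" by (auto simp: letters_def)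
    have v: "v \<in> words" using fv time_words_words by auto
    have rem: "rem_sum q v (\<lambda>g r. L2inner f g *\<^sub>C wick r) \<in> poly_alg s"
    proof (rule rem_sum_in[OF sub])
      fix y r assume m: "mset (y # r) = mset v"
      have "length r < length w" using m Cons by (metis length_Cons less_Suc_eq mset_eq_length)
      moreover have "r \<in> time_words s" using time_words_mset[OF m, of s] fv by simp
      ultimately show "L2inner f y *\<^sub>C wick r \<in> poly_alg s"
        using less.hyps csubspace_scale[OF sub] by blast
    qed
    have "qbm E r \<in> poly_alg s" using r by (intro hull_inc) auto
    moreover have "wick v \<in> poly_alg s" using less.hyps fv Cons by simp
    ultimately have "qbm E r o\<^sub>L wick v \<in> poly_alg s"
      using unital_subalgebra_hull[of "qbm E ` {0..s}"] by (simp add: unital_subalgebra_def)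
    moreover have "wick w = (qbm E r o\<^sub>L wick v) - rem_sum q v (\<lambda>g r. L2inner f g *\<^sub>C wick r)"
      using wick_Cons[of f v] r v Cons by (simp add: qbm_field field_def)
    ultimately show ?thesis using rem csubspace_diff[OF sub] by simp
  qed
qed

text \<open>The operators whose left multiplication preserves the span form a unital algebra, and it
  contains the generators by \<open>wick_Cons\<close>. Applying such a multiplier to the identity,
  which is \<open>wick []\<close>, puts it into the span.\<close>

lemma poly_alg_subset_wick_span: "poly_alg s \<subseteq> csubspace hull (wick ` time_words s)"
proof -
  let ?W = "csubspace hull (wick ` time_words s)"
  define M where "M = {V \<in> cops. \<forall>T\<in>?W. V o\<^sub>L T \<in> ?W}"
  have "unital_subalgebra M"
    unfolding unital_subalgebra_def csubspace_def
  proof (intro conjI ballI allI)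
    show "0 \<in> M" by (simp add: M_def csubspace_0[OF csubspace_hull] bounded_bilinear.zero_left[OF bounded_bilinear_blinfun_compose])
    show "id_blinfun \<in> M" by (simp add: M_def)
    show "x + y \<in> M" if "x \<in> M" "y \<in> M" for x y
      using that by (simp add: M_def cops_add bounded_bilinear.add_left[OF bounded_bilinear_blinfun_compose]
          csubspace_add[OF csubspace_hull])
    show "c *\<^sub>C x \<in> M" if "x \<in> M" for c x
    proof -
      have "(c *\<^sub>C x) o\<^sub>L T = c *\<^sub>C (x o\<^sub>L T)" for T :: "'h \<Rightarrow>\<^sub>L 'h"
        by (rule blinfun_eqI) (simp add: scaleC_blinfun_apply)
      then show ?thesis using that by (simp add: M_def cops_scaleC csubspace_scale[OF csubspace_hull])
    qed
    show "x o\<^sub>L y \<in> M" if "x \<in> M" "y \<in> M" for x y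
    proof -
      have "(x o\<^sub>L y) o\<^sub>L T = x o\<^sub>L (y o\<^sub>L T)" for T :: "'h \<Rightarrow>\<^sub>L 'h" by (rule blinfun_eqI) simp
      then show ?thesis using that by (simp add: M_def cops_compose)
    qed
  qed
  moreover have "qbm E ` {0..s} \<subseteq> M"
  proof
    fix X assume "X \<in> qbm E ` {0..s}"
    then obtain r where r: "X = qbm E r" "0 \<le> r" "r \<le> s" by auto
    have fl: "ind {0..r} \<in> letters s" using r by (auto simp: letters_def)
    have "X o\<^sub>L T \<in> ?W" if "T \<in> ?W" for T
      using that
    proof (induction rule: csubspace_hull_induct)
      case (base T)
      then obtain w where w: "w \<in> time_words s" "T = wick w" by auto
      have ww: "w \<in> words" using w time_words_words by auto
      have "wick (ind {0..r} # w) \<in> ?W" using fl w by (intro hull_inc imageI) simp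
      moreover have "rem_sum q w (\<lambda>g r'. L2inner (ind {0..r}) g *\<^sub>C wick r') \<in> ?W"
      proof (rule rem_sum_in[OF csubspace_hull])
        fix y v assume m: "mset (y # v) = mset w"
        have "v \<in> time_words s" using time_words_mset[OF m, of s] w by simp
        then show "L2inner (ind {0..r}) y *\<^sub>C wick v \<in> ?W"
          by (intro csubspace_scale csubspace_hull hull_inc imageI)
      qed
      ultimately show ?case
        using wick_Cons[of "ind {0..r}" w] ww w r
        by (simp add: qbm_field field_def csubspace_add[OF csubspace_hull])
    next
      case zero
      then show ?case by (simp add: csubspace_0[OF csubspace_hull] bounded_bilinear.zero_right[OF bounded_bilinear_blinfun_compose])
    next
      case (add x y)
      then show ?case by (simp add: bounded_bilinear.add_right[OF bounded_bilinear_blinfun_compose] csubspace_add[OF csubspace_hull])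
    next
      case (scale c x)
      have "X o\<^sub>L (c *\<^sub>C x) = c *\<^sub>C (X o\<^sub>L x)" 
        using r by (intro blinfun_eqI) (simp add: scaleC_blinfun_apply copsD)
      then show ?case using scale by (simp add: csubspace_scale[OF csubspace_hull])
    qed
    then show "X \<in> M" using r by (simp add: M_def)
  qed
  ultimately have "poly_alg s \<subseteq> M" by (intro hull_minimal)
  moreover have "id_blinfun \<in> ?W"
  proof -
    have "wick [] \<in> ?W" by (intro hull_inc imageI) simp
    then show ?thesis by (simp add: wick_def)
  qed
  ultimately show ?thesis by (force simp: M_def)
qed

lemma norm_alg_upto_unital: "unital_subalgebra (norm_alg_upto E s)"
  unfolding norm_alg_upto_def by (intro unital_subalgebra_closure unital_subalgebra_hull)

lemma norm_alg_upto_csubspace: "csubspace (norm_alg_upto E s)"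
  and norm_alg_upto_id: "id_blinfun \<in> norm_alg_upto E s"
  and norm_alg_upto_compose: "S \<in> norm_alg_upto E s \<Longrightarrow> T \<in> norm_alg_upto E s \<Longrightarrow> S o\<^sub>L T \<in> norm_alg_upto E s"
  using norm_alg_upto_unital by (auto simp: unital_subalgebra_def)

lemma norm_alg_upto_closed: "closed (norm_alg_upto E s)"
  by (simp add: norm_alg_upto_def)

lemma norm_alg_upto_poly: "poly_alg s \<subseteq> norm_alg_upto E s"
  unfolding norm_alg_upto_def by (rule closure_subset)

lemma norm_alg_upto_qbm: "0 \<le> r \<Longrightarrow> r \<le> s \<Longrightarrow> qbm E r \<in> norm_alg_upto E s"
  by (rule subsetD[OF norm_alg_upto_poly], rule hull_inc) auto

lemma norm_alg_upto_mono: "s \<le> t \<Longrightarrow> norm_alg_upto E s \<subseteq> norm_alg_upto E t"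
  unfolding norm_alg_upto_def by (intro closure_mono hull_mono) auto

lemma qbm_image_cops: "qbm E ` S \<subseteq> cops" "\<And>T. T \<in> qbm E ` S \<Longrightarrow> cadjoint T = T"
  by (auto simp: cadjoint_qbm)

lemma vn_alg_upto_vn: "von_neumann_algebra (vn_alg_upto E s)"
  unfolding vn_alg_upto_def by (intro von_neumann_algebra_hull qbm_image_cops)

lemma vn_alg_vn: "von_neumann_algebra (vn_alg E)"
  unfolding vn_alg_def by (intro von_neumann_algebra_hull qbm_image_cops)

lemma vn_alg_upto_subset: "vn_alg_upto E s \<subseteq> vn_alg E"
  unfolding vn_alg_upto_def vn_alg_def by (intro hull_mono) auto

lemma norm_alg_upto_vn: "norm_alg_upto E s \<subseteq> vn_alg_upto E s"
  unfolding norm_alg_upto_def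
proof (intro closure_minimal hull_minimal)
  show "qbm E ` {0..s} \<subseteq> vn_alg_upto E s" unfolding vn_alg_upto_def by (rule hull_subset)
qed (use von_neumann_algebra_props[OF vn_alg_upto_vn] in auto)

lemma vn_alg_cops: "vn_alg E \<subseteq> cops"
  by (rule von_neumann_algebra_cops[OF vn_alg_vn])

lemma norm_alg_upto_cops: "norm_alg_upto E s \<subseteq> cops"
  using norm_alg_upto_vn vn_alg_upto_subset vn_alg_cops by blast

lemma norm_alg_upto_adjoint:
  assumes "T \<in> norm_alg_upto E s"
  shows "cadjoint T \<in> norm_alg_upto E s"
proof -
  have "unital_subalgebra {T \<in> cops. cadjoint T \<in> poly_alg s}"
    using unital_subalgebra_hull[of "qbm E ` {0..s}"]
    by (auto simp: unital_subalgebra_def csubspace_def cops_add cops_scaleC cops_compose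
        cadjoint_add cadjoint_scaleC cadjoint_compose)
  then have "poly_alg s \<subseteq> {T \<in> cops. cadjoint T \<in> poly_alg s}"
    by (rule hull_minimal[rotated]) (auto simp: cadjoint_qbm intro: hull_inc)
  note p = this
  obtain f where f: "\<forall>n::nat. f n \<in> poly_alg s" "f \<longlonglongrightarrow> T"
    using assms unfolding norm_alg_upto_def closure_sequential by blast
  have "(\<lambda>n. cadjoint (f n)) \<longlonglongrightarrow> cadjoint T"
    using f p norm_alg_upto_cops assms by (intro tendsto_cadjoint) auto
  moreover have "\<forall>n. cadjoint (f n) \<in> poly_alg s" using f p by auto
  ultimately show ?thesis unfolding norm_alg_upto_def closure_sequential
    by (intro exI[of _ "\<lambda>n. cadjoint (f n)"]) auto
qed

definition fock_upto :: "real \<Rightarrow> 'h set" where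
  "fock_upto s = closure (csubspace hull (E ` time_words s))"

lemma fock_upto_csubspace: "csubspace (fock_upto s)"
  unfolding fock_upto_def by (intro csubspace_closure csubspace_hull)

lemma fock_upto_closed: "closed (fock_upto s)"
  by (simp add: fock_upto_def)

lemma fock_upto_E: "w \<in> time_words s \<Longrightarrow> E w \<in> fock_upto s"
  unfolding fock_upto_def using closure_subset hull_inc by (metis imageI subsetD)

lemma fock_upto_vacuum: "E [] \<in> fock_upto s"
  by (rule fock_upto_E) simp

lemma fock_upto_induct:
  assumes "csubspace M" "closed M" "\<And>w. w \<in> time_words s \<Longrightarrow> E w \<in> M" "x \<in> fock_upto s"
  shows "x \<in> M"
proof -
  have "csubspace hull (E ` time_words s) \<subseteq> M" by (rule hull_minimal) (use assms in auto)
  then have "fock_upto s \<subseteq> M" unfolding fock_upto_def using assms(2) by (rule closure_minimal)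
  then show ?thesis using assms by auto
qed

lemma preimage_closed_csubspace:
  assumes "T \<in> cops" "csubspace M" "closed M"
  shows "csubspace {x. T \<cdot> x \<in> M}" "closed {x. T \<cdot> x \<in> M}"
proof -
  show "csubspace {x. T \<cdot> x \<in> M}"
    using assms by (auto simp: csubspace_def blinfun.add_right copsD)
  have "{x. T \<cdot> x \<in> M} = blinfun_apply T -` M" by auto
  moreover have "closed (blinfun_apply T -` M)"
    by (rule continuous_closed_vimage[OF assms(3)]) (intro continuous_intros)
  ultimately show "closed {x. T \<cdot> x \<in> M}" by simp
qed

lemma fock_upto_creation:
  assumes f: "f \<in> letters s" and x: "x \<in> fock_upto s"
  shows "creation E f \<cdot> x \<in> fock_upto s"
proof -
  have fL: "f \<in> L2fun" using letters_L2fun f by blast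
  have "x \<in> {x. creation E f \<cdot> x \<in> fock_upto s}"
  proof (rule fock_upto_induct[OF preimage_closed_csubspace _ x])
    fix w assume "w \<in> time_words s"
    then show "E w \<in> {x. creation E f \<cdot> x \<in> fock_upto s}"
      using f fL time_words_words by (auto simp: subset_iff intro: fock_upto_E)
  qed (use fL fock_upto_csubspace fock_upto_closed in auto)
  then show ?thesis by simp
qed

lemma fock_upto_annihilation:
  assumes f: "f \<in> L2fun" and x: "x \<in> fock_upto s"
  shows "annihilation E f \<cdot> x \<in> fock_upto s"
proof -
  have "x \<in> {x. annihilation E f \<cdot> x \<in> fock_upto s}"
  proof (rule fock_upto_induct[OF preimage_closed_csubspace _ x])
    fix w assume w: "w \<in> time_words s"
    have ww: "w \<in> words" using w time_words_words by auto
    have "rem_sum q w (\<lambda>g r. L2inner f g *\<^sub>C E r) \<in> fock_upto s"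
    proof (rule rem_sum_in[OF fock_upto_csubspace])
      fix y r assume m: "mset (y # r) = mset w"
      have "r \<in> time_words s" using time_words_mset[OF m, of s] w by simp
      then show "L2inner f y *\<^sub>C E r \<in> fock_upto s"
        by (intro csubspace_scale fock_upto_csubspace fock_upto_E)
    qed
    then show "E w \<in> {x. annihilation E f \<cdot> x \<in> fock_upto s}"
      using f ww by (simp add: annihilation_E)
  qed (use f fock_upto_csubspace fock_upto_closed in auto)
  then show ?thesis by simp
qed

lemma fock_upto_annihilation_orthogonal:
  assumes h: "h \<in> L2fun" "\<And>f. f \<in> letters s \<Longrightarrow> L2inner h f = 0" and x: "x \<in> fock_upto s"
  shows "annihilation E h \<cdot> x = 0"
proof -
  have "x \<in> {x. annihilation E h \<cdot> x \<in> {0}}"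
  proof (rule fock_upto_induct[OF preimage_closed_csubspace _ x])
    fix w assume w: "w \<in> time_words s"
    have ww: "w \<in> words" using w time_words_words by auto
    have "rem_sum q w (\<lambda>g r. L2inner h g *\<^sub>C E r) = rem_sum q w (\<lambda>g r. 0)"
    proof (rule rem_sum_cong)
      fix y r assume m: "mset (y # r) = mset w"
      have "y \<in> letters s" using time_words_mset[OF m, of s] w by simp
      then show "L2inner h y *\<^sub>C E r = 0" using h by simp
    qed
    then show "E w \<in> {x. annihilation E h \<cdot> x \<in> {0}}"
      using h ww by (simp add: annihilation_E)
  qed (use h in \<open>auto simp: csubspace_def\<close>)
  then show ?thesis by simp
qed

text \<open>Von Neumann algebras appear as bicommutants and not as closures, so invariance is not
  obtained by a limit: the projection onto the past commutes with the generators, hence with every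
  element of the bicommutant.\<close>

lemma vn_alg_upto_fock_upto:
  assumes W: "W \<in> vn_alg_upto E s" and x: "x \<in> fock_upto s"
  shows "W \<cdot> x \<in> fock_upto s"
proof -
  obtain P where P: "P \<in> cops" "\<And>x. P \<cdot> x \<in> fock_upto s" "\<And>x. x \<in> fock_upto s \<Longrightarrow> P \<cdot> x = x"
    "\<And>T. T \<in> cops \<Longrightarrow> cadjoint T = T \<Longrightarrow> (\<And>x. x \<in> fock_upto s \<Longrightarrow> T \<cdot> x \<in> fock_upto s) \<Longrightarrow> T o\<^sub>L P = P o\<^sub>L T"
    using projection_operator_exists[OF fock_upto_csubspace fock_upto_closed] by blast
  have "P \<in> commutant (qbm E ` {0..s})"
    unfolding commutant_def
  proof (intro CollectI conjI ballI P(1))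
    fix S assume "S \<in> qbm E ` {0..s}"
    then obtain r where r: "S = qbm E r" "ind {0..r} \<in> letters s" by (auto simp: letters_def)
    show "S o\<^sub>L P = P o\<^sub>L S"
      using r by (intro P) (auto simp: cadjoint_field qbm_field field_apply
          intro!: csubspace_add[OF fock_upto_csubspace] fock_upto_annihilation fock_upto_creation)
  qed
  moreover have "W \<in> commutant (commutant (qbm E ` {0..s}))"
    using W von_neumann_algebra_hull(2)[OF qbm_image_cops] unfolding vn_alg_upto_def by blast
  ultimately have "W \<cdot> P \<cdot> x = P \<cdot> W \<cdot> x"
    by (simp add: commutant_iff)
  then show ?thesis using P x by metis
qed

end

text \<open>The right field operators are the field operators of the Fock space with all words reversed.\<close>

lemma right_creation_E:
  assumes "q_fock q E" "g \<in> L2fun" "w \<in> words"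
  shows "creation (\<lambda>w. E (rev w)) g \<cdot> E w = E (w @ [g])"
proof -
  interpret R: q_fock q "\<lambda>w. E (rev w)" by (rule q_fock_rev) fact
  show ?thesis using R.creation_E[of g "rev w"] assms by simp
qed

text \<open>Either a letter of \<open>w\<close> is removed and \<open>g\<close> stays last, or
  \<open>g\<close> itself is removed from position \<open>length w\<close>, with weight
  q^|w|.\<close>

lemma annihilation_snoc:
  assumes "q_fock q E" "f \<in> L2fun" "g \<in> L2fun" "w \<in> words"
  shows "annihilation E f \<cdot> E (w @ [g]) =
    creation (\<lambda>w. E (rev w)) g \<cdot> annihilation E f \<cdot> E w + (q ^ length w) *\<^sub>R L2inner f g *\<^sub>C E w"
proof -
  interpret q_fock q E by fact
  interpret R: q_fock q "\<lambda>w. E (rev w)" by (rule q_fock_rev) fact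
  define C where "C = creation (\<lambda>w. E (rev w)) g"
  have C: "C \<in> cops" using assms by (simp add: C_def)
  have "rem_sum q w (\<lambda>h r. L2inner f h *\<^sub>C E (r @ [g])) = rem_sum q w (\<lambda>h r. C \<cdot> (L2inner f h *\<^sub>C E r))"
  proof (rule rem_sum_cong)
    fix y r assume "mset (y # r) = mset w"
    then have "r \<in> words" using words_rem[OF assms(4)] by blast
    then show "L2inner f y *\<^sub>C E (r @ [g]) = C \<cdot> (L2inner f y *\<^sub>C E r)"
      using C assms right_creation_E[OF assms(1,3)] by (simp add: copsD C_def)
  qed
  also have "\<dots> = C \<cdot> rem_sum q w (\<lambda>h r. L2inner f h *\<^sub>C E r)"
    by (intro rem_sum_linear[symmetric] bounded_linear.linear[OF blinfun.bounded_linear_right])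
  finally show ?thesis using assms by (simp add: annihilation_E rem_sum_append C_def)
qed

section \<open>Right fields and the separating property of the vacuum\<close>

context q_fock begin

text \<open>Left and right operators of the same kind commute. The two mixed commutators leave q^n
  times \<open>L2inner f g\<close> and \<open>L2inner g f\<close> with opposite signs, and these
  cancel when the inner products agree.\<close>

lemma right_field_commutes:
  assumes f: "f \<in> L2fun" and g: "g \<in> L2fun" and real: "L2inner g f = L2inner f g"
  defines "E' \<equiv> \<lambda>w. E (rev w)"
  shows "field f o\<^sub>L (annihilation E' g + creation E' g) = (annihilation E' g + creation E' g) o\<^sub>L field f"
proof -
  interpret R: q_fock q E' unfolding E'_def by (rule q_fock_rev) unfold_locales
  have E'': "(\<lambda>w. E' (rev w)) = E" by (simp add: E'_def)
  have qf: "q_fock q E" by unfold_locales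
  have c[simp]: "annihilation E' g \<in> cops" "creation E' g \<in> cops" using g by auto
  have cE: "creation E' g \<cdot> E w = E (w @ [g])" if "w \<in> words" for w
    unfolding E'_def by (rule right_creation_E[OF qf g that])
  have cc: "creation E f o\<^sub>L creation E' g = creation E' g o\<^sub>L creation E f"
    using f g by (intro op_eqI cops_compose) (simp_all add: cE)
  then have "cadjoint (creation E f o\<^sub>L creation E' g) = cadjoint (creation E' g o\<^sub>L creation E f)" by simp
  then have aa: "annihilation E f o\<^sub>L annihilation E' g = annihilation E' g o\<^sub>L annihilation E f"
    using f by (simp add: cadjoint_compose annihilation_def)
  have 1: "annihilation E f \<cdot> creation E' g \<cdot> E w =
      creation E' g \<cdot> annihilation E f \<cdot> E w + q ^ length w *\<^sub>R L2inner f g *\<^sub>C E w"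
    if "w \<in> words" for w
    using annihilation_snoc[OF qf f g that] cE[OF that] by (simp add: E'_def)
  have 2: "annihilation E' g \<cdot> creation E f \<cdot> E w =
      creation E f \<cdot> annihilation E' g \<cdot> E w + q ^ length w *\<^sub>R L2inner f g *\<^sub>C E w"
    if "w \<in> words" for w
  proof -
    have "annihilation E' g \<cdot> E' (rev w @ [f]) =
        creation E f \<cdot> annihilation E' g \<cdot> E' (rev w) + q ^ length (rev w) *\<^sub>R L2inner g f *\<^sub>C E' (rev w)"
      using annihilation_snoc[OF R.q_fock_axioms g f, of "rev w"] that by (simp add: E'')
    then show ?thesis using f that real by (simp add: E'_def)
  qed
  show ?thesis
  proof (rule op_eqI)
    fix w assume w: "w \<in> words"
    have "creation E f \<cdot> creation E' g \<cdot> x = creation E' g \<cdot> creation E f \<cdot> x"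
      "annihilation E f \<cdot> annihilation E' g \<cdot> x = annihilation E' g \<cdot> annihilation E f \<cdot> x" for x
      using cc aa by (simp_all add: blinfun_compose_eq_iff)
    then show "(field f o\<^sub>L (annihilation E' g + creation E' g)) \<cdot> E w =
        ((annihilation E' g + creation E' g) o\<^sub>L field f) \<cdot> E w"
      using 1[OF w] 2[OF w] by (simp add: field_apply blinfun.add_left blinfun.add_right)
  qed (use f in \<open>auto intro!: cops_compose cops_add\<close>)
qed

text \<open>The right field operators of real functions lie in the commutant, and applied to the vacuum they generate
  the whole space.\<close>

lemma vacuum_separating:
  assumes W: "W \<in> vn_alg E" and W0: "W \<cdot> E [] = 0"
  shows "W = 0"
proof -
  define E' where "E' = (\<lambda>w. E (rev w))"
  interpret R: q_fock q E' unfolding E'_def by (rule q_fock_rev) unfold_locales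
  have qf: "q_fock q E" by unfold_locales
  have Wc: "W \<in> cops" using W vn_alg_cops by blast
  have WR: "W \<cdot> R.field g \<cdot> x = R.field g \<cdot> W \<cdot> x"
    if g: "g \<in> L2fun" "\<And>x. cnj (g x) = g x" for g x
  proof -
    have "R.field g \<in> commutant (qbm E ` {0..})"
      unfolding commutant_def
    proof (intro CollectI conjI ballI)
      fix S assume "S \<in> qbm E ` {0..}"
      then obtain r where r: "S = field (ind {0..r})" by (auto simp: qbm_field)
      have "L2inner g (ind {0..r}) = L2inner (ind {0..r}) g"
        unfolding L2inner_def using g by (intro Bochner_Integration.integral_cong) (auto simp: indicator_def)
      then show "S o\<^sub>L R.field g = R.field g o\<^sub>L S"
        unfolding R.field_def r unfolding E'_def by (intro right_field_commutes g) auto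
    qed (use g in simp)
    moreover have "W \<in> commutant (commutant (qbm E ` {0..}))"
      using W von_neumann_algebra_hull(2)[OF qbm_image_cops] unfolding vn_alg_def by blast
    ultimately show ?thesis by (simp add: commutant_iff)
  qed
  have "W \<cdot> E' w = 0" if "w \<in> words" for w
    using that
  proof (induction "length w" arbitrary: w rule: less_induct)
    case less
    show ?case
    proof (cases w)
      case Nil
      then show ?thesis using W0 by (simp add: E'_def)
    next
      case (Cons g v)
      then have gv: "g \<in> L2fun" "v \<in> words" using less.prems by auto
      \<comment> \<open>Only right fields of real functions are known to commute with the algebra; a
        complex letter is reached because creation is complex linear in its function.\<close>
      define a b where "a x = complex_of_real (Re (g x))" and "b x = complex_of_real (Im (g x))" for x
      have ab: "a \<in> L2fun" "b \<in> L2fun" unfolding a_def b_def by (intro L2fun_Re L2fun_Im gv)+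
      have g_eq: "g = (\<lambda>x. a x + \<i> * b x)" by (simp add: a_def b_def complex_eq mult.commute fun_eq_iff)
      have ann: "W \<cdot> annihilation E' k \<cdot> E' v = 0" if "k \<in> L2fun" for k
      proof -
        have "W \<cdot> rem_sum q v (\<lambda>h r. L2inner k h *\<^sub>C E' r) =
            rem_sum q v (\<lambda>h r. W \<cdot> (L2inner k h *\<^sub>C E' r))"
          by (intro rem_sum_linear bounded_linear.linear[OF blinfun.bounded_linear_right])
        also have "\<dots> = rem_sum q v (\<lambda>h r. 0)"
        proof (rule rem_sum_cong)
          fix y r assume m: "mset (y # r) = mset v"
          have "length r < length w" using m Cons by (metis length_Cons less_Suc_eq mset_eq_length)
          moreover have "r \<in> words" using words_rem[OF gv(2) m] by simp
          ultimately show "W \<cdot> (L2inner k y *\<^sub>C E' r) = 0" using less.hyps Wc by (simp add: copsD)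
        qed
        finally show ?thesis using that gv by (simp add: R.annihilation_E)
      qed
      have cr: "W \<cdot> creation E' k \<cdot> E' v = 0"
        if k: "k \<in> L2fun" "\<And>x. cnj (k x) = k x" for k
      proof -
        have "W \<cdot> E' v = 0" using less.hyps gv Cons by simp
        then have "W \<cdot> R.field k \<cdot> E' v = 0" using WR[OF k] by simp
        then show ?thesis using ann[OF k(1)] by (simp add: R.field_apply blinfun.add_right)
      qed
      have "creation E' g = creation E' a + \<i> *\<^sub>C creation E' b"
        using ab by (subst g_eq) (simp add: R.creation_add L2fun_scale R.creation_scale)
      then have "E' w = creation E' a \<cdot> E' v + \<i> *\<^sub>C creation E' b \<cdot> E' v"
        using R.creation_E[OF gv] Cons by (simp add: blinfun.add_left scaleC_blinfun_apply)
      moreover have "W \<cdot> creation E' a \<cdot> E' v = 0"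
        "W \<cdot> creation E' b \<cdot> E' v = 0"
        using ab by (intro cr; simp add: a_def b_def)+
      ultimately show ?thesis using Wc by (simp add: blinfun.add_right copsD)
    qed
  qed
  then have "W \<cdot> E w = 0 \<cdot> E w" if "w \<in> words" for w
    using that by (metis E'_def rev_rev_ident words_rev zero_blinfun.rep_eq)
  then show ?thesis using Wc by (intro op_eqI) auto
qed

end

section \<open>Second quantization\<close>

context q_fock begin

lemma norm_vacuum_apply_le: "norm (T \<cdot> E []) \<le> norm T"
  using norm_blinfun[of T "E []"] by (simp add: norm_vacuum)

lemma real_words_time_words: "F \<subseteq> time_words s \<Longrightarrow> real_words F"
  unfolding real_words_def time_words_def using L2inner_letters_real by blast

text \<open>Evaluating at the vacuum bounds the vector norm in the Haagerup inequality by the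
  operator norm. The estimate for pairs yields single-valuedness although Wick products may be
  linearly dependent.\<close>

lemma haagerup_lin_graph:
  assumes "(V, N) \<in> lin_graph (time_words s) wick (\<lambda>w. q ^ length w *\<^sub>R wick_with Q w)" "Q \<in> cops"
  shows "norm N \<le> haagerup_const * norm Q * norm V"
proof -
  obtain F c where F: "finite F" "F \<subseteq> time_words s" "V = (\<Sum>w\<in>F. c w *\<^sub>C wick w)"
    "N = (\<Sum>w\<in>F. c w *\<^sub>C q ^ length w *\<^sub>R wick_with Q w)"
    by (rule lin_graphE[OF assms(1)])
  have Fw: "F \<subseteq> words" using F time_words_words by blast
  have "N = (\<Sum>w\<in>F. (c w * of_real (q ^ length w)) *\<^sub>C wick_with Q w)"
    unfolding F(4) by (simp add: scaleC_scaleC[symmetric] scaleC_of_real del: of_real_power)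
  then have "norm N \<le> haagerup_const * norm Q * norm (\<Sum>w\<in>F. c w *\<^sub>C E w)"
    using haagerup_inequality[OF F(1) Fw real_words_time_words[OF F(2)] assms(2)] by simp
  also have "(\<Sum>w\<in>F. c w *\<^sub>C E w) = V \<cdot> E []"
    unfolding F(3) using Fw by (auto simp: blinfun.sum_left scaleC_blinfun_apply wick_vacuum intro!: sum.cong)
  also have "haagerup_const * norm Q * norm (V \<cdot> E []) \<le> haagerup_const * norm Q * norm V"
    using haagerup_const_nonneg by (intro mult_left_mono norm_vacuum_apply_le) auto
  finally show ?thesis .
qed

text \<open>The second quantization is first built as a closed relation extending \<open>wick w \<mapsto> q\<^sup>|\<^sup>w\<^sup>| wick w\<close>, since
  \<open>second_quantization\<close> itself is a definite description.\<close>

definition gamma_graph0 :: "real \<Rightarrow> (('h \<Rightarrow>\<^sub>L 'h) \<times> ('h \<Rightarrow>\<^sub>L 'h)) set" where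
  "gamma_graph0 s = lin_graph (time_words s) wick (\<lambda>w. q ^ length w *\<^sub>R wick w)"

definition gamma_graph :: "real \<Rightarrow> (('h \<Rightarrow>\<^sub>L 'h) \<times> ('h \<Rightarrow>\<^sub>L 'h)) set" where
  "gamma_graph s = closure (gamma_graph0 s)"

lemma norm_id_le: "norm (id_blinfun :: 'h \<Rightarrow>\<^sub>L 'h) \<le> 1"
  by (rule norm_blinfun_bound) auto

lemma gamma_graph0_bound:
  assumes "(V, Z) \<in> gamma_graph0 s"
  shows "norm Z \<le> haagerup_const * norm V"
proof -
  have "norm Z \<le> haagerup_const * norm (id_blinfun :: 'h \<Rightarrow>\<^sub>L 'h) * norm V"
    using haagerup_lin_graph[of V Z s id_blinfun] assms by (simp add: gamma_graph0_def wick_with_id)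
  also have "\<dots> \<le> haagerup_const * 1 * norm V"
    using haagerup_const_nonneg norm_id_le by (intro mult_right_mono mult_left_mono) auto
  finally show ?thesis by simp
qed

lemma gamma_graph_exists:
  assumes "V \<in> norm_alg_upto E s"
  obtains Z where "(V, Z) \<in> gamma_graph s"
proof -
  have "V \<in> closure (csubspace hull (wick ` time_words s))"
    using assms closure_mono[OF poly_alg_subset_wick_span] unfolding norm_alg_upto_def by blast
  then obtain Z where "(V, Z) \<in> closure (lin_graph (time_words s) wick (\<lambda>w. q ^ length w *\<^sub>R wick w))"
    by (rule closure_lin_graph_total[OF gamma_graph0_bound[unfolded gamma_graph0_def], rotated])
  then show thesis
    by (intro that) (simp only: gamma_graph_def gamma_graph0_def)
qed

lemma gamma_graph_seq:
  assumes "(V, Z) \<in> gamma_graph s"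
  obtains f z where "\<And>n::nat. (f n, z n) \<in> gamma_graph0 s" "f \<longlonglongrightarrow> V" "z \<longlonglongrightarrow> Z"
  using assms closure_lin_graph_seq unfolding gamma_graph_def gamma_graph0_def by blast

lemma gamma_graph_bound: "(V, Z) \<in> gamma_graph s \<Longrightarrow> norm Z \<le> haagerup_const * norm V"
  and gamma_graph_add: "(V, Z) \<in> gamma_graph s \<Longrightarrow> (V', Z') \<in> gamma_graph s \<Longrightarrow> (V + V', Z + Z') \<in> gamma_graph s"
  and gamma_graph_scale: "(V, Z) \<in> gamma_graph s \<Longrightarrow> (c *\<^sub>C V, c *\<^sub>C Z) \<in> gamma_graph s"
  and gamma_graph_functional: "(V, Z) \<in> gamma_graph s \<Longrightarrow> (V, Z') \<in> gamma_graph s \<Longrightarrow> Z = Z'"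
  unfolding gamma_graph_def gamma_graph0_def
  by (rule closure_lin_graph_bound[OF gamma_graph0_bound[unfolded gamma_graph0_def]]
      closure_lin_graph_functional[OF gamma_graph0_bound[unfolded gamma_graph0_def]]
      closure_lin_graph_add closure_lin_graph_scale; assumption)+

lemma gamma_graph_mono: "s \<le> t \<Longrightarrow> gamma_graph s \<subseteq> gamma_graph t"
  unfolding gamma_graph_def gamma_graph0_def by (intro closure_mono lin_graph_mono time_words_mono)

lemma gamma_graph_in:
  assumes "(V, Z) \<in> gamma_graph s"
  shows "Z \<in> norm_alg_upto E s"
proof -
  obtain f z where f: "\<And>n::nat. (f n, z n) \<in> gamma_graph0 s" "f \<longlonglongrightarrow> V" "z \<longlonglongrightarrow> Z"
    using gamma_graph_seq[OF assms] by blast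
  have "csubspace hull ((\<lambda>w. q ^ length w *\<^sub>R wick w) ` time_words s) \<subseteq> norm_alg_upto E s"
    using poly_alg_wick norm_alg_upto_poly
    by (intro hull_minimal norm_alg_upto_csubspace) (blast intro: csubspace_scaleR[OF norm_alg_upto_csubspace])
  then have "z n \<in> norm_alg_upto E s" for n
    using lin_graph_range(2) f(1)[of n] unfolding gamma_graph0_def by blast
  then show ?thesis using closed_sequentially[OF norm_alg_upto_closed _ f(3)] by blast
qed

lemma annihilate_word_fock_upto:
  "w \<in> words \<Longrightarrow> y \<in> fock_upto s \<Longrightarrow> annihilate_word w \<cdot> y \<in> fock_upto s"
  by (induction w) (auto intro: fock_upto_annihilation)

text \<open>The annihilators of a Wick product of the past keep \<open>y\<close> in the past, where
  a(h) a*(h) is the scalar |h|^2, since a(h) kills the past. Only the factor q^|w| from commuting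
  inwards remains, and the relation passes to limits.\<close>

lemma annihilation_gamma_creation:
  assumes VZ: "(V, Z) \<in> gamma_graph s" and h: "h \<in> L2fun" "\<And>f. f \<in> letters s \<Longrightarrow> L2inner h f = 0"
    and y: "y \<in> fock_upto s"
  shows "annihilation E h \<cdot> V \<cdot> creation E h \<cdot> y = L2inner h h *\<^sub>C Z \<cdot> y"
proof -
  have wick: "annihilation E h \<cdot> wick w \<cdot> creation E h \<cdot> y =
      L2inner h h *\<^sub>C q ^ length w *\<^sub>R wick w \<cdot> y" if w: "w \<in> time_words s" for w
  proof -
    have ww: "w \<in> words" using w time_words_words by blast
    have orth: "\<And>f. f \<in> set w \<Longrightarrow> L2inner h f = 0" using w h by (auto simp: time_words_def)
    have l: "linear (\<lambda>T. T \<cdot> y)" by (rule bounded_linear.linear[OF blinfun.bounded_linear_left])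
    have "(annihilation E h o\<^sub>L wick w o\<^sub>L creation E h) \<cdot> y =
        q ^ length w *\<^sub>R (wick_with (annihilation E h o\<^sub>L creation E h) w) \<cdot> y"
      using annihilation_wick_creation[OF h(1) h(1) ww orth orth] by (simp add: blinfun.scaleR_left)
    also have "(wick_with (annihilation E h o\<^sub>L creation E h) w) \<cdot> y =
        (\<Sum>k\<le>length w. split_sum q w k (\<lambda>A R. L2inner h h *\<^sub>C (create_word A o\<^sub>L annihilate_word R) \<cdot> y))"
      unfolding wick_with_def blinfun.sum_left split_sum_linear[OF l]
    proof (intro sum.cong refl split_sum_cong)
      fix k A R assume m: "mset (A @ R) = mset w"
      have AR: "A \<in> words" "R \<in> words" using words_split[OF ww m] by auto
      have "annihilate_word R \<cdot> y \<in> fock_upto s" by (intro annihilate_word_fock_upto AR y)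
      from fock_upto_annihilation_orthogonal[OF h this] have "annihilation E h \<cdot> creation E h \<cdot> annihilate_word R \<cdot> y =
          L2inner h h *\<^sub>C annihilate_word R \<cdot> y"
        using h by (simp add: annihilation_creation_apply)
      then show "(create_word A o\<^sub>L (annihilation E h o\<^sub>L creation E h) o\<^sub>L annihilate_word R) \<cdot> y =
          L2inner h h *\<^sub>C (create_word A o\<^sub>L annihilate_word R) \<cdot> y"
        using create_word_cops[OF AR(1)] by (simp add: copsD)
    qed
    also have "\<dots> = L2inner h h *\<^sub>C wick w \<cdot> y"
      unfolding wick_def blinfun.sum_left split_sum_linear[OF l]
      by (simp add: scaleC_sum_right split_sum_linear[OF bounded_linear.linear[OF bounded_linear_scaleC_right]])
    finally show ?thesis by (simp add: scaleC_scaleR)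
  qed
  have g0: "annihilation E h \<cdot> V \<cdot> creation E h \<cdot> y = L2inner h h *\<^sub>C Z \<cdot> y"
    if VZ0: "(V, Z) \<in> gamma_graph0 s" for V Z
  proof -
    obtain F c where F: "finite F" "F \<subseteq> time_words s" "V = (\<Sum>w\<in>F. c w *\<^sub>C wick w)"
      "Z = (\<Sum>w\<in>F. c w *\<^sub>C q ^ length w *\<^sub>R wick w)"
      using VZ0 unfolding gamma_graph0_def by (rule lin_graphE)
    have "annihilation E h \<cdot> V \<cdot> creation E h \<cdot> y =
      (\<Sum>w\<in>F. c w *\<^sub>C annihilation E h \<cdot> wick w \<cdot> creation E h \<cdot> y)"
      unfolding F(3) using h by (simp add: blinfun.sum_left blinfun.sum_right scaleC_blinfun_apply copsD)
    also have "\<dots> = (\<Sum>w\<in>F. c w *\<^sub>C L2inner h h *\<^sub>C q ^ length w *\<^sub>R wick w \<cdot> y)"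
      using F(2) wick by (intro sum.cong) auto
    also have "\<dots> = L2inner h h *\<^sub>C Z \<cdot> y"
      unfolding F(4) by (simp add: blinfun.sum_left scaleC_blinfun_apply blinfun.scaleR_left scaleC_sum_right scaleC_commute)
    finally show ?thesis .
  qed
  obtain f z where f: "\<And>n::nat. (f n, z n) \<in> gamma_graph0 s" "f \<longlonglongrightarrow> V" "z \<longlonglongrightarrow> Z"
    using gamma_graph_seq[OF VZ] by blast
  have "(\<lambda>n. annihilation E h \<cdot> f n \<cdot> creation E h \<cdot> y)
      \<longlonglongrightarrow> annihilation E h \<cdot> V \<cdot> creation E h \<cdot> y"
    by (intro tendsto_intros f)
  moreover have "(\<lambda>n. L2inner h h *\<^sub>C z n \<cdot> y) \<longlonglongrightarrow> L2inner h h *\<^sub>C Z \<cdot> y"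
    by (intro bounded_linear.tendsto[OF bounded_linear_scaleC_right] tendsto_intros f)
  ultimately show ?thesis using g0[OF f(1)] LIMSEQ_unique by simp
qed

text \<open>Against \<open>W\<close> only the past vector \<open>cadjoint W\<close> applied to the
  vacuum matters. On it and on the vacuum the field of a future interval reduces to creation, so the
  pairing is the compression computed just before, with |h|^2 = 1.\<close>

lemma cond_expectation_gamma:
  assumes s: "0 \<le> s" and VZ: "(V, Z) \<in> gamma_graph s"
  shows "cond_expectation E s ((qbm E (s + 1) - qbm E s) o\<^sub>L V o\<^sub>L (qbm E (s + 1) - qbm E s)) = Z"
proof -
  define h where "h = ind {s<..s + 1}"
  have h: "h \<in> L2fun" "\<And>f. f \<in> letters s \<Longrightarrow> L2inner h f = 0" "L2inner h h = 1"
    using s L2inner_ind_letters[of s s] L2inner_ind_self[of s "s + 1"] by (auto simp: h_def)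
  have inc: "qbm E (s + 1) - qbm E s = field h" using qbm_increment[of s "s + 1"] s by (simp add: h_def)
  let ?U = "field h o\<^sub>L V o\<^sub>L field h"
  have ZB: "Z \<in> vn_alg_upto E s" using gamma_graph_in[OF VZ] norm_alg_upto_vn by blast
  have eq: "vacuum_state E (Z o\<^sub>L cadjoint W) = vacuum_state E (?U o\<^sub>L cadjoint W)" if W: "W \<in> vn_alg_upto E s" for W
  proof -
    define y where "y = cadjoint W \<cdot> E []"
    have y: "y \<in> fock_upto s"
      unfolding y_def using von_neumann_algebra_props(4)[OF vn_alg_upto_vn W]
      by (intro vn_alg_upto_fock_upto fock_upto_vacuum)
    have "vacuum_state E (?U o\<^sub>L cadjoint W) = cinner (E []) (field h \<cdot> V \<cdot> field h \<cdot> y)"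
      by (simp add: vacuum_state_def vacuum_def y_def)
    also have "\<dots> = cinner (field h \<cdot> E []) (V \<cdot> field h \<cdot> y)"
      using cinner_cadjoint_left[OF field_cops[OF h(1)]] cadjoint_field[OF h(1)] by simp
    also have "field h \<cdot> y = creation E h \<cdot> y"
      using fock_upto_annihilation_orthogonal[OF h(1,2) y] by (simp add: field_apply)
    also have "field h \<cdot> E [] = creation E h \<cdot> E []"
      using h(1) by (simp add: field_apply)
    also have "cinner (creation E h \<cdot> E []) (V \<cdot> creation E h \<cdot> y) =
        cinner (E []) (annihilation E h \<cdot> V \<cdot> creation E h \<cdot> y)"
      using h(1) by (simp add: annihilation_def cinner_cadjoint_right)
    also have "\<dots> = cinner (E []) (Z \<cdot> y)"
      using annihilation_gamma_creation[OF VZ h(1,2) y] h(3) by simp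
    finally show ?thesis by (simp add: vacuum_state_def vacuum_def y_def)
  qed
  show ?thesis
    unfolding cond_expectation_def inc
  proof (rule the_equality)
    show "Z \<in> vn_alg_upto E s \<and> (\<forall>W\<in>vn_alg_upto E s. vacuum_state E (Z o\<^sub>L cadjoint W) = vacuum_state E (?U o\<^sub>L cadjoint W))"
      using ZB eq by blast
  next
    fix Z' assume Z': "Z' \<in> vn_alg_upto E s \<and> (\<forall>W\<in>vn_alg_upto E s. vacuum_state E (Z' o\<^sub>L cadjoint W) = vacuum_state E (?U o\<^sub>L cadjoint W))"
    define D where "D = Z' - Z"
    have D: "D \<in> vn_alg_upto E s"
      using Z' ZB csubspace_diff[OF von_neumann_algebra_props(1)[OF vn_alg_upto_vn]] by (simp add: D_def)
    then have Dc: "D \<in> cops" using vn_alg_upto_subset vn_alg_cops by blast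
    \<comment> \<open>Testing with the difference \<open>D\<close> itself shows that the adjoint of
      \<open>D\<close> kills the vacuum; the adjoint lies in the algebra, so it vanishes.\<close>
    have "vacuum_state E (Z' o\<^sub>L cadjoint D) = vacuum_state E (Z o\<^sub>L cadjoint D)" using Z' eq D by simp
    then have "cinner (E []) (D \<cdot> cadjoint D \<cdot> E []) = 0"
      by (simp add: vacuum_state_def vacuum_def D_def blinfun.diff_left cinner_diff_right)
    then have "cadjoint D \<cdot> E [] = 0"
      using cinner_cadjoint_left[OF Dc, of "E []" "cadjoint D \<cdot> E []"] by (simp add: cinner_self)
    moreover have "cadjoint D \<in> vn_alg E"
      using von_neumann_algebra_props(4)[OF vn_alg_upto_vn D] vn_alg_upto_subset by blast
    ultimately have "cadjoint D = 0" by (intro vacuum_separating)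
    then have "D = 0" using cadjoint_cadjoint[OF Dc] by simp
    then show "Z' = Z" by (simp add: D_def)
  qed
qed

text \<open>The description asks for one value valid at all admissible times. The graphs at two
  times both lie in the graph at the later time, which is single-valued.\<close>

lemma second_quantization_gamma:
  assumes s: "0 \<le> s" and VZ: "(V, Z) \<in> gamma_graph s" and V: "V \<in> norm_alg_upto E s"
  shows "second_quantization E V = Z"
  unfolding second_quantization_def
proof (rule the_equality)
  show "\<forall>s\<ge>0. V \<in> norm_alg_upto E s \<longrightarrow> Z = cond_expectation E s ((qbm E (s + 1) - qbm E s) o\<^sub>L V o\<^sub>L (qbm E (s + 1) - qbm E s))"
  proof (intro allI impI)
    fix s' :: real assume s': "s' \<ge> 0" "V \<in> norm_alg_upto E s'"
    obtain Z' where Z': "(V, Z') \<in> gamma_graph s'" using gamma_graph_exists[OF s'(2)] .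
    have "(V, Z) \<in> gamma_graph (max s s')" "(V, Z') \<in> gamma_graph (max s s')"
      using VZ Z' gamma_graph_mono by (meson max.cobounded1 max.cobounded2 subsetD)+
    then have "Z = Z'" by (rule gamma_graph_functional)
    then show "Z = cond_expectation E s' ((qbm E (s' + 1) - qbm E s') o\<^sub>L V o\<^sub>L (qbm E (s' + 1) - qbm E s'))"
      using cond_expectation_gamma[OF s'(1) Z'] by simp
  qed
next
  fix Z' assume "\<forall>s\<ge>0. V \<in> norm_alg_upto E s \<longrightarrow> Z' = cond_expectation E s ((qbm E (s + 1) - qbm E s) o\<^sub>L V o\<^sub>L (qbm E (s + 1) - qbm E s))"
  then show "Z' = Z" using cond_expectation_gamma[OF s VZ] s V by simp
qed

lemma second_quantization_graph:
  assumes "0 \<le> s" "V \<in> norm_alg_upto E s"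
  shows "(V, second_quantization E V) \<in> gamma_graph s"
  using gamma_graph_exists[OF assms(2)] second_quantization_gamma[OF assms(1) _ assms(2)] by metis

end

section \<open>Projective tensor products\<close>

definition bilinear_on ::
  "'a::complex_normed_vector set \<Rightarrow> ('a \<Rightarrow> 'a \<Rightarrow> 'b::complex_normed_vector) \<Rightarrow> real \<Rightarrow> bool" where
  "bilinear_on A \<beta> K \<longleftrightarrow>
     (\<forall>U\<in>A. \<forall>U'\<in>A. \<forall>V\<in>A. \<beta> (U + U') V = \<beta> U V + \<beta> U' V) \<and>
     (\<forall>U\<in>A. \<forall>V\<in>A. \<forall>V'\<in>A. \<beta> U (V + V') = \<beta> U V + \<beta> U V') \<and>
     (\<forall>c. \<forall>U\<in>A. \<forall>V\<in>A. \<beta> (c *\<^sub>C U) V = c *\<^sub>C \<beta> U V \<and> \<beta> U (c *\<^sub>C V) = c *\<^sub>C \<beta> U V) \<and>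
     0 \<le> K \<and> (\<forall>U\<in>A. \<forall>V\<in>A. norm (\<beta> U V) \<le> K * (norm U * norm V))"

text \<open>A tensor is a functional on scalar bilinear forms, so a vector-valued lift is pinned down by testing with
  such a family.\<close>

definition separating :: "('b::complex_normed_vector \<Rightarrow> complex) set \<Rightarrow> bool" where
  "separating \<Psi> \<longleftrightarrow> (\<forall>\<psi>\<in>\<Psi>. bounded_linear \<psi> \<and> (\<forall>c x. \<psi> (c *\<^sub>C x) = c * \<psi> x)) \<and>
     (\<forall>x. (\<forall>\<psi>\<in>\<Psi>. \<psi> x = 0) \<longrightarrow> x = 0)"

lemma bilinear_form_zero: "b \<in> bilinear_forms A \<Longrightarrow> 0 \<in> A \<Longrightarrow> b 0 0 = 0"
proof -
  assume "b \<in> bilinear_forms A" "0 \<in> A"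
  then have "b (0 *\<^sub>C 0) 0 = 0 * b 0 0" unfolding bilinear_forms_def by blast
  then show ?thesis by simp
qed

lemma tensor_series_elem:
  assumes "csubspace A" "U \<in> A" "V \<in> A"
  shows "tensor_series A (elem_tensor A U V) (\<lambda>i. if i = 0 then U else 0) (\<lambda>i. if i = 0 then V else 0)"
  unfolding tensor_series_def
proof (intro conjI)
  have z: "0 \<in> A" using assms csubspace_0 by blast
  show "range (\<lambda>i::nat. if i = 0 then U else 0) \<subseteq> A" "range (\<lambda>i::nat. if i = 0 then V else 0) \<subseteq> A"
    using assms z by auto
  show "summable (\<lambda>i::nat. norm (if i = 0 then U else 0) * norm (if i = 0 then V else 0))"
    by (rule summable_finite[of "{0}"]) auto
  show "elem_tensor A U V = (\<lambda>b. \<Sum>i::nat. elem_tensor A (if i = 0 then U else 0) (if i = 0 then V else 0) b)"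
  proof
    fix b
    have "(\<lambda>i::nat. elem_tensor A (if i = 0 then U else 0) (if i = 0 then V else 0) b) = (\<lambda>i. if i = 0 then elem_tensor A U V b else 0)"
      using bilinear_form_zero[of b A] z by (auto simp: elem_tensor_def)
    then show "elem_tensor A U V b = (\<Sum>i::nat. elem_tensor A (if i = 0 then U else 0) (if i = 0 then V else 0) b)"
      using sums_unique[OF sums_single[of 0 "\<lambda>_. elem_tensor A U V b"]] by simp
  qed
qed

lemma summable_elem_tensor:
  assumes "range U \<subseteq> A" "range V \<subseteq> A" "summable (\<lambda>i. norm (U i) * norm (V i))"
  shows "summable (\<lambda>i. elem_tensor A (U i) (V i) b)"
proof (cases "b \<in> bilinear_forms A")
  case True
  then obtain K where K: "\<forall>U\<in>A. \<forall>V\<in>A. cmod (b U V) \<le> K * (norm U * norm V)"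
    unfolding bilinear_forms_def by blast
  have "summable (\<lambda>i. K * (norm (U i) * norm (V i)))" using assms by (intro summable_mult)
  then show ?thesis
    by (rule summable_comparison_test'[where N = 0]) (use True K range_subsetD[OF assms(1)] range_subsetD[OF assms(2)] in \<open>simp add: elem_tensor_def\<close>)
qed (simp add: elem_tensor_def)

lemma proj_norm_le:
  assumes "tensor_series A x U V"
  shows "proj_norm A x \<le> (\<Sum>i. norm (U i) * norm (V i))"
  unfolding proj_norm_def
proof (rule cInf_lower)
  show "bdd_below {\<Sum>i. norm (U i) * norm (V i) |U V. tensor_series A x U V}"
    by (rule bdd_belowI[of _ 0]) (auto simp: tensor_series_def intro!: suminf_nonneg)
qed (use assms in blast)

text \<open>Every bounded extension takes this value, which gives uniqueness of the lift. Linearity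
  alone handles finitely many terms; boundedness then lets the value at the remaining tail tend to
  0.\<close>

lemma tensor_lift_unique_sums:
  assumes A: "csubspace A" and F: "bounded_linear_on_tensor A F"
    and Fe: "\<And>U V. U \<in> A \<Longrightarrow> V \<in> A \<Longrightarrow> F (elem_tensor A U V) = \<beta> U V"
    and x: "tensor_series A x U V"
  shows "(\<lambda>i. \<beta> (U i) (V i)) sums F x"
proof -
  have UV: "range U \<subseteq> A" "range V \<subseteq> A" "summable (\<lambda>i. norm (U i) * norm (V i))"
    and x_eq: "x = (\<lambda>b. \<Sum>i. elem_tensor A (U i) (V i) b)"
    using x by (auto simp: tensor_series_def)
  \<comment> \<open>The tail of the series is again a tensor, with projective norm at most the tail
    of the norm series.\<close>
  define t where "t n = (\<lambda>b. \<Sum>i. elem_tensor A (U (i + n)) (V (i + n)) b)" for n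
  have ts: "tensor_series A (t n) (\<lambda>i. U (i + n)) (\<lambda>i. V (i + n))" for n
    unfolding tensor_series_def t_def
    using UV summable_iff_shift[of "\<lambda>i. norm (U i) * norm (V i)" n] by auto
  have tP: "t n \<in> proj_tensor A" for n using ts by (auto simp: proj_tensor_def)
  have eP: "elem_tensor A (U n) (V n) \<in> proj_tensor A" for n
    using tensor_series_elem[OF A range_subsetD[OF UV(1)] range_subsetD[OF UV(2)]] unfolding proj_tensor_def by blast
  have step: "t n = (\<lambda>b. elem_tensor A (U n) (V n) b + t (Suc n) b)" for n
  proof
    fix b
    have "summable (\<lambda>i. elem_tensor A (U (i + n)) (V (i + n)) b)"
      using ts[of n] unfolding tensor_series_def by (intro summable_elem_tensor) auto
    from suminf_split_head[OF this] show "t n b = elem_tensor A (U n) (V n) b + t (Suc n) b"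
      by (simp add: t_def)
  qed
  have "F (t 0) = (\<Sum>i<n. \<beta> (U i) (V i)) + F (t n)" for n
  proof (induction n)
    case (Suc n)
    have "F (t n) = F (elem_tensor A (U n) (V n)) + F (t (Suc n))"
      using F eP tP unfolding bounded_linear_on_tensor_def by (subst step) blast
    then show ?case using Suc Fe[of "U n" "V n"] UV by (simp add: range_subsetD add.assoc)
  qed simp
  moreover have "t 0 = x" by (simp add: t_def x_eq)
  ultimately have eq: "(\<Sum>i<n. \<beta> (U i) (V i)) = F x - F (t n)" for n by (simp add: algebra_simps)
  obtain K where K: "\<And>x. x \<in> proj_tensor A \<Longrightarrow> norm (F x) \<le> K * proj_norm A x"
    using F unfolding bounded_linear_on_tensor_def by blast
  have "(\<lambda>n. F (t n)) \<longlonglongrightarrow> 0"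
  proof (rule Lim_null_comparison)
    have nonneg: "0 \<le> proj_norm A (t n)" for n
      unfolding proj_norm_def
      by (rule cInf_greatest) (use ts[of n] in \<open>auto simp: tensor_series_def intro!: suminf_nonneg\<close>)
    have "norm (F (t n)) \<le> \<bar>K\<bar> * (\<Sum>i. norm (U (i + n)) * norm (V (i + n)))" for n
    proof -
      have "norm (F (t n)) \<le> K * proj_norm A (t n)" by (rule K[OF tP])
      also have "\<dots> \<le> \<bar>K\<bar> * proj_norm A (t n)" using nonneg by (intro mult_right_mono) auto
      also have "\<dots> \<le> \<bar>K\<bar> * (\<Sum>i. norm (U (i + n)) * norm (V (i + n)))"
        by (intro mult_left_mono proj_norm_le ts) auto
      finally show ?thesis .
    qed
    then show "\<forall>\<^sub>F n in sequentially. norm (F (t n)) \<le> \<bar>K\<bar> * (\<Sum>i. norm (U (i + n)) * norm (V (i + n)))" by simp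
    have "(\<lambda>n. \<Sum>i. norm (U (i + n)) * norm (V (i + n))) \<longlonglongrightarrow> 0"
      by (rule suminf_exist_split2[OF UV(3)])
    then show "(\<lambda>n. \<bar>K\<bar> * (\<Sum>i. norm (U (i + n)) * norm (V (i + n)))) \<longlonglongrightarrow> 0"
      using tendsto_mult_right_zero by blast
  qed
  then have "(\<lambda>n. F x - F (t n)) \<longlonglongrightarrow> F x - 0" by (intro tendsto_diff tendsto_const)
  then show ?thesis by (simp add: sums_def eq)
qed

text \<open>A tensor has many series, so the value is characterised without any of them: its image
  under each \<open>\<psi>\<close> is the tensor evaluated at the form \<open>\<psi>\<close> after
  \<open>\<beta>\<close>. Linearity then follows from the characterisation, and a series is used
  only for existence and the bound.\<close>

lemma tensor_lift_exists:
  fixes \<beta> :: "'a::complex_normed_vector \<Rightarrow> 'a \<Rightarrow> 'b::{complex_normed_vector, banach}"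
    and \<Psi> :: "('b \<Rightarrow> complex) set"
  assumes A: "csubspace A" and \<beta>: "bilinear_on A \<beta> K" and \<Psi>: "separating \<Psi>"
  obtains F where "bounded_linear_on_tensor A F" "\<And>U V. U \<in> A \<Longrightarrow> V \<in> A \<Longrightarrow> F (elem_tensor A U V) = \<beta> U V"
proof -
  have K: "0 \<le> K" "\<And>U V. U \<in> A \<Longrightarrow> V \<in> A \<Longrightarrow> norm (\<beta> U V) \<le> K * (norm U * norm V)"
    using \<beta> by (auto simp: bilinear_on_def)
  have bl: "bounded_linear \<psi>" "\<psi> (c *\<^sub>C x) = c * \<psi> x" if "\<psi> \<in> \<Psi>" for \<psi> c x
    using \<Psi> that by (auto simp: separating_def)
  define P where "P x z \<longleftrightarrow> (\<forall>\<psi>\<in>\<Psi>. \<psi> z = x (\<lambda>U V. \<psi> (\<beta> U V)))" for x z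
  define F where "F x = (THE z. P x z)" for x
  have P_unique: "z = z'" if "P x z" "P x z'" for x z z'
  proof -
    have "\<forall>\<psi>\<in>\<Psi>. \<psi> (z - z') = 0" using that bl(1) by (auto simp: P_def linear_diff[OF bounded_linear.linear])
    then show ?thesis using \<Psi> unfolding separating_def by (metis right_minus_eq)
  qed
  have FP: "F x = z" if "P x z" for x z
    unfolding F_def using that P_unique by blast
  have form: "(\<lambda>U V. \<psi> (\<beta> U V)) \<in> bilinear_forms A" if "\<psi> \<in> \<Psi>" for \<psi>
  proof -
    interpret bounded_linear \<psi> by (rule bl(1)[OF that])
    obtain L where L: "\<And>x. cmod (\<psi> x) \<le> norm x * L" "L > 0" using pos_bounded by blast
    have "cmod (\<psi> (\<beta> U V)) \<le> (K * L) * (norm U * norm V)" if "U \<in> A" "V \<in> A" for U V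
    proof -
      have "norm (\<beta> U V) * L \<le> K * (norm U * norm V) * L" using K(2)[OF that] L(2) by (intro mult_right_mono) auto
      then show ?thesis using L(1)[of "\<beta> U V"] by (simp add: mult_ac)
    qed
    then show ?thesis using \<beta> bl(2)[OF that] unfolding bilinear_on_def bilinear_forms_def by (auto simp: add)
  qed
  have val: "P x (\<Sum>i. \<beta> (U i) (V i))" "norm (\<Sum>i. \<beta> (U i) (V i)) \<le> K * (\<Sum>i. norm (U i) * norm (V i))"
    if "tensor_series A x U V" for x U V
  proof -
    have UV: "range U \<subseteq> A" "range V \<subseteq> A" "summable (\<lambda>i. norm (U i) * norm (V i))"
      and x_eq: "x = (\<lambda>b. \<Sum>i. elem_tensor A (U i) (V i) b)"
      using that by (auto simp: tensor_series_def)
    have sK: "summable (\<lambda>i. K * (norm (U i) * norm (V i)))" using UV by (intro summable_mult)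
    have le: "norm (\<beta> (U i) (V i)) \<le> K * (norm (U i) * norm (V i))" for i using K(2) UV by (simp add: range_subsetD)
    have sn: "summable (\<lambda>i. norm (\<beta> (U i) (V i)))"
      by (rule summable_comparison_test'[OF sK, where N = 0]) (use le in simp)
    have s: "summable (\<lambda>i. \<beta> (U i) (V i))" by (rule summable_norm_cancel[OF sn])
    show "P x (\<Sum>i. \<beta> (U i) (V i))"
      unfolding P_def
    proof
      fix \<psi> assume p: "\<psi> \<in> \<Psi>"
      show "\<psi> (\<Sum>i. \<beta> (U i) (V i)) = x (\<lambda>U V. \<psi> (\<beta> U V))"
        using bounded_linear.suminf[OF bl(1)[OF p] s] form[OF p] by (simp add: x_eq elem_tensor_def)
    qed
    have "norm (\<Sum>i. \<beta> (U i) (V i)) \<le> (\<Sum>i. norm (\<beta> (U i) (V i)))" by (rule summable_norm[OF sn])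
    also have "\<dots> \<le> (\<Sum>i. K * (norm (U i) * norm (V i)))" by (intro suminf_le le sn sK)
    also have "\<dots> = K * (\<Sum>i. norm (U i) * norm (V i))" by (rule suminf_mult[OF UV(3)])
    finally show "norm (\<Sum>i. \<beta> (U i) (V i)) \<le> K * (\<Sum>i. norm (U i) * norm (V i))" .
  qed
  have PF: "P x (F x)" if xP: "x \<in> proj_tensor A" for x
  proof -
    obtain U V where "tensor_series A x U V" using xP unfolding proj_tensor_def by blast
    from val(1)[OF this] show ?thesis using FP by metis
  qed
  have "bounded_linear_on_tensor A F"
    unfolding bounded_linear_on_tensor_def
  proof (intro conjI ballI allI exI[of _ K])
    fix x y assume "x \<in> proj_tensor A" "y \<in> proj_tensor A"
    then have "P (\<lambda>b. x b + y b) (F x + F y)"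
      using PF[of x] PF[of y] bl(1) by (auto simp: P_def linear_add[OF bounded_linear.linear])
    then show "F (\<lambda>b. x b + y b) = F x + F y" by (rule FP)
  next
    fix c x assume "x \<in> proj_tensor A"
    then have "P (\<lambda>b. c * x b) (c *\<^sub>C F x)" using PF[of x] bl(2) by (auto simp: P_def)
    then show "F (\<lambda>b. c * x b) = c *\<^sub>C F x" by (rule FP)
  next
    fix x assume x: "x \<in> proj_tensor A"
    have le: "norm (F x) \<le> K * (\<Sum>i. norm (U i) * norm (V i))" if "tensor_series A x U V" for U V
      using val[OF that] FP[OF val(1)[OF that]] by simp
    show "norm (F x) \<le> K * proj_norm A x"
    \<comment> \<open>The comparison with the infimum divides by \<open>K\<close>.\<close>
    proof (cases "K = 0")
      case True
      then show ?thesis using x le unfolding proj_tensor_def by fastforce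
    next
      case False
      have "norm (F x) / K \<le> proj_norm A x"
        unfolding proj_norm_def
        by (rule cInf_greatest) (use x le K(1) False in \<open>auto simp: proj_tensor_def field_simps\<close>)
      then show ?thesis using K(1) False by (simp add: field_simps)
    qed
  qed
  moreover have "F (elem_tensor A U V) = \<beta> U V" if UV: "U \<in> A" "V \<in> A" for U V
  proof (rule FP, unfold P_def, intro ballI)
    fix \<psi> assume "\<psi> \<in> \<Psi>"
    then show "\<psi> (\<beta> U V) = elem_tensor A U V (\<lambda>U V. \<psi> (\<beta> U V))" using form by (simp add: elem_tensor_def)
  qed
  ultimately show thesis by (rule that)
qed

lemma tensor_lift_sums:
  fixes \<beta> :: "'a::complex_normed_vector \<Rightarrow> 'a \<Rightarrow> 'b::{complex_normed_vector, banach}"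
    and \<Psi> :: "('b \<Rightarrow> complex) set"
  assumes A: "csubspace A" and \<beta>: "bilinear_on A \<beta> K" and \<Psi>: "separating \<Psi>" and x: "tensor_series A x U V"
  shows "(\<lambda>i. \<beta> (U i) (V i)) sums tensor_lift A \<beta> x"
proof -
  obtain F where F: "bounded_linear_on_tensor A F" "\<And>U V. U \<in> A \<Longrightarrow> V \<in> A \<Longrightarrow> F (elem_tensor A U V) = \<beta> U V"
    using tensor_lift_exists[OF A \<beta> \<Psi>] by blast
  note s = tensor_lift_unique_sums[OF A _ _ x, where \<beta> = \<beta>]
  have "tensor_lift A \<beta> x = F x"
    unfolding tensor_lift_def
  proof (rule the_equality)
    show "\<exists>F'. bounded_linear_on_tensor A F' \<and> (\<forall>U\<in>A. \<forall>V\<in>A. F' (elem_tensor A U V) = \<beta> U V) \<and> F x = F' x"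
      using F by blast
  next
    fix z assume "\<exists>F'. bounded_linear_on_tensor A F' \<and> (\<forall>U\<in>A. \<forall>V\<in>A. F' (elem_tensor A U V) = \<beta> U V) \<and> z = F' x"
    then obtain F' where F': "bounded_linear_on_tensor A F'" "\<And>U V. U \<in> A \<Longrightarrow> V \<in> A \<Longrightarrow> F' (elem_tensor A U V) = \<beta> U V" "z = F' x"
      by blast
    show "z = F x" using sums_unique2[OF s[OF F'(1,2)] s[OF F]] F'(3) by simp
  qed
  then show ?thesis using s[OF F] by simp
qed

lemma separating_hilbert: "separating (range (cinner :: 'a::complex_hilbert \<Rightarrow> _))"
  unfolding separating_def
proof (intro conjI ballI allI impI)
  fix x :: 'a assume "\<forall>\<psi>\<in>range cinner. \<psi> x = 0"
  then have "cinner x x = 0" by blast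
  then show "x = 0" by (simp add: cinner_self)
qed (auto simp: cinner_scaleC_right bounded_linear_cinner_right)

lemma separating_operators:
  "separating {\<psi>. \<exists>x y. \<psi> = (\<lambda>T :: 'h::complex_hilbert \<Rightarrow>\<^sub>L 'h. cinner x (T \<cdot> y))}"
  unfolding separating_def
proof (intro conjI ballI allI impI)
  fix \<psi> :: "('h \<Rightarrow>\<^sub>L 'h) \<Rightarrow> complex" and c :: complex and T
  assume "\<psi> \<in> {\<psi>. \<exists>x y. \<psi> = (\<lambda>T :: 'h \<Rightarrow>\<^sub>L 'h. cinner x (T \<cdot> y))}"
  then obtain x y where \<psi>: "\<psi> = (\<lambda>T. cinner x (T \<cdot> y))" by blast
  show "bounded_linear \<psi>"
    unfolding \<psi> by (rule bounded_linear_compose[OF bounded_linear_cinner_right blinfun.bounded_linear_left])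
  show "\<psi> (c *\<^sub>C T) = c * \<psi> T" unfolding \<psi> by (simp add: scaleC_blinfun_apply cinner_scaleC_right)
next
  fix T :: "'h \<Rightarrow>\<^sub>L 'h"
  assume *: "\<forall>\<psi>\<in>{\<psi>. \<exists>x y. \<psi> = (\<lambda>T :: 'h \<Rightarrow>\<^sub>L 'h. cinner x (T \<cdot> y))}. \<psi> T = 0"
  have "T \<cdot> y = 0 \<cdot> y" for y
  proof (rule cinner_eqI)
    fix x
    have "(\<lambda>T :: 'h \<Rightarrow>\<^sub>L 'h. cinner x (T \<cdot> y)) \<in> {\<psi>. \<exists>x y. \<psi> = (\<lambda>T. cinner x (T \<cdot> y))}"
      by (intro CollectI exI) (rule refl)
    from bspec[OF * this] show "cinner x (T \<cdot> y) = cinner x (0 \<cdot> y)" by simp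
  qed
  then show "T = 0" by (rule blinfun_eqI)
qed

section \<open>The action of a tensor on an operator\<close>

lemma norm_compose3_le: "norm (S o\<^sub>L T o\<^sub>L R) \<le> norm T * (norm S * norm R)"
proof -
  have "norm (S o\<^sub>L T o\<^sub>L R) \<le> norm (S o\<^sub>L T) * norm R" by (rule norm_blinfun_compose)
  also have "\<dots> \<le> (norm S * norm T) * norm R" by (intro mult_right_mono norm_blinfun_compose) auto
  finally show ?thesis by (simp add: mult_ac)
qed

lemma sharp_sums:
  assumes A: "csubspace A" "A \<subseteq> cops" and Y: "Y \<in> cops" and x: "tensor_series A x U V"
  shows "(\<lambda>i. U i o\<^sub>L Y o\<^sub>L V i) sums sharp A x Y"
  unfolding sharp_def
proof (rule tensor_lift_sums[OF A(1) _ separating_operators x, where \<beta> = "\<lambda>U V. U o\<^sub>L Y o\<^sub>L V"])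
  show "bilinear_on A (\<lambda>U V. U o\<^sub>L Y o\<^sub>L V) (norm Y)"
    unfolding bilinear_on_def using A(2) Y norm_compose3_le
    by (auto intro!: blinfun_eqI simp: blinfun.add_left blinfun.add_right scaleC_blinfun_apply copsD subset_iff)
qed

lemma sharp_elem_id:
  assumes A: "csubspace A" "A \<subseteq> cops" "id_blinfun \<in> A" and Y: "Y \<in> cops" and T: "T \<in> A"
  shows "sharp A (elem_tensor A T id_blinfun) Y = T o\<^sub>L Y"
proof -
  have "(\<lambda>i::nat. (if i = 0 then T else 0) o\<^sub>L Y o\<^sub>L (if i = 0 then id_blinfun else 0)) = (\<lambda>i. if i = 0 then T o\<^sub>L Y else 0)"
    by (auto intro!: blinfun_eqI)
  then have "(\<lambda>i::nat. if i = 0 then T o\<^sub>L Y else 0) sums sharp A (elem_tensor A T id_blinfun) Y"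
    using sharp_sums[OF A(1,2) Y tensor_series_elem[OF A(1) T A(3)]] by simp
  then show ?thesis using sums_unique2[OF _ sums_single[of 0 "\<lambda>_. T o\<^sub>L Y"]] by blast
qed

context
  fixes A :: "('h::complex_hilbert \<Rightarrow>\<^sub>L 'h) set" and x U V
  assumes A: "csubspace A" "A \<subseteq> cops" and x: "tensor_series A x U V"
begin

lemma sharp_add: "Y \<in> cops \<Longrightarrow> Z \<in> cops \<Longrightarrow> sharp A x (Y + Z) = sharp A x Y + sharp A x Z"
proof (rule sums_unique2[OF sharp_sums[OF A _ x]])
  assume *: "Y \<in> cops" "Z \<in> cops"
  show "Y + Z \<in> cops" using * by (rule cops_add)
  have "(\<lambda>i. U i o\<^sub>L (Y + Z) o\<^sub>L V i) = (\<lambda>i. (U i o\<^sub>L Y o\<^sub>L V i) + (U i o\<^sub>L Z o\<^sub>L V i))"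
    by (auto intro!: blinfun_eqI simp: blinfun.add_left blinfun.add_right)
  then show "(\<lambda>i. U i o\<^sub>L (Y + Z) o\<^sub>L V i) sums (sharp A x Y + sharp A x Z)"
    using sums_add[OF sharp_sums[OF A *(1) x] sharp_sums[OF A *(2) x]] by simp
qed

lemma sharp_scaleR: "Y \<in> cops \<Longrightarrow> sharp A x (r *\<^sub>R Y) = r *\<^sub>R sharp A x Y"
proof (rule sums_unique2[OF sharp_sums[OF A _ x]])
  assume *: "Y \<in> cops"
  show "r *\<^sub>R Y \<in> cops" using * by (rule cops_scaleR)
  have "(\<lambda>i. U i o\<^sub>L (r *\<^sub>R Y) o\<^sub>L V i) = (\<lambda>i. r *\<^sub>R (U i o\<^sub>L Y o\<^sub>L V i))"
    by (auto intro!: blinfun_eqI simp: blinfun.scaleR_left blinfun.scaleR_right)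
  then show "(\<lambda>i. U i o\<^sub>L (r *\<^sub>R Y) o\<^sub>L V i) sums (r *\<^sub>R sharp A x Y)"
    using bounded_linear.sums[OF bounded_linear_scaleR_right sharp_sums[OF A * x]] by simp
qed

lemma sharp_diff: "Y \<in> cops \<Longrightarrow> Z \<in> cops \<Longrightarrow> sharp A x (Y - Z) = sharp A x Y - sharp A x Z"
  using sharp_add[of Y "(-1) *\<^sub>R Z"] sharp_scaleR[of Z "-1"] cops_scaleR[of Z "-1"] by simp

lemma sharp_in:
  assumes M: "unital_subalgebra M" "closed M" "A \<subseteq> M" and Y: "Y \<in> M" "Y \<in> cops"
  shows "sharp A x Y \<in> M"
proof -
  have UV: "U i \<in> M" "V i \<in> M" for i using x M(3) unfolding tensor_series_def by blast+
  have lim: "(\<lambda>n. \<Sum>i<n. U i o\<^sub>L Y o\<^sub>L V i) \<longlonglongrightarrow> sharp A x Y"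
    using sharp_sums[OF A Y(2) x] by (simp add: sums_def)
  have "(\<Sum>i<n. U i o\<^sub>L Y o\<^sub>L V i) \<in> M" for n
    using M(1) UV Y(1) unfolding unital_subalgebra_def by (intro csubspace_sum) auto
  then show ?thesis by (rule closed_sequentially[OF M(2) _ lim])
qed

lemma norm_sharp_le:
  assumes Y: "Y \<in> cops"
  shows "norm (sharp A x Y) \<le> (\<Sum>i. norm (U i) * norm (V i)) * norm Y"
proof -
  have s: "summable (\<lambda>i. norm (U i) * norm (V i))" using x by (simp add: tensor_series_def)
  have s': "summable (\<lambda>i. norm Y * (norm (U i) * norm (V i)))" by (intro summable_mult s)
  have sn: "summable (\<lambda>i. norm (U i o\<^sub>L Y o\<^sub>L V i))"
    by (rule summable_comparison_test'[OF s', where N = 0]) (simp add: norm_compose3_le)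
  have "norm (sharp A x Y) = norm (\<Sum>i. U i o\<^sub>L Y o\<^sub>L V i)"
    using sums_unique[OF sharp_sums[OF A Y x]] by simp
  also have "\<dots> \<le> (\<Sum>i. norm (U i o\<^sub>L Y o\<^sub>L V i))" by (rule summable_norm[OF sn])
  also have "\<dots> \<le> (\<Sum>i. norm Y * (norm (U i) * norm (V i)))" by (intro suminf_le sn s' norm_compose3_le)
  also have "\<dots> = norm Y * (\<Sum>i. norm (U i) * norm (V i))" by (rule suminf_mult[OF s])
  finally show ?thesis by (simp add: mult.commute)
qed

end

section \<open>The map Id times second quantization, and the inclusion into L2\<close>

context q_fock begin

lemma norm_alg_upto_tensor:
  "csubspace (norm_alg_upto E s)" "norm_alg_upto E s \<subseteq> cops"
  by (rule norm_alg_upto_csubspace norm_alg_upto_cops)+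

lemma bilinear_id_times_second_quantization:
  assumes s: "0 \<le> s"
  shows "bilinear_on (norm_alg_upto E s) (\<lambda>U V. U o\<^sub>L second_quantization E V) haagerup_const"
proof -
  let ?\<Gamma> = "second_quantization E"
  have add: "?\<Gamma> (V + V') = ?\<Gamma> V + ?\<Gamma> V'" if "V \<in> norm_alg_upto E s" "V' \<in> norm_alg_upto E s" for V V'
    using that by (intro second_quantization_gamma[OF s] gamma_graph_add second_quantization_graph[OF s]
        csubspace_add[OF norm_alg_upto_csubspace])
  have scale: "?\<Gamma> (c *\<^sub>C V) = c *\<^sub>C ?\<Gamma> V" if "V \<in> norm_alg_upto E s" for c V
    using that by (intro second_quantization_gamma[OF s] gamma_graph_scale second_quantization_graph[OF s]
        csubspace_scale[OF norm_alg_upto_csubspace])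
  have bound: "norm (U o\<^sub>L ?\<Gamma> V) \<le> haagerup_const * (norm U * norm V)" if "V \<in> norm_alg_upto E s" for U V
  proof -
    have "norm (U o\<^sub>L ?\<Gamma> V) \<le> norm U * norm (?\<Gamma> V)" by (rule norm_blinfun_compose)
    also have "\<dots> \<le> norm U * (haagerup_const * norm V)"
      by (intro mult_left_mono gamma_graph_bound[OF second_quantization_graph[OF s that]]) auto
    finally show ?thesis by (simp add: mult_ac)
  qed
  show ?thesis
    unfolding bilinear_on_def using add scale bound haagerup_const_nonneg norm_alg_upto_cops
    by (auto intro!: blinfun_eqI simp: blinfun.add_left blinfun.add_right scaleC_blinfun_apply copsD subset_iff)
qed

context
  fixes J :: "('h \<Rightarrow>\<^sub>L 'h) \<Rightarrow> 'l::complex_hilbert"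
  assumes J: "L2_vacuum E J"
begin

lemma cinner_J:
  assumes "S \<in> vn_alg E" "T \<in> vn_alg E"
  shows "cinner (J S) (J T) = cinner (cadjoint T \<cdot> E []) (cadjoint S \<cdot> E [])"
proof -
  have c: "T \<in> cops" using assms vn_alg_cops by blast
  have "cinner (J S) (J T) = vacuum_state E (T o\<^sub>L cadjoint S)"
    using J assms by (auto simp: L2_vacuum_def hilbert_completion_def)
  also have "\<dots> = cinner (cadjoint T \<cdot> E []) (cadjoint S \<cdot> E [])"
    by (simp add: vacuum_state_def vacuum_def cinner_cadjoint_left[OF c])
  finally show ?thesis .
qed

lemma norm_J: "T \<in> vn_alg E \<Longrightarrow> norm (J T) = norm (cadjoint T \<cdot> E [])"
  using cinner_J[of T T] unfolding cinner_self of_real_eq_iff by simp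

text \<open>\<open>J\<close> is only assumed to respect the form; linearity follows because the
  defect has norm 0.\<close>

lemma J_add:
  assumes S: "S \<in> vn_alg E" and T: "T \<in> vn_alg E"
  shows "J (S + T) = J S + J T"
proof -
  have c: "S \<in> cops" "T \<in> cops" using S T vn_alg_cops by auto
  have ST: "S + T \<in> vn_alg E" using S T by (intro csubspace_add von_neumann_algebra_props(1)[OF vn_alg_vn])
  have "cinner (J (S + T) - (J S + J T)) (J (S + T) - (J S + J T)) = 0"
    using S T ST c
    by (simp add: cinner_diff_left cinner_diff_right cinner_add_left cinner_add_right cinner_J cadjoint_add blinfun.add_left)
  then show ?thesis unfolding cinner_self by simp
qed

lemma J_scale:
  assumes T: "T \<in> vn_alg E"
  shows "J (c *\<^sub>C T) = c *\<^sub>C J T"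
proof -
  have c: "T \<in> cops" using T vn_alg_cops by auto
  have cT: "c *\<^sub>C T \<in> vn_alg E" using T by (intro csubspace_scale von_neumann_algebra_props(1)[OF vn_alg_vn])
  have "cinner (J (c *\<^sub>C T) - c *\<^sub>C J T) (J (c *\<^sub>C T) - c *\<^sub>C J T) = 0"
    using T cT c
    by (simp add: cinner_diff_left cinner_diff_right cinner_scaleC_left cinner_scaleC_right cinner_J cadjoint_scaleC
        scaleC_blinfun_apply)
  then show ?thesis unfolding cinner_self by simp
qed

lemma J_scaleR: "T \<in> vn_alg E \<Longrightarrow> J (r *\<^sub>R T) = r *\<^sub>R J T"
  using J_scale[of T "of_real r"] by (simp add: scaleC_of_real)

lemma J_diff: "S \<in> vn_alg E \<Longrightarrow> T \<in> vn_alg E \<Longrightarrow> J (S - T) = J S - J T"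
  using J_add[of S "(-1) *\<^sub>R T"] J_scaleR[of T "-1"] csubspace_scaleR[OF von_neumann_algebra_props(1)[OF vn_alg_vn], of T "-1"]
  by simp

lemma norm_J_le: "T \<in> vn_alg E \<Longrightarrow> norm (J T) \<le> norm T"
  using norm_J[of T] norm_vacuum_apply_le[of "cadjoint T"] norm_cadjoint[of T] vn_alg_cops by auto

lemma tendsto_J:
  assumes "f \<longlonglongrightarrow> T" "\<And>n. f n \<in> vn_alg E" "T \<in> vn_alg E"
  shows "(\<lambda>n. J (f n)) \<longlonglongrightarrow> J T"
proof (rule metric_tendsto_imp_tendsto[OF assms(1)])
  have "dist (J (f n)) (J T) \<le> dist (f n) T" for n
    using norm_J_le[of "f n - T"] assms csubspace_diff[OF von_neumann_algebra_props(1)[OF vn_alg_vn]]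
    by (simp add: dist_norm J_diff)
  then show "\<forall>\<^sub>F n in sequentially. dist (J (f n)) (J T) \<le> dist (f n) T" by simp
qed

lemma id_times_second_quantization_sums:
  assumes s: "0 \<le> s" and x: "tensor_series (norm_alg_upto E s) x U V"
  shows "(\<lambda>i. J (U i o\<^sub>L second_quantization E (V i))) sums id_times_second_quantization E J s x"
  unfolding id_times_second_quantization_def
proof (rule tensor_lift_sums[OF norm_alg_upto_csubspace _ separating_hilbert x, where \<beta> = "\<lambda>U V. J (U o\<^sub>L second_quantization E V)"])
  have b: "bilinear_on (norm_alg_upto E s) (\<lambda>U V. U o\<^sub>L second_quantization E V) haagerup_const"
    by (rule bilinear_id_times_second_quantization[OF s])
  have vn: "U o\<^sub>L second_quantization E V \<in> vn_alg E" if "U \<in> norm_alg_upto E s" "V \<in> norm_alg_upto E s" for U V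
    using that gamma_graph_in[OF second_quantization_graph[OF s that(2)]] norm_alg_upto_compose
      norm_alg_upto_vn vn_alg_upto_subset by blast
  have J_le: "norm (J (U o\<^sub>L second_quantization E V)) \<le> haagerup_const * (norm U * norm V)"
    if "U \<in> norm_alg_upto E s" "V \<in> norm_alg_upto E s" for U V
    using norm_J_le[OF vn[OF that]] b that unfolding bilinear_on_def by (meson order_trans)
  show "bilinear_on (norm_alg_upto E s) (\<lambda>U V. J (U o\<^sub>L second_quantization E V)) haagerup_const"
    using b unfolding bilinear_on_def by (auto simp: J_add J_scale vn J_le)
qed

end

end

section \<open>Field operators around an element of the past\<close>

context q_fock begin

text \<open>A row, the diagonal operator with entries \<open>V\<close>, and a column: the norms of
  row and column multiply by Cauchy-Schwarz.\<close>

lemma norm_sum_sandwich_le: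
  fixes S R :: "'i \<Rightarrow> 'h \<Rightarrow>\<^sub>L 'h" and V :: "'h \<Rightarrow>\<^sub>L 'h"
  assumes S: "\<And>i. i \<in> I \<Longrightarrow> S i \<in> cops"
    and \<alpha>: "\<And>x. (\<Sum>i\<in>I. (norm (cadjoint (S i) \<cdot> x))\<^sup>2) \<le> \<alpha> * (norm x)\<^sup>2"
    and \<beta>: "\<And>y. (\<Sum>i\<in>I. (norm (R i \<cdot> y))\<^sup>2) \<le> \<beta> * (norm y)\<^sup>2"
    and nonneg: "0 \<le> \<alpha>" "0 \<le> \<beta>"
  shows "norm (\<Sum>i\<in>I. S i o\<^sub>L V o\<^sub>L R i) \<le> sqrt \<alpha> * sqrt \<beta> * norm V"
proof (rule norm_blinfun_le_of_cinner)
  fix x y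
  have "cmod (cinner x ((\<Sum>i\<in>I. S i o\<^sub>L V o\<^sub>L R i) \<cdot> y)) =
      cmod (\<Sum>i\<in>I. cinner (cadjoint (S i) \<cdot> x) (V \<cdot> R i \<cdot> y))"
    using S by (simp add: blinfun.sum_left cinner_sum_right cinner_cadjoint_left)
  also have "\<dots> \<le> (\<Sum>i\<in>I. norm V * (norm (cadjoint (S i) \<cdot> x) * norm (R i \<cdot> y)))"
    by (intro sum_norm_le cmod_cinner_blinfun_le)
  also have "\<dots> = norm V * (\<Sum>i\<in>I. norm (cadjoint (S i) \<cdot> x) * norm (R i \<cdot> y))"
    by (simp add: sum_distrib_left)
  also have "\<dots> \<le> norm V * (sqrt (\<alpha> * (norm x)\<^sup>2) * sqrt (\<beta> * (norm y)\<^sup>2))"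
    by (intro mult_left_mono L2_set_product_bound \<alpha> \<beta>) auto
  also have "\<dots> = sqrt \<alpha> * sqrt \<beta> * norm V * (norm x * norm y)"
    by (simp add: real_sqrt_mult)
  finally show "cmod (cinner x ((\<Sum>i\<in>I. S i o\<^sub>L V o\<^sub>L R i) \<cdot> y)) \<le> sqrt \<alpha> * sqrt \<beta> * norm V * (norm x * norm y)" .
qed (use nonneg in simp)

text \<open>Two sizes are recorded because the estimates differ: annihilation columns see the mesh
  \<open>\<epsilon>\<close>, creation columns the total length \<open>T\<close>.\<close>

definition orthogonal_family :: "'i set \<Rightarrow> ('i \<Rightarrow> real \<Rightarrow> complex) \<Rightarrow> real \<Rightarrow> real \<Rightarrow> bool" where
  "orthogonal_family I g \<epsilon> T \<longleftrightarrow> finite I \<and> (\<forall>i\<in>I. g i \<in> L2fun) \<and>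
    (\<forall>i\<in>I. \<forall>j\<in>I. i \<noteq> j \<longrightarrow> L2inner (g i) (g j) = 0) \<and>
    (\<forall>i\<in>I. Re (L2inner (g i) (g i)) \<le> \<epsilon>) \<and> (\<Sum>i\<in>I. Re (L2inner (g i) (g i))) \<le> T \<and> 0 \<le> \<epsilon> \<and> 0 \<le> T"

lemma orthogonal_family_annihilation:
  assumes "orthogonal_family I g \<epsilon> T"
  shows "(\<Sum>i\<in>I. (norm (annihilation E (g i) \<cdot> x))\<^sup>2) \<le> (Cq * \<epsilon>) * (norm x)\<^sup>2"
  using assms by (intro sum_norm_annihilation_le) (auto simp: orthogonal_family_def)

lemma orthogonal_family_creation:
  assumes "orthogonal_family I g \<epsilon> T"
  shows "(\<Sum>i\<in>I. (norm (creation E (g i) \<cdot> x))\<^sup>2) \<le> (Cq * T) * (norm x)\<^sup>2"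
proof -
  have "(\<Sum>i\<in>I. (norm (creation E (g i) \<cdot> x))\<^sup>2) \<le> (\<Sum>i\<in>I. Cq * (norm x)\<^sup>2 * Re (L2inner (g i) (g i)))"
  proof (rule sum_mono)
    fix i assume i: "i \<in> I"
    then have g: "g i \<in> L2fun" using assms by (simp add: orthogonal_family_def)
    have "norm (creation E (g i) \<cdot> x) \<le> sqrt (Cq * Re (L2inner (g i) (g i))) * norm x"
      using norm_creation_le[OF g] norm_blinfun[of "creation E (g i)" x] 
      by (meson mult_right_mono norm_ge_zero order_trans)
    then have "(norm (creation E (g i) \<cdot> x))\<^sup>2 \<le> (sqrt (Cq * Re (L2inner (g i) (g i))) * norm x)\<^sup>2"
      by (intro power_mono) auto
    also have "\<dots> = Cq * (norm x)\<^sup>2 * Re (L2inner (g i) (g i))"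
      using Cq_pos L2inner_self(2) by (simp add: power_mult_distrib)
    finally show "(norm (creation E (g i) \<cdot> x))\<^sup>2 \<le> Cq * (norm x)\<^sup>2 * Re (L2inner (g i) (g i))" .
  qed
  also have "\<dots> = Cq * (norm x)\<^sup>2 * (\<Sum>i\<in>I. Re (L2inner (g i) (g i)))" by (simp add: sum_distrib_left)
  also have "\<dots> \<le> Cq * (norm x)\<^sup>2 * T"
    using assms Cq_pos by (intro mult_left_mono) (auto simp: orthogonal_family_def)
  finally show ?thesis by (simp add: mult_ac)
qed

text \<open>Commuting the outer operators inwards turns a Wick product \<open>wick w\<close> of the past into \<open>q\<^sup>|\<^sup>w\<^sup>| wick_with Q w\<close> with \<open>Q\<close>
  the sum of the contracted products, so the Haagerup inequality applies.\<close>

lemma norm_sum_annihilation_creation_le: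
  assumes V: "V \<in> norm_alg_upto E s"
    and g: "orthogonal_family I g \<epsilon> T" "\<And>i f. i \<in> I \<Longrightarrow> f \<in> letters s \<Longrightarrow> L2inner (g i) f = 0"
    and h: "orthogonal_family I h \<epsilon> T" "\<And>i f. i \<in> I \<Longrightarrow> f \<in> letters s \<Longrightarrow> L2inner (h i) f = 0"
    and gh: "\<And>i. i \<in> I \<Longrightarrow> L2inner (g i) (h i) = 0"
  shows "norm (\<Sum>i\<in>I. annihilation E (g i) o\<^sub>L V o\<^sub>L creation E (h i)) \<le> haagerup_const * (Cq * \<epsilon>) * norm V"
proof -
  define \<Phi> where "\<Phi> V = (\<Sum>i\<in>I. annihilation E (g i) o\<^sub>L V o\<^sub>L creation E (h i))" for V
  have L2: "g i \<in> L2fun" "h i \<in> L2fun" if "i \<in> I" for i using g h that by (auto simp: orthogonal_family_def)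
  have eps: "0 \<le> \<epsilon>" using g by (simp add: orthogonal_family_def)
  define Q where "Q = (\<Sum>i\<in>I. annihilation E (g i) o\<^sub>L creation E (h i))"
  have Qc: "Q \<in> cops" unfolding Q_def using L2 by (intro cops_sum cops_compose) auto
  \<comment> \<open>Orthogonality of \<open>g i\<close> and \<open>h i\<close> removes the scalar of
    the commutation relation. What is left has an annihilation column on either side, each
    contributing \<open>sqrt (Cq * \<epsilon>)\<close>.\<close>
  have Q_eq: "Q = q *\<^sub>R (\<Sum>i\<in>I. creation E (h i) o\<^sub>L id_blinfun o\<^sub>L annihilation E (g i))"
    unfolding Q_def scaleR_sum_right using L2 gh by (intro sum.cong) (auto simp: annihilation_creation)
  have "norm (\<Sum>i\<in>I. creation E (h i) o\<^sub>L id_blinfun o\<^sub>L annihilation E (g i)) \<le> sqrt (Cq * \<epsilon>) * sqrt (Cq * \<epsilon>) * norm (id_blinfun :: 'h \<Rightarrow>\<^sub>L 'h)"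
    using orthogonal_family_annihilation[OF g(1)] orthogonal_family_annihilation[OF h(1)] L2 eps Cq_pos
    by (intro norm_sum_sandwich_le) (auto simp: annihilation_def)
  also have "\<dots> \<le> Cq * \<epsilon> * 1"
    using eps Cq_pos norm_id_le by (simp add: mult_left_le)
  finally have "norm (\<Sum>i\<in>I. creation E (h i) o\<^sub>L id_blinfun o\<^sub>L annihilation E (g i)) \<le> Cq * \<epsilon>" by simp
  then have Q_le: "norm Q \<le> Cq * \<epsilon>"
    unfolding Q_eq using q_nonneg q_less_1 by (simp add: mult_left_le_one_le order_trans[OF mult_left_le_one_le])
  have \<Phi>_add: "\<Phi> (\<Sum>w\<in>F. c w *\<^sub>C X w) = (\<Sum>w\<in>F. c w *\<^sub>C \<Phi> (X w))" for F c and X :: "_ \<Rightarrow> 'h \<Rightarrow>\<^sub>L 'h"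
  proof (rule blinfun_eqI)
    fix y
    have "\<Phi> (\<Sum>w\<in>F. c w *\<^sub>C X w) \<cdot> y =
        (\<Sum>i\<in>I. \<Sum>w\<in>F. c w *\<^sub>C annihilation E (g i) \<cdot> X w \<cdot> creation E (h i) \<cdot> y)"
      unfolding \<Phi>_def by (auto simp: blinfun.sum_left blinfun.sum_right scaleC_blinfun_apply copsD L2 intro!: sum.cong)
    also have "\<dots> = (\<Sum>w\<in>F. c w *\<^sub>C \<Phi> (X w)) \<cdot> y"
      unfolding \<Phi>_def by (subst sum.swap) (simp add: blinfun.sum_left scaleC_blinfun_apply scaleC_sum_right)
    finally show "\<Phi> (\<Sum>w\<in>F. c w *\<^sub>C X w) \<cdot> y = (\<Sum>w\<in>F. c w *\<^sub>C \<Phi> (X w)) \<cdot> y" .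
  qed
  have \<Phi>_wick: "\<Phi> (wick w) = q ^ length w *\<^sub>R wick_with Q w" if w: "w \<in> time_words s" for w
  proof -
    have ww: "w \<in> words" using w time_words_words by blast
    have "\<Phi> (wick w) = (\<Sum>i\<in>I. q ^ length w *\<^sub>R wick_with (annihilation E (g i) o\<^sub>L creation E (h i)) w)"
      unfolding \<Phi>_def
    proof (rule sum.cong[OF refl])
      fix i assume "i \<in> I"
      then show "annihilation E (g i) o\<^sub>L wick w o\<^sub>L creation E (h i) = q ^ length w *\<^sub>R wick_with (annihilation E (g i) o\<^sub>L creation E (h i)) w"
        using L2 ww g(2) h(2) w by (intro annihilation_wick_creation) (auto simp: time_words_def)
    qed
    then show ?thesis by (simp add: Q_def wick_with_sum[OF ww] scaleR_sum_right)
  qed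
  have poly: "norm (\<Phi> V) \<le> haagerup_const * (Cq * \<epsilon>) * norm V" if "V \<in> poly_alg s" for V
  proof -
    have "V \<in> csubspace hull (wick ` time_words s)" using that poly_alg_subset_wick_span by blast
    then obtain F c where F: "finite F" "F \<subseteq> time_words s" "V = (\<Sum>w\<in>F. c w *\<^sub>C wick w)"
      by (rule csubspace_hull_image_sum)
    have "\<Phi> V = (\<Sum>w\<in>F. c w *\<^sub>C q ^ length w *\<^sub>R wick_with Q w)"
      unfolding F(3) \<Phi>_add using F(2) \<Phi>_wick by (intro sum.cong) auto
    then have "(V, \<Phi> V) \<in> lin_graph (time_words s) wick (\<lambda>w. q ^ length w *\<^sub>R wick_with Q w)"
      using lin_graphI[OF F(1,2)] F(3) by simp
    then have "norm (\<Phi> V) \<le> haagerup_const * norm Q * norm V" using Qc by (rule haagerup_lin_graph)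
    also have "\<dots> \<le> haagerup_const * (Cq * \<epsilon>) * norm V"
      using Q_le haagerup_const_nonneg by (intro mult_right_mono mult_left_mono) auto
    finally show ?thesis .
  qed
  obtain f where f: "\<forall>n::nat. f n \<in> poly_alg s" "f \<longlonglongrightarrow> V"
    using V unfolding norm_alg_upto_def closure_sequential by blast
  have "(\<lambda>n. \<Phi> (f n)) \<longlonglongrightarrow> \<Phi> V"
    unfolding \<Phi>_def by (intro tendsto_intros bounded_bilinear.tendsto[OF bounded_bilinear_blinfun_compose] f)
  then have "norm (\<Phi> V) \<le> haagerup_const * (Cq * \<epsilon>) * norm V"
    by (intro LIMSEQ_le[OF tendsto_norm tendsto_mult[OF tendsto_const tendsto_norm[OF f(2)]]])
      (use poly f(1) in auto)
  then show ?thesis by (simp add: \<Phi>_def)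
qed

text \<open>Expanding two fields gives four products: three of them cost \<open>Cq\<close> each, the
  fourth \<open>haagerup_const * Cq\<close>.\<close>

definition key_const :: real where
  "key_const = Cq * (3 + haagerup_const)"

lemma key_const_nonneg: "0 \<le> key_const"
  using Cq_pos haagerup_const_nonneg by (simp add: key_const_def)

text \<open>A creator on the left or an annihilator on the right provides a factor
  \<open>sqrt \<epsilon>\<close>. The product with an annihilator on the left and a creator on the
  right has neither and is taken from the Haagerup estimate.\<close>

theorem norm_sum_field_sandwich_le:
  assumes V: "V \<in> norm_alg_upto E s"
    and g: "orthogonal_family I g \<epsilon> T" "\<And>i f. i \<in> I \<Longrightarrow> f \<in> letters s \<Longrightarrow> L2inner (g i) f = 0"
    and h: "orthogonal_family I h \<epsilon> T" "\<And>i f. i \<in> I \<Longrightarrow> f \<in> letters s \<Longrightarrow> L2inner (h i) f = 0"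
    and gh: "\<And>i. i \<in> I \<Longrightarrow> L2inner (g i) (h i) = 0"
  shows "norm (\<Sum>i\<in>I. field (g i) o\<^sub>L V o\<^sub>L field (h i)) \<le> key_const * (\<epsilon> + sqrt (\<epsilon> * T)) * norm V"
proof -
  have L2: "g i \<in> L2fun" "h i \<in> L2fun" if "i \<in> I" for i using g h that by (auto simp: orthogonal_family_def)
  have eps: "0 \<le> \<epsilon>" "0 \<le> T" using g by (auto simp: orthogonal_family_def)
  note ag = orthogonal_family_annihilation[OF g(1)] and ah = orthogonal_family_annihilation[OF h(1)]
    and cg = orthogonal_family_creation[OF g(1)] and ch = orthogonal_family_creation[OF h(1)]
  have split: "(\<Sum>i\<in>I. field (g i) o\<^sub>L V o\<^sub>L field (h i)) =
      (\<Sum>i\<in>I. annihilation E (g i) o\<^sub>L V o\<^sub>L creation E (h i)) + (\<Sum>i\<in>I. annihilation E (g i) o\<^sub>L V o\<^sub>L annihilation E (h i)) +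
      (\<Sum>i\<in>I. creation E (g i) o\<^sub>L V o\<^sub>L creation E (h i)) + (\<Sum>i\<in>I. creation E (g i) o\<^sub>L V o\<^sub>L annihilation E (h i))"
    unfolding sum.distrib[symmetric]
    by (intro sum.cong refl blinfun_eqI) (simp add: field_apply blinfun.add_left blinfun.add_right)
  have 1: "norm (\<Sum>i\<in>I. annihilation E (g i) o\<^sub>L V o\<^sub>L annihilation E (h i)) \<le> sqrt (Cq * T) * sqrt (Cq * \<epsilon>) * norm V"
    using cg ah L2 eps Cq_pos by (intro norm_sum_sandwich_le) (auto simp: cadjoint_annihilation)
  have 2: "norm (\<Sum>i\<in>I. creation E (g i) o\<^sub>L V o\<^sub>L creation E (h i)) \<le> sqrt (Cq * \<epsilon>) * sqrt (Cq * T) * norm V"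
    using ag ch L2 eps Cq_pos by (intro norm_sum_sandwich_le) (auto simp: cadjoint_creation)
  have 3: "norm (\<Sum>i\<in>I. creation E (g i) o\<^sub>L V o\<^sub>L annihilation E (h i)) \<le> sqrt (Cq * \<epsilon>) * sqrt (Cq * \<epsilon>) * norm V"
    using ag ah L2 eps Cq_pos by (intro norm_sum_sandwich_le) (auto simp: cadjoint_creation)
  have 4: "norm (\<Sum>i\<in>I. annihilation E (g i) o\<^sub>L V o\<^sub>L creation E (h i)) \<le> haagerup_const * (Cq * \<epsilon>) * norm V"
    by (rule norm_sum_annihilation_creation_le[OF V g h gh])
  have "norm (\<Sum>i\<in>I. field (g i) o\<^sub>L V o\<^sub>L field (h i)) \<le>
      haagerup_const * (Cq * \<epsilon>) * norm V + sqrt (Cq * T) * sqrt (Cq * \<epsilon>) * norm V +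
      sqrt (Cq * \<epsilon>) * sqrt (Cq * T) * norm V + sqrt (Cq * \<epsilon>) * sqrt (Cq * \<epsilon>) * norm V"
    unfolding split by (intro norm_triangle_le add_mono 1 2 3 4)
  also have "\<dots> = Cq * (haagerup_const * \<epsilon> + 2 * sqrt (\<epsilon> * T) + \<epsilon>) * norm V"
    using eps Cq_pos by (simp add: real_sqrt_mult algebra_simps)
  also have "\<dots> \<le> Cq * ((3 + haagerup_const) * (\<epsilon> + sqrt (\<epsilon> * T))) * norm V"
    using eps Cq_pos haagerup_const_nonneg
    by (intro mult_right_mono mult_left_mono) (simp_all add: algebra_simps)
  finally show ?thesis by (simp add: key_const_def mult_ac)
qed

lemma norm_field_le:
  assumes "g \<in> L2fun"
  shows "norm (field g) \<le> 2 * sqrt (Cq * Re (L2inner g g))"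
  using norm_triangle_ineq[of "annihilation E g" "creation E g"] norm_creation_le[OF assms] norm_annihilation[OF assms]
  by (simp add: field_def)

lemma norm_qbm_increment_le:
  assumes "0 \<le> a" "a \<le> b"
  shows "norm (qbm E b - qbm E a) \<le> 2 * sqrt (Cq * (b - a))"
  using norm_field_le[of "ind {a<..b}"] L2inner_ind_self[OF assms] by (simp add: qbm_increment[OF assms])

lemma orthogonal_family_intervals:
  assumes fin: "finite I" and ab: "\<And>i. i \<in> I \<Longrightarrow> 0 \<le> a i \<and> a i \<le> b i"
    and disj: "\<And>i j. i \<in> I \<Longrightarrow> j \<in> I \<Longrightarrow> i \<noteq> j \<Longrightarrow> {a i<..b i} \<inter> {a j<..b j} = {}"
    and le: "\<And>i. i \<in> I \<Longrightarrow> b i - a i \<le> \<epsilon>" "(\<Sum>i\<in>I. b i - a i) \<le> T" and nonneg: "0 \<le> \<epsilon>" "0 \<le> T"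
  shows "orthogonal_family I (\<lambda>i. ind {a i<..b i}) \<epsilon> T"
  unfolding orthogonal_family_def
proof (intro conjI ballI impI)
  show "(\<Sum>i\<in>I. Re (L2inner (ind {a i<..b i}) (ind {a i<..b i}))) \<le> T"
    using ab le(2) by (simp add: L2inner_ind_self)
  show "Re (L2inner (ind {a i<..b i}) (ind {a i<..b i})) \<le> \<epsilon>" if "i \<in> I" for i
    using ab[OF that] le(1)[OF that] by (simp add: L2inner_ind_self)
  show "L2inner (ind {a i<..b i}) (ind {a j<..b j}) = 0" if "i \<in> I" "j \<in> I" "i \<noteq> j" for i j
    using ab[OF that(1)] disj[OF that] by (intro L2inner_ind_disjoint) auto
qed (use fin nonneg in auto)

end

section \<open>The Stratonovich area\<close>

locale levy = q_fock q E for q and E :: "(real \<Rightarrow> complex) list \<Rightarrow> 'h::complex_hilbert" +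
  fixes s t :: real and x :: "('h \<Rightarrow>\<^sub>L 'h) tensor" and U V :: "nat \<Rightarrow> 'h \<Rightarrow>\<^sub>L 'h"
  assumes s_nonneg: "0 \<le> s" and s_less_t: "s < t"
    and series: "tensor_series (norm_alg_upto E s) x U V"
begin

abbreviation W :: "real \<Rightarrow> 'h \<Rightarrow>\<^sub>L 'h" where "W \<equiv> qbm E"

text \<open>The cost of the fixed series. It need not be the projective norm: the proof uses only
  that it is finite and does not depend on the partition.\<close>

definition M :: real where "M = (\<Sum>k. norm (U k) * norm (V k))"

lemma summable_UV: "summable (\<lambda>k. norm (U k) * norm (V k))"
  using series by (simp add: tensor_series_def)

lemma M_nonneg: "0 \<le> M"
  unfolding M_def by (intro suminf_nonneg summable_UV) auto

lemma U_in: "U k \<in> norm_alg_upto E s" and V_in: "V k \<in> norm_alg_upto E s"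
  using series unfolding tensor_series_def by blast+

abbreviation ap :: "('h \<Rightarrow>\<^sub>L 'h) \<Rightarrow> 'h \<Rightarrow>\<^sub>L 'h" where
  "ap Y \<equiv> sharp (norm_alg_upto E s) x Y"

lemmas ap_add = sharp_add[OF norm_alg_upto_tensor series]
  and ap_diff = sharp_diff[OF norm_alg_upto_tensor series]
  and ap_scaleR = sharp_scaleR[OF norm_alg_upto_tensor series]
  and ap_sums = sharp_sums[OF norm_alg_upto_tensor _ series]

lemma norm_ap_le: "Y \<in> cops \<Longrightarrow> norm (ap Y) \<le> M * norm Y"
  unfolding M_def by (rule norm_sharp_le[OF norm_alg_upto_tensor series])

lemma ap_cops: "Y \<in> cops \<Longrightarrow> ap Y \<in> cops"
  using sharp_in[OF norm_alg_upto_tensor series, of cops Y]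
  by (simp add: unital_subalgebra_def csubspace_cops cops_compose closed_cops norm_alg_upto_cops)

lemma ap_in_alg: "s \<le> u \<Longrightarrow> Y \<in> norm_alg_upto E u \<Longrightarrow> ap Y \<in> norm_alg_upto E u"
  using norm_alg_upto_cops
  by (intro sharp_in[OF norm_alg_upto_tensor series norm_alg_upto_unital norm_alg_upto_closed norm_alg_upto_mono]) auto

definition B :: "('h \<Rightarrow>\<^sub>L 'h) \<Rightarrow> ('h \<Rightarrow>\<^sub>L 'h) \<Rightarrow> 'h \<Rightarrow>\<^sub>L 'h" where
  "B Y Z = ap Y o\<^sub>L Z"

lemma B_add_left: "Y \<in> cops \<Longrightarrow> Y' \<in> cops \<Longrightarrow> B (Y + Y') Z = B Y Z + B Y' Z"
  and B_diff_left: "Y \<in> cops \<Longrightarrow> Y' \<in> cops \<Longrightarrow> B (Y - Y') Z = B Y Z - B Y' Z"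
  and B_scaleR_left: "Y \<in> cops \<Longrightarrow> B (r *\<^sub>R Y) Z = r *\<^sub>R B Y Z"
  and B_add_right: "B Y (Z + Z') = B Y Z + B Y Z'"
  and B_diff_right: "B Y (Z - Z') = B Y Z - B Y Z'"
  and B_scaleR_right: "B Y (r *\<^sub>R Z) = r *\<^sub>R B Y Z"
  by (auto simp: B_def ap_add ap_diff ap_scaleR intro!: blinfun_eqI
      simp: blinfun.add_left blinfun.add_right blinfun.diff_left blinfun.diff_right blinfun.scaleR_left blinfun.scaleR_right)

lemmas B_simps = B_add_left B_diff_left B_scaleR_left B_add_right B_diff_right B_scaleR_right

lemma norm_B_le: "Y \<in> cops \<Longrightarrow> norm (B Y Z) \<le> M * norm Y * norm Z"
  unfolding B_def by (intro order_trans[OF norm_blinfun_compose] mult_right_mono norm_ap_le) auto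

lemma sum_B_sums:
  assumes X: "\<And>i. i \<in> I \<Longrightarrow> X i \<in> cops"
  shows "(\<lambda>k. U k o\<^sub>L (\<Sum>i\<in>I. X i o\<^sub>L V k o\<^sub>L Y i)) sums (\<Sum>i\<in>I. B (X i) (Y i))"
proof -
  have "(\<lambda>k. \<Sum>i\<in>I. (U k o\<^sub>L X i o\<^sub>L V k) o\<^sub>L Y i) sums (\<Sum>i\<in>I. B (X i) (Y i))"
    unfolding B_def
    by (intro sums_sum bounded_linear.sums[OF bounded_bilinear.bounded_linear_left[OF bounded_bilinear_blinfun_compose]] ap_sums X)
  moreover have "(\<Sum>i\<in>I. (U k o\<^sub>L X i o\<^sub>L V k) o\<^sub>L Y i) = U k o\<^sub>L (\<Sum>i\<in>I. X i o\<^sub>L V k o\<^sub>L Y i)" for k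
    by (rule blinfun_eqI) (simp add: blinfun.sum_left blinfun.sum_right)
  ultimately show ?thesis by simp
qed

text \<open>Each \<open>U k\<close> stands to the left of the whole finite sum and can be pulled
  out, so an estimate uniform over operators of the past extends to the tensor with factor
  \<open>M\<close>.\<close>

lemma norm_sum_B_le:
  assumes X: "\<And>i. i \<in> I \<Longrightarrow> X i \<in> cops"
    and le: "\<And>V. V \<in> norm_alg_upto E s \<Longrightarrow> norm (\<Sum>i\<in>I. X i o\<^sub>L V o\<^sub>L Y i) \<le> K * norm V"
  shows "norm (\<Sum>i\<in>I. B (X i) (Y i)) \<le> K * M"
proof -
  note sums = sum_B_sums[of I X Y, OF X]
  have le': "norm (U k o\<^sub>L (\<Sum>i\<in>I. X i o\<^sub>L V k o\<^sub>L Y i)) \<le> K * (norm (U k) * norm (V k))" for k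
  proof -
    have "norm (U k o\<^sub>L (\<Sum>i\<in>I. X i o\<^sub>L V k o\<^sub>L Y i)) \<le> norm (U k) * norm (\<Sum>i\<in>I. X i o\<^sub>L V k o\<^sub>L Y i)"
      by (rule norm_blinfun_compose)
    also have "\<dots> \<le> norm (U k) * (K * norm (V k))" by (intro mult_left_mono le V_in) auto
    finally show ?thesis by (simp add: mult_ac)
  qed
  have sK: "summable (\<lambda>k. K * (norm (U k) * norm (V k)))" by (intro summable_mult summable_UV)
  have sn: "summable (\<lambda>k. norm (U k o\<^sub>L (\<Sum>i\<in>I. X i o\<^sub>L V k o\<^sub>L Y i)))"
    by (rule summable_comparison_test'[OF sK, where N = 0]) (use le' in simp)
  have "norm (\<Sum>i\<in>I. B (X i) (Y i)) = norm (\<Sum>k. U k o\<^sub>L (\<Sum>i\<in>I. X i o\<^sub>L V k o\<^sub>L Y i))"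
    using sums_unique[OF sums] by simp
  also have "\<dots> \<le> (\<Sum>k. norm (U k o\<^sub>L (\<Sum>i\<in>I. X i o\<^sub>L V k o\<^sub>L Y i)))" by (rule summable_norm[OF sn])
  also have "\<dots> \<le> (\<Sum>k. K * (norm (U k) * norm (V k)))" by (intro suminf_le le' sn sK)
  also have "\<dots> = K * M" unfolding M_def by (rule suminf_mult[OF summable_UV])
  finally show ?thesis .
qed

text \<open>Clamping makes the cells outside \<open>[s, t]\<close> degenerate, so that every cell, including the first and the last,
  splits into two cells of the next level.\<close>

definition grid :: "nat \<Rightarrow> nat \<Rightarrow> real" where
  "grid n i = max s (min t (real i / 2 ^ n))"

text \<open>Rounding \<open>t\<close> up before multiplying by a power of two makes the number of
  cells double exactly at each level while the grid still reaches \<open>t\<close>.\<close>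

definition cells :: "nat \<Rightarrow> nat" where
  "cells n = nat \<lceil>t\<rceil> * 2 ^ n"

lemma grid_0 [simp]: "grid n 0 = s"
  using s_nonneg s_less_t by (simp add: grid_def)

lemma grid_cells [simp]: "grid n (cells n) = t"
proof -
  have "t \<le> real (nat \<lceil>t\<rceil>)" by (rule real_nat_ceiling_ge)
  then show ?thesis using s_less_t by (simp add: grid_def cells_def)
qed

lemma grid_mono: "i \<le> j \<Longrightarrow> grid n i \<le> grid n j"
  unfolding grid_def by (intro max.mono min.mono divide_right_mono) auto

lemma grid_step: "grid n (Suc i) - grid n i \<le> 1 / 2 ^ n"
proof -
  have "real (Suc i) / 2 ^ n = real i / 2 ^ n + 1 / 2 ^ n" by (simp add: add_divide_distrib)
  moreover have "(0::real) \<le> 1 / 2 ^ n" by simp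
  ultimately show ?thesis unfolding grid_def by linarith
qed

lemma grid_range: "s \<le> grid n i" "grid n i \<le> t"
  using s_less_t by (auto simp: grid_def)

lemma grid_nonneg: "0 \<le> grid n i"
  using grid_range(1)[of n i] s_nonneg by linarith

lemma grid_refine: "grid (Suc n) (2 * i) = grid n i"
  by (simp add: grid_def)

lemma cells_Suc: "cells (Suc n) = 2 * cells n"
  by (simp add: cells_def)

definition trap :: "nat \<Rightarrow> 'h \<Rightarrow>\<^sub>L 'h" where
  "trap n = (\<Sum>i<cells n. (1/2) *\<^sub>R B (W (grid n i) + W (grid n (Suc i)) - 2 *\<^sub>R W s) (W (grid n (Suc i)) - W (grid n i)))"

lemma sum_lessThan_double: "(\<Sum>j<2 * n. f j) = (\<Sum>i<n. f (2 * i) + f (Suc (2 * i)) :: 'z::comm_monoid_add)"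
  by (induction n) (simp_all add: add.assoc)

text \<open>For values P, Q, R at the ends and the middle of a cell the squares cancel and only B (Q
  - P) (R - Q) minus B (R - Q) (Q - P) remains, products over disjoint intervals.\<close>

lemma trap_refine:
  "trap (Suc n) - trap n = (1/2) *\<^sub>R
    ((\<Sum>i<cells n. B (W (grid (Suc n) (Suc (2 * i))) - W (grid n i)) (W (grid n (Suc i)) - W (grid (Suc n) (Suc (2 * i))))) -
     (\<Sum>i<cells n. B (W (grid n (Suc i)) - W (grid (Suc n) (Suc (2 * i)))) (W (grid (Suc n) (Suc (2 * i))) - W (grid n i))))"
proof -
  have alg: "(1/2) *\<^sub>R B (P + Q - 2 *\<^sub>R S) (Q - P) + (1/2) *\<^sub>R B (Q + R - 2 *\<^sub>R S) (R - Q) - (1/2) *\<^sub>R B (P + R - 2 *\<^sub>R S) (R - P) =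
      (1/2) *\<^sub>R (B (Q - P) (R - Q) - B (R - Q) (Q - P))"
    if "P \<in> cops" "Q \<in> cops" "R \<in> cops" "S \<in> cops" for P Q R S
    using that by (simp add: B_simps cops_add cops_diff cops_scaleR scaleR_diff_right scaleR_add_right)
  have refine: "grid (Suc n) (Suc (Suc (2 * i))) = grid n (Suc i)" for i
    using grid_refine[of n "Suc i"] by simp
  show ?thesis
    unfolding trap_def cells_Suc sum_lessThan_double sum_subtractf[symmetric] scaleR_sum_right grid_refine refine
    by (intro sum.cong refl alg) auto
qed

lemma grid_disjoint:
  assumes "i \<noteq> j" "\<And>i. grid n i \<le> a i \<and> a i \<le> b i \<and> b i \<le> grid n (Suc i)"
  shows "{a i<..b i} \<inter> {a j<..b j} = {}"
proof -
  have *: "{a i<..b i} \<inter> {a j<..b j} = {}" if "i < j" for i j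
  proof -
    have "grid n (Suc i) \<le> grid n j" using that by (intro grid_mono) auto
    then have "b i \<le> a j" using assms(2)[of i] assms(2)[of j] by linarith
    then show ?thesis by auto
  qed
  show ?thesis using assms(1) *[of i j] *[of j i] by (cases "i < j") auto
qed

lemma sum_grid_lengths_le:
  assumes "\<And>i. grid n i \<le> a i \<and> a i \<le> b i \<and> b i \<le> grid n (Suc i)"
  shows "(\<Sum>i<cells n. b i - a i) \<le> t - s"
proof -
  have "b i - a i \<le> grid n (Suc i) - grid n i" for i using assms[of i] by linarith
  then have "(\<Sum>i<cells n. b i - a i) \<le> (\<Sum>i<cells n. grid n (Suc i) - grid n i)" by (intro sum_mono)
  also have "\<dots> = t - s" by (simp add: sum_lessThan_telescope)
  finally show ?thesis .
qed

lemma orthogonal_family_grid: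
  assumes ab: "\<And>i. grid n i \<le> a i \<and> a i \<le> b i \<and> b i \<le> grid n (Suc i)"
  shows "orthogonal_family {..<cells n} (\<lambda>i. ind {a i<..b i}) (1 / 2 ^ n) (t - s)"
proof (rule orthogonal_family_intervals)
  show "0 \<le> a i \<and> a i \<le> b i" for i using ab[of i] grid_nonneg[of n i] by linarith
  show "b i - a i \<le> 1 / 2 ^ n" for i using ab[of i] grid_step[of n i] by linarith
  show "{a i<..b i} \<inter> {a j<..b j} = {}" if "i \<noteq> j" for i j using grid_disjoint[OF that ab] .
  show "(\<Sum>i<cells n. b i - a i) \<le> t - s" by (rule sum_grid_lengths_le[OF ab])
qed (use s_less_t in auto)

lemma norm_sum_B_increments_le:
  assumes ab: "\<And>i. grid n i \<le> a i \<and> a i \<le> b i \<and> b i \<le> grid n (Suc i)"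
    and cd: "\<And>i. grid n i \<le> c i \<and> c i \<le> d i \<and> d i \<le> grid n (Suc i)"
    and disj: "\<And>i. {a i<..b i} \<inter> {c i<..d i} = {}"
  shows "norm (\<Sum>i<cells n. B (W (b i) - W (a i)) (W (d i) - W (c i))) \<le>
    key_const * (1 / 2 ^ n + sqrt (1 / 2 ^ n * (t - s))) * M"
proof (rule norm_sum_B_le)
  have pos: "0 \<le> a i" "0 \<le> c i" for i using ab[of i] cd[of i] grid_nonneg[of n i] by linarith+
  have inc: "W (b i) - W (a i) = field (ind {a i<..b i})" "W (d i) - W (c i) = field (ind {c i<..d i})" for i
    using pos[of i] ab[of i] cd[of i] by (auto intro!: qbm_increment)
  have sl: "s \<le> a i" "s \<le> c i" for i using ab[of i] cd[of i] grid_range(1)[of n i] by linarith+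
  fix Z assume Z: "Z \<in> norm_alg_upto E s"
  show "norm (\<Sum>i<cells n. (W (b i) - W (a i)) o\<^sub>L Z o\<^sub>L (W (d i) - W (c i))) \<le>
      key_const * (1 / 2 ^ n + sqrt (1 / 2 ^ n * (t - s))) * norm Z"
    unfolding inc
    by (intro norm_sum_field_sandwich_le[OF Z orthogonal_family_grid[OF ab] _ orthogonal_family_grid[OF cd]]
        L2inner_ind_letters[OF s_nonneg] sl L2inner_ind_disjoint pos disj)
qed (intro cops_diff qbm_cops)

lemma norm_trap_step_le:
  "norm (trap (Suc n) - trap n) \<le> key_const * (1 / 2 ^ n + sqrt (1 / 2 ^ n * (t - s))) * M"
proof -
  have refine: "grid (Suc n) (Suc (Suc (2 * i))) = grid n (Suc i)" for i
    using grid_refine[of n "Suc i"] by simp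
  have mid: "grid n i \<le> grid (Suc n) (Suc (2 * i))" "grid (Suc n) (Suc (2 * i)) \<le> grid n (Suc i)" for i
    using grid_mono[of "2 * i" "Suc (2 * i)" "Suc n"] grid_mono[of "Suc (2 * i)" "Suc (Suc (2 * i))" "Suc n"]
    by (simp_all add: grid_refine refine)
  let ?K = "key_const * (1 / 2 ^ n + sqrt (1 / 2 ^ n * (t - s))) * M"
  have 1: "norm (\<Sum>i<cells n. B (W (grid (Suc n) (Suc (2 * i))) - W (grid n i)) (W (grid n (Suc i)) - W (grid (Suc n) (Suc (2 * i))))) \<le> ?K"
    by (rule norm_sum_B_increments_le) (use mid in auto)
  have 2: "norm (\<Sum>i<cells n. B (W (grid n (Suc i)) - W (grid (Suc n) (Suc (2 * i)))) (W (grid (Suc n) (Suc (2 * i))) - W (grid n i))) \<le> ?K"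
    by (rule norm_sum_B_increments_le) (use mid in auto)
  have half: "norm ((1/2) *\<^sub>R Z) \<le> K" if "norm Z \<le> K + K" for Z :: "'h \<Rightarrow>\<^sub>L 'h" and K
    using that by simp
  show ?thesis
    unfolding trap_refine by (rule half, rule order_trans[OF norm_triangle_ineq4 add_mono[OF 1 2]])
qed

lemma trap_convergent: "convergent trap"
proof -
  \<comment> \<open>The refinement step is of order 2^(-n/2), from the term
    \<open>sqrt (\<epsilon> * T)\<close>; the mesh itself is the square of this rate and is
    absorbed.\<close>
  define r where "r = sqrt (1 / 2 :: real)"
  have r: "0 \<le> r" "r < 1" by (auto simp: r_def real_sqrt_lt_1_iff)
  have rn: "sqrt (1 / 2 ^ n) = r ^ n" for n by (simp add: r_def real_sqrt_power[symmetric] power_one_over)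
  have "norm (trap (Suc n) - trap n) \<le> key_const * (1 + sqrt (t - s)) * M * r ^ n" for n
  proof -
    have "1 / 2 ^ n = r ^ n * r ^ n" using rn[of n] by (metis abs_of_nonneg divide_nonneg_nonneg real_sqrt_mult_self zero_le_one zero_le_numeral zero_le_power)
    also have "\<dots> \<le> r ^ n * 1" using r by (intro mult_left_mono power_le_one) auto
    finally have "1 / 2 ^ n + sqrt (1 / 2 ^ n * (t - s)) \<le> r ^ n + r ^ n * sqrt (t - s)"
      unfolding real_sqrt_mult rn by simp
    then have "key_const * (1 / 2 ^ n + sqrt (1 / 2 ^ n * (t - s))) * M \<le> key_const * (r ^ n + r ^ n * sqrt (t - s)) * M"
      using key_const_nonneg M_nonneg by (intro mult_right_mono mult_left_mono) auto
    then show ?thesis using norm_trap_step_le[of n] by (simp add: algebra_simps)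
  qed
  note step = this
  have "summable (\<lambda>n. key_const * (1 + sqrt (t - s)) * M * r ^ n)"
    using r by (intro summable_mult summable_geometric) auto
  from summable_comparison_test'[OF this step] have "summable (\<lambda>n. trap (Suc n) - trap n)" .
  then have "(\<lambda>n. \<Sum>i<n. trap (Suc i) - trap i) \<longlonglongrightarrow> (\<Sum>n. trap (Suc n) - trap n)"
    by (rule summable_LIMSEQ)
  then have "(\<lambda>n. trap n - trap 0) \<longlonglongrightarrow> (\<Sum>n. trap (Suc n) - trap n)"
    by (simp add: sum_lessThan_telescope)
  then have "(\<lambda>n. (trap n - trap 0) + trap 0) \<longlonglongrightarrow> (\<Sum>n. trap (Suc n) - trap n) + trap 0"
    by (intro tendsto_add tendsto_const)
  then show ?thesis unfolding convergent_def by auto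
qed

section \<open>The area of the interpolated path as a trapezoidal sum\<close>

lemma dyadic_qbm_cell:
  assumes "real i / 2 ^ n \<le> u" "u \<le> real (Suc i) / 2 ^ n"
  shows "dyadic_qbm E n u = W (real i / 2 ^ n) + (2 ^ n * u - real i) *\<^sub>R (W (real (Suc i) / 2 ^ n) - W (real i / 2 ^ n))"
proof (cases "u = real (Suc i) / 2 ^ n")
  case True
  \<comment> \<open>At the right end point the floor already selects the next cell, whose
    interpolation has the same value there.\<close>
  have "\<lfloor>2 ^ n * u\<rfloor> = int (Suc i)" using True by simp
  then show ?thesis using True by (simp add: dyadic_qbm_def Let_def)
next
  case False
  then have lt: "u < real (Suc i) / 2 ^ n" using assms(2) by (rule le_neq_trans[rotated])
  have "real i \<le> 2 ^ n * u" using assms(1) by (simp add: pos_divide_le_eq mult.commute)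
  moreover have "2 ^ n * u < real i + 1" using lt by (simp add: pos_less_divide_eq mult.commute add.commute)
  ultimately have "\<lfloor>2 ^ n * u\<rfloor> = int i" by (simp add: floor_eq_iff)
  then show ?thesis by (simp add: dyadic_qbm_def Let_def add.commute)
qed

lemma dyadic_qbm_cops: "dyadic_qbm E n u \<in> cops"
  unfolding dyadic_qbm_def Let_def by (intro cops_add cops_scaleR cops_diff) auto

definition levy_integrand :: "nat \<Rightarrow> real \<Rightarrow> 'h \<Rightarrow>\<^sub>L 'h" where
  "levy_integrand n u = B (dyadic_qbm E n u - dyadic_qbm E n s) (vector_derivative (dyadic_qbm E n) (at u))"

lemma levy_integrand_cell:
  assumes ab: "real i / 2 ^ n \<le> a" "a \<le> b" "b \<le> real (Suc i) / 2 ^ n"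
  shows "(levy_integrand n has_integral
    (1/2) *\<^sub>R B (dyadic_qbm E n a + dyadic_qbm E n b - 2 *\<^sub>R dyadic_qbm E n s) (dyadic_qbm E n b - dyadic_qbm E n a)) {a..b}"
proof -
  define P where "P = W (real i / 2 ^ n) - real i *\<^sub>R (W (real (Suc i) / 2 ^ n) - W (real i / 2 ^ n))"
  define D where "D = 2 ^ n *\<^sub>R (W (real (Suc i) / 2 ^ n) - W (real i / 2 ^ n))"
  define S where "S = dyadic_qbm E n s"
  have c: "P \<in> cops" "D \<in> cops" "S \<in> cops"
    by (auto simp: P_def D_def S_def intro!: cops_diff cops_scaleR dyadic_qbm_cops)
  have lin: "dyadic_qbm E n u = P + u *\<^sub>R D" if "u \<in> {real i / 2 ^ n..real (Suc i) / 2 ^ n}" for u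
    using dyadic_qbm_cell[of i n u] that unfolding P_def D_def
    by (simp add: scaleR_diff_left mult.commute)
  \<comment> \<open>On a cell the path is affine, hence so is the integrand, and this is its
    antiderivative.\<close>
  define G where "G u = u *\<^sub>R B (P - S) D + (u\<^sup>2 / 2) *\<^sub>R B D D" for u
  have int: "((\<lambda>u. B (P - S) D + u *\<^sub>R B D D) has_integral (G b - G a)) {a..b}"
  proof (rule fundamental_theorem_of_calculus[OF ab(2)])
    fix u assume "u \<in> {a..b}"
    show "(G has_vector_derivative B (P - S) D + u *\<^sub>R B D D) (at u within {a..b})"
      unfolding G_def by (auto intro!: derivative_eq_intros has_vector_derivative_scaleR simp: has_real_derivative_iff_has_vector_derivative[symmetric])
  qed
  \<comment> \<open>The path may have a kink at an end point of a cell, so \<open>a\<close> and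
    \<open>b\<close> are left out; two points do not change the integral.\<close>
  have eq: "levy_integrand n u = B (P - S) D + u *\<^sub>R B D D" if u: "u \<in> {a..b} - {a, b}" for u
  proof -
    have uu: "u \<in> {real i / 2 ^ n<..<real (Suc i) / 2 ^ n}" using u ab by auto
    have "((\<lambda>u. P + u *\<^sub>R D) has_vector_derivative D) (at u)"
      by (auto intro!: derivative_eq_intros)
    then have "(dyadic_qbm E n has_vector_derivative D) (at u)"
      by (rule has_vector_derivative_transform_within_open[where S = "{real i / 2 ^ n<..<real (Suc i) / 2 ^ n}"])
        (use uu lin in auto)
    then have "vector_derivative (dyadic_qbm E n) (at u) = D" by (rule vector_derivative_at)
    moreover have "dyadic_qbm E n u = P + u *\<^sub>R D" using uu by (intro lin) auto
    ultimately show ?thesis using c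
      by (simp add: levy_integrand_def S_def[symmetric] B_simps cops_add cops_scaleR)
  qed
  have "(levy_integrand n has_integral (G b - G a)) {a..b}"
    by (rule has_integral_spike_finite[where S = "{a, b}", OF _ eq int]) simp_all
  moreover have "G b - G a = (1/2) *\<^sub>R B (dyadic_qbm E n a + dyadic_qbm E n b - 2 *\<^sub>R dyadic_qbm E n s) (dyadic_qbm E n b - dyadic_qbm E n a)"
  proof -
    have "dyadic_qbm E n a = P + a *\<^sub>R D" "dyadic_qbm E n b = P + b *\<^sub>R D" using ab by (auto intro!: lin)
    moreover have "(1/2) *\<^sub>R B (P + a *\<^sub>R D + (P + b *\<^sub>R D) - 2 *\<^sub>R S) (P + b *\<^sub>R D - (P + a *\<^sub>R D)) = G b - G a"
    proof -
      have 1: "P + a *\<^sub>R D + (P + b *\<^sub>R D) - 2 *\<^sub>R S = 2 *\<^sub>R (P - S) + (a + b) *\<^sub>R D"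
        by (simp add: algebra_simps scaleR_2)
      have 2: "P + b *\<^sub>R D - (P + a *\<^sub>R D) = (b - a) *\<^sub>R D" by (simp add: algebra_simps)
      have "(1/2) *\<^sub>R B (2 *\<^sub>R (P - S) + (a + b) *\<^sub>R D) ((b - a) *\<^sub>R D) =
          (b - a) *\<^sub>R B (P - S) D + ((b - a) * (a + b) / 2) *\<^sub>R B D D"
        using c by (simp add: B_add_left B_scaleR_left B_scaleR_right cops_scaleR cops_diff scaleR_add_right)
      also have "\<dots> = G b - G a"
        by (simp add: G_def scaleR_diff_left power2_eq_square algebra_simps diff_divide_distrib)
      finally show ?thesis unfolding 1 2 .
    qed
    ultimately show ?thesis by (simp add: S_def)
  qed
  ultimately show ?thesis by simp
qed

lemma grid_cell:
  assumes "grid n i < grid n (Suc i)"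
  shows "real i / 2 ^ n \<le> grid n i" "grid n (Suc i) \<le> real (Suc i) / 2 ^ n"
proof -
  have "s < real (Suc i) / 2 ^ n" "real i / 2 ^ n < t"
    using assms s_less_t unfolding grid_def by linarith+
  then show "real i / 2 ^ n \<le> grid n i" "grid n (Suc i) \<le> real (Suc i) / 2 ^ n"
    unfolding grid_def by linarith+
qed

lemma levy_area_approx_eq:
  "levy_area_approx E n s t x = (\<Sum>i<cells n. (1/2) *\<^sub>R
    B (dyadic_qbm E n (grid n i) + dyadic_qbm E n (grid n (Suc i)) - 2 *\<^sub>R dyadic_qbm E n s)
      (dyadic_qbm E n (grid n (Suc i)) - dyadic_qbm E n (grid n i)))"
proof -
  let ?T = "\<lambda>i. (1/2) *\<^sub>R B (dyadic_qbm E n (grid n i) + dyadic_qbm E n (grid n (Suc i)) - 2 *\<^sub>R dyadic_qbm E n s)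
      (dyadic_qbm E n (grid n (Suc i)) - dyadic_qbm E n (grid n i))"
  have cell: "(levy_integrand n has_integral ?T i) {grid n i..grid n (Suc i)}" for i
  proof (cases "grid n i < grid n (Suc i)")
    case True
    then show ?thesis using grid_cell[OF True] by (intro levy_integrand_cell) auto
  next
    case False
    then have eq: "grid n (Suc i) = grid n i" using grid_mono[of i "Suc i" n] by linarith
    have "(levy_integrand n has_integral 0) {grid n i..grid n i}"
      using has_integral_refl(1)[of "levy_integrand n" "grid n i"] by simp
    moreover have "B Y 0 = 0" for Y by (simp add: B_def)
    ultimately show ?thesis unfolding eq by simp
  qed
  have "(levy_integrand n has_integral (\<Sum>i<m. ?T i)) {s..grid n m}" for m
  proof (induction m)
    case 0
    then show ?case using has_integral_refl(1)[of "levy_integrand n" s] by simp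
  next
    case (Suc m)
    have "(levy_integrand n has_integral (\<Sum>i<m. ?T i) + ?T m) {s..grid n (Suc m)}"
      by (rule has_integral_combine[OF grid_range(1) grid_mono Suc.IH cell]) simp
    then show ?case by simp
  qed
  from this[of "cells n"] have "(levy_integrand n has_integral (\<Sum>i<cells n. ?T i)) {s..t}" by simp
  then have "integral {s..t} (levy_integrand n) = (\<Sum>i<cells n. ?T i)" by (rule integral_unique)
  moreover have "levy_area_approx E n s t x = integral {s..t} (levy_integrand n)"
    unfolding levy_area_approx_def levy_integrand_def B_def by simp
  ultimately show ?thesis by simp
qed

end

context levy
begin

text \<open>The idea is summation by parts, which moves every increment onto the difference of the two paths.\<close>

lemma norm_trap_diff_le:
  fixes X Y :: "nat \<Rightarrow> 'h \<Rightarrow>\<^sub>L 'h"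
  assumes X: "\<And>i. X i \<in> cops" and Y: "\<And>i. Y i \<in> cops"
    and R: "\<And>i. norm (X i - X 0) \<le> R"
    and D: "(\<Sum>i<N. norm ((Y (Suc i) - X (Suc i)) - (Y i - X i))) \<le> D"
  shows "norm ((\<Sum>i<N. (1/2) *\<^sub>R B (Y i + Y (Suc i) - 2 *\<^sub>R Y 0) (Y (Suc i) - Y i)) -
      (\<Sum>i<N. (1/2) *\<^sub>R B (X i + X (Suc i) - 2 *\<^sub>R X 0) (X (Suc i) - X i))) \<le> M * D * (3 * R + D)"
proof -
  define x where "x i = X i - X 0" for i
  define d where "d i = (Y i - Y 0) - x i" for i
  have xc: "x i \<in> cops" and dc: "d i \<in> cops" for i
    unfolding x_def d_def by (intro cops_diff X Y)+
  have d_step: "d (Suc i) - d i = (Y (Suc i) - X (Suc i)) - (Y i - X i)" for i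
    by (simp add: d_def x_def)
  have d0: "d 0 = 0" and x0: "x 0 = 0" by (simp_all add: d_def x_def)
  have R0: "0 \<le> R" using R[of 0] by simp
  have D0: "0 \<le> D" using D sum_nonneg[of "{..<N}" "\<lambda>i. norm ((Y (Suc i) - X (Suc i)) - (Y i - X i))"] by simp
  have d_le: "norm (d i) \<le> D" if "i \<le> N" for i
  proof -
    have "norm (d i) = norm (\<Sum>j<i. d (Suc j) - d j)" by (simp add: sum_lessThan_telescope d0)
    also have "\<dots> \<le> (\<Sum>j<i. norm (d (Suc j) - d j))" by (rule norm_sum)
    also have "\<dots> \<le> (\<Sum>j<N. norm (d (Suc j) - d j))" using that by (intro sum_mono2) auto
    finally show ?thesis using D unfolding d_step by simp
  qed
  have x_le: "norm (x i) \<le> R" for i unfolding x_def by (rule R)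
  have half: "(1/2) *\<^sub>R p - (1/2) *\<^sub>R r = (1/2) *\<^sub>R r - (1/2) *\<^sub>R p + (p - r)" for p r :: "'h \<Rightarrow>\<^sub>L 'h"
  proof -
    define P R where "P = (1/2) *\<^sub>R p" and "R = (1/2) *\<^sub>R r"
    have "p = P + P" "r = R + R" by (simp_all add: P_def R_def flip: scaleR_add_left)
    then show ?thesis by (simp flip: P_def R_def)
  qed
  \<comment> \<open>Half of B (d i + d (i+1)) (x (i+1) - x i) is traded for the increment of B (d i)
    (x i) minus half of B (d (i+1) - d i) (x i + x (i+1)). After this every remaining product
    contains an increment of \<open>d\<close>, and the rest telescopes.\<close>
  have step: "(1/2) *\<^sub>R B (Y i + Y (Suc i) - 2 *\<^sub>R Y 0) (Y (Suc i) - Y i) -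
      (1/2) *\<^sub>R B (X i + X (Suc i) - 2 *\<^sub>R X 0) (X (Suc i) - X i) =
      (1/2) *\<^sub>R B (x i + x (Suc i) + (d i + d (Suc i))) (d (Suc i) - d i) -
      (1/2) *\<^sub>R B (d (Suc i) - d i) (x i + x (Suc i)) +
      (B (d (Suc i)) (x (Suc i)) - B (d i) (x i))" for i
  proof -
    have y: "Y i + Y (Suc i) - 2 *\<^sub>R Y 0 = x i + x (Suc i) + (d i + d (Suc i))"
      "Y (Suc i) - Y i = (x (Suc i) - x i) + (d (Suc i) - d i)"
      "X i + X (Suc i) - 2 *\<^sub>R X 0 = x i + x (Suc i)" "X (Suc i) - X i = x (Suc i) - x i"
      by (simp_all add: d_def x_def scaleR_2)
    show ?thesis
      unfolding y using xc dc
      by (simp add: B_simps cops_add cops_diff scaleR_add_right scaleR_diff_right) (rule half)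
  qed
  have tel: "(\<Sum>i<N. B (d (Suc i)) (x (Suc i)) - B (d i) (x i)) = B (d N) (x N)"
    using sum_lessThan_telescope[of "\<lambda>i. B (d i) (x i)" N] by (simp add: x0 B_def)
  have "norm ((\<Sum>i<N. (1/2) *\<^sub>R B (Y i + Y (Suc i) - 2 *\<^sub>R Y 0) (Y (Suc i) - Y i)) -
      (\<Sum>i<N. (1/2) *\<^sub>R B (X i + X (Suc i) - 2 *\<^sub>R X 0) (X (Suc i) - X i))) =
      norm ((\<Sum>i<N. (1/2) *\<^sub>R B (x i + x (Suc i) + (d i + d (Suc i))) (d (Suc i) - d i) -
      (1/2) *\<^sub>R B (d (Suc i) - d i) (x i + x (Suc i))) + B (d N) (x N))"
    unfolding sum_subtractf[symmetric] step sum.distrib tel by (rule refl)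
  also have "\<dots> \<le> (\<Sum>i<N. M * (2 * R + D) * norm (d (Suc i) - d i)) + M * D * R"
  proof (intro order_trans[OF norm_triangle_ineq] add_mono order_trans[OF norm_sum] sum_mono)
    fix i assume "i \<in> {..<N}"
    then have i: "i \<le> N" "Suc i \<le> N" by auto
    have n: "norm (x i + x (Suc i)) \<le> 2 * R" "norm (d i + d (Suc i)) \<le> 2 * D"
      using norm_triangle_ineq[of "x i" "x (Suc i)"] norm_triangle_ineq[of "d i" "d (Suc i)"]
        x_le[of i] x_le[of "Suc i"] d_le[OF i(1)] d_le[OF i(2)] by linarith+
    then have n': "norm (x i + x (Suc i) + (d i + d (Suc i))) \<le> 2 * R + 2 * D"
      using norm_triangle_ineq[of "x i + x (Suc i)" "d i + d (Suc i)"] by linarith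
    have 1: "norm (B (x i + x (Suc i) + (d i + d (Suc i))) (d (Suc i) - d i)) \<le> M * (2 * R + 2 * D) * norm (d (Suc i) - d i)"
      by (rule order_trans[OF norm_B_le]) (use xc dc n' M_nonneg in \<open>auto intro!: cops_add mult_right_mono mult_left_mono\<close>)
    have 2: "norm (B (d (Suc i) - d i) (x i + x (Suc i))) \<le> M * norm (d (Suc i) - d i) * (2 * R)"
      by (rule order_trans[OF norm_B_le]) (use xc dc n M_nonneg in \<open>auto intro!: cops_diff mult_left_mono\<close>)
    show "norm ((1/2) *\<^sub>R B (x i + x (Suc i) + (d i + d (Suc i))) (d (Suc i) - d i) -
      (1/2) *\<^sub>R B (d (Suc i) - d i) (x i + x (Suc i))) \<le> M * (2 * R + D) * norm (d (Suc i) - d i)"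
      using 1 2 by (intro order_trans[OF norm_triangle_ineq4]) (simp add: algebra_simps)
  next
    show "norm (B (d N) (x N)) \<le> M * D * R"
      by (rule order_trans[OF norm_B_le[OF dc]]) (use M_nonneg d_le[of N] x_le[of N] D0 in \<open>auto intro!: mult_mono\<close>)
  qed
  also have "(\<Sum>i<N. M * (2 * R + D) * norm (d (Suc i) - d i)) = M * (2 * R + D) * (\<Sum>i<N. norm (d (Suc i) - d i))"
    by (simp add: sum_distrib_left)
  also have "\<dots> \<le> M * (2 * R + D) * D"
    using D M_nonneg R0 D0 unfolding d_step by (intro mult_left_mono) auto
  finally show ?thesis by (simp add: algebra_simps)
qed

lemma norm_dyadic_qbm_diff_le:
  assumes "0 \<le> u"
  shows "norm (dyadic_qbm E n u - W u) \<le> 4 * sqrt (Cq * (1 / 2 ^ n))"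
proof -
  define i where "i = nat \<lfloor>2 ^ n * u\<rfloor>"
  have i: "real i \<le> 2 ^ n * u" "2 ^ n * u \<le> real i + 1"
    using assms by (auto simp: i_def)
  have ab: "real i / 2 ^ n \<le> u" "u \<le> real (Suc i) / 2 ^ n"
    using i by (simp_all add: pos_divide_le_eq pos_le_divide_eq mult.commute add.commute)
  have eq: "real (Suc i) / 2 ^ n - real i / 2 ^ n = 1 / 2 ^ n" by (simp add: add_divide_distrib)
  have inc: "norm (W d - W c) \<le> 2 * sqrt (Cq * (1 / 2 ^ n))"
    if "0 \<le> c" "c \<le> d" "d - c \<le> 1 / 2 ^ n" for c d
    using norm_qbm_increment_le[OF that(1,2)] that(3) Cq_pos
    by (elim order_trans) (intro mult_left_mono real_sqrt_le_mono; simp)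
  define \<theta> where "\<theta> = 2 ^ n * u - real i"
  have \<theta>: "0 \<le> \<theta>" "\<theta> \<le> 1" using i by (auto simp: \<theta>_def)
  let ?D = "W (real (Suc i) / 2 ^ n) - W (real i / 2 ^ n)"
  have "dyadic_qbm E n u - W u = \<theta> *\<^sub>R ?D - (W u - W (real i / 2 ^ n))"
    using dyadic_qbm_cell[OF ab] by (simp add: \<theta>_def)
  then have "norm (dyadic_qbm E n u - W u) \<le> norm (\<theta> *\<^sub>R ?D) + norm (W u - W (real i / 2 ^ n))"
    by (simp only: norm_triangle_ineq4)
  also have "norm (\<theta> *\<^sub>R ?D) \<le> norm ?D" using \<theta> by (simp add: mult_left_le_one_le)
  also have "norm ?D \<le> 2 * sqrt (Cq * (1 / 2 ^ n))"
    using eq by (intro inc) (auto intro: divide_right_mono)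
  also have "norm (W u - W (real i / 2 ^ n)) \<le> 2 * sqrt (Cq * (1 / 2 ^ n))"
    using ab eq by (intro inc) auto
  finally show ?thesis by simp
qed

text \<open>On the clamped grid the interpolation differs from the Brownian motion at most at \<open>s\<close> and \<open>t\<close>.\<close>

lemma dyadic_qbm_grid_variation:
  "(\<Sum>i<cells n. norm ((dyadic_qbm E n (grid n (Suc i)) - W (grid n (Suc i))) - (dyadic_qbm E n (grid n i) - W (grid n i)))) \<le>
    8 * sqrt (Cq * (1 / 2 ^ n))"
proof -
  define e where "e u = dyadic_qbm E n u - W u" for u
  define first where "first i = (if grid n i = s then 1 else 0 :: real)" for i
  define final where "final i = (if grid n i = t then 1 else 0 :: real)" for i
  have e: "e (grid n i) = first i *\<^sub>R e s + final i *\<^sub>R e t" for i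
  proof (cases "grid n i = s \<or> grid n i = t")
    case True
    then show ?thesis using s_less_t by (auto simp: first_def final_def)
  next
    case False
    then have "grid n i = real i / 2 ^ n" unfolding grid_def by linarith
    moreover have "dyadic_qbm E n (real i / 2 ^ n) = W (real i / 2 ^ n)"
      using dyadic_qbm_cell[of i n "real i / 2 ^ n"] by (simp add: divide_right_mono)
    ultimately show ?thesis using False by (simp add: first_def final_def e_def)
  qed
  \<comment> \<open>Along the grid \<open>first\<close> falls from 1 to 0 and \<open>final\<close>
    rises from 0 to 1, so their variations telescope and leave the errors at \<open>s\<close> and
    \<open>t\<close> once each.\<close>
  have mono: "first (Suc i) \<le> first i" "final i \<le> final (Suc i)" for i
    using grid_mono[of i "Suc i" n] grid_range[of n i] grid_range[of n "Suc i"]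
    by (auto simp: first_def final_def)
  have "norm (e (grid n (Suc i)) - e (grid n i)) \<le> (first i - first (Suc i)) * norm (e s) + (final (Suc i) - final i) * norm (e t)" for i
  proof -
    have "e (grid n (Suc i)) - e (grid n i) = (final (Suc i) - final i) *\<^sub>R e t - (first i - first (Suc i)) *\<^sub>R e s"
      unfolding e by (simp add: scaleR_diff_left)
    then show ?thesis using norm_triangle_ineq4[of "(final (Suc i) - final i) *\<^sub>R e t" "(first i - first (Suc i)) *\<^sub>R e s"] mono[of i]
      by simp
  qed
  then have "(\<Sum>i<cells n. norm (e (grid n (Suc i)) - e (grid n i))) \<le>
      (\<Sum>i<cells n. (first i - first (Suc i)) * norm (e s) + (final (Suc i) - final i) * norm (e t))"
    by (intro sum_mono)
  also have "\<dots> = (first 0 - first (cells n)) * norm (e s) + (final (cells n) - final 0) * norm (e t)"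
    unfolding sum.distrib sum_distrib_right[symmetric] sum_lessThan_telescope sum_lessThan_telescope' by simp
  also have "\<dots> = norm (e s) + norm (e t)" using s_less_t by (simp add: first_def final_def)
  also have "\<dots> \<le> 8 * sqrt (Cq * (1 / 2 ^ n))"
    using norm_dyadic_qbm_diff_le[of s n] norm_dyadic_qbm_diff_le[of t n] s_nonneg s_less_t by (simp add: e_def)
  finally show ?thesis by (simp add: e_def)
qed

lemma levy_area_approx_trap: "(\<lambda>n. levy_area_approx E n s t x - trap n) \<longlonglongrightarrow> 0"
proof (rule Lim_null_comparison)
  define R where "R = 2 * sqrt (Cq * (t - s))"
  let ?D = "\<lambda>n. 8 * sqrt (Cq * (1 / 2 ^ n))"
  have "norm (levy_area_approx E n s t x - trap n) \<le> M * ?D n * (3 * R + ?D n)" for n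
  proof -
    have R: "norm (W (grid n i) - W (grid n 0)) \<le> R" for i
      using norm_qbm_increment_le[OF s_nonneg grid_range(1)[of n i]] grid_range(2)[of n i] Cq_pos unfolding R_def
      unfolding grid_0 by (elim order_trans) (auto intro!: mult_left_mono)
    show ?thesis
      using norm_trap_diff_le[OF _ dyadic_qbm_cops R dyadic_qbm_grid_variation]
      by (simp add: levy_area_approx_eq trap_def)
  qed
  then show "\<forall>\<^sub>F n in sequentially. norm (levy_area_approx E n s t x - trap n) \<le> M * ?D n * (3 * R + ?D n)" by simp
  have "(\<lambda>n. 1 / 2 ^ n :: real) \<longlonglongrightarrow> 0"
    by (rule LIMSEQ_divide_realpow_zero) simp
  then have "(\<lambda>n. M * ?D n * (3 * R + ?D n)) \<longlonglongrightarrow> M * (8 * sqrt (Cq * 0)) * (3 * R + 8 * sqrt (Cq * 0))"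
    by (intro tendsto_intros)
  then show "(\<lambda>n. M * ?D n * (3 * R + ?D n)) \<longlonglongrightarrow> 0" by simp
qed

lemma trap_tendsto: "trap \<longlonglongrightarrow> stratonovich_levy_area E s t x"
proof -
  obtain Z where Z: "trap \<longlonglongrightarrow> Z" using trap_convergent by (auto simp: convergent_def)
  have "(\<lambda>n. levy_area_approx E n s t x) \<longlonglongrightarrow> Z"
    using tendsto_add[OF levy_area_approx_trap Z] by simp
  then show ?thesis using Z by (simp add: stratonovich_levy_area_def limI)
qed

end

section \<open>The product Ito integral\<close>

lemma interval_Int_clamp:
  fixes a b c d :: real
  assumes "a \<le> b" "c \<le> d"
  shows "{a<..b} \<inter> {c<..d} = {max a (min b c)<..max a (min b d)}"
  using assms by (auto simp: max_def min_def)

context q_fock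
begin

lemma L2inner_ind_Int:
  assumes "0 \<le> a" "a \<le> b" "c \<le> d"
  shows "Re (L2inner (ind ({a<..b} \<inter> {c<..d})) (ind ({a<..b} \<inter> {c<..d}))) = max a (min b d) - max a (min b c)"
  using assms unfolding interval_Int_clamp[OF assms(2,3)] by (subst L2inner_ind_self) auto

text \<open>Clamping the points \<open>r j\<close> to \<open>[a, b]\<close> makes both sums
  telescope; a cell that misses the interval becomes degenerate.\<close>

lemma
  assumes ab: "0 \<le> a" "a \<le> b" and r: "\<And>j. j < N \<Longrightarrow> r j \<le> r (Suc j)" "r 0 \<le> a" "b \<le> r N"
  shows creation_ind_subdivide:
      "creation E (ind {a<..b}) = (\<Sum>j<N. creation E (ind ({a<..b} \<inter> {r j<..r (Suc j)})))" (is ?A)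
    and sum_L2inner_ind_subdivide:
      "(\<Sum>j<N. Re (L2inner (ind ({a<..b} \<inter> {r j<..r (Suc j)})) (ind ({a<..b} \<inter> {r j<..r (Suc j)})))) = b - a" (is ?B)
proof -
  define c where "c j = max a (min b (r j))" for j
  have c: "c 0 = a" "c N = b" using ab r(2,3) by (auto simp: c_def)
  have c_mono: "0 \<le> c j" "c j \<le> c (Suc j)" if "j < N" for j
    using ab r(1)[OF that] by (auto simp: c_def)
  have "(\<Sum>j<N. creation E (ind ({a<..b} \<inter> {r j<..r (Suc j)}))) =
      (\<Sum>j<N. creation E (ind {0..c (Suc j)}) - creation E (ind {0..c j}))"
  proof (rule sum.cong[OF refl])
    fix j assume "j \<in> {..<N}"
    then have j: "j < N" by simp
    show "creation E (ind ({a<..b} \<inter> {r j<..r (Suc j)})) = creation E (ind {0..c (Suc j)}) - creation E (ind {0..c j})"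
      unfolding interval_Int_clamp[OF ab(2) r(1)[OF j]] c_def[symmetric] by (rule creation_ind_diff[OF c_mono[OF j]])
  qed
  also have "\<dots> = creation E (ind {0..c N}) - creation E (ind {0..c 0})" by (rule sum_lessThan_telescope)
  also have "\<dots> = creation E (ind {a<..b})" unfolding c by (rule creation_ind_diff[OF ab, symmetric])
  finally show ?A by simp
  have "(\<Sum>j<N. Re (L2inner (ind ({a<..b} \<inter> {r j<..r (Suc j)})) (ind ({a<..b} \<inter> {r j<..r (Suc j)})))) =
      (\<Sum>j<N. c (Suc j) - c j)"
    unfolding c_def by (intro sum.cong refl L2inner_ind_Int ab r(1)) simp
  also have "\<dots> = b - a" unfolding sum_lessThan_telescope c ..
  finally show ?B .
qed

end

context levy
begin

text \<open>The adjoint integrand applied to the vacuum, which carries the whole \<open>L\<^sup>2\<close> norm.\<close>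

definition past :: "real \<Rightarrow> 'h" where
  "past u = cadjoint (ap (W u - W s)) \<cdot> E []"

lemma increment_in: "s \<le> u \<Longrightarrow> W u - W s \<in> norm_alg_upto E u"
  using s_nonneg by (intro csubspace_diff[OF norm_alg_upto_csubspace] norm_alg_upto_qbm) auto

lemma past_in: "s \<le> u \<Longrightarrow> past u \<in> fock_upto u"
  unfolding past_def
  by (intro vn_alg_upto_fock_upto[OF _ fock_upto_vacuum] subsetD[OF norm_alg_upto_vn] norm_alg_upto_adjoint ap_in_alg increment_in)

text \<open>Increments of the process have operator norm of order the square root of their length,
  so the integrand is Hoelder continuous of order 1/2. This gives the rate at which Ito sums
  converge.\<close>

lemma norm_past_diff_le:
  assumes "0 \<le> u" "u \<le> v"
  shows "norm (past v - past u) \<le> M * (2 * sqrt (Cq * (v - u)))"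
proof -
  have "past v - past u = cadjoint (ap (W v - W u)) \<cdot> E []"
  proof -
    have "ap (W v - W u) = ap (W v - W s) - ap (W u - W s)"
      using ap_diff[of "W v - W s" "W u - W s"] by (simp add: cops_diff)
    then show ?thesis by (simp add: past_def cadjoint_diff ap_cops cops_diff blinfun.diff_left)
  qed
  also have "norm \<dots> \<le> norm (cadjoint (ap (W v - W u)))" by (rule norm_vacuum_apply_le)
  also have "\<dots> = norm (ap (W v - W u))" by (intro norm_cadjoint ap_cops cops_diff) auto
  also have "\<dots> \<le> M * norm (W v - W u)" by (intro norm_ap_le cops_diff) auto
  also have "\<dots> \<le> M * (2 * sqrt (Cq * (v - u)))"
    by (intro mult_left_mono norm_qbm_increment_le assms M_nonneg)
  finally show ?thesis .
qed

definition ito_sum :: "nat \<Rightarrow> (nat \<Rightarrow> real) \<Rightarrow> 'h \<Rightarrow>\<^sub>L 'h" where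
  "ito_sum N p = (\<Sum>i<N. B (W (p i) - W s) (W (p (Suc i)) - W (p i)))"

text \<open>Weakly increasing, so that the clamped dyadic grid qualifies.\<close>

definition partition :: "nat \<Rightarrow> (nat \<Rightarrow> real) \<Rightarrow> real \<Rightarrow> bool" where
  "partition N p \<delta> \<longleftrightarrow> p 0 = s \<and> p N = t \<and> (\<forall>i<N. p i \<le> p (Suc i) \<and> p (Suc i) - p i \<le> \<delta>)"

lemma partition_mono:
  assumes p: "partition N p \<delta>" and ij: "i \<le> j" "j \<le> N"
  shows "p i \<le> p j"
  using ij
proof (induction rule: dec_induct)
  case (step k)
  then show ?case using p by (auto simp: partition_def dest: spec[of _ k])
qed simp

lemma partition_range:
  assumes p: "partition N p \<delta>" and i: "i \<le> N"
  shows "s \<le> p i" "p i \<le> t"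
  using partition_mono[OF p, of 0 i] partition_mono[OF p i] i p by (auto simp: partition_def)

lemma partition_grid: "partition (cells n) (grid n) (1 / 2 ^ n)"
  using grid_mono[of _ _ n] grid_step[of n] by (simp add: partition_def)

lemma partition_disjoint:
  assumes p: "partition N p \<delta>" and ij: "i < N" "j < N" "i \<noteq> j"
  shows "{p i<..p (Suc i)} \<inter> {p j<..p (Suc j)} = {}"
proof -
  have *: "{p i<..p (Suc i)} \<inter> {p j<..p (Suc j)} = {}" if "i < j" "j < N" for i j
    using partition_mono[OF p, of "Suc i" j] that by auto
  show ?thesis using ij *[of i j] *[of j i] by (cases "i < j") auto
qed

lemma ito_sum_in:
  assumes p: "partition N p \<delta>"
  shows "ito_sum N p \<in> vn_alg E"
proof -
  have "ito_sum N p \<in> norm_alg_upto E t"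
    unfolding ito_sum_def B_def
  proof (intro csubspace_sum[OF norm_alg_upto_csubspace] norm_alg_upto_compose csubspace_diff[OF norm_alg_upto_csubspace])
    fix i assume "i \<in> {..<N}"
    then have r: "s \<le> p i" "p i \<le> t" "s \<le> p (Suc i)" "p (Suc i) \<le> t" using partition_range[OF p] by auto
    show "ap (W (p i) - W s) \<in> norm_alg_upto E t"
      using subsetD[OF norm_alg_upto_mono[OF r(2)] ap_in_alg[OF r(1) increment_in[OF r(1)]]] .
    show "W (p (Suc i)) \<in> norm_alg_upto E t" "W (p i) \<in> norm_alg_upto E t"
      using r s_nonneg by (auto intro: norm_alg_upto_qbm)
  qed
  then show ?thesis using norm_alg_upto_vn vn_alg_upto_subset by blast
qed

text \<open>The adjoint moves the future increment to the left of a vector of the past, where its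
  annihilation part vanishes.\<close>

lemma ito_sum_vacuum:
  assumes p: "partition N p \<delta>"
  shows "cadjoint (ito_sum N p) \<cdot> E [] =
    (\<Sum>i<N. creation E (ind {p i<..p (Suc i)}) \<cdot> past (p i))"
proof -
  have c: "B (W (p i) - W s) (W (p (Suc i)) - W (p i)) \<in> cops" for i
    unfolding B_def by (intro cops_compose ap_cops cops_diff) auto
  have "cadjoint (B (W (p i) - W s) (W (p (Suc i)) - W (p i))) \<cdot> E [] =
      creation E (ind {p i<..p (Suc i)}) \<cdot> past (p i)" if "i < N" for i
  proof -
    have r: "s \<le> p i" "p i \<le> p (Suc i)" "0 \<le> p i"
      using partition_range(1)[OF p, of i] p that s_nonneg by (auto simp: partition_def)
    have "cadjoint (B (W (p i) - W s) (W (p (Suc i)) - W (p i))) =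
        field (ind {p i<..p (Suc i)}) o\<^sub>L cadjoint (ap (W (p i) - W s))"
      unfolding B_def qbm_increment[OF r(3,2)] by (simp add: cadjoint_compose ap_cops cops_diff cadjoint_field)
    moreover have "annihilation E (ind {p i<..p (Suc i)}) \<cdot> past (p i) = 0"
      by (rule fock_upto_annihilation_orthogonal[OF _ _ past_in[OF r(1)]]) (use r in \<open>auto intro: L2inner_ind_letters\<close>)
    ultimately show ?thesis by (simp add: field_apply past_def)
  qed
  then show ?thesis unfolding ito_sum_def by (simp add: cadjoint_sum c blinfun.sum_left)
qed

text \<open>On the common refinement the squared norm is at most \<open>Cq\<close> times the sum of
  length times squared difference of the integrands. The lengths add up to \<open>t - s\<close>, and
  each difference is at most \<open>2 * M * sqrt (Cq * \<delta>)\<close>.\<close>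

lemma norm_ito_sum_diff_le:
  assumes p: "partition N p \<delta>" and r: "partition N' r \<delta>" and \<delta>: "0 \<le> \<delta>"
  shows "norm (cadjoint (ito_sum N p) \<cdot> E [] - cadjoint (ito_sum N' r) \<cdot> E []) \<le>
    2 * M * Cq * sqrt ((t - s) * \<delta>)"
proof -
  define g where "g ij = ind ({p (fst ij)<..p (Suc (fst ij))} \<inter> {r (snd ij)<..r (Suc (snd ij))})" for ij
  define I where "I = {..<N} \<times> {..<N'}"
  define z where "z ij = past (p (fst ij)) - past (r (snd ij))" for ij
  have pp: "0 \<le> p i" "p i \<le> p (Suc i)" "s \<le> p i" "p (Suc i) \<le> t" "p (Suc i) - p i \<le> \<delta>" if "i < N" for i
    using partition_range[OF p, of i] partition_range[OF p, of "Suc i"] p that s_nonneg by (auto simp: partition_def)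
  have rr: "0 \<le> r i" "r i \<le> r (Suc i)" "s \<le> r i" "r (Suc i) \<le> t" "r (Suc i) - r i \<le> \<delta>" if "i < N'" for i
    using partition_range[OF r, of i] partition_range[OF r, of "Suc i"] r that s_nonneg by (auto simp: partition_def)
  have ends: "p 0 = s" "p N = t" "r 0 = s" "r N' = t" using p r by (auto simp: partition_def)
  have sp: "cadjoint (ito_sum N p) \<cdot> E [] = (\<Sum>i<N. \<Sum>j<N'. creation E (g (i, j)) \<cdot> past (p i))"
    unfolding ito_sum_vacuum[OF p]
  proof (rule sum.cong[OF refl])
    fix i assume "i \<in> {..<N}"
    then have i: "i < N" by simp
    have "creation E (ind {p i<..p (Suc i)}) = (\<Sum>j<N'. creation E (g (i, j)))"
      unfolding g_def fst_conv snd_conv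
      by (rule creation_ind_subdivide) (use pp[OF i] rr ends in auto)
    then show "creation E (ind {p i<..p (Suc i)}) \<cdot> past (p i) = (\<Sum>j<N'. creation E (g (i, j)) \<cdot> past (p i))"
      by (simp add: blinfun.sum_left)
  qed
  have "cadjoint (ito_sum N' r) \<cdot> E [] = (\<Sum>j<N'. \<Sum>i<N. creation E (g (i, j)) \<cdot> past (r j))"
    unfolding ito_sum_vacuum[OF r]
  proof (rule sum.cong[OF refl])
    fix j assume "j \<in> {..<N'}"
    then have j: "j < N'" by simp
    have "creation E (ind {r j<..r (Suc j)}) = (\<Sum>i<N. creation E (g (i, j)))"
      unfolding g_def fst_conv snd_conv
      by (subst Int_commute, rule creation_ind_subdivide) (use rr[OF j] pp ends in auto)
    then show "creation E (ind {r j<..r (Suc j)}) \<cdot> past (r j) = (\<Sum>i<N. creation E (g (i, j)) \<cdot> past (r j))"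
      by (simp add: blinfun.sum_left)
  qed
  then have sr: "cadjoint (ito_sum N' r) \<cdot> E [] = (\<Sum>i<N. \<Sum>j<N'. creation E (g (i, j)) \<cdot> past (r j))"
    using sum.swap by (rule trans)
  have eq: "cadjoint (ito_sum N p) \<cdot> E [] - cadjoint (ito_sum N' r) \<cdot> E [] =
      (\<Sum>ij\<in>I. creation E (g ij) \<cdot> z ij)"
    unfolding sp sr I_def z_def sum_subtractf[symmetric] sum.cartesian_product
    by (simp add: blinfun.diff_right case_prod_beta)
  let ?l = "\<lambda>ij. Re (L2inner (g ij) (g ij))"
  have g: "g ij \<in> L2fun" if "ij \<in> I" for ij
  proof -
    have "fst ij < N" "snd ij < N'" using that by (auto simp: I_def)
    then show ?thesis unfolding g_def interval_Int_clamp[OF pp(2) rr(2)] by simp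
  qed
  have orth: "L2inner (g ij) (g kl) = 0" if "ij \<in> I" "kl \<in> I" "ij \<noteq> kl" for ij kl
  proof -
    have b: "fst ij < N" "snd ij < N'" "fst kl < N" "snd kl < N'" using that by (auto simp: I_def)
    have ne: "fst ij \<noteq> fst kl \<or> snd ij \<noteq> snd kl" using that(3) by (auto simp: prod_eq_iff)
    have disj: "({p (fst ij)<..p (Suc (fst ij))} \<inter> {r (snd ij)<..r (Suc (snd ij))}) \<inter>
        ({p (fst kl)<..p (Suc (fst kl))} \<inter> {r (snd kl)<..r (Suc (snd kl))}) = {}"
      using ne partition_disjoint[OF p b(1,3)] partition_disjoint[OF r b(2,4)] by blast
    note e = interval_Int_clamp[OF pp(2)[OF b(1)] rr(2)[OF b(2)]] interval_Int_clamp[OF pp(2)[OF b(3)] rr(2)[OF b(4)]]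
    show ?thesis unfolding g_def e
      by (rule L2inner_ind_disjoint[OF _ disj[unfolded e]]) (rule max.coboundedI1[OF pp(1)[OF b(1)]])
  qed
  have l_z: "?l ij * (norm (z ij))\<^sup>2 \<le> ?l ij * (4 * M\<^sup>2 * Cq * \<delta>)" and l_nonneg: "0 \<le> ?l ij" if "ij \<in> I" for ij
  proof -
    have b: "fst ij < N" "snd ij < N'" using that by (auto simp: I_def)
    let ?i = "fst ij" and ?j = "snd ij"
    have l: "?l ij = max (p ?i) (min (p (Suc ?i)) (r (Suc ?j))) - max (p ?i) (min (p (Suc ?i)) (r ?j))"
      unfolding g_def by (rule L2inner_ind_Int[OF pp(1)[OF b(1)] pp(2)[OF b(1)] rr(2)[OF b(2)]])
    show l0: "0 \<le> ?l ij" unfolding l using pp(2)[OF b(1)] rr(2)[OF b(2)] by linarith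
    show "?l ij * (norm (z ij))\<^sup>2 \<le> ?l ij * (4 * M\<^sup>2 * Cq * \<delta>)"
    \<comment> \<open>Nonzero length means that the two cells overlap, so their left end points are
      at distance at most \<open>\<delta>\<close>.\<close>
    proof (cases "?l ij = 0")
      case False
      then have close: "\<bar>p ?i - r ?j\<bar> \<le> \<delta>" unfolding l using pp[OF b(1)] rr[OF b(2)] by linarith
      have "norm (z ij) \<le> M * (2 * sqrt (Cq * \<bar>p ?i - r ?j\<bar>))"
        using norm_past_diff_le[OF rr(1)[OF b(2)], of "p ?i"] norm_past_diff_le[OF pp(1)[OF b(1)], of "r ?j"]
        unfolding z_def by (cases "r ?j \<le> p ?i") (auto simp: norm_minus_commute)
      also have "\<dots> \<le> M * (2 * sqrt (Cq * \<delta>))"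
        using close Cq_pos M_nonneg by (intro mult_left_mono real_sqrt_le_mono) auto
      finally have "(norm (z ij))\<^sup>2 \<le> (M * (2 * sqrt (Cq * \<delta>)))\<^sup>2" by (intro power_mono) auto
      also have "\<dots> = 4 * M\<^sup>2 * Cq * \<delta>" using Cq_pos \<delta> by (simp add: power_mult_distrib)
      finally show ?thesis by (rule mult_left_mono[OF _ l0])
    qed simp
  qed
  have "(norm (\<Sum>ij\<in>I. creation E (g ij) \<cdot> z ij))\<^sup>2 \<le> Cq * (\<Sum>ij\<in>I. ?l ij * (norm (z ij))\<^sup>2)"
    by (rule norm_sum_creation_le[OF _ g orth]) (auto simp: I_def)
  also have "\<dots> \<le> Cq * (\<Sum>ij\<in>I. ?l ij * (4 * M\<^sup>2 * Cq * \<delta>))"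
    using Cq_pos by (intro mult_left_mono sum_mono l_z) auto
  also have "(\<Sum>ij\<in>I. ?l ij * (4 * M\<^sup>2 * Cq * \<delta>)) = (t - s) * (4 * M\<^sup>2 * Cq * \<delta>)"
  proof -
    have "(\<Sum>ij\<in>I. ?l ij) = (\<Sum>i<N. \<Sum>j<N'. ?l (i, j))"
      unfolding I_def by (simp add: sum.cartesian_product case_prod_beta)
    also have "\<dots> = (\<Sum>i<N. p (Suc i) - p i)"
      unfolding g_def fst_conv snd_conv
      by (intro sum.cong refl sum_L2inner_ind_subdivide) (use pp rr ends in auto)
    also have "\<dots> = t - s" by (simp add: sum_lessThan_telescope ends)
    finally show ?thesis by (simp add: sum_distrib_right[symmetric])
  qed
  also have "Cq * ((t - s) * (4 * M\<^sup>2 * Cq * \<delta>)) = (2 * M * Cq * sqrt ((t - s) * \<delta>))\<^sup>2"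
    using s_less_t \<delta> by (simp add: power_mult_distrib power2_eq_square)
  finally show ?thesis unfolding eq
    using M_nonneg Cq_pos s_less_t \<delta> by (elim power2_le_imp_le) auto
qed

end

text \<open>Since s < t, a uniform partition finer than both tolerances exists; its Riemann sum is
  close to both candidates. Without a common partition the definition would not exclude several
  limits.\<close>

lemma has_ito_integral_unique:
  assumes "s < t" and Z: "has_ito_integral E J V Z s t" and Z': "has_ito_integral E J V Z' s t"
  shows "Z = Z'"
proof (rule ccontr)
  assume "Z \<noteq> Z'"
  then have e: "dist Z Z' / 2 > 0" by simp
  obtain \<delta> where \<delta>: "\<delta> > 0" "\<And>N p. p 0 = s \<and> p N = t \<and> (\<forall>i<N. p i < p (Suc i) \<and> p (Suc i) - p i < \<delta>) \<Longrightarrow>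
      dist (J (\<Sum>i<N. sharp (norm_alg_upto E (p i)) (V (p i)) (qbm E (p (Suc i)) - qbm E (p i)))) Z < dist Z Z' / 2"
    using Z e unfolding has_ito_integral_def by meson
  obtain \<delta>' where \<delta>': "\<delta>' > 0" "\<And>N p. p 0 = s \<and> p N = t \<and> (\<forall>i<N. p i < p (Suc i) \<and> p (Suc i) - p i < \<delta>') \<Longrightarrow>
      dist (J (\<Sum>i<N. sharp (norm_alg_upto E (p i)) (V (p i)) (qbm E (p (Suc i)) - qbm E (p i)))) Z' < dist Z Z' / 2"
    using Z' e unfolding has_ito_integral_def by meson
  obtain N :: nat where N: "(t - s) / min \<delta> \<delta>' < real N" using reals_Archimedean2 by blast
  have m: "0 < min \<delta> \<delta>'" using \<delta>(1) \<delta>'(1) by simp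
  have N0: "0 < real N" using N m assms(1) by (meson diff_gt_0_iff_gt divide_pos_pos less_trans)
  have step: "(t - s) / real N < min \<delta> \<delta>'"
    using N unfolding pos_divide_less_eq[OF N0] pos_divide_less_eq[OF m] by (simp only: mult.commute)
  define p where "p i = s + real i * ((t - s) / real N)" for i
  have inc: "p (Suc i) - p i = (t - s) / real N" for i
    by (simp add: p_def algebra_simps add_divide_distrib diff_divide_distrib)
  have pos: "0 < (t - s) / real N" using N0 assms(1) by simp
  have p: "p 0 = s" "p N = t" using N0 by (simp_all add: p_def)
  have p_step: "p i < p (Suc i)" "p (Suc i) - p i < min \<delta> \<delta>'" for i
    using inc[of i] pos step by linarith+
  let ?S = "J (\<Sum>i<N. sharp (norm_alg_upto E (p i)) (V (p i)) (qbm E (p (Suc i)) - qbm E (p i)))"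
  have "dist ?S Z < dist Z Z' / 2" by (rule \<delta>(2)) (use p p_step in auto)
  moreover have "dist ?S Z' < dist Z Z' / 2" by (rule \<delta>'(2)) (use p p_step in auto)
  ultimately have "dist Z Z' < dist Z Z'"
    using dist_triangle3[of Z Z' ?S] by linarith
  then show False by simp
qed

context levy
begin

lemma levy_biprocess_adapted: "adapted_biprocess E {s..t} (levy_biprocess E s x)"
  unfolding adapted_biprocess_def
proof
  fix u assume "u \<in> {s..t}"
  then have u: "s \<le> u" by simp
  have "tensor_series (norm_alg_upto E u) (levy_biprocess E s x u)
      (\<lambda>i. if i = 0 then ap (W u - W s) else 0) (\<lambda>i. if i = 0 then id_blinfun else 0)"
    unfolding levy_biprocess_def
    by (intro tensor_series_elem norm_alg_upto_csubspace ap_in_alg u increment_in norm_alg_upto_id)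
  then show "levy_biprocess E s x u \<in> proj_tensor (norm_alg_upto E u)"
    unfolding proj_tensor_def by blast
qed

lemma levy_riemann_sum:
  assumes "partition N p \<delta>"
  shows "(\<Sum>i<N. sharp (norm_alg_upto E (p i)) (levy_biprocess E s x (p i)) (W (p (Suc i)) - W (p i))) = ito_sum N p"
  unfolding ito_sum_def
proof (rule sum.cong[OF refl])
  fix i assume "i \<in> {..<N}"
  then have "s \<le> p i" using partition_range(1)[OF assms] by simp
  then show "sharp (norm_alg_upto E (p i)) (levy_biprocess E s x (p i)) (W (p (Suc i)) - W (p i)) = B (W (p i) - W s) (W (p (Suc i)) - W (p i))"
    unfolding levy_biprocess_def B_def
    by (intro sharp_elem_id norm_alg_upto_tensor norm_alg_upto_id cops_diff qbm_cops ap_in_alg increment_in)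
qed

context
  fixes J :: "('h \<Rightarrow>\<^sub>L 'h) \<Rightarrow> 'l::complex_hilbert"
  assumes J: "L2_vacuum E J"
begin

lemma dist_J_ito_sum_le:
  assumes p: "partition N p \<delta>" and r: "partition N' r \<delta>" and \<delta>: "0 \<le> \<delta>"
  shows "dist (J (ito_sum N p)) (J (ito_sum N' r)) \<le> 2 * M * Cq * sqrt ((t - s) * \<delta>)"
proof -
  have in_vn: "ito_sum N p \<in> vn_alg E" "ito_sum N' r \<in> vn_alg E" using ito_sum_in p r by auto
  then have c: "ito_sum N p \<in> cops" "ito_sum N' r \<in> cops" using vn_alg_cops by auto
  have "dist (J (ito_sum N p)) (J (ito_sum N' r)) = norm (J (ito_sum N p - ito_sum N' r))"
    by (simp add: dist_norm J_diff[OF J in_vn])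
  also have "\<dots> = norm (cadjoint (ito_sum N p - ito_sum N' r) \<cdot> E [])"
    by (intro norm_J[OF J] csubspace_diff in_vn von_neumann_algebra_props(1)[OF vn_alg_vn])
  also have "\<dots> = norm (cadjoint (ito_sum N p) \<cdot> E [] - cadjoint (ito_sum N' r) \<cdot> E [])"
    by (simp add: cadjoint_diff c blinfun.diff_left)
  finally show ?thesis using norm_ito_sum_diff_le[OF p r \<delta>] by simp
qed

lemma partition_coarsen: "partition N p \<delta> \<Longrightarrow> \<delta> \<le> \<delta>' \<Longrightarrow> partition N p \<delta>'"
  unfolding partition_def by (blast intro: order_trans)

lemma mesh_bound_tendsto: "(\<lambda>n. 2 * M * Cq * sqrt ((t - s) * (1 / 2 ^ n))) \<longlonglongrightarrow> 0"
proof -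
  have "(\<lambda>n. 1 / 2 ^ n :: real) \<longlonglongrightarrow> 0"
    by (rule LIMSEQ_divide_realpow_zero) simp
  then have "(\<lambda>n. 2 * M * Cq * sqrt ((t - s) * (1 / 2 ^ n))) \<longlonglongrightarrow> 2 * M * Cq * sqrt ((t - s) * 0)"
    by (intro tendsto_intros)
  then show ?thesis by simp
qed

lemma dyadic_ito_sum_convergent: "convergent (\<lambda>n. J (ito_sum (cells n) (grid n)))"
proof -
  have "Cauchy (\<lambda>n. J (ito_sum (cells n) (grid n)))"
  proof (rule metric_CauchyI)
    fix e :: real assume "0 < e"
    obtain k where "\<forall>n\<ge>k. 2 * M * Cq * sqrt ((t - s) * (1 / 2 ^ n)) < e"
      using order_tendstoD(2)[OF mesh_bound_tendsto \<open>0 < e\<close>] unfolding eventually_sequentially by (rule exE)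
    then have k: "2 * M * Cq * sqrt ((t - s) * (1 / 2 ^ k)) < e" by simp
    have fine: "partition (cells n) (grid n) (1 / 2 ^ k)" if "k \<le> n" for n
      using that by (intro partition_coarsen[OF partition_grid]) (simp add: frac_le power_increasing)
    then have "dist (J (ito_sum (cells m) (grid m))) (J (ito_sum (cells n) (grid n))) < e" if "k \<le> m" "k \<le> n" for m n
      by (rule le_less_trans[OF dist_J_ito_sum_le k]) (use that fine in simp_all)
    then show "\<exists>K. \<forall>m\<ge>K. \<forall>n\<ge>K. dist (J (ito_sum (cells m) (grid m))) (J (ito_sum (cells n) (grid n))) < e" by blast
  qed
  then show ?thesis by (simp add: Cauchy_convergent_iff)
qed

text \<open>Any partition of mesh below 1 / 2^n is compared with the dyadic grid of level n, so
  convergence along the dyadic grids is enough.\<close>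

lemma levy_has_ito_integral:
  assumes Z: "(\<lambda>n. J (ito_sum (cells n) (grid n))) \<longlonglongrightarrow> Z"
  shows "has_ito_integral E J (levy_biprocess E s x) Z s t"
  unfolding has_ito_integral_def
proof (intro conjI levy_biprocess_adapted allI impI)
  fix \<epsilon> :: real assume \<epsilon>: "0 < \<epsilon>"
  have "\<forall>\<^sub>F n in sequentially. 2 * M * Cq * sqrt ((t - s) * (1 / 2 ^ n)) < \<epsilon> / 2 \<and> dist (J (ito_sum (cells n) (grid n))) Z < \<epsilon> / 2"
    using \<epsilon> by (intro eventually_conj order_tendstoD(2)[OF mesh_bound_tendsto] tendstoD[OF Z]) auto
  then obtain n where n: "2 * M * Cq * sqrt ((t - s) * (1 / 2 ^ n)) < \<epsilon> / 2" "dist (J (ito_sum (cells n) (grid n))) Z < \<epsilon> / 2"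
    by (auto simp: eventually_sequentially)
  show "\<exists>\<delta>>0. \<forall>N p. p 0 = s \<and> p N = t \<and> (\<forall>i<N. p i < p (Suc i) \<and> p (Suc i) - p i < \<delta>) \<longrightarrow>
      dist (J (\<Sum>i<N. sharp (norm_alg_upto E (p i)) (levy_biprocess E s x (p i)) (W (p (Suc i)) - W (p i)))) Z < \<epsilon>"
  proof (intro exI[of _ "1 / 2 ^ n"] conjI allI impI)
    fix N p
    assume "p 0 = s \<and> p N = t \<and> (\<forall>i<N. p i < p (Suc i) \<and> p (Suc i) - p i < 1 / 2 ^ n)"
    then have p: "partition N p (1 / 2 ^ n)" unfolding partition_def by (blast intro: less_imp_le)
    have "dist (J (ito_sum N p)) (J (ito_sum (cells n) (grid n))) < \<epsilon> / 2"
      using n(1) by (intro le_less_trans[OF dist_J_ito_sum_le[OF p partition_grid]]) auto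
    then have "dist (J (ito_sum N p)) Z < \<epsilon>" 
      using n(2) dist_triangle[of "J (ito_sum N p)" Z "J (ito_sum (cells n) (grid n))"] by linarith
    then show "dist (J (\<Sum>i<N. sharp (norm_alg_upto E (p i)) (levy_biprocess E s x (p i)) (W (p (Suc i)) - W (p i)))) Z < \<epsilon>"
      unfolding levy_riemann_sum[OF p] .
  qed simp
qed

end

end

section \<open>The quadratic term\<close>

context q_fock
begin

text \<open>On the past, second quantization is the compression of \<open>V\<close> by creation over
  a unit interval of the future, and adjoints pass through a compression. The difference of the two
  sides is itself a vector of the past, so it can be tested against itself.\<close>

lemma cadjoint_second_quantization:
  assumes s: "0 \<le> s" and V: "V \<in> norm_alg_upto E s" and y: "y \<in> fock_upto s"
  shows "second_quantization E (cadjoint V) \<cdot> y = cadjoint (second_quantization E V) \<cdot> y"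
proof -
  let ?\<Gamma> = "second_quantization E" and ?h = "ind {s<..s + 1}"
  have Vs: "cadjoint V \<in> norm_alg_upto E s" by (rule norm_alg_upto_adjoint[OF V])
  have G: "?\<Gamma> V \<in> norm_alg_upto E s" "?\<Gamma> (cadjoint V) \<in> norm_alg_upto E s"
    using gamma_graph_in[OF second_quantization_graph[OF s]] V Vs by auto
  have stable: "T \<cdot> z \<in> fock_upto s" if "T \<in> norm_alg_upto E s" "z \<in> fock_upto s" for T z
    using vn_alg_upto_fock_upto[OF subsetD[OF norm_alg_upto_vn that(1)] that(2)] .
  have c: "V \<in> cops" "?\<Gamma> V \<in> cops" using V G norm_alg_upto_cops by auto
  have hh: "L2inner ?h ?h = 1" using s by (simp add: L2inner_ind_self)
  have orth: "\<And>f. f \<in> letters s \<Longrightarrow> L2inner ?h f = 0" using s by (intro L2inner_ind_letters) auto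
  have agc: "annihilation E ?h \<cdot> T \<cdot> creation E ?h \<cdot> z = ?\<Gamma> T \<cdot> z"
    if "T \<in> norm_alg_upto E s" "z \<in> fock_upto s" for T z
    using annihilation_gamma_creation[OF second_quantization_graph[OF s that(1)] ind_L2fun(2) orth that(2)]
    by (simp add: hh)
  define w where "w = ?\<Gamma> (cadjoint V) \<cdot> y - cadjoint (?\<Gamma> V) \<cdot> y"
  have w: "w \<in> fock_upto s"
    unfolding w_def by (intro csubspace_diff[OF fock_upto_csubspace] stable G norm_alg_upto_adjoint y)
  have "cinner w (?\<Gamma> (cadjoint V) \<cdot> y) =
      cinner w (annihilation E ?h \<cdot> cadjoint V \<cdot> creation E ?h \<cdot> y)"
    by (simp only: agc[OF Vs y])
  also have "\<dots> = cinner (annihilation E ?h \<cdot> V \<cdot> creation E ?h \<cdot> w) y"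
    by (simp add: annihilation_def cinner_cadjoint_left cinner_cadjoint_right c)
  also have "\<dots> = cinner w (cadjoint (?\<Gamma> V) \<cdot> y)"
    by (simp only: agc[OF V w] cinner_cadjoint_right[OF c(2)])
  finally have "cinner w w = 0" by (subst (2) w_def) (simp add: cinner_diff_right)
  then show ?thesis unfolding cinner_self by (simp add: w_def)
qed

text \<open>The right annihilator kills \<open>y\<close>. Annihilation, \<open>T\<close>, creation
  gives exactly the second quantization term, and the error is the sum of creation,
  \<open>T\<close>, creation: a creation row applied to vectors whose squared norms are of order
  \<open>\<epsilon>\<close>.\<close>

lemma norm_sum_field_sandwich_vacuum_le:
  assumes s: "0 \<le> s" and T: "T \<in> norm_alg_upto E s" and y: "y \<in> fock_upto s"
    and h: "orthogonal_family I h \<epsilon> K" "\<And>i f. i \<in> I \<Longrightarrow> f \<in> letters s \<Longrightarrow> L2inner (h i) f = 0"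
  shows "norm ((\<Sum>i\<in>I. field (h i) o\<^sub>L T o\<^sub>L field (h i)) \<cdot> y -
      (\<Sum>i\<in>I. L2inner (h i) (h i)) *\<^sub>C second_quantization E T \<cdot> y) \<le> Cq * sqrt (\<epsilon> * K) * (norm T * norm y)"
proof -
  have fin: "finite I" and L2: "\<And>i. i \<in> I \<Longrightarrow> h i \<in> L2fun"
    and orth: "\<And>i j. i \<in> I \<Longrightarrow> j \<in> I \<Longrightarrow> i \<noteq> j \<Longrightarrow> L2inner (h i) (h j) = 0"
    and le: "\<And>i. i \<in> I \<Longrightarrow> Re (L2inner (h i) (h i)) \<le> \<epsilon>" "(\<Sum>i\<in>I. Re (L2inner (h i) (h i))) \<le> K"
    and nonneg: "0 \<le> \<epsilon>" "0 \<le> K"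
    using h(1) by (auto simp: orthogonal_family_def)
  define z where "z i = T \<cdot> creation E (h i) \<cdot> y" for i
  have expand: "(field (h i) o\<^sub>L T o\<^sub>L field (h i)) \<cdot> y =
      L2inner (h i) (h i) *\<^sub>C second_quantization E T \<cdot> y + creation E (h i) \<cdot> z i" if i: "i \<in> I" for i
  proof -
    have "annihilation E (h i) \<cdot> y = 0"
      by (rule fock_upto_annihilation_orthogonal[OF L2[OF i] h(2)[OF i] y])
    then show ?thesis
      using annihilation_gamma_creation[OF second_quantization_graph[OF s T] L2[OF i] h(2)[OF i] y]
      by (simp add: field_apply z_def)
  qed
  have eq: "(\<Sum>i\<in>I. field (h i) o\<^sub>L T o\<^sub>L field (h i)) \<cdot> y -
      (\<Sum>i\<in>I. L2inner (h i) (h i)) *\<^sub>C second_quantization E T \<cdot> y = (\<Sum>i\<in>I. creation E (h i) \<cdot> z i)"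
  proof -
    have "(\<Sum>i\<in>I. field (h i) o\<^sub>L T o\<^sub>L field (h i)) \<cdot> y =
        (\<Sum>i\<in>I. L2inner (h i) (h i) *\<^sub>C second_quantization E T \<cdot> y) + (\<Sum>i\<in>I. creation E (h i) \<cdot> z i)"
      unfolding blinfun.sum_left sum.distrib[symmetric] by (intro sum.cong refl expand)
    then show ?thesis by (simp add: scaleC_sum_left)
  qed
  have z_le: "(norm (z i))\<^sup>2 \<le> Cq * \<epsilon> * (norm T * norm y)\<^sup>2" if i: "i \<in> I" for i
  proof -
    have "norm (z i) \<le> norm T * (norm (creation E (h i)) * norm y)"
      unfolding z_def by (intro order_trans[OF norm_blinfun] mult_left_mono norm_blinfun) auto
    also have "\<dots> \<le> norm T * (sqrt (Cq * Re (L2inner (h i) (h i))) * norm y)"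
      by (intro mult_left_mono mult_right_mono norm_creation_le L2 i) auto
    also have "\<dots> \<le> norm T * (sqrt (Cq * \<epsilon>) * norm y)"
      using le(1)[OF i] Cq_pos by (intro mult_left_mono mult_right_mono real_sqrt_le_mono) auto
    finally have "(norm (z i))\<^sup>2 \<le> (norm T * (sqrt (Cq * \<epsilon>) * norm y))\<^sup>2" by (intro power_mono) auto
    also have "\<dots> = Cq * \<epsilon> * (norm T * norm y)\<^sup>2" using Cq_pos nonneg by (simp add: power_mult_distrib)
    finally show ?thesis .
  qed
  have "(norm (\<Sum>i\<in>I. creation E (h i) \<cdot> z i))\<^sup>2 \<le> Cq * (\<Sum>i\<in>I. Re (L2inner (h i) (h i)) * (norm (z i))\<^sup>2)"
    by (rule norm_sum_creation_le[OF fin L2 orth])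
  also have "\<dots> \<le> Cq * (\<Sum>i\<in>I. Re (L2inner (h i) (h i)) * (Cq * \<epsilon> * (norm T * norm y)\<^sup>2))"
    using Cq_pos by (intro mult_left_mono sum_mono z_le) (auto simp: L2inner_self(2))
  also have "\<dots> = Cq * ((\<Sum>i\<in>I. Re (L2inner (h i) (h i))) * (Cq * \<epsilon> * (norm T * norm y)\<^sup>2))"
    by (simp only: sum_distrib_right)
  also have "\<dots> \<le> Cq * (K * (Cq * \<epsilon> * (norm T * norm y)\<^sup>2))"
    using Cq_pos nonneg by (intro mult_left_mono mult_right_mono le(2)) auto
  also have "\<dots> = (Cq * sqrt (\<epsilon> * K) * (norm T * norm y))\<^sup>2"
    using nonneg by (simp add: power_mult_distrib power2_eq_square)
  finally show ?thesis unfolding eq using Cq_pos nonneg by (elim power2_le_imp_le) auto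
qed

context
  fixes J :: "('h \<Rightarrow>\<^sub>L 'h) \<Rightarrow> 'l::complex_hilbert"
  assumes J: "L2_vacuum E J"
begin

lemma J_sums:
  assumes f: "f sums T" "\<And>n. f n \<in> vn_alg E" "T \<in> vn_alg E"
  shows "(\<lambda>n. J (f n)) sums J T"
proof -
  have cs: "csubspace (vn_alg E)" by (rule von_neumann_algebra_props(1)[OF vn_alg_vn])
  have "J (\<Sum>i<n. f i) = (\<Sum>i<n. J (f i))" for n
  proof (induction n)
    case 0
    then show ?case using J_scaleR[OF J f(3), of 0] by simp
  next
    case (Suc n)
    then show ?case by (simp add: J_add[OF J csubspace_sum[OF cs f(2)] f(2)])
  qed
  moreover have "(\<lambda>n. J (\<Sum>i<n. f i)) \<longlonglongrightarrow> J T"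
    by (intro tendsto_J[OF J f(1)[unfolded sums_def]] csubspace_sum[OF cs] f)
  ultimately show ?thesis by (simp add: sums_def)
qed

text \<open>Taking the adjoint lets \<open>U\<close> act first on the vacuum, producing a vector of
  the past, so the left factor only contributes its norm. The inner factor turns into its adjoint,
  whence the compatibility of second quantization with adjoints.\<close>

lemma norm_J_sum_sandwich_le:
  assumes s: "0 \<le> s" and U: "U \<in> norm_alg_upto E s" and V: "V \<in> norm_alg_upto E s"
    and h: "orthogonal_family I h \<epsilon> K" "\<And>i f. i \<in> I \<Longrightarrow> f \<in> letters s \<Longrightarrow> L2inner (h i) f = 0"
    and c: "(\<Sum>i\<in>I. L2inner (h i) (h i)) = of_real c"
    and vn: "U o\<^sub>L (\<Sum>i\<in>I. field (h i) o\<^sub>L V o\<^sub>L field (h i)) \<in> vn_alg E"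
  shows "norm (J (U o\<^sub>L (\<Sum>i\<in>I. field (h i) o\<^sub>L V o\<^sub>L field (h i))) - c *\<^sub>R J (U o\<^sub>L second_quantization E V))
    \<le> Cq * sqrt (\<epsilon> * K) * (norm U * norm V)"
proof -
  let ?\<Gamma> = "second_quantization E" and ?S = "\<Sum>i\<in>I. field (h i) o\<^sub>L V o\<^sub>L field (h i)"
  have G: "?\<Gamma> V \<in> norm_alg_upto E s" by (rule gamma_graph_in[OF second_quantization_graph[OF s V]])
  have UG: "U o\<^sub>L ?\<Gamma> V \<in> vn_alg E"
    using norm_alg_upto_compose[OF U G] norm_alg_upto_vn vn_alg_upto_subset by blast
  have cs: "csubspace (vn_alg E)" by (rule von_neumann_algebra_props(1)[OF vn_alg_vn])
  have L2: "\<And>i. i \<in> I \<Longrightarrow> h i \<in> L2fun" using h(1) by (auto simp: orthogonal_family_def)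
  have co: "U \<in> cops" "V \<in> cops" "?\<Gamma> V \<in> cops" using U V G norm_alg_upto_cops by auto
  have summand: "field (h i) o\<^sub>L V o\<^sub>L field (h i) \<in> cops"
    "cadjoint (field (h i) o\<^sub>L V o\<^sub>L field (h i)) = field (h i) o\<^sub>L cadjoint V o\<^sub>L field (h i)" if "i \<in> I" for i
    using L2[OF that] co by (auto simp: cops_compose cadjoint_compose cadjoint_field intro!: blinfun_eqI)
  have S: "?S \<in> cops" "cadjoint ?S = (\<Sum>i\<in>I. field (h i) o\<^sub>L cadjoint V o\<^sub>L field (h i))"
    using summand by (auto simp: cadjoint_sum intro!: cops_sum)
  define y where "y = cadjoint U \<cdot> E []"
  have y: "y \<in> fock_upto s"
    unfolding y_def by (intro vn_alg_upto_fock_upto[OF _ fock_upto_vacuum] subsetD[OF norm_alg_upto_vn] norm_alg_upto_adjoint U)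
  have "norm (J (U o\<^sub>L ?S) - c *\<^sub>R J (U o\<^sub>L ?\<Gamma> V)) = norm (J ((U o\<^sub>L ?S) - c *\<^sub>R (U o\<^sub>L ?\<Gamma> V)))"
    by (simp only: J_diff[OF J vn csubspace_scaleR[OF cs UG]] J_scaleR[OF J UG])
  also have "\<dots> = norm ((cadjoint ((U o\<^sub>L ?S) - c *\<^sub>R (U o\<^sub>L ?\<Gamma> V))) \<cdot> E [])"
    by (intro norm_J[OF J] csubspace_diff[OF cs] csubspace_scaleR[OF cs] vn UG)
  also have "(cadjoint ((U o\<^sub>L ?S) - c *\<^sub>R (U o\<^sub>L ?\<Gamma> V))) \<cdot> E [] =
      (\<Sum>i\<in>I. field (h i) o\<^sub>L cadjoint V o\<^sub>L field (h i)) \<cdot> y - c *\<^sub>R cadjoint (?\<Gamma> V) \<cdot> y"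
    using co S by (simp add: cadjoint_diff cadjoint_scaleR cadjoint_compose cops_compose cops_scaleR
        blinfun.diff_left blinfun.scaleR_left y_def)
  also have "c *\<^sub>R cadjoint (?\<Gamma> V) \<cdot> y = (\<Sum>i\<in>I. L2inner (h i) (h i)) *\<^sub>C ?\<Gamma> (cadjoint V) \<cdot> y"
    by (simp only: cadjoint_second_quantization[OF s V y] c scaleC_of_real)
  also have "norm ((\<Sum>i\<in>I. field (h i) o\<^sub>L cadjoint V o\<^sub>L field (h i)) \<cdot> y - \<dots>) \<le> Cq * sqrt (\<epsilon> * K) * (norm (cadjoint V) * norm y)"
    by (rule norm_sum_field_sandwich_vacuum_le[OF s norm_alg_upto_adjoint[OF V] y h])
  also have "\<dots> \<le> Cq * sqrt (\<epsilon> * K) * (norm V * norm U)"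
    using h(1) Cq_pos norm_vacuum_apply_le[of "cadjoint U"] unfolding y_def
    by (intro mult_left_mono mult_mono) (auto simp: norm_cadjoint co orthogonal_family_def)
  finally show ?thesis by (simp only: mult.commute[of "norm V"])
qed

end

end

context levy
begin

definition quadratic_sum :: "nat \<Rightarrow> 'h \<Rightarrow>\<^sub>L 'h" where
  "quadratic_sum n = (\<Sum>i<cells n. B (W (grid n (Suc i)) - W (grid n i)) (W (grid n (Suc i)) - W (grid n i)))"

lemma trap_eq_ito_sum: "trap n = ito_sum (cells n) (grid n) + (1/2) *\<^sub>R quadratic_sum n"
proof -
  have alg: "(1/2) *\<^sub>R B (P + Q - 2 *\<^sub>R S) (Q - P) = B (P - S) (Q - P) + (1/2) *\<^sub>R B (Q - P) (Q - P)"
    if "P \<in> cops" "Q \<in> cops" "S \<in> cops" for P Q S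
  proof -
    have eq: "P + Q - 2 *\<^sub>R S = 2 *\<^sub>R (P - S) + (Q - P)" by (simp add: scaleR_2)
    show ?thesis unfolding eq using that by (simp add: B_add_left B_scaleR_left cops_diff cops_scaleR scaleR_add_right)
  qed
  show ?thesis
    unfolding trap_def ito_sum_def quadratic_sum_def scaleR_sum_right sum.distrib[symmetric]
    by (intro sum.cong refl alg) auto
qed

lemma grid_increment_in: "W (grid n (Suc i)) - W (grid n i) \<in> norm_alg_upto E t"
  using grid_range(2) grid_nonneg by (intro csubspace_diff[OF norm_alg_upto_csubspace] norm_alg_upto_qbm)

lemma UV_in_t: "U k \<in> norm_alg_upto E t" "V k \<in> norm_alg_upto E t"
  using U_in V_in norm_alg_upto_mono[of s t] s_less_t by auto

lemma quadratic_sum_in: "quadratic_sum n \<in> norm_alg_upto E t"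
  unfolding quadratic_sum_def B_def
  using s_less_t
  by (intro csubspace_sum[OF norm_alg_upto_csubspace] norm_alg_upto_compose ap_in_alg grid_increment_in) auto

lemma norm_alg_upto_vn_alg: "norm_alg_upto E r \<subseteq> vn_alg E"
  using norm_alg_upto_vn vn_alg_upto_subset by blast

context
  fixes J :: "('h \<Rightarrow>\<^sub>L 'h) \<Rightarrow> 'l::complex_hilbert"
  assumes J: "L2_vacuum E J"
begin

text \<open>Term by term in the series, the squared norms of the interval indicators add up to
  exactly \<open>t - s\<close>, the coefficient of the correction; the errors are summable with
  total \<open>M\<close>.\<close>

lemma norm_quadratic_sum_le:
  "norm (J (quadratic_sum n) - (t - s) *\<^sub>R id_times_second_quantization E J s x) \<le> Cq * sqrt (1 / 2 ^ n * (t - s)) * M"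
proof -
  define h where "h i = ind {grid n i<..grid n (Suc i)}" for i
  let ?S = "\<lambda>k. \<Sum>i<cells n. field (h i) o\<^sub>L V k o\<^sub>L field (h i)" and ?G = "\<lambda>k. U k o\<^sub>L second_quantization E (V k)"
  let ?K = "Cq * sqrt (1 / 2 ^ n * (t - s))"
  have mono: "grid n i \<le> grid n (Suc i)" for i by (rule grid_mono) simp
  have inc: "W (grid n (Suc i)) - W (grid n i) = field (h i)" for i
    unfolding h_def by (rule qbm_increment[OF grid_nonneg mono])
  have fam: "orthogonal_family {..<cells n} h (1 / 2 ^ n) (t - s)"
    unfolding h_def by (rule orthogonal_family_grid) (simp add: mono)
  have orth: "L2inner (h i) f = 0" if "f \<in> letters s" for i f
    unfolding h_def by (rule L2inner_ind_letters[OF s_nonneg grid_range(1) that])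
  have len: "(\<Sum>i<cells n. L2inner (h i) (h i)) = of_real (t - s)"
  proof -
    have "(\<Sum>i<cells n. L2inner (h i) (h i)) = of_real (\<Sum>i<cells n. grid n (Suc i) - grid n i)"
      by (simp add: h_def L2inner_ind_self[OF grid_nonneg mono])
    also have "(\<Sum>i<cells n. grid n (Suc i) - grid n i) = t - s" by (simp add: sum_lessThan_telescope)
    finally show ?thesis .
  qed
  have S_in: "U k o\<^sub>L ?S k \<in> vn_alg E" for k
    unfolding inc[symmetric]
    by (intro subsetD[OF norm_alg_upto_vn_alg[of t]] norm_alg_upto_compose csubspace_sum[OF norm_alg_upto_csubspace]
        grid_increment_in UV_in_t)
  have "(\<lambda>k. U k o\<^sub>L ?S k) sums quadratic_sum n"
    unfolding quadratic_sum_def inc by (rule sum_B_sums) (auto simp: h_def)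
  then have "(\<lambda>k. J (U k o\<^sub>L ?S k)) sums J (quadratic_sum n)"
    by (rule J_sums[OF J]) (use S_in quadratic_sum_in norm_alg_upto_vn_alg in auto)
  then have diff: "(\<lambda>k. J (U k o\<^sub>L ?S k) - (t - s) *\<^sub>R J (?G k)) sums
      (J (quadratic_sum n) - (t - s) *\<^sub>R id_times_second_quantization E J s x)"
    by (intro sums_diff sums_scaleR_right id_times_second_quantization_sums[OF J s_nonneg series])
  have le: "norm (J (U k o\<^sub>L ?S k) - (t - s) *\<^sub>R J (?G k)) \<le> ?K * (norm (U k) * norm (V k))" for k
    by (rule norm_J_sum_sandwich_le[OF J s_nonneg U_in V_in fam orth len S_in])
  have sK: "summable (\<lambda>k. ?K * (norm (U k) * norm (V k)))" by (intro summable_mult summable_UV)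
  have "norm (\<Sum>k. J (U k o\<^sub>L ?S k) - (t - s) *\<^sub>R J (?G k)) \<le> (\<Sum>k. ?K * (norm (U k) * norm (V k)))"
    by (rule norm_suminf_le[OF le sK])
  also have "\<dots> = ?K * M" unfolding M_def by (rule suminf_mult[OF summable_UV])
  finally show ?thesis by (simp only: sums_unique[OF diff, symmetric])
qed

lemma quadratic_sum_tendsto:
  "(\<lambda>n. J (quadratic_sum n)) \<longlonglongrightarrow> (t - s) *\<^sub>R id_times_second_quantization E J s x"
proof (rule Lim_null_comparison[THEN LIM_zero_cancel])
  show "\<forall>\<^sub>F n in sequentially. norm (J (quadratic_sum n) - (t - s) *\<^sub>R id_times_second_quantization E J s x) \<le>
      Cq * sqrt (1 / 2 ^ n * (t - s)) * M"
    using norm_quadratic_sum_le by simp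
  have "(\<lambda>n. 1 / 2 ^ n :: real) \<longlonglongrightarrow> 0"
    by (rule LIMSEQ_divide_realpow_zero) simp
  then have "(\<lambda>n. Cq * sqrt (1 / 2 ^ n * (t - s)) * M) \<longlonglongrightarrow> Cq * sqrt (0 * (t - s)) * M"
    by (intro tendsto_intros)
  then show "(\<lambda>n. Cq * sqrt (1 / 2 ^ n * (t - s)) * M) \<longlonglongrightarrow> 0" by simp
qed

text \<open>\<open>J\<close> is contractive, so the norm limit of the trapezoidal sums passes to L2.
  There the Ito part and the quadratic part converge separately, although neither has been shown to
  converge in norm.\<close>

theorem ito_stratonovich:
  "ito_integrable E J (levy_biprocess E s x) s t \<and>
    J (stratonovich_levy_area E s t x) = ito_integral E J (levy_biprocess E s x) s t +
      ((t - s) / 2) *\<^sub>R id_times_second_quantization E J s x"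
proof -
  obtain Z where Z: "(\<lambda>n. J (ito_sum (cells n) (grid n))) \<longlonglongrightarrow> Z"
    using dyadic_ito_sum_convergent[OF J] unfolding convergent_def by (rule exE)
  have ito: "has_ito_integral E J (levy_biprocess E s x) Z s t" by (rule levy_has_ito_integral[OF J Z])
  then have int: "ito_integral E J (levy_biprocess E s x) s t = Z"
    unfolding ito_integral_def by (rule the_equality) (rule has_ito_integral_unique[OF s_less_t _ ito])
  have cs: "csubspace (vn_alg E)" by (rule von_neumann_algebra_props(1)[OF vn_alg_vn])
  have quad: "quadratic_sum n \<in> vn_alg E" for n using quadratic_sum_in norm_alg_upto_vn_alg by blast
  have ito_in: "ito_sum (cells n) (grid n) \<in> vn_alg E" for n by (rule ito_sum_in[OF partition_grid])
  have trap_in: "trap n \<in> vn_alg E" for n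
    unfolding trap_eq_ito_sum by (intro csubspace_add[OF cs] csubspace_scaleR[OF cs] quad ito_in)
  have "stratonovich_levy_area E s t x \<in> vn_alg E"
    by (rule closed_sequentially[OF von_neumann_algebra_props(3)[OF vn_alg_vn] trap_in trap_tendsto])
  then have lim: "(\<lambda>n. J (trap n)) \<longlonglongrightarrow> J (stratonovich_levy_area E s t x)"
    by (intro tendsto_J[OF J trap_tendsto trap_in])
  have "J (trap n) = J (ito_sum (cells n) (grid n)) + (1/2) *\<^sub>R J (quadratic_sum n)" for n
    unfolding trap_eq_ito_sum by (simp add: J_add[OF J] J_scaleR[OF J] ito_in quad csubspace_scaleR[OF cs])
  then have "(\<lambda>n. J (trap n)) \<longlonglongrightarrow> Z + (1/2) *\<^sub>R (t - s) *\<^sub>R id_times_second_quantization E J s x"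
    by (simp only:) (intro tendsto_add Z tendsto_scaleR[OF tendsto_const quadratic_sum_tendsto])
  from LIMSEQ_unique[OF lim this] show ?thesis
    using ito by (auto simp: ito_integrable_def int)
qed

end

end

theorem proposition4p8:
  fixes q s t :: real
    and E :: "(real \<Rightarrow> complex) list \<Rightarrow> 'h::complex_hilbert"
    and J :: "('h \<Rightarrow>\<^sub>L 'h) \<Rightarrow> 'l::complex_hilbert"
    and U :: "('h \<Rightarrow>\<^sub>L 'h) tensor"
  assumes "0 \<le> q" and "q < 1"
    and "q_fock_space q E"
    and "L2_vacuum E J"
    and "0 \<le> s" and "s < t"
    and "U \<in> proj_tensor (norm_alg_upto E s)"
  shows "ito_integrable E J (levy_biprocess E s U) s t \<and>
    J (stratonovich_levy_area E s t U) =
      ito_integral E J (levy_biprocess E s U) s t +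
      ((t - s) / 2) *\<^sub>R id_times_second_quantization E J s U"
proof -
  \<comment> \<open>Any series may be fixed, because the quantities in the conclusion depend on the
    tensor alone.\<close>
  obtain A B where "tensor_series (norm_alg_upto E s) U A B"
    using assms(7) by (auto simp: proj_tensor_def)
  then interpret levy q E s t U A B
    using assms by unfold_locales
  show ?thesis by (rule ito_stratonovich[OF assms(4)])
qed

end
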